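(* (Bruhat decomposition.) Let $G$ be a group with a generating root group datum of type $\Phi\neq\emptyset$, an $R$-valuation $(\varphi_\alpha)_{\alpha\in\Phi}$ of it, and an action $\nu:N\to\mathrm{Aff}_R(\mathbb{A}_R)$ compatible with the valuation (all defined in the context). Suppose that the totally ordered abelian group $R$ is equipped with a $\mathbb{Q}$-module structure. Let $C,C'$ be two vector chambers of $V_R$ and $x,x'\in\mathbb{A}_R$ two points. Then $$G=\widehat{P}_{\mathcal{F}_{x,C}}\,N\,\widehat{P}_{\mathcal{F}_{x',C'}}$$ and there is a natural one-to-one correspondence $N/T_b\to\widehat{P}_{\mathcal{F}_{x,C}}\backslash G/\widehat{P}_{\mathcal{F}_{x',C'}}$ (induced by $n\mapsto\widehat{P}_{\mathcal{F}_{x,C}}\,n\,\widehat{P}_{\mathcal{F}_{x',C'}}$).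
   Context: **Root systems.** $V_{\mathbb{R}}$ is a finite-dimensional real vector space and $\Phi\subset V_{\mathbb{R}}^*$ a (possibly non-reduced) root system spanning $V_{\mathbb R}^*$, with coroots $\alpha^\vee$, reflections $r_\alpha(\beta)=\beta-\beta(\alpha^\vee)\alpha$, Weyl group $W(\Phi)$. $\alpha$ is multipliable if $2\alpha\in\Phi$. $(\alpha,\beta)=\{r\alpha+s\beta\in\Phi:r,s\in\mathbb{Z}_{>0}\}$. **Root group datum** of type $\Phi$ of a group $G$: a system $(T,(U_\alpha,M_\alpha)_{\alpha\in\Phi})$ with (RGD1) $T$ and the $U_\alpha$ are subgroups, $U_\alpha\neq1$; (RGD2) if $\beta\notin\mathbb{R}_{<0}\alpha$, $[U_\alpha,U_\beta]$ lies in the group generated by the $U_\gamma$, $\gamma\in(\alpha,\beta)$; (RGD3) $U_{2\alpha}\subsetneq U_\alpha$ if $\alpha$ is multipliable; (RGD4) $M_\alpha$ is a right coset of $T$ and $U_{-\alpha}\setminus\{1\}\subset U_\alpha M_\alpha U_\alpha$; (RGD5) $mU_\beta m^{-1}=U_{r_\alpha(\beta)}$ for $m\in M_\alpha$; (RGD6) for any choice of positive roots, $TU^+\cap U^-=\{1\}$, where $U^\pm$ is generated by the $U_\alpha$, $\alpha\in\Phi^\pm$. It is generating if $T$ and the $U_\alpha$ generate $G$. $N$ is the group generated by the $M_\alpha$; there is an epimorphism ${}^v\nu:N\to W(\Phi)$ with kernel $T$ and ${}^v\nu(M_\alpha)=\{r_\alpha\}$. For $u\in U_\alpha\setminus\{1\}$,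 $m(u)$ is the unique element of $M_\alpha\cap U_{-\alpha}uU_{-\alpha}$. **$R$-valuation** ($R$ a non-zero totally ordered abelian group): maps $\varphi_\alpha:U_\alpha\to R\cup\{\infty\}$ with (V0) $\varphi_\alpha(U_\alpha)$ has at least 3 elements; (V1) $U_{\alpha,\lambda}=\varphi_\alpha^{-1}([\lambda,\infty])$ is a subgroup and $U_{\alpha,\infty}=\{1\}$; (V2) for $m\in M_\alpha$, $u\mapsto\varphi_{-\alpha}(u)-\varphi_\alpha(mum^{-1})$ is constant on $U_{-\alpha}\setminus\{1\}$; (V3) if $\beta\notin\mathbb{R}_{\le0}\alpha$, $[U_{\alpha,\lambda},U_{\beta,\mu}]$ lies in the group generated by the $U_{r\alpha+s\beta,r\lambda+s\mu}$, $r,s\in\mathbb{Z}_{>0}$, $r\alpha+s\beta\in\Phi$; (V4) $\varphi_{2\alpha}=2\varphi_\alpha|_{U_{2\alpha}}$ for $\alpha$ multipliable; (V5) if $u\in U_\alpha$, $u',u''\in U_{-\alpha}$ and $u'uu''\in M_\alpha$ then $\varphi_{-\alpha}(u')=-\varphi_\alpha(u)$. $\Gamma_\alpha=\varphi_\alpha(U_\alpha\setminus\{1\})$. **Apartment and compatible action.** $V_{\mathbb{Z}}\subset V_{\mathbb{R}}$ is the coweight lattice, $V_R=V_{\mathbb{Z}}\otimes R$, $\mathbb{A}_R$ an affine space under $V_R$ with origin $o$; $\alpha(x)$ means $\alpha(x-o)$. $\mathrm{Aff}_R(\mathbb{A}_R)=V_R\rtimes\mathrm{GL}(V_{\mathbb{Z}})$.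 $\nu:N\to\mathrm{Aff}_R(\mathbb{A}_R)$ is compatible with the valuation if (CA1) its linear part is ${}^v\nu$; (CA2) $2\varphi_\alpha(u)+\alpha(\nu(m(u))(o)-o)=0$ for any $\alpha\in\Phi$ and $u\in U_\alpha\setminus\{1\}$; (CA3) for any $\alpha\in\Phi$ and $m\in M_\alpha$, the element $\nu(m)$ has order 2. $T_b=\ker\nu$. **Subgroups.** For $\emptyset\ne\Omega\subset\mathbb{A}_R$: $U_{\alpha,\Omega}=\bigcap_{x\in\Omega}U_{\alpha,-\alpha(x)}$, $U_\Omega$ is generated by the $U_{\alpha,\Omega}$ ($\alpha\in\Phi$), $\widehat{N}_\Omega$ is the pointwise stabilizer of $\Omega$ in $N$ (via $\nu$), $\widehat{P}_\Omega$ is generated by $U_\Omega$ and $\widehat{N}_\Omega$. For a filter $\mathcal{V}$ on $\mathbb{A}_R$, $\widehat{P}_{\mathcal{V}}=\bigcup_{\Omega\in\mathcal{V}}\widehat{P}_\Omega$. **Chambers and faces.** Vector chambers are the sets $C^v_\Delta=\{v\in V_R:\alpha(v)>0\ \forall\alpha\in\Delta\}$ for bases $\Delta$ of $\Phi$. Put $D_{\alpha,\lambda}=\{y\in\mathbb{A}_R:\alpha(y)\ge-\lambda\}$, $\mathring{D}_{\alpha,\lambda}=\{y:\alpha(y)>-\lambda\}$, $D_{\alpha,\infty}=\mathring{D}_{\alpha,\infty}=\mathbb{A}_R$; $\mathbb{A}_R$ has the topology generated by the $\mathring{D}_{\alpha,\lambda}$, $\lambda\in R$. $\mathcal{F}_{x,C}$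 is the filter generated by the sets $\bigcap_{\alpha\in\Psi}\mathring{D}_{\alpha,\lambda_\alpha}\cap\bigcap_{\alpha\in\Phi\setminus\Psi}D_{\alpha,\lambda_\alpha}$ ($\Psi\subset\Phi$, $\lambda_\alpha\in\Gamma_\alpha\cup\{\infty\}$) containing $(x+C)\cap\Omega$ for some neighbourhood $\Omega$ of $x$. *)

theory Defs
  imports
    "HOL-Analysis.Bounded_Linear_Function"
    "HOL-Algebra.Free_Abelian_Groups"
    "HOL-Algebra.Bij"
    "HOL-Library.Extended"
begin

section \<open>Root systems\<close>

text \<open>Since \<^typ>\<open>'v::euclidean_space\<close> is finite-dimensional, every linear form on it is bounded.
  No use is made of the inner product.\<close>

type_synonym 'v dual = "'v \<Rightarrow>\<^sub>L real"

definition reflection :: "('v::euclidean_space dual \<Rightarrow> 'v) \<Rightarrow> 'v dual \<Rightarrow> 'v dual \<Rightarrow> 'v dual" where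
  "reflection cr \<alpha> \<beta> = \<beta> - blinfun_apply \<beta> (cr \<alpha>) *\<^sub>R \<alpha>"

text \<open>Not necessarily reduced.  The coroot map \<^term>\<open>cr\<close> is part of the data, but its values on
  \<^term>\<open>\<Phi>\<close> are determined by \<^term>\<open>\<Phi>\<close>.\<close>

locale root_system =
  fixes \<Phi> :: "'v::euclidean_space dual set" and cr :: "'v dual \<Rightarrow> 'v"
  assumes finite_roots: "finite \<Phi>"
    and zero_not_root: "0 \<notin> \<Phi>"
    and span_roots: "span \<Phi> = UNIV"
    and coroot_pairing: "\<And>\<alpha>. \<alpha> \<in> \<Phi> \<Longrightarrow> blinfun_apply \<alpha> (cr \<alpha>) = 2"
    and reflection_roots: "\<And>\<alpha>. \<alpha> \<in> \<Phi> \<Longrightarrow> reflection cr \<alpha> ` \<Phi> = \<Phi>"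
    and pairing_int: "\<And>\<alpha> \<beta>. \<alpha> \<in> \<Phi> \<Longrightarrow> \<beta> \<in> \<Phi> \<Longrightarrow> blinfun_apply \<beta> (cr \<alpha>) \<in> \<int>"

definition weyl_group ::
    "'v::euclidean_space dual set \<Rightarrow> ('v dual \<Rightarrow> 'v) \<Rightarrow> ('v dual \<Rightarrow> 'v dual) monoid" where
  "weyl_group \<Phi> cr =
     (BijGroup UNIV)\<lparr>carrier := generate (BijGroup UNIV) (reflection cr ` \<Phi>)\<rparr>"

text \<open>The contragredient action of the Weyl group on the space itself.\<close>

definition dual_action :: "('v::euclidean_space dual \<Rightarrow> 'v dual) \<Rightarrow> 'v \<Rightarrow> 'v" where
  "dual_action w v = (THE v'. \<forall>\<beta>. blinfun_apply (w \<beta>) v' = blinfun_apply \<beta> v)"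

definition multipliable :: "'v::euclidean_space dual set \<Rightarrow> 'v dual \<Rightarrow> bool" where
  "multipliable \<Phi> \<alpha> \<longleftrightarrow> 2 *\<^sub>R \<alpha> \<in> \<Phi>"

definition open_root_interval ::
    "'v::euclidean_space dual set \<Rightarrow> 'v dual \<Rightarrow> 'v dual \<Rightarrow> 'v dual set" where
  "open_root_interval \<Phi> \<alpha> \<beta> =
     {\<gamma> \<in> \<Phi>. \<exists>r s :: nat. r > 0 \<and> s > 0 \<and> \<gamma> = real r *\<^sub>R \<alpha> + real s *\<^sub>R \<beta>}"

definition nonneg_comb :: "'v::euclidean_space dual set \<Rightarrow> 'v dual set" where
  "nonneg_comb \<Delta> = {\<beta>. \<exists>c :: 'v dual \<Rightarrow> nat. \<beta> = (\<Sum>\<delta>\<in>\<Delta>. real (c \<delta>) *\<^sub>R \<delta>)}"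

definition root_base :: "'v::euclidean_space dual set \<Rightarrow> 'v dual set \<Rightarrow> bool" where
  "root_base \<Phi> \<Delta> \<longleftrightarrow> \<Delta> \<subseteq> \<Phi> \<and> independent \<Delta> \<and>
     (\<forall>\<beta>\<in>\<Phi>. \<beta> \<in> nonneg_comb \<Delta> \<or> - \<beta> \<in> nonneg_comb \<Delta>)"

definition positive_roots :: "'v::euclidean_space dual set \<Rightarrow> 'v dual set \<Rightarrow> 'v dual set" where
  "positive_roots \<Phi> \<Delta> = \<Phi> \<inter> nonneg_comb \<Delta>"

definition coweight_lattice :: "'v::euclidean_space dual set \<Rightarrow> 'v set" where
  "coweight_lattice \<Phi> = {v. \<forall>\<alpha>\<in>\<Phi>. blinfun_apply \<alpha> v \<in> \<int>}"


section \<open>Root group data\<close>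

definition commutators :: "('g, 'b) monoid_scheme \<Rightarrow> 'g set \<Rightarrow> 'g set \<Rightarrow> 'g set" where
  "commutators G H K =
     {h \<otimes>\<^bsub>G\<^esub> k \<otimes>\<^bsub>G\<^esub> inv\<^bsub>G\<^esub> h \<otimes>\<^bsub>G\<^esub> inv\<^bsub>G\<^esub> k | h k. h \<in> H \<and> k \<in> K}"

locale root_group_datum = root_system \<Phi> cr + group G
  for G :: "('g, 'b) monoid_scheme" and \<Phi> :: "'v::euclidean_space dual set" and cr +
  fixes T :: "'g set" and U M :: "'v dual \<Rightarrow> 'g set"
  assumes RGD1: "subgroup T G"
      "\<And>\<alpha>. \<alpha> \<in> \<Phi> \<Longrightarrow> subgroup (U \<alpha>) G" "\<And>\<alpha>. \<alpha> \<in> \<Phi> \<Longrightarrow> U \<alpha> \<noteq> {\<one>\<^bsub>G\<^esub>}"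
    and RGD2: "\<And>\<alpha> \<beta>. \<alpha> \<in> \<Phi> \<Longrightarrow> \<beta> \<in> \<Phi> \<Longrightarrow> (\<nexists>c. c < 0 \<and> \<beta> = c *\<^sub>R \<alpha>) \<Longrightarrow>
      generate G (commutators G (U \<alpha>) (U \<beta>))
        \<subseteq> generate G (\<Union>\<gamma>\<in>open_root_interval \<Phi> \<alpha> \<beta>. U \<gamma>)"
    and RGD3: "\<And>\<alpha>. \<alpha> \<in> \<Phi> \<Longrightarrow> multipliable \<Phi> \<alpha> \<Longrightarrow> U (2 *\<^sub>R \<alpha>) \<subset> U \<alpha>"
    and RGD4: "\<And>\<alpha>. \<alpha> \<in> \<Phi> \<Longrightarrow> M \<alpha> \<in> rcosets\<^bsub>G\<^esub> T"
      "\<And>\<alpha>. \<alpha> \<in> \<Phi> \<Longrightarrow> U (- \<alpha>) - {\<one>\<^bsub>G\<^esub>} \<subseteq> U \<alpha> <#>\<^bsub>G\<^esub> M \<alpha> <#>\<^bsub>G\<^esub> U \<alpha>"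
    and RGD5: "\<And>\<alpha> \<beta> m. \<alpha> \<in> \<Phi> \<Longrightarrow> \<beta> \<in> \<Phi> \<Longrightarrow> m \<in> M \<alpha> \<Longrightarrow>
      (\<lambda>u. m \<otimes>\<^bsub>G\<^esub> u \<otimes>\<^bsub>G\<^esub> inv\<^bsub>G\<^esub> m) ` U \<beta> = U (reflection cr \<alpha> \<beta>)"
    and RGD6: "\<And>\<Delta>. root_base \<Phi> \<Delta> \<Longrightarrow>
      (T <#>\<^bsub>G\<^esub> generate G (\<Union>\<alpha>\<in>positive_roots \<Phi> \<Delta>. U \<alpha>))
        \<inter> generate G (\<Union>\<alpha>\<in>\<Phi> - positive_roots \<Phi> \<Delta>. U \<alpha>) = {\<one>\<^bsub>G\<^esub>}"

definition generating ::
    "('g, 'b) monoid_scheme \<Rightarrow> 'v::euclidean_space dual set \<Rightarrow> 'g set \<Rightarrow> ('v dual \<Rightarrow> 'g set) \<Rightarrow> bool" where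
  "generating G \<Phi> T U \<longleftrightarrow> generate G (T \<union> (\<Union>\<alpha>\<in>\<Phi>. U \<alpha>)) = carrier G"

definition N_group ::
    "('g, 'b) monoid_scheme \<Rightarrow> 'v::euclidean_space dual set \<Rightarrow> ('v dual \<Rightarrow> 'g set) \<Rightarrow> 'g monoid" where
  "N_group G \<Phi> M = \<lparr>carrier = generate G (\<Union>\<alpha>\<in>\<Phi>. M \<alpha>), mult = mult G, one = one G\<rparr>"

text \<open>The epimorphism from \<open>N\<close> onto the Weyl group.  As \<open>N\<close> is generated by the \<open>M \<alpha>\<close>, the
  condition on the images of the \<open>M \<alpha>\<close> determines it (on \<open>N\<close>); that it is onto
  and has kernel \<open>T\<close> is a property of root group data.\<close>

definition vnu ::
    "('g, 'b) monoid_scheme \<Rightarrow> 'v::euclidean_space dual set \<Rightarrow> ('v dual \<Rightarrow> 'v) \<Rightarrow> ('v dual \<Rightarrow> 'g set)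
      \<Rightarrow> 'g \<Rightarrow> 'v dual \<Rightarrow> 'v dual" where
  "vnu G \<Phi> cr M = (THE f. f \<in> extensional (carrier (N_group G \<Phi> M)) \<and>
     f \<in> hom (N_group G \<Phi> M) (weyl_group \<Phi> cr) \<and>
     (\<forall>\<alpha>\<in>\<Phi>. f ` M \<alpha> = {reflection cr \<alpha>}))"

definition m_elt ::
    "('g, 'b) monoid_scheme \<Rightarrow> ('v::euclidean_space dual \<Rightarrow> 'g set) \<Rightarrow> ('v dual \<Rightarrow> 'g set)
      \<Rightarrow> 'v dual \<Rightarrow> 'g \<Rightarrow> 'g" where
  "m_elt G U M \<alpha> u = (THE m. m \<in> M \<alpha> \<inter> (U (- \<alpha>) <#>\<^bsub>G\<^esub> {u} <#>\<^bsub>G\<^esub> U (- \<alpha>)))"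


section \<open>Valuations\<close>

text \<open>\<open>R \<union> {\<infinity>}\<close> is represented by the elements of \<^typ>\<open>'r extended\<close> other than \<^const>\<open>Minf\<close>.\<close>

definition U_level ::
    "('v::euclidean_space dual \<Rightarrow> 'g set) \<Rightarrow> ('v dual \<Rightarrow> 'g \<Rightarrow> 'r::linordered_ab_group_add extended)
      \<Rightarrow> 'v dual \<Rightarrow> 'r extended \<Rightarrow> 'g set" where
  "U_level U \<phi> \<alpha> l = {u \<in> U \<alpha>. l \<le> \<phi> \<alpha> u}"

definition int_mult :: "int \<Rightarrow> 'a::ab_group_add \<Rightarrow> 'a" where
  "int_mult k a = (if 0 \<le> k then (\<Sum>i<nat k. a) else - (\<Sum>i<nat (- k). a))"

locale R_valuation = root_group_datum G \<Phi> cr T U M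
  for G :: "('g, 'b) monoid_scheme" and \<Phi> :: "'v::euclidean_space dual set" and cr T U M +
  fixes \<phi> :: "'v dual \<Rightarrow> 'g \<Rightarrow> 'r::linordered_ab_group_add extended"
  assumes nonzero: "\<exists>r::'r. r \<noteq> 0"
    and not_Minf: "\<And>\<alpha> u. \<alpha> \<in> \<Phi> \<Longrightarrow> u \<in> U \<alpha> \<Longrightarrow> \<phi> \<alpha> u \<noteq> Minf"
    and V0: "\<And>\<alpha>. \<alpha> \<in> \<Phi> \<Longrightarrow> \<exists>F \<subseteq> \<phi> \<alpha> ` U \<alpha>. card F = 3"
    and V1: "\<And>\<alpha> l. \<alpha> \<in> \<Phi> \<Longrightarrow> l \<noteq> Minf \<Longrightarrow> subgroup (U_level U \<phi> \<alpha> l) G"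
      "\<And>\<alpha>. \<alpha> \<in> \<Phi> \<Longrightarrow> U_level U \<phi> \<alpha> Pinf = {\<one>\<^bsub>G\<^esub>}"
    and V2: "\<And>\<alpha> m. \<alpha> \<in> \<Phi> \<Longrightarrow> m \<in> M \<alpha> \<Longrightarrow>
      \<exists>c. \<forall>u\<in>U (- \<alpha>) - {\<one>\<^bsub>G\<^esub>}. \<phi> (- \<alpha>) u - \<phi> \<alpha> (m \<otimes>\<^bsub>G\<^esub> u \<otimes>\<^bsub>G\<^esub> inv\<^bsub>G\<^esub> m) = c"
    and V3: "\<And>\<alpha> \<beta> l k. \<alpha> \<in> \<Phi> \<Longrightarrow> \<beta> \<in> \<Phi> \<Longrightarrow> (\<nexists>c. c \<le> 0 \<and> \<beta> = c *\<^sub>R \<alpha>) \<Longrightarrow>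
      generate G (commutators G (U_level U \<phi> \<alpha> (Fin l)) (U_level U \<phi> \<beta> (Fin k)))
        \<subseteq> generate G (\<Union>{U_level U \<phi> (real r *\<^sub>R \<alpha> + real s *\<^sub>R \<beta>)
                              (Fin (int_mult (int r) l + int_mult (int s) k)) | r s :: nat.
                            r > 0 \<and> s > 0 \<and> real r *\<^sub>R \<alpha> + real s *\<^sub>R \<beta> \<in> \<Phi>})"
    and V4: "\<And>\<alpha> u. \<alpha> \<in> \<Phi> \<Longrightarrow> multipliable \<Phi> \<alpha> \<Longrightarrow> u \<in> U (2 *\<^sub>R \<alpha>) \<Longrightarrow>
      \<phi> (2 *\<^sub>R \<alpha>) u = \<phi> \<alpha> u + \<phi> \<alpha> u"
    and V5: "\<And>\<alpha> u u' u''. \<alpha> \<in> \<Phi> \<Longrightarrow> u \<in> U \<alpha> \<Longrightarrow> u' \<in> U (- \<alpha>) \<Longrightarrow> u'' \<in> U (- \<alpha>) \<Longrightarrow>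
      u' \<otimes>\<^bsub>G\<^esub> u \<otimes>\<^bsub>G\<^esub> u'' \<in> M \<alpha> \<Longrightarrow> \<phi> (- \<alpha>) u' = - \<phi> \<alpha> u"

definition Gamma_values ::
    "('g, 'b) monoid_scheme \<Rightarrow> ('v::euclidean_space dual \<Rightarrow> 'g set)
      \<Rightarrow> ('v dual \<Rightarrow> 'g \<Rightarrow> 'r::linordered_ab_group_add extended) \<Rightarrow> 'v dual \<Rightarrow> 'r extended set" where
  "Gamma_values G U \<phi> \<alpha> = \<phi> \<alpha> ` (U \<alpha> - {\<one>\<^bsub>G\<^esub>})"


section \<open>The apartment\<close>

text \<open>\<open>V\<^sub>R = V\<^sub>\<int> \<otimes> R\<close> depends on \<open>\<Phi>\<close>, so it cannot be a type constructed from \<open>'r\<close> and \<open>'v\<close>.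
  Instead it is an arbitrary type \<open>'y\<close> with a map \<open>t\<close> (read \<open>t v a\<close> as \<open>v \<otimes> a\<close>) that exhibits it as the
  tensor product over the integers of a subgroup \<open>A\<close> of \<open>'v\<close> with \<open>'r\<close>: the free abelian group on \<open>A \<times> R\<close>
  maps onto \<open>'y\<close>, and the kernel is the subgroup generated by the bilinearity relations.\<close>

definition frag_eval ::
    "('v \<Rightarrow> 'r \<Rightarrow> 'y::ab_group_add) \<Rightarrow> ('v \<times> 'r \<Rightarrow>\<^sub>0 int) \<Rightarrow> 'y" where
  "frag_eval t c = (\<Sum>p\<in>Poly_Mapping.keys c. int_mult (Poly_Mapping.lookup c p) (t (fst p) (snd p)))"

definition bilinear_relations ::
    "'v::ab_group_add set \<Rightarrow> ('v \<times> 'r::ab_group_add \<Rightarrow>\<^sub>0 int) set" where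
  "bilinear_relations A =
     {frag_of (v + w, a) - frag_of (v, a) - frag_of (w, a) | v w a. v \<in> A \<and> w \<in> A} \<union>
     {frag_of (v, a + b) - frag_of (v, a) - frag_of (v, b) | v a b. v \<in> A}"

definition tensor_product ::
    "'v::ab_group_add set \<Rightarrow> ('v \<Rightarrow> 'r::ab_group_add \<Rightarrow> 'y::ab_group_add) \<Rightarrow> bool" where
  "tensor_product A t \<longleftrightarrow>
     frag_eval t ` carrier (free_Abelian_group (A \<times> UNIV)) = UNIV \<and>
     {c \<in> carrier (free_Abelian_group (A \<times> UNIV)). frag_eval t c = 0} =
       generate (free_Abelian_group (A \<times> UNIV)) (bilinear_relations A)"

text \<open>The linear extension of a root to \<open>V\<^sub>R\<close>, with values in \<open>R\<close>.\<close>

definition root_ext ::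
    "'v::euclidean_space dual set \<Rightarrow> ('v \<Rightarrow> 'r::ab_group_add \<Rightarrow> 'y::ab_group_add) \<Rightarrow> 'v dual \<Rightarrow> 'y \<Rightarrow> 'r" where
  "root_ext \<Phi> t \<alpha> = (THE f. additive f \<and>
     (\<forall>v\<in>coweight_lattice \<Phi>. \<forall>a. f (t v a) = int_mult \<lfloor>blinfun_apply \<alpha> v\<rfloor> a))"

text \<open>Affine spaces (Weyl's axioms); \<open>diff y x\<close> is the vector \<open>y - x\<close>.\<close>

definition affine_space :: "('p \<Rightarrow> 'p \<Rightarrow> 'y::ab_group_add) \<Rightarrow> bool" where
  "affine_space diff \<longleftrightarrow>
     (\<forall>x v. \<exists>!y. diff y x = v) \<and> (\<forall>x y z. diff z y + diff y x = diff z x)"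

definition root_at ::
    "'v::euclidean_space dual set \<Rightarrow> ('v \<Rightarrow> 'r::ab_group_add \<Rightarrow> 'y::ab_group_add) \<Rightarrow>
      ('p \<Rightarrow> 'p \<Rightarrow> 'y) \<Rightarrow> 'p \<Rightarrow> 'v dual \<Rightarrow> 'p \<Rightarrow> 'r" where
  "root_at \<Phi> t diff orig \<alpha> x = root_ext \<Phi> t \<alpha> (diff x orig)"

text \<open>The linear part of \<open>f\<close> is \<open>g \<otimes> id\<close>.\<close>

definition has_linear_part ::
    "'v::euclidean_space dual set \<Rightarrow> ('v \<Rightarrow> 'r \<Rightarrow> 'y::ab_group_add) \<Rightarrow>
      ('p \<Rightarrow> 'p \<Rightarrow> 'y) \<Rightarrow> ('p \<Rightarrow> 'p) \<Rightarrow> ('v \<Rightarrow> 'v) \<Rightarrow> bool" where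
  "has_linear_part \<Phi> t diff f g \<longleftrightarrow>
     (\<exists>L. additive L \<and> (\<forall>v\<in>coweight_lattice \<Phi>. \<forall>a. L (t v a) = t (g v) a) \<and>
          (\<forall>x y. diff (f x) (f y) = L (diff x y)))"

definition GL_lattice :: "'v::ab_group_add set \<Rightarrow> ('v \<Rightarrow> 'v) set" where
  "GL_lattice A = {g. bij_betw g A A \<and> (\<forall>v\<in>A. \<forall>w\<in>A. g (v + w) = g v + g w)}"

definition Aff_group ::
    "'v::euclidean_space dual set \<Rightarrow> ('v \<Rightarrow> 'r \<Rightarrow> 'y::ab_group_add) \<Rightarrow>
      ('p \<Rightarrow> 'p \<Rightarrow> 'y) \<Rightarrow> ('p \<Rightarrow> 'p) monoid" where
  "Aff_group \<Phi> t diff = (BijGroup UNIV)\<lparr>carrier :=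
     {f. bij f \<and> (\<exists>g\<in>GL_lattice (coweight_lattice \<Phi>). has_linear_part \<Phi> t diff f g)}\<rparr>"

locale compatible_action = R_valuation G \<Phi> cr T U M \<phi>
  for G :: "('g, 'b) monoid_scheme" and \<Phi> :: "'v::euclidean_space dual set" and cr T U M
    and \<phi> :: "'v dual \<Rightarrow> 'g \<Rightarrow> 'r::linordered_ab_group_add extended" +
  fixes t :: "'v \<Rightarrow> 'r \<Rightarrow> 'y::ab_group_add"
    and diff :: "'p \<Rightarrow> 'p \<Rightarrow> 'y"
    and orig :: 'p
    and \<nu> :: "'g \<Rightarrow> 'p \<Rightarrow> 'p"
  assumes tensor: "tensor_product (coweight_lattice \<Phi>) t"
    and affine: "affine_space diff"
    and action: "\<nu> \<in> hom (N_group G \<Phi> M) (Aff_group \<Phi> t diff)"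
    and CA1: "\<And>n. n \<in> carrier (N_group G \<Phi> M) \<Longrightarrow>
      has_linear_part \<Phi> t diff (\<nu> n) (dual_action (vnu G \<Phi> cr M n))"
    and CA2: "\<And>\<alpha> u. \<alpha> \<in> \<Phi> \<Longrightarrow> u \<in> U \<alpha> - {\<one>\<^bsub>G\<^esub>} \<Longrightarrow>
      \<phi> \<alpha> u + \<phi> \<alpha> u + Fin (root_ext \<Phi> t \<alpha> (diff (\<nu> (m_elt G U M \<alpha> u) orig) orig)) = 0"
    and CA3: "\<And>\<alpha> m. \<alpha> \<in> \<Phi> \<Longrightarrow> m \<in> M \<alpha> \<Longrightarrow> \<nu> m \<circ> \<nu> m = id \<and> \<nu> m \<noteq> id"

definition T_b ::
    "('g, 'b) monoid_scheme \<Rightarrow> 'v::euclidean_space dual set \<Rightarrow> ('v dual \<Rightarrow> 'g set) \<Rightarrow>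
      ('g \<Rightarrow> 'p \<Rightarrow> 'p) \<Rightarrow> 'g set" where
  "T_b G \<Phi> M \<nu> = {n \<in> carrier (N_group G \<Phi> M). \<nu> n = id}"


section \<open>The subgroups attached to subsets and filters of the apartment\<close>

text \<open>In the following, \<open>a \<alpha> x\<close> stands for the value \<open>\<alpha>(x) = \<alpha>(x - o)\<close>, i.e. \<open>a\<close> is \<^const>\<open>root_at\<close>
  applied to the data of the apartment.\<close>

definition U_root_subset ::
    "('v::euclidean_space dual \<Rightarrow> 'g set) \<Rightarrow> ('v dual \<Rightarrow> 'g \<Rightarrow> 'r::linordered_ab_group_add extended)
      \<Rightarrow> ('v dual \<Rightarrow> 'p \<Rightarrow> 'r) \<Rightarrow> 'p set \<Rightarrow> 'v dual \<Rightarrow> 'g set" where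
  "U_root_subset U \<phi> a \<Omega> \<alpha> = (\<Inter>x\<in>\<Omega>. U_level U \<phi> \<alpha> (Fin (- a \<alpha> x)))"

definition U_subset ::
    "('g, 'b) monoid_scheme \<Rightarrow> 'v::euclidean_space dual set \<Rightarrow> ('v dual \<Rightarrow> 'g set)
      \<Rightarrow> ('v dual \<Rightarrow> 'g \<Rightarrow> 'r::linordered_ab_group_add extended)
      \<Rightarrow> ('v dual \<Rightarrow> 'p \<Rightarrow> 'r) \<Rightarrow> 'p set \<Rightarrow> 'g set" where
  "U_subset G \<Phi> U \<phi> a \<Omega> = generate G (\<Union>\<alpha>\<in>\<Phi>. U_root_subset U \<phi> a \<Omega> \<alpha>)"

definition N_hat ::
    "('g, 'b) monoid_scheme \<Rightarrow> 'v::euclidean_space dual set \<Rightarrow> ('v dual \<Rightarrow> 'g set)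
      \<Rightarrow> ('g \<Rightarrow> 'p \<Rightarrow> 'p) \<Rightarrow> 'p set \<Rightarrow> 'g set" where
  "N_hat G \<Phi> M \<nu> \<Omega> = {n \<in> carrier (N_group G \<Phi> M). \<forall>x\<in>\<Omega>. \<nu> n x = x}"

definition P_hat ::
    "('g, 'b) monoid_scheme \<Rightarrow> 'v::euclidean_space dual set \<Rightarrow> ('v dual \<Rightarrow> 'g set) \<Rightarrow> ('v dual \<Rightarrow> 'g set)
      \<Rightarrow> ('v dual \<Rightarrow> 'g \<Rightarrow> 'r::linordered_ab_group_add extended)
      \<Rightarrow> ('g \<Rightarrow> 'p \<Rightarrow> 'p) \<Rightarrow> ('v dual \<Rightarrow> 'p \<Rightarrow> 'r) \<Rightarrow> 'p set \<Rightarrow> 'g set" where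
  "P_hat G \<Phi> U M \<phi> \<nu> a \<Omega> = generate G (U_subset G \<Phi> U \<phi> a \<Omega> \<union> N_hat G \<Phi> M \<nu> \<Omega>)"

definition P_hat_filter ::
    "('g, 'b) monoid_scheme \<Rightarrow> 'v::euclidean_space dual set \<Rightarrow> ('v dual \<Rightarrow> 'g set) \<Rightarrow> ('v dual \<Rightarrow> 'g set)
      \<Rightarrow> ('v dual \<Rightarrow> 'g \<Rightarrow> 'r::linordered_ab_group_add extended)
      \<Rightarrow> ('g \<Rightarrow> 'p \<Rightarrow> 'p) \<Rightarrow> ('v dual \<Rightarrow> 'p \<Rightarrow> 'r) \<Rightarrow> 'p filter \<Rightarrow> 'g set" where
  "P_hat_filter G \<Phi> U M \<phi> \<nu> a F =
     (\<Union>\<Omega>\<in>{\<Omega>. eventually (\<lambda>y. y \<in> \<Omega>) F}. P_hat G \<Phi> U M \<phi> \<nu> a \<Omega>)"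


section \<open>Chambers and faces\<close>

definition vector_chambers ::
    "'v::euclidean_space dual set \<Rightarrow> ('v \<Rightarrow> 'r::linordered_ab_group_add \<Rightarrow> 'y::ab_group_add)
      \<Rightarrow> 'y set set" where
  "vector_chambers \<Phi> t = {{v. \<forall>\<alpha>\<in>\<Delta>. root_ext \<Phi> t \<alpha> v > 0} | \<Delta>. root_base \<Phi> \<Delta>}"

text \<open>For \<open>l = \<infinity>\<close> both half-spaces are the whole apartment, because \<open>- \<infinity>\<close> is \<^const>\<open>Minf\<close>.\<close>

definition half_space ::
    "('v::euclidean_space dual \<Rightarrow> 'p \<Rightarrow> 'r::linordered_ab_group_add) \<Rightarrow> 'v dual \<Rightarrow> 'r extended \<Rightarrow> 'p set" where
  "half_space a \<alpha> l = {y. Fin (a \<alpha> y) \<ge> - l}"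

definition open_half_space ::
    "('v::euclidean_space dual \<Rightarrow> 'p \<Rightarrow> 'r::linordered_ab_group_add) \<Rightarrow> 'v dual \<Rightarrow> 'r extended \<Rightarrow> 'p set" where
  "open_half_space a \<alpha> l = {y. Fin (a \<alpha> y) > - l}"

definition apartment_open ::
    "'v::euclidean_space dual set \<Rightarrow> ('v dual \<Rightarrow> 'p \<Rightarrow> 'r::linordered_ab_group_add) \<Rightarrow> 'p set \<Rightarrow> bool" where
  "apartment_open \<Phi> a = generate_topology {open_half_space a \<alpha> (Fin l) | \<alpha> l. \<alpha> \<in> \<Phi>}"

definition neighbourhood ::
    "'v::euclidean_space dual set \<Rightarrow> ('v dual \<Rightarrow> 'p \<Rightarrow> 'r::linordered_ab_group_add) \<Rightarrow> 'p \<Rightarrow> 'p set \<Rightarrow> bool" where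
  "neighbourhood \<Phi> a x \<Omega> \<longleftrightarrow> (\<exists>S. apartment_open \<Phi> a S \<and> x \<in> S \<and> S \<subseteq> \<Omega>)"

definition chamber_filter ::
    "('g, 'b) monoid_scheme \<Rightarrow> 'v::euclidean_space dual set \<Rightarrow> ('v dual \<Rightarrow> 'g set)
      \<Rightarrow> ('v dual \<Rightarrow> 'g \<Rightarrow> 'r::linordered_ab_group_add extended)
      \<Rightarrow> ('p \<Rightarrow> 'p \<Rightarrow> 'y::ab_group_add) \<Rightarrow> ('v dual \<Rightarrow> 'p \<Rightarrow> 'r) \<Rightarrow> 'p \<Rightarrow> 'y set \<Rightarrow> 'p filter" where
  "chamber_filter G \<Phi> U \<phi> diff a x C =
     (INF A\<in>{A. (\<exists>\<Psi> l. \<Psi> \<subseteq> \<Phi> \<and> (\<forall>\<alpha>\<in>\<Phi>. l \<alpha> \<in> Gamma_values G U \<phi> \<alpha> \<union> {Pinf}) \<and>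
                   A = (\<Inter>\<alpha>\<in>\<Psi>. open_half_space a \<alpha> (l \<alpha>)) \<inter> (\<Inter>\<alpha>\<in>\<Phi> - \<Psi>. half_space a \<alpha> (l \<alpha>))) \<and>
                (\<exists>\<Omega>. neighbourhood \<Phi> a x \<Omega> \<and> {y. diff y x \<in> C} \<inter> \<Omega> \<subseteq> A)}. principal A)"

end

theory Submission
  imports Defs
begin

text \<open>The group attached to the germ of a chamber \<open>x + C\<close> is generated by \<open>T\<^sub>b\<close> and the \<open>u \<in> U\<^sub>\<alpha>\<close> with
  \<open>\<phi>\<^sub>\<alpha>(u) \<ge> -\<alpha>(x)\<close>, with strict inequality if \<open>\<alpha>\<close> is negative on \<open>C\<close>; divisibility of \<open>R\<close> ensures that a germ
  contains enough points for this.  Call it \<open>B\<close>.  By a rank one computation, \<open>B = (B \<inter> U\<^sup>-)(B \<inter> U\<^sup>+)T\<^sub>b\<close> for every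
  choice of positive roots, and flipping one simple root after the other gives the Iwasawa decomposition
  \<open>G = B N U\<^sup>+\<close> in the same way.  If \<open>n \<in> N \<inter> B B'\<close>, choose the positive roots by the sign of \<open>\<alpha>(x' - x)\<close>: then \<open>n\<close>
  lies in \<open>U\<^sup>-U\<^sup>+\<close> up to \<open>T\<^sub>b\<close>, hence in \<open>T\<^sub>b\<close>; this gives injectivity.  Surjectivity is proved by moving a point
  from \<open>x'\<close> deep into the chamber opposite to \<open>C'\<close>, where the Iwasawa decomposition suffices, and back.\<close>

section \<open>Integer multiples\<close>

text \<open>This shapes the last step: the moving point must reach \<open>x'\<close> although a
  descending family of positions may have no limit. Hence one Iwasawa decomposition of the element
  is fixed for each of the finitely many positive systems; its coordinates do not depend on the
  position, each bounds the parameter by one linear inequality, and divisibility solves the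
  corresponding equations. The left endpoints so obtained are finite in number, and a descent that
  can always go below a positive position must end at 0. Chamber geometry is replaced by the
  combinatorics of positive systems: a product decomposition is carried from one system to another
  by flips, and a generator is absorbed in a system where its root has the suitable sign. The facts
  about \<open>N\<close> used on the way (\<open>M a\<close> and \<open>M (- a)\<close> agree,
  \<open>N\<close> normalizes \<open>T\<close>, \<open>N\<close> meets U^- U^+ trivially) are not
  axioms; they are derived from RGD3 to RGD6, mostly by the uniqueness of the middle factor in
  RGD4.\<close>

lemma int_mult_0 [simp]: "int_mult 0 a = 0" "int_mult k 0 = 0"
  by (simp_all add: int_mult_def)

lemma int_mult_1 [simp]: "int_mult 1 a = a"
  by (simp add: int_mult_def)

lemma int_mult_minus_left [simp]: "int_mult (- k) a = - int_mult k a"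
  by (simp add: int_mult_def)

lemma int_mult_Suc: "int_mult (k + 1) a = int_mult k a + a"
proof (cases "0 \<le> k")
  case True
  then have "nat (k + 1) = Suc (nat k)" by simp
  then show ?thesis using True by (simp add: int_mult_def)
next
  case False
  then have "nat (- k) = Suc (nat (- (k + 1)))" by simp
  then show ?thesis using False by (simp add: int_mult_def)
qed

lemma int_mult_add_left: "int_mult (j + k) a = int_mult j a + int_mult k a"
proof (induct j rule: int_induct[where k = 0])
  case (step1 i)
  then show ?case using int_mult_Suc[of i a] int_mult_Suc[of "i + k" a] by (simp add: algebra_simps)
next
  case (step2 i)
  then show ?case using int_mult_Suc[of "i - 1" a] int_mult_Suc[of "i - 1 + k" a]
    by (simp add: algebra_simps)
qed simp

lemma int_mult_add_right: "int_mult k (a + b) = int_mult k a + int_mult k b"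
  by (simp add: int_mult_def sum.distrib)

lemma int_mult_minus_right [simp]: "int_mult k (- a) = - int_mult k a"
  using int_mult_add_right[of k a "- a"] by (simp add: eq_neg_iff_add_eq_0 add.commute)

lemma int_mult_diff_right: "int_mult k (a - b) = int_mult k a - int_mult k b"
  using int_mult_add_right[of k a "- b"] by simp

lemma int_mult_mult: "int_mult (j * k) a = int_mult j (int_mult k a)"
  by (induct j rule: int_induct[where k = 0]) (simp_all add: algebra_simps int_mult_add_left
      left_diff_distrib' int_mult_add_left[of _ "- _", simplified])

lemma int_mult_2: "int_mult 2 a = a + a"
  using int_mult_add_left[of 1 1 a] by simp

lemma int_mult_sum_left: "int_mult (\<Sum>i\<in>I. f i) a = (\<Sum>i\<in>I. int_mult (f i) a)"
  by (induct I rule: infinite_finite_induct) (simp_all add: int_mult_add_left)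

lemma int_mult_real: "int_mult k (x :: real) = of_int k * x"
  by (induct k rule: int_induct[where k = 0])
    (simp_all add: algebra_simps int_mult_add_left int_mult_add_left[of _ "- _", simplified])

lemma additive_int_mult:
  assumes "additive f"
  shows "f (int_mult k a) = int_mult k (f a)"
proof -
  interpret additive f by fact
  show ?thesis by (induct k rule: int_induct[where k = 0])
    (simp_all add: int_mult_add_left add zero diff int_mult_add_left[of _ "- _", simplified])
qed

lemma int_mult_nonneg:
  fixes a :: "'r::linordered_ab_group_add"
  shows "0 \<le> k \<Longrightarrow> 0 \<le> a \<Longrightarrow> 0 \<le> int_mult k a"
  by (simp add: int_mult_def sum_nonneg)

lemma int_mult_ge:
  fixes a :: "'r::linordered_ab_group_add"
  assumes "0 < k" "0 \<le> a" shows "a \<le> int_mult k a"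
  using int_mult_add_left[of "k - 1" 1 a] int_mult_nonneg[of "k - 1" a] assms by simp

lemma int_mult_pos:
  fixes a :: "'r::linordered_ab_group_add"
  assumes "0 < k" "0 < a" shows "0 < int_mult k a"
  using less_le_trans[OF assms(2) int_mult_ge[of k a]] assms by simp

lemma int_mult_less_iff:
  fixes a b :: "'r::linordered_ab_group_add"
  assumes "0 < k" shows "int_mult k a < int_mult k b \<longleftrightarrow> a < b"
proof -
  have "a < b \<Longrightarrow> int_mult k a < int_mult k b" for a b :: 'r
    using int_mult_pos[of k "b - a"] assms by (simp add: int_mult_diff_right)
  then show ?thesis by (metis less_asym linorder_less_linear)
qed

lemma int_mult_le_iff:
  fixes a b :: "'r::linordered_ab_group_add"
  assumes "0 < k" shows "int_mult k a \<le> int_mult k b \<longleftrightarrow> a \<le> b"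
  using int_mult_less_iff[OF assms, of b a] by (simp add: not_less[symmetric])

lemma int_mult_le_left:
  fixes a :: "'r::linordered_ab_group_add"
  assumes "j \<le> k" "0 \<le> a" shows "int_mult j a \<le> int_mult k a"
  using int_mult_add_left[of "k - j" j a] int_mult_nonneg[of "k - j" a] assms by simp

lemma int_mult_inj:
  fixes a :: "'r::linordered_ab_group_add"
  assumes "a \<noteq> 0" "int_mult j a = int_mult k a" shows "j = k"
proof -
  have *: "int_mult n a \<noteq> 0" if "0 < n" for n
    using int_mult_pos[OF that, of a] int_mult_pos[OF that, of "- a"] assms(1)
    by (cases "0 < a") (auto simp: not_less order.strict_iff_order)
  have "int_mult (j - k) a = 0" "int_mult (k - j) a = 0"
    using int_mult_add_left[of j "- k" a] int_mult_add_left[of k "- j" a] assms(2) by simp_all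
  with *[of "j - k"] *[of "k - j"] show ?thesis by force
qed


section \<open>Positive systems and galleries\<close>

text \<open>Reflexivity in finite dimension: the representing vector has as coordinates the values
  of \<open>f\<close> on the dual basis \<open>blinfun_inner_left i\<close>.\<close>

lemma dual_functional:
  fixes f :: "'v::euclidean_space dual \<Rightarrow> real"
  assumes "linear f"
  shows "\<exists>v. \<forall>\<beta>. blinfun_apply \<beta> v = f \<beta>"
proof -
  have "blinfun_apply \<beta> (\<Sum>i\<in>Basis. f (blinfun_inner_left i) *\<^sub>R i) = f \<beta>" for \<beta> :: "'v dual"
  proof -
    have "\<beta> = (\<Sum>i\<in>Basis. blinfun_apply \<beta> i *\<^sub>R blinfun_inner_left i)"
    proof (rule blinfun_eqI)
      fix x :: 'v
      have "blinfun_apply \<beta> x = blinfun_apply \<beta> (\<Sum>i\<in>Basis. (x \<bullet> i) *\<^sub>R i)"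
        by (simp add: euclidean_representation)
      also have "\<dots> = (\<Sum>i\<in>Basis. (x \<bullet> i) * blinfun_apply \<beta> i)"
        by (simp add: blinfun.sum_right blinfun.scaleR_right)
      finally show "blinfun_apply \<beta> x
          = blinfun_apply (\<Sum>i\<in>Basis. blinfun_apply \<beta> i *\<^sub>R blinfun_inner_left i) x"
        by (simp add: blinfun.sum_left blinfun.scaleR_left mult.commute)
    qed
    then have "f \<beta> = f (\<Sum>i\<in>Basis. blinfun_apply \<beta> i *\<^sub>R blinfun_inner_left i)"
      by (rule arg_cong)
    then have "f \<beta> = (\<Sum>i\<in>Basis. blinfun_apply \<beta> i * f (blinfun_inner_left i))"
      by (simp add: linear_sum[OF assms] linear_scale[OF assms])
    then show ?thesis by (simp add: blinfun.sum_right blinfun.scaleR_right mult.commute)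
  qed
  then show ?thesis by blast
qed

lemma independent_functional:
  fixes B :: "'v::euclidean_space dual set"
  assumes "independent B"
  shows "\<exists>v. \<forall>\<beta>\<in>B. blinfun_apply \<beta> v = f \<beta>"
proof -
  obtain g where "linear g" "\<forall>x\<in>B. g x = f x"
    using linear_independent_extend[OF assms, of f] by blast
  with dual_functional[of g] show ?thesis by metis
qed

context root_system
begin

definition pos :: "'v dual set \<Rightarrow> bool" where
  "pos \<Psi> \<longleftrightarrow> (\<exists>\<Delta>. root_base \<Phi> \<Delta> \<and> \<Psi> = positive_roots \<Phi> \<Delta>)"

definition simple :: "'v dual set \<Rightarrow> 'v dual \<Rightarrow> bool" where
  "simple \<Psi> a \<longleftrightarrow> (\<exists>\<Delta>. root_base \<Phi> \<Delta> \<and> a \<in> \<Delta> \<and> \<Psi> = positive_roots \<Phi> \<Delta>)"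

text \<open>The positive system of the chamber on the other side of the wall of \<open>a\<close>,
  when \<open>a\<close> is simple for \<Psi>.\<close>

definition flip :: "'v dual set \<Rightarrow> 'v dual \<Rightarrow> 'v dual set" where
  "flip \<Psi> a = reflection cr a ` \<Psi>"

section \<open>Reflections and proportional roots\<close>

lemma reflection_self [simp]: "a \<in> \<Phi> \<Longrightarrow> reflection cr a a = - a"
  by (simp add: reflection_def coroot_pairing scaleR_2)

lemma root_neg: "a \<in> \<Phi> \<Longrightarrow> - a \<in> \<Phi>"
  using reflection_roots[of a] reflection_self[of a] by (metis imageI)

lemma root_neg_iff [simp]: "- a \<in> \<Phi> \<longleftrightarrow> a \<in> \<Phi>"
  using root_neg[of a] root_neg[of "- a"] by auto

lemma linear_reflection: "linear (reflection cr a)"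
  by (rule linearI) (simp_all add: reflection_def blinfun.add_left blinfun.scaleR_left algebra_simps)

lemma reflection_minus [simp]: "reflection cr a (- b) = - reflection cr a b"
  by (rule linear_neg[OF linear_reflection])

lemma reflection_invol [simp]: "a \<in> \<Phi> \<Longrightarrow> reflection cr a (reflection cr a b) = b"
  by (simp add: reflection_def blinfun.diff_left blinfun.scaleR_left coroot_pairing algebra_simps
      flip: scaleR_add_left)

lemma reflection_root: "a \<in> \<Phi> \<Longrightarrow> b \<in> \<Phi> \<Longrightarrow> reflection cr a b \<in> \<Phi>"
  using reflection_roots[of a] by blast

text \<open>Both m = 2c and n = 2/c are pairings of a root with a coroot, hence integers, and m n =
  4 leaves m = 1, 2 or 4 for positive c.\<close>

lemma root_multiple:
  assumes "a \<in> \<Phi>" "c *\<^sub>R a \<in> \<Phi>" "c > 0"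
  shows "c = 1 \<or> c = 2 \<or> c = 1 / 2"
proof -
  have "c \<noteq> 0" using assms by simp
  have "c * 2 \<in> \<int>" using pairing_int[OF assms(1,2)] coroot_pairing[OF assms(1)]
    by (simp add: blinfun.scaleR_left)
  then obtain m where m: "c * 2 = of_int m" by (auto elim: Ints_cases)
  have "c * blinfun_apply a (cr (c *\<^sub>R a)) = 2"
    using coroot_pairing[OF assms(2)] by (simp add: blinfun.scaleR_left)
  moreover obtain n where n: "blinfun_apply a (cr (c *\<^sub>R a)) = of_int n"
    using pairing_int[OF assms(2,1)] by (auto elim: Ints_cases)
  ultimately have cn: "c * of_int n = 2" by simp
  have "of_int (m * n) = 2 * (c * of_int n)" by (simp flip: m)
  then have "of_int (m * n) = (4 :: real)" by (simp only: cn)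
  then have mn: "m * n = 4" by linarith
  have "m > 0" using m assms(3) by linarith
  moreover have "m dvd 4" using mn by (metis dvd_triv_left)
  ultimately have "m \<le> 4" "m > 0" by (auto dest: zdvd_imp_le)
  moreover have "m \<noteq> 3"
  proof
    assume "m = 3"
    with mn have "3 * n = 4" by simp
    then show False by presburger
  qed
  ultimately have "m = 1 \<or> m = 2 \<or> m = 4" by linarith
  with m show ?thesis by auto
qed

section \<open>Coordinates of roots through the fundamental coweights of a base\<close>

definition cow :: "'v dual set \<Rightarrow> 'v dual \<Rightarrow> 'v" where
  "cow \<Delta> \<delta> = (SOME v. \<forall>\<beta>\<in>\<Delta>. blinfun_apply \<beta> v = (if \<beta> = \<delta> then 1 else 0))"

context
  fixes \<Delta>
  assumes base: "root_base \<Phi> \<Delta>"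
begin

lemma base_finite: "finite \<Delta>"
  using base finite_roots finite_subset by (auto simp: root_base_def)

lemma base_cow:
  assumes "\<delta>' \<in> \<Delta>"
  shows "blinfun_apply \<delta>' (cow \<Delta> \<delta>) = (if \<delta>' = \<delta> then 1 else 0)"
proof -
  have "independent \<Delta>" using base by (simp add: root_base_def)
  from someI_ex[OF independent_functional[OF this, of "\<lambda>\<beta>. if \<beta> = \<delta> then 1 else 0"]] assms
  show ?thesis by (simp add: cow_def)
qed

lemma cow_nonneg_comb:
  assumes "\<beta> \<in> nonneg_comb \<Delta>"
  shows "\<forall>\<delta>\<in>\<Delta>. blinfun_apply \<beta> (cow \<Delta> \<delta>) \<in> \<int> \<and> blinfun_apply \<beta> (cow \<Delta> \<delta>) \<ge> 0"
    "\<beta> = (\<Sum>\<delta>\<in>\<Delta>. blinfun_apply \<beta> (cow \<Delta> \<delta>) *\<^sub>R \<delta>)"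
proof -
  obtain c :: "'v dual \<Rightarrow> nat" where c: "\<beta> = (\<Sum>\<delta>\<in>\<Delta>. real (c \<delta>) *\<^sub>R \<delta>)"
    using assms unfolding nonneg_comb_def by blast
  have *: "blinfun_apply \<beta> (cow \<Delta> \<delta>) = real (c \<delta>)" if "\<delta> \<in> \<Delta>" for \<delta>
  proof -
    have "blinfun_apply \<beta> (cow \<Delta> \<delta>) = (\<Sum>\<delta>'\<in>\<Delta>. if \<delta>' = \<delta> then real (c \<delta>') else 0)"
      unfolding c blinfun.sum_left blinfun.scaleR_left by (rule sum.cong) (auto simp: base_cow)
    then show ?thesis using base_finite that by simp
  qed
  then show "\<forall>\<delta>\<in>\<Delta>. blinfun_apply \<beta> (cow \<Delta> \<delta>) \<in> \<int> \<and> blinfun_apply \<beta> (cow \<Delta> \<delta>) \<ge> 0" by simp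
  show "\<beta> = (\<Sum>\<delta>\<in>\<Delta>. blinfun_apply \<beta> (cow \<Delta> \<delta>) *\<^sub>R \<delta>)"
    using * by (subst c) (rule sum.cong, auto)
qed

lemma base_pm: "\<beta> \<in> \<Phi> \<Longrightarrow> \<beta> \<in> nonneg_comb \<Delta> \<or> - \<beta> \<in> nonneg_comb \<Delta>"
  using base by (simp add: root_base_def)

lemma base_rep:
  assumes "\<beta> \<in> \<Phi>"
  shows "\<beta> = (\<Sum>\<delta>\<in>\<Delta>. blinfun_apply \<beta> (cow \<Delta> \<delta>) *\<^sub>R \<delta>)"
  using base_pm[OF assms]
proof
  assume "- \<beta> \<in> nonneg_comb \<Delta>"
  from cow_nonneg_comb(2)[OF this]
  have "- \<beta> = - (\<Sum>\<delta>\<in>\<Delta>. blinfun_apply \<beta> (cow \<Delta> \<delta>) *\<^sub>R \<delta>)"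
    by (simp add: blinfun.minus_left sum_negf)
  then show ?thesis by simp
qed (rule cow_nonneg_comb(2))

lemma base_cow_int:
  assumes "\<beta> \<in> \<Phi>" "\<delta> \<in> \<Delta>"
  shows "blinfun_apply \<beta> (cow \<Delta> \<delta>) \<in> \<int>"
  using base_pm[OF assms(1)] cow_nonneg_comb(1)[of \<beta>] cow_nonneg_comb(1)[of "- \<beta>"] assms(2)
  by (auto simp: blinfun.minus_left)

lemma base_cow_coweight: "\<delta> \<in> \<Delta> \<Longrightarrow> cow \<Delta> \<delta> \<in> coweight_lattice \<Phi>"
  using base_cow_int by (simp add: coweight_lattice_def)

lemma base_cow_nonzero:
  assumes "\<beta> \<in> \<Phi>"
  shows "\<exists>\<delta>\<in>\<Delta>. blinfun_apply \<beta> (cow \<Delta> \<delta>) \<noteq> 0"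
proof (rule ccontr)
  assume "\<not> ?thesis"
  then have "(\<Sum>\<delta>\<in>\<Delta>. blinfun_apply \<beta> (cow \<Delta> \<delta>) *\<^sub>R \<delta>) = 0" by simp
  with base_rep[OF assms] zero_not_root assms show False by simp
qed

lemma base_cow_neg:
  assumes "\<beta> \<in> \<Phi>" "\<beta> \<notin> nonneg_comb \<Delta>" "\<delta> \<in> \<Delta>"
  shows "blinfun_apply \<beta> (cow \<Delta> \<delta>) \<le> 0"
  using cow_nonneg_comb(1)[of "- \<beta>"] base_pm[OF assms(1)] assms by (simp add: blinfun.minus_left)

lemma base_pos_iff_all:
  assumes "\<beta> \<in> \<Phi>"
  shows "\<beta> \<in> positive_roots \<Phi> \<Delta> \<longleftrightarrow> (\<forall>\<delta>\<in>\<Delta>. blinfun_apply \<beta> (cow \<Delta> \<delta>) \<ge> 0)"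
proof
  assume "\<forall>\<delta>\<in>\<Delta>. blinfun_apply \<beta> (cow \<Delta> \<delta>) \<ge> 0"
  then show "\<beta> \<in> positive_roots \<Phi> \<Delta>"
    using base_cow_neg[OF assms] base_cow_nonzero[OF assms] assms
    by (force simp: positive_roots_def)
qed (use cow_nonneg_comb(1)[of \<beta>] in \<open>simp add: positive_roots_def\<close>)

text \<open>All coordinates of a root have one sign and they do not all vanish, so one positive
  coordinate is as good as all being nonnegative. The form with "all" serves closure properties, the
  form with "some" serves negation.\<close>

lemma base_pos_iff_ex:
  assumes "\<beta> \<in> \<Phi>"
  shows "\<beta> \<in> positive_roots \<Phi> \<Delta> \<longleftrightarrow> (\<exists>\<delta>\<in>\<Delta>. blinfun_apply \<beta> (cow \<Delta> \<delta>) > 0)"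
proof
  assume "\<beta> \<in> positive_roots \<Phi> \<Delta>"
  then show "\<exists>\<delta>\<in>\<Delta>. blinfun_apply \<beta> (cow \<Delta> \<delta>) > 0"
    using base_pos_iff_all[OF assms] base_cow_nonzero[OF assms] by force
next
  assume "\<exists>\<delta>\<in>\<Delta>. blinfun_apply \<beta> (cow \<Delta> \<delta>) > 0"
  then show "\<beta> \<in> positive_roots \<Phi> \<Delta>"
    using base_cow_neg[OF assms] assms by (force simp: positive_roots_def)
qed

end

section \<open>Positive systems and their simple roots\<close>

lemma simple_pos: "simple \<Psi> a \<Longrightarrow> pos \<Psi>"
  by (auto simp: pos_def simple_def)

lemma simple_mem: "simple \<Psi> a \<Longrightarrow> a \<in> \<Psi>"
  unfolding simple_def
proof (elim exE conjE)
  fix \<Delta> assume b: "root_base \<Phi> \<Delta>" and a: "a \<in> \<Delta>" and P: "\<Psi> = positive_roots \<Phi> \<Delta>"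
  define \<omega> where "\<omega> = cow \<Delta>"
  have w1: "\<And>\<delta> \<delta>'. \<delta> \<in> \<Delta> \<Longrightarrow> \<delta>' \<in> \<Delta> \<Longrightarrow> blinfun_apply \<delta>' (\<omega> \<delta>) = (if \<delta>' = \<delta> then 1 else 0)"
    unfolding \<omega>_def by (rule base_cow[OF b])
  have w2: "\<And>\<beta>. \<beta> \<in> \<Phi> \<Longrightarrow> \<beta> \<in> positive_roots \<Phi> \<Delta> \<longleftrightarrow> (\<exists>\<delta>\<in>\<Delta>. blinfun_apply \<beta> (\<omega> \<delta>) > 0)"
    unfolding \<omega>_def by (rule base_pos_iff_ex[OF b])
  have "a \<in> \<Phi>" using a b by (auto simp: root_base_def)
  then show "a \<in> \<Psi>" using w2[of a] w1[OF a a] a P by (metis zero_less_one)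
qed

lemma pos_subset: "pos \<Psi> \<Longrightarrow> \<Psi> \<subseteq> \<Phi>"
  by (auto simp: pos_def positive_roots_def)

lemma pos_neg_iff:
  assumes "pos \<Psi>" "a \<in> \<Phi>"
  shows "- a \<in> \<Psi> \<longleftrightarrow> a \<notin> \<Psi>"
proof -
  obtain \<Delta> where b: "root_base \<Phi> \<Delta>" and P: "\<Psi> = positive_roots \<Phi> \<Delta>"
    using assms by (auto simp: pos_def)
  define \<omega> where "\<omega> = cow \<Delta>"
  have w1: "\<And>\<beta>. \<beta> \<in> \<Phi> \<Longrightarrow> \<beta> \<in> positive_roots \<Phi> \<Delta> \<longleftrightarrow> (\<forall>\<delta>\<in>\<Delta>. blinfun_apply \<beta> (\<omega> \<delta>) \<ge> 0)"
    unfolding \<omega>_def by (rule base_pos_iff_all[OF b])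
  have w2: "\<And>\<beta>. \<beta> \<in> \<Phi> \<Longrightarrow> \<beta> \<in> positive_roots \<Phi> \<Delta> \<longleftrightarrow> (\<exists>\<delta>\<in>\<Delta>. blinfun_apply \<beta> (\<omega> \<delta>) > 0)"
    unfolding \<omega>_def by (rule base_pos_iff_ex[OF b])
  from w1[of "- a"] w2[of a] assms(2) P show ?thesis
    by (auto simp: blinfun.minus_left not_less)
qed

lemma pos_comb:
  assumes "pos \<Psi>" "a \<in> \<Psi>" "b \<in> \<Psi>" "r *\<^sub>R a + s *\<^sub>R b \<in> \<Phi>" "r \<ge> 0" "s \<ge> 0"
  shows "r *\<^sub>R a + s *\<^sub>R b \<in> \<Psi>"
proof -
  obtain \<Delta> where b: "root_base \<Phi> \<Delta>" and P: "\<Psi> = positive_roots \<Phi> \<Delta>"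
    using assms by (auto simp: pos_def)
  define \<omega> where "\<omega> = cow \<Delta>"
  have *: "\<And>\<beta>. \<beta> \<in> \<Phi> \<Longrightarrow> \<beta> \<in> positive_roots \<Phi> \<Delta> \<longleftrightarrow> (\<forall>\<delta>\<in>\<Delta>. blinfun_apply \<beta> (\<omega> \<delta>) \<ge> 0)"
    unfolding \<omega>_def by (rule base_pos_iff_all[OF b])
  have "a \<in> \<Phi>" "b \<in> \<Phi>" using assms pos_subset by blast+
  then show ?thesis using assms *[of a] *[of b] *[of "r *\<^sub>R a + s *\<^sub>R b"]
    by (simp add: P blinfun.add_left blinfun.scaleR_left)
qed

lemma pos_scale: "pos \<Psi> \<Longrightarrow> a \<in> \<Psi> \<Longrightarrow> c *\<^sub>R a \<in> \<Phi> \<Longrightarrow> c \<ge> 0 \<Longrightarrow> c *\<^sub>R a \<in> \<Psi>"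
  using pos_comb[of \<Psi> a a c 0] by simp

lemma pos_scale_nonneg:
  assumes "pos \<Psi>" "a \<in> \<Psi>" "c *\<^sub>R a \<in> \<Psi>"
  shows "c > 0"
proof (rule ccontr)
  assume "\<not> c > 0"
  then have "- (c *\<^sub>R a) \<in> \<Psi>"
    using pos_scale[of \<Psi> a "- c"] assms pos_subset[OF assms(1)] by auto
  then show False using pos_neg_iff[OF assms(1), of "c *\<^sub>R a"] assms pos_subset by blast
qed

lemma nonneg_comb_image:
  fixes f :: "'v dual \<Rightarrow> 'v dual"
  assumes "linear f" "inj_on f \<Delta>" "\<beta> \<in> nonneg_comb \<Delta>"
  shows "f \<beta> \<in> nonneg_comb (f ` \<Delta>)"
proof -
  obtain c :: "'v dual \<Rightarrow> nat" where c: "\<beta> = (\<Sum>\<delta>\<in>\<Delta>. real (c \<delta>) *\<^sub>R \<delta>)"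
    using assms(3) unfolding nonneg_comb_def by blast
  have "f \<beta> = (\<Sum>\<delta>\<in>\<Delta>. real (c \<delta>) *\<^sub>R f \<delta>)"
    by (simp add: c linear_sum[OF assms(1)] linear_scale[OF assms(1)])
  also have "\<dots> = (\<Sum>\<delta>\<in>f ` \<Delta>. real (c (inv_into \<Delta> f \<delta>)) *\<^sub>R \<delta>)"
    using assms(2) by (simp add: sum.reindex)
  finally show ?thesis unfolding nonneg_comb_def by (intro CollectI exI[of _ "\<lambda>\<delta>. c (inv_into \<Delta> f \<delta>)"])
qed

text \<open>Stated for involutions, since it is meant for reflections and for -1: the converse
  inclusions come from applying the first half to the image.\<close>

lemma root_base_image:
  fixes f :: "'v dual \<Rightarrow> 'v dual"
  assumes "linear f" "f ` \<Phi> = \<Phi>" "\<And>x. f (f x) = x" "root_base \<Phi> \<Delta>"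
  shows "root_base \<Phi> (f ` \<Delta>)" "positive_roots \<Phi> (f ` \<Delta>) = f ` positive_roots \<Phi> \<Delta>"
proof -
  have inj: "inj f" using assms(3) by (metis injI)
  have ff: "f ` f ` X = X" for X using assms(3) by (simp add: image_image)
  have N: "f \<beta> \<in> nonneg_comb (f ` \<Delta>)" if "\<beta> \<in> nonneg_comb \<Delta>" for \<beta> \<Delta>
    using nonneg_comb_image[OF assms(1) _ that] inj by (simp add: inj_on_subset)
  have N': "f \<beta> \<in> nonneg_comb (f ` \<Delta>) \<longleftrightarrow> \<beta> \<in> nonneg_comb \<Delta>" for \<beta>
    using N[of \<beta> \<Delta>] N[of "f \<beta>" "f ` \<Delta>"] assms(3) ff by auto
  have neg: "- f \<beta> = f (- \<beta>)" for \<beta> using linear_neg[OF assms(1)] by simp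
  show "root_base \<Phi> (f ` \<Delta>)"
    unfolding root_base_def
  proof (intro conjI ballI)
    show "f ` \<Delta> \<subseteq> \<Phi>" using assms(2,4) by (auto simp: root_base_def)
    have "independent \<Delta>" using assms(4) by (simp add: root_base_def)
    then show "independent (f ` \<Delta>)"
      by (intro linear_independent_injective_image assms(1) inj_on_subset[OF inj] subset_UNIV)
    fix \<beta> assume "\<beta> \<in> \<Phi>"
    then obtain \<gamma> where g: "\<gamma> \<in> \<Phi>" "\<beta> = f \<gamma>" using assms(2) by blast
    then have "\<gamma> \<in> nonneg_comb \<Delta> \<or> - \<gamma> \<in> nonneg_comb \<Delta>" using assms(4) by (auto simp: root_base_def)
    then show "\<beta> \<in> nonneg_comb (f ` \<Delta>) \<or> - \<beta> \<in> nonneg_comb (f ` \<Delta>)"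
      unfolding g(2) neg N' .
  qed
  show "positive_roots \<Phi> (f ` \<Delta>) = f ` positive_roots \<Phi> \<Delta>"
    unfolding positive_roots_def
  proof (intro equalityI subsetI)
    fix x assume "x \<in> \<Phi> \<inter> nonneg_comb (f ` \<Delta>)"
    then have "f x \<in> \<Phi> \<inter> nonneg_comb \<Delta>" using N'[of "f x"] assms(2,3) by auto
    then show "x \<in> f ` (\<Phi> \<inter> nonneg_comb \<Delta>)" using assms(3) by (metis imageI)
  next
    fix x assume "x \<in> f ` (\<Phi> \<inter> nonneg_comb \<Delta>)"
    then show "x \<in> \<Phi> \<inter> nonneg_comb (f ` \<Delta>)" using N' assms(2) by auto
  qed
qed

lemma pos_reflection: "pos \<Psi> \<Longrightarrow> a \<in> \<Phi> \<Longrightarrow> pos (reflection cr a ` \<Psi>)"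
  unfolding pos_def using root_base_image[OF linear_reflection reflection_roots reflection_invol] by metis

lemma uminus_roots: "uminus ` \<Phi> = \<Phi>"
proof -
  have "x \<in> uminus ` \<Phi>" if "x \<in> \<Phi>" for x using that by (intro image_eqI[of _ _ "- x"]) auto
  then show ?thesis by auto
qed

lemma linear_uminus': "linear (uminus :: 'v dual \<Rightarrow> 'v dual)"
  by (rule linearI) simp_all

lemma pos_uminus: "pos \<Psi> \<Longrightarrow> pos (uminus ` \<Psi>)"
  unfolding pos_def using root_base_image[OF linear_uminus' uminus_roots] by (metis minus_minus)

lemma pos_uminus_iff: "pos \<Psi> \<Longrightarrow> a \<in> \<Phi> \<Longrightarrow> a \<in> uminus ` \<Psi> \<longleftrightarrow> a \<notin> \<Psi>"
  using pos_neg_iff[of \<Psi> a] by (metis image_iff minus_minus)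

lemma simple_flip:
  assumes "simple \<Psi> a" shows "simple (flip \<Psi> a) (- a)"
proof -
  have a: "a \<in> \<Phi>" using simple_mem[OF assms] simple_pos[OF assms] pos_subset by blast
  from assms obtain \<Delta> where "root_base \<Phi> \<Delta>" "a \<in> \<Delta>" "\<Psi> = positive_roots \<Phi> \<Delta>"
    by (auto simp: simple_def)
  with root_base_image[OF linear_reflection reflection_roots reflection_invol] a
  show ?thesis unfolding simple_def flip_def by (metis imageI reflection_self)
qed

lemma simple_root: "simple \<Psi> a \<Longrightarrow> a \<in> \<Phi>"
  using simple_mem simple_pos pos_subset by blast

text \<open>The coordinate of c a along \<open>a\<close> is c, and coordinates of roots are
  integers; this removes the value 1/2 left open by \<open>root_multiple\<close>.\<close>

lemma simple_multiple:
  assumes "simple \<Psi> a" "c *\<^sub>R a \<in> \<Phi>" "c > 0"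
  shows "c = 1 \<or> c = 2"
proof -
  from assms obtain \<Delta> where b: "root_base \<Phi> \<Delta>" "a \<in> \<Delta>" by (auto simp: simple_def)
  define \<omega> where "\<omega> = cow \<Delta>"
  have w1: "\<And>\<delta> \<delta>'. \<delta> \<in> \<Delta> \<Longrightarrow> \<delta>' \<in> \<Delta> \<Longrightarrow> blinfun_apply \<delta>' (\<omega> \<delta>) = (if \<delta>' = \<delta> then 1 else 0)"
    unfolding \<omega>_def by (rule base_cow[OF b(1)])
  have w2: "\<And>\<delta>. \<delta> \<in> \<Delta> \<Longrightarrow> \<omega> \<delta> \<in> coweight_lattice \<Phi>"
    unfolding \<omega>_def by (rule base_cow_coweight[OF b(1)])
  from w2[OF b(2)] assms(2) have "blinfun_apply (c *\<^sub>R a) (\<omega> a) \<in> \<int>"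
    unfolding coweight_lattice_def by blast
  then have "c \<in> \<int>" using w1[OF b(2) b(2)] by (simp add: blinfun.scaleR_left)
  moreover have "(1 / 2 :: real) \<notin> \<int>"
  proof
    assume "(1 / 2 :: real) \<in> \<int>"
    then obtain k where "(1 / 2 :: real) = of_int k" by (auto elim: Ints_cases)
    then have "of_int (2 * k) = (1 :: real)" by simp
    then have "2 * k = 1" by linarith
    then show False by presburger
  qed
  ultimately show ?thesis using root_multiple[OF simple_root[OF assms(1)] assms(2,3)] by blast
qed

text \<open>The classical fact that a simple reflection permutes the positive roots off its own
  line, in a form that allows for the multiple 2a: membership is reversed on the line of
  \<open>a\<close> and unchanged elsewhere.\<close>

lemma flip_iff:
  assumes "simple \<Psi> a" "b \<in> \<Phi>"
  shows "b \<in> flip \<Psi> a \<longleftrightarrow> (if \<exists>c. b = c *\<^sub>R a then b \<notin> \<Psi> else b \<in> \<Psi>)"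
proof -
  have aP: "a \<in> \<Phi>" using assms(1) by (rule simple_root)
  have pP: "pos \<Psi>" using assms(1) by (rule simple_pos)
  from assms obtain \<Delta> where b: "root_base \<Phi> \<Delta>" "a \<in> \<Delta>" "\<Psi> = positive_roots \<Phi> \<Delta>"
    by (auto simp: simple_def)
  define \<omega> where "\<omega> = cow \<Delta>"
  have fin: "finite \<Delta>"
    unfolding \<omega>_def by (rule base_finite[OF b(1)])
  have rep: "\<And>\<beta>. \<beta> \<in> \<Phi> \<Longrightarrow> \<beta> = (\<Sum>\<delta>\<in>\<Delta>. blinfun_apply \<beta> (\<omega> \<delta>) *\<^sub>R \<delta>)"
    unfolding \<omega>_def by (rule base_rep[OF b(1)])
  have w3: "\<And>\<delta> \<delta>'. \<delta> \<in> \<Delta> \<Longrightarrow> \<delta>' \<in> \<Delta> \<Longrightarrow> blinfun_apply \<delta>' (\<omega> \<delta>) = (if \<delta>' = \<delta> then 1 else 0)"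
    unfolding \<omega>_def by (rule base_cow[OF b(1)])
  have P: "\<And>\<beta>. \<beta> \<in> \<Phi> \<Longrightarrow> \<beta> \<in> positive_roots \<Phi> \<Delta> \<longleftrightarrow> (\<exists>\<delta>\<in>\<Delta>. blinfun_apply \<beta> (\<omega> \<delta>) > 0)"
    unfolding \<omega>_def by (rule base_pos_iff_ex[OF b(1)])
  have mem: "x \<in> flip \<Psi> a \<longleftrightarrow> reflection cr a x \<in> \<Psi>" for x
    unfolding flip_def using reflection_invol[OF aP] by (metis imageE imageI)
  \<comment> \<open>Such a root has a positive coordinate along some other simple root, and
    subtracting a multiple of \<open>a\<close> does not change it.\<close>
  have K: "reflection cr a x \<in> \<Psi>" if x: "x \<in> \<Psi>" "\<nexists>c. x = c *\<^sub>R a" for x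
  proof -
    have xP: "x \<in> \<Phi>" using x pos_subset[OF pP] by blast
    have "\<exists>\<delta>\<in>\<Delta>. \<delta> \<noteq> a \<and> blinfun_apply x (\<omega> \<delta>) \<noteq> 0"
    proof (rule ccontr)
      assume "\<not> ?thesis"
      then have "(\<Sum>\<delta>\<in>\<Delta>. blinfun_apply x (\<omega> \<delta>) *\<^sub>R \<delta>)
          = (\<Sum>\<delta>\<in>\<Delta>. if \<delta> = a then blinfun_apply x (\<omega> a) *\<^sub>R a else 0)"
        by (intro sum.cong) auto
      also have "\<dots> = blinfun_apply x (\<omega> a) *\<^sub>R a" using fin b(2) by simp
      finally show False using rep[OF xP] x(2) by metis
    qed
    then obtain \<delta> where d: "\<delta> \<in> \<Delta>" "\<delta> \<noteq> a" "blinfun_apply x (\<omega> \<delta>) \<noteq> 0" by blast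
    have "blinfun_apply x (\<omega> \<delta>) \<ge> 0"
    proof (rule ccontr)
      assume "\<not> ?thesis"
      then have "- x \<in> \<Psi>" using P[of "- x"] xP d(1) b(3)
        by (auto simp: blinfun.minus_left not_le)
      then show False using pos_neg_iff[OF pP xP] x by blast
    qed
    with d have "blinfun_apply x (\<omega> \<delta>) > 0" by simp
    moreover have "blinfun_apply (reflection cr a x) (\<omega> \<delta>) = blinfun_apply x (\<omega> \<delta>)"
      using w3[OF d(1) b(2)] d(2) by (simp add: reflection_def blinfun.diff_left blinfun.scaleR_left)
    ultimately show ?thesis using P[OF reflection_root[OF aP xP]] d(1) b(3) by force
  qed
  show ?thesis
  proof (cases "\<exists>c. b = c *\<^sub>R a")
    case True
    then obtain c where "b = c *\<^sub>R a" by blast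
    then have "reflection cr a b = - b"
      using linear_scale[OF linear_reflection, of a c a] reflection_self[OF aP] by simp
    then show ?thesis using True mem pos_neg_iff[OF pP assms(2)] by simp
  next
    case False
    have nl: "\<nexists>c. reflection cr a b = c *\<^sub>R a"
    proof
      assume "\<exists>c. reflection cr a b = c *\<^sub>R a"
      then obtain c where "b = reflection cr a (c *\<^sub>R a)" using reflection_invol[OF aP] by metis
      then have "b = (- c) *\<^sub>R a" using linear_scale[OF linear_reflection, of a c a] reflection_self[OF aP] by simp
      then show False using False by blast
    qed
    show ?thesis using False mem K[of b] K[OF _ nl] reflection_invol[OF aP] by auto
  qed
qed

lemma simple_line:
  assumes "simple \<Psi> a" "b \<in> \<Psi>" "b = c *\<^sub>R a"
  shows "b = a \<or> b = 2 *\<^sub>R a"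
proof -
  have "c > 0" using pos_scale_nonneg[OF simple_pos simple_mem] assms by blast
  moreover have "b \<in> \<Phi>" using assms pos_subset simple_pos by blast
  ultimately show ?thesis using simple_multiple[OF assms(1), of c] assms(3) by auto
qed

text \<open>Flip at a simple root outside \<open>S\<close> as long as there is one: this lowers the
  number of roots of the current system outside \<open>S\<close>, and once the base lies in
  \<open>S\<close> the two sets coincide. \<open>S\<close> is not assumed to be a positive system,
  so the same induction transports a property \<open>Q\<close> and also recognizes new positive
  systems, as in \<open>pos_lex\<close>.\<close>

lemma gallery:
  assumes "pos \<Psi>" "Q \<Psi>" "S \<subseteq> \<Phi>"
    and S_neg: "\<And>a. a \<in> \<Phi> \<Longrightarrow> a \<in> S \<longleftrightarrow> - a \<notin> S"
    and S_scale: "\<And>a. a \<in> S \<Longrightarrow> 2 *\<^sub>R a \<in> \<Phi> \<Longrightarrow> 2 *\<^sub>R a \<in> S"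
    and S_base: "\<And>\<Delta>. root_base \<Phi> \<Delta> \<Longrightarrow> \<Delta> \<subseteq> S \<Longrightarrow> positive_roots \<Phi> \<Delta> \<subseteq> S"
    and step: "\<And>\<Xi> a. simple \<Xi> a \<Longrightarrow> a \<notin> S \<Longrightarrow> Q \<Xi> \<Longrightarrow> Q (flip \<Xi> a)"
  shows "pos S \<and> Q S"
  using assms(1,2)
proof (induct "card (\<Psi> - S)" arbitrary: \<Psi> rule: less_induct)
  case less
  obtain \<Delta> where b: "root_base \<Phi> \<Delta>" "\<Psi> = positive_roots \<Phi> \<Delta>"
    using less.prems(1) by (auto simp: pos_def)
  show ?case
  proof (cases "\<Delta> \<subseteq> S")
    case True
    then have sub: "\<Psi> \<subseteq> S" using S_base b by blast
    have "S \<subseteq> \<Psi>"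
    proof
      fix x assume x: "x \<in> S"
      then have xP: "x \<in> \<Phi>" using assms(3) by blast
      then show "x \<in> \<Psi>" using pos_neg_iff[OF less.prems(1) xP] S_neg[OF xP] x sub by blast
    qed
    with sub have "\<Psi> = S" by blast
    then show ?thesis using less.prems by blast
  next
    case False
    then obtain a where a: "a \<in> \<Delta>" "a \<notin> S" by blast
    then have s: "simple \<Psi> a" using b by (auto simp: simple_def)
    have aP: "a \<in> \<Phi>" using s by (rule simple_root)
    have nS: "- a \<in> S" using S_neg[OF aP] a by blast
    \<comment> \<open>The flipped system meets the line of \<open>a\<close> in - a and possibly -
      2a, and both lie in \<open>S\<close>; off this line nothing changes.\<close>
    have "flip \<Psi> a - S \<subseteq> \<Psi> - S"
    proof
      fix x assume x: "x \<in> flip \<Psi> a - S"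
      then have xP: "x \<in> \<Phi>" using pos_subset[OF simple_pos[OF simple_flip[OF s]]] by blast
      have "\<nexists>c. x = c *\<^sub>R a"
      proof
        assume "\<exists>c. x = c *\<^sub>R a"
        then obtain c where "x = (- c) *\<^sub>R (- a)" by auto
        then have "x = - a \<or> x = 2 *\<^sub>R - a"
          using simple_line[OF simple_flip[OF s]] x by blast
        then show False using nS S_scale x xP by blast
      qed
      then show "x \<in> \<Psi> - S" using x flip_iff[OF s xP] by auto
    qed
    moreover have "a \<in> \<Psi> - S" "a \<notin> flip \<Psi> a"
      using a simple_mem[OF s] flip_iff[OF s aP] scaleR_one[of a] by (metis DiffI)+
    ultimately have "flip \<Psi> a - S \<subset> \<Psi> - S" by blast
    moreover have "finite (\<Psi> - S)" using pos_subset[OF less.prems(1)] finite_roots finite_subset by blast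
    ultimately have "card (flip \<Psi> a - S) < card (\<Psi> - S)" by (rule psubset_card_mono[rotated])
    from less.hyps[OF this simple_pos[OF simple_flip[OF s]] step[OF s a(2) less.prems(2)]]
    show ?thesis .
  qed
qed

lemma gallery_pos:
  assumes "pos \<Psi>" "pos \<Xi>" "Q \<Psi>"
    and step: "\<And>\<Xi>' a. simple \<Xi>' a \<Longrightarrow> a \<notin> \<Xi> \<Longrightarrow> Q \<Xi>' \<Longrightarrow> Q (flip \<Xi>' a)"
  shows "Q \<Xi>"
proof -
  have "pos \<Xi> \<and> Q \<Xi>"
  proof (rule gallery[where Q = Q and S = \<Xi>, OF assms(1,3) pos_subset[OF assms(2)]])
    show "a \<in> \<Xi> \<longleftrightarrow> - a \<notin> \<Xi>" if "a \<in> \<Phi>" for a using pos_neg_iff[OF assms(2) that] by blast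
    show "2 *\<^sub>R a \<in> \<Xi>" if "a \<in> \<Xi>" "2 *\<^sub>R a \<in> \<Phi>" for a using pos_scale[OF assms(2)] that by simp
    show "positive_roots \<Phi> \<Delta> \<subseteq> \<Xi>" if "root_base \<Phi> \<Delta>" "\<Delta> \<subseteq> \<Xi>" for \<Delta>
    proof
      obtain \<Delta>' where b': "root_base \<Phi> \<Delta>'" "\<Xi> = positive_roots \<Phi> \<Delta>'" using assms(2) by (auto simp: pos_def)
      define \<omega> where "\<omega> = cow \<Delta>'"
      have *: "\<And>\<beta>. \<beta> \<in> \<Phi> \<Longrightarrow> \<beta> \<in> positive_roots \<Phi> \<Delta>' \<longleftrightarrow> (\<forall>\<delta>\<in>\<Delta>'. blinfun_apply \<beta> (\<omega> \<delta>) \<ge> 0)"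
        unfolding \<omega>_def by (rule base_pos_iff_all[OF b'(1)])
      fix x assume x: "x \<in> positive_roots \<Phi> \<Delta>"
      then obtain c :: "'v dual \<Rightarrow> nat" where c: "x = (\<Sum>\<delta>\<in>\<Delta>. real (c \<delta>) *\<^sub>R \<delta>)"
        unfolding positive_roots_def nonneg_comb_def by blast
      have "blinfun_apply x (\<omega> \<delta>) \<ge> 0" if d: "\<delta> \<in> \<Delta>'" for \<delta>
        unfolding c blinfun.sum_left blinfun.scaleR_left
      proof (rule sum_nonneg)
        fix e assume "e \<in> \<Delta>"
        then have "e \<in> \<Xi>" "e \<in> \<Phi>" using \<open>\<Delta> \<subseteq> \<Xi>\<close> pos_subset[OF assms(2)] by blast+
        then show "0 \<le> real (c e) *\<^sub>R blinfun_apply e (\<omega> \<delta>)" using *[of e] b'(2) d by simp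
      qed
      then show "x \<in> \<Xi>" using *[of x] x b'(2) by (auto simp: positive_roots_def)
    qed
    show "\<And>\<Xi>' a. simple \<Xi>' a \<Longrightarrow> a \<notin> \<Xi> \<Longrightarrow> Q \<Xi>' \<Longrightarrow> Q (flip \<Xi>' a)" by (rule step)
  qed
  then show ?thesis ..
qed

text \<open>A lexicographic choice: the sign of \<open>h\<close> decides and \<Psi> breaks ties, as
  for a point perturbed slightly into the chamber of \<Psi>. \<open>h\<close> is given on roots and
  takes values in an ordered group, so linearity is required for those integral combinations that
  are roots.\<close>

lemma pos_lex:
  fixes h :: "'v dual \<Rightarrow> 'r::linordered_ab_group_add"
  assumes "pos \<Psi>"
    and h_neg: "\<And>a. a \<in> \<Phi> \<Longrightarrow> h (- a) = - h a"
    and h_double: "\<And>a. a \<in> \<Phi> \<Longrightarrow> 2 *\<^sub>R a \<in> \<Phi> \<Longrightarrow> h (2 *\<^sub>R a) = h a + h a"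
    and h_comb: "\<And>\<Delta> c. \<Delta> \<subseteq> \<Phi> \<Longrightarrow> finite \<Delta> \<Longrightarrow> (\<Sum>\<delta>\<in>\<Delta>. real (c \<delta>) *\<^sub>R \<delta>) \<in> \<Phi> \<Longrightarrow>
      h (\<Sum>\<delta>\<in>\<Delta>. real (c \<delta>) *\<^sub>R \<delta>) = (\<Sum>\<delta>\<in>\<Delta>. int_mult (int (c \<delta>)) (h \<delta>))"
  shows "pos {a \<in> \<Phi>. 0 < h a \<or> h a = 0 \<and> a \<in> \<Psi>}" (is "pos ?S")
proof -
  have "pos ?S \<and> True"
  proof (rule gallery[OF assms(1)])
    show "a \<in> ?S \<longleftrightarrow> - a \<notin> ?S" if "a \<in> \<Phi>" for a
      using pos_neg_iff[OF assms(1) that] h_neg[OF that] that by auto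
    show "2 *\<^sub>R a \<in> ?S" if "a \<in> ?S" "2 *\<^sub>R a \<in> \<Phi>" for a
      using that h_double[of a] pos_scale[OF assms(1), of a 2] by (auto simp: add_pos_pos)
    show "positive_roots \<Phi> \<Delta> \<subseteq> ?S" if b: "root_base \<Phi> \<Delta>" and sub: "\<Delta> \<subseteq> ?S" for \<Delta>
    proof
      fix x assume x: "x \<in> positive_roots \<Phi> \<Delta>"
      then have xP: "x \<in> \<Phi>" by (simp add: positive_roots_def)
      have sP: "\<Delta> \<subseteq> \<Phi>" and fin: "finite \<Delta>" using b finite_roots finite_subset by (auto simp: root_base_def)
      obtain c :: "'v dual \<Rightarrow> nat" where c: "x = (\<Sum>\<delta>\<in>\<Delta>. real (c \<delta>) *\<^sub>R \<delta>)"
        using x unfolding positive_roots_def nonneg_comb_def by blast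
      have hx: "h x = (\<Sum>\<delta>\<in>\<Delta>. int_mult (int (c \<delta>)) (h \<delta>))"
        using h_comb[OF sP fin, of c] xP c by simp
      have nn: "0 \<le> int_mult (int (c \<delta>)) (h \<delta>)" if "\<delta> \<in> \<Delta>" for \<delta>
        using that sub by (intro int_mult_nonneg) auto
      have ge: "0 \<le> h x" unfolding hx by (intro sum_nonneg nn)
      show "x \<in> ?S"
      proof (cases "h x = 0")
        case True
        then have z: "int_mult (int (c \<delta>)) (h \<delta>) = 0" if "\<delta> \<in> \<Delta>" for \<delta>
          using sum_nonneg_eq_0_iff[OF fin, of "\<lambda>\<delta>. int_mult (int (c \<delta>)) (h \<delta>)"] nn that
            unfolding hx by blast
        \<comment> \<open>If a sum of nonnegative terms vanishes, each term does; so only base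
          elements with \<open>h\<close> = 0 occur in x, and these lie in \<Psi> by the choice of
          the set.\<close>
        have cz: "c \<delta> = 0 \<or> \<delta> \<in> \<Psi>" if d: "\<delta> \<in> \<Delta>" for \<delta>
        proof (rule ccontr)
          assume "\<not> ?thesis"
          then have "c \<delta> > 0" "h \<delta> > 0" using sub d by auto
          then have "int_mult (int (c \<delta>)) (h \<delta>) > 0" by (intro int_mult_pos) auto
          with z[OF d] show False by simp
        qed
        obtain \<Delta>' where b': "root_base \<Phi> \<Delta>'" "\<Psi> = positive_roots \<Phi> \<Delta>'" using assms(1) by (auto simp: pos_def)
        define \<omega> where "\<omega> = cow \<Delta>'"
        have *: "\<And>\<beta>. \<beta> \<in> \<Phi> \<Longrightarrow> \<beta> \<in> positive_roots \<Phi> \<Delta>' \<longleftrightarrow> (\<forall>\<delta>\<in>\<Delta>'. blinfun_apply \<beta> (\<omega> \<delta>) \<ge> 0)"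
          unfolding \<omega>_def by (rule base_pos_iff_all[OF b'(1)])
        have "blinfun_apply x (\<omega> \<delta>) \<ge> 0" if d: "\<delta> \<in> \<Delta>'" for \<delta>
          unfolding c blinfun.sum_left blinfun.scaleR_left
        proof (rule sum_nonneg)
          fix e assume e: "e \<in> \<Delta>"
          then have "e \<in> \<Phi>" using sP by blast
          then show "0 \<le> real (c e) *\<^sub>R blinfun_apply e (\<omega> \<delta>)" using *[of e] b'(2) d cz[OF e] by auto
        qed
        then show ?thesis using *[OF xP] True b'(2) xP by blast
      qed (use ge xP in auto)
    qed
  qed auto
  then show ?thesis ..
qed

text \<open>There is a vector v with a(v) > 0 > b(v): the coroot of \<open>a\<close> if the roots
  are proportional, otherwise by linear independence. The sign at v gives the system, and \<Psi>
  orders the roots vanishing at v.\<close>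

lemma pos_separate:
  assumes "pos \<Psi>" "a \<in> \<Phi>" "b \<in> \<Phi>" "\<And>c. c > 0 \<Longrightarrow> b \<noteq> c *\<^sub>R a"
  shows "\<exists>\<Xi>. pos \<Xi> \<and> a \<in> \<Xi> \<and> b \<notin> \<Xi>"
proof -
  have "\<exists>v. blinfun_apply a v > 0 \<and> blinfun_apply b v < 0"
  proof (cases "\<exists>c. b = c *\<^sub>R a")
    case True
    then obtain c where c: "b = c *\<^sub>R a" by blast
    have "c \<noteq> 0" using c assms zero_not_root by auto
    then have "c < 0" using assms(4)[of c] c by force
    then show ?thesis using coroot_pairing[OF assms(2)] c
      by (intro exI[of _ "cr a"]) (simp add: blinfun.scaleR_left)
  next
    case False
    have "a \<noteq> 0" using assms zero_not_root by auto
    then have "independent {b, a}"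
      using False by (auto simp: independent_insert span_singleton)
    from independent_functional[OF this, of "\<lambda>x. if x = a then 1 else - 1"]
    obtain v where "\<forall>\<beta>\<in>{b, a}. blinfun_apply \<beta> v = (if \<beta> = a then 1 else - 1)" by blast
    moreover have "b \<noteq> a" using False by (metis scaleR_one)
    ultimately show ?thesis by (intro exI[of _ v]) auto
  qed
  then obtain v where v: "blinfun_apply a v > 0" "blinfun_apply b v < 0" by blast
  let ?S = "{x \<in> \<Phi>. 0 < blinfun_apply x v \<or> blinfun_apply x v = 0 \<and> x \<in> \<Psi>}"
  have "pos ?S"
    by (rule pos_lex[OF assms(1)])
      (simp_all add: blinfun.minus_left blinfun.scaleR_left blinfun.sum_left int_mult_real)
  with v assms show ?thesis by (intro exI[of _ ?S]) auto
qed

end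

section \<open>Groups generated by families of root subgroups\<close>

context group
begin

definition cj :: "'a \<Rightarrow> 'a \<Rightarrow> 'a" where
  "cj g x = g \<otimes> x \<otimes> inv g"

lemma inv_mult_cancel [simp]:
  "x \<in> carrier G \<Longrightarrow> y \<in> carrier G \<Longrightarrow> inv x \<otimes> (x \<otimes> y) = y"
  "x \<in> carrier G \<Longrightarrow> y \<in> carrier G \<Longrightarrow> x \<otimes> (inv x \<otimes> y) = y"
  by (simp_all flip: m_assoc)

lemma cj_closed [simp]: "g \<in> carrier G \<Longrightarrow> x \<in> carrier G \<Longrightarrow> cj g x \<in> carrier G"
  by (simp add: cj_def)

lemma cj_mult: "g \<in> carrier G \<Longrightarrow> x \<in> carrier G \<Longrightarrow> y \<in> carrier G \<Longrightarrow> cj g (x \<otimes> y) = cj g x \<otimes> cj g y"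
  by (simp add: cj_def m_assoc)

lemma cj_one [simp]: "g \<in> carrier G \<Longrightarrow> cj g \<one> = \<one>" "x \<in> carrier G \<Longrightarrow> cj \<one> x = x"
  by (simp_all add: cj_def)

lemma cj_inv: "g \<in> carrier G \<Longrightarrow> x \<in> carrier G \<Longrightarrow> cj g (inv x) = inv (cj g x)"
  by (simp add: cj_def m_assoc inv_mult_group)

lemma cj_cj: "g \<in> carrier G \<Longrightarrow> h \<in> carrier G \<Longrightarrow> x \<in> carrier G \<Longrightarrow> cj g (cj h x) = cj (g \<otimes> h) x"
  by (simp add: cj_def m_assoc inv_mult_group)

lemma cj_inv_cancel [simp]:
  "g \<in> carrier G \<Longrightarrow> x \<in> carrier G \<Longrightarrow> cj (inv g) (cj g x) = x"
  "g \<in> carrier G \<Longrightarrow> x \<in> carrier G \<Longrightarrow> cj g (cj (inv g) x) = x"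
  by (simp_all add: cj_cj)

lemma cj_swap: "g \<in> carrier G \<Longrightarrow> x \<in> carrier G \<Longrightarrow> g \<otimes> x = cj g x \<otimes> g"
  by (simp add: cj_def m_assoc)

lemma cj_eq_one_iff: "g \<in> carrier G \<Longrightarrow> x \<in> carrier G \<Longrightarrow> cj g x = \<one> \<longleftrightarrow> x = \<one>"
  by (metis cj_inv_cancel(1) cj_one(1) inv_closed)

lemma cj_subgroup: "subgroup H G \<Longrightarrow> g \<in> H \<Longrightarrow> x \<in> H \<Longrightarrow> cj g x \<in> H"
  by (simp add: cj_def subgroup.m_closed subgroup.m_inv_closed)

lemma cj_generate:
  assumes "subgroup H G" "X \<subseteq> carrier G" "g \<in> carrier G" "\<And>x. x \<in> X \<Longrightarrow> cj g x \<in> H"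
    and "y \<in> generate G X"
  shows "cj g y \<in> H"
  using assms(5)
proof (induct rule: generate.induct)
  case one
  then show ?case using assms(1,3) by (simp add: subgroup.one_closed)
next
  case (incl h)
  then show ?case by (rule assms(4))
next
  case (inv h)
  then have "h \<in> carrier G" using assms(2) by blast
  then show ?case using assms(1,3) assms(4)[OF inv] by (simp add: cj_inv subgroup.m_inv_closed)
next
  case (eng h1 h2)
  then have "h1 \<in> carrier G" "h2 \<in> carrier G" using generate_in_carrier[OF assms(2)] by blast+
  then show ?case using eng assms(1,3) by (simp add: cj_mult subgroup.m_closed)
qed

text \<open>The way in which product sets are shown below to exhaust a group: a set that contains 1
  and is stable under a symmetric set of generators contains all they generate.\<close>

lemma generate_left_closed:
  assumes "S \<subseteq> carrier G" "X \<subseteq> carrier G" "\<And>s. s \<in> S \<Longrightarrow> inv s \<in> S"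
    and "\<And>s x. s \<in> S \<Longrightarrow> x \<in> X \<Longrightarrow> s \<otimes> x \<in> X"
    and "y \<in> generate G S" "x \<in> X"
  shows "y \<otimes> x \<in> X"
  using assms(5,6)
proof (induct arbitrary: x rule: generate.induct)
  case one
  then show ?case using assms(2) by (simp add: subset_iff)
next
  case (incl h)
  then show ?case by (intro assms(4))
next
  case (inv h)
  then show ?case by (intro assms(4) assms(3))
next
  case (eng h1 h2)
  then have "h1 \<in> carrier G" "h2 \<in> carrier G" "x \<in> carrier G"
    using generate_in_carrier[OF assms(1)] assms(2) by blast+
  then show ?case using eng by (simp add: m_assoc)
qed

lemma generate_right_closed:
  assumes "S \<subseteq> carrier G" "X \<subseteq> carrier G" "\<And>s. s \<in> S \<Longrightarrow> inv s \<in> S"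
    and "\<And>s x. s \<in> S \<Longrightarrow> x \<in> X \<Longrightarrow> x \<otimes> s \<in> X"
    and "y \<in> generate G S" "x \<in> X"
  shows "x \<otimes> y \<in> X"
  using assms(5,6)
proof (induct arbitrary: x rule: generate.induct)
  case one
  then show ?case using assms(2) by (simp add: subset_iff)
next
  case (incl h)
  then show ?case by (intro assms(4))
next
  case (inv h)
  then show ?case by (intro assms(4) assms(3))
next
  case (eng h1 h2)
  then have "h1 \<in> carrier G" "h2 \<in> carrier G" "x \<in> carrier G"
    using generate_in_carrier[OF assms(1)] assms(2) by blast+
  then show ?case using eng by (simp flip: m_assoc)
qed

end

section \<open>Complements, flips and root intervals\<close>

context root_system
begin

lemma simple_uminus:
  assumes "simple \<Psi> a" shows "simple (uminus ` \<Psi>) (- a)"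
proof -
  from assms obtain \<Delta> where "root_base \<Phi> \<Delta>" "a \<in> \<Delta>" "\<Psi> = positive_roots \<Phi> \<Delta>"
    by (auto simp: simple_def)
  then show ?thesis using root_base_image[OF linear_uminus' uminus_roots minus_minus, of \<Delta>]
    by (auto simp: simple_def)
qed

lemma uminus_eq_compl:
  assumes "pos \<Psi>" shows "uminus ` \<Psi> = \<Phi> - \<Psi>"
proof (rule Set.set_eqI)
  fix b
  show "b \<in> uminus ` \<Psi> \<longleftrightarrow> b \<in> \<Phi> - \<Psi>"
    using pos_uminus_iff[OF assms, of b] pos_subset[OF assms] uminus_roots by auto
qed

lemma pos_compl: "pos \<Psi> \<Longrightarrow> pos (\<Phi> - \<Psi>)"
  using pos_uminus uminus_eq_compl by metis

lemma simple_compl: "simple \<Psi> a \<Longrightarrow> simple (\<Phi> - \<Psi>) (- a)"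
  using simple_uminus uminus_eq_compl simple_pos by metis

lemma flip_subset: "simple \<Psi> a \<Longrightarrow> flip \<Psi> a \<subseteq> \<Phi>"
  using pos_subset simple_pos simple_flip by blast

lemma line_uminus: "(\<exists>c. b = c *\<^sub>R (- a)) \<longleftrightarrow> (\<exists>c. b = c *\<^sub>R (a :: 'v dual))"
proof
  assume "\<exists>c. b = c *\<^sub>R (- a)"
  then obtain c where "b = (- c) *\<^sub>R a" by auto
  then show "\<exists>c. b = c *\<^sub>R a" ..
next
  assume "\<exists>c. b = c *\<^sub>R a"
  then obtain c where "b = (- c) *\<^sub>R (- a)" by auto
  then show "\<exists>c. b = c *\<^sub>R (- a)" ..
qed

lemma flip_compl:
  assumes "simple \<Psi> a"
  shows "flip (\<Phi> - \<Psi>) (- a) = \<Phi> - flip \<Psi> a"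
proof (rule Set.set_eqI)
  fix b
  show "b \<in> flip (\<Phi> - \<Psi>) (- a) \<longleftrightarrow> b \<in> \<Phi> - flip \<Psi> a"
  proof (cases "b \<in> \<Phi>")
    case True
    then show ?thesis
      unfolding Diff_iff flip_iff[OF assms True] flip_iff[OF simple_compl[OF assms] True]
      by (simp only: line_uminus) simp
  next
    case False
    then show ?thesis using flip_subset[OF simple_compl[OF assms]] by blast
  qed
qed

lemma flip_flip:
  assumes "simple \<Psi> a" shows "flip (flip \<Psi> a) (- a) = \<Psi>"
proof (rule Set.set_eqI)
  fix b
  show "b \<in> flip (flip \<Psi> a) (- a) \<longleftrightarrow> b \<in> \<Psi>"
  proof (cases "b \<in> \<Phi>")
    case True
    then show ?thesis
      unfolding flip_iff[OF simple_flip[OF assms] True] line_uminus flip_iff[OF assms True] by auto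
  next
    case False
    then show ?thesis using flip_subset[OF simple_flip[OF assms]] pos_subset[OF simple_pos[OF assms]] by blast
  qed
qed

lemma simple_not_flip: "simple \<Psi> a \<Longrightarrow> a \<notin> flip \<Psi> a"
  using flip_iff[OF _ simple_root, of \<Psi> a \<Psi> a] simple_mem by (metis scaleR_one)

lemma simple_neg_flip: "simple \<Psi> a \<Longrightarrow> - a \<in> flip \<Psi> a"
  using simple_mem simple_flip by blast

lemma flip_Int_subset:
  assumes "simple \<Xi> e" "pos \<Psi>" "e \<notin> \<Psi>"
  shows "\<Psi> \<inter> \<Xi> \<subseteq> \<Psi> \<inter> flip \<Xi> e"
proof
  fix b assume b: "b \<in> \<Psi> \<inter> \<Xi>"
  then have bP: "b \<in> \<Phi>" using pos_subset[OF assms(2)] by blast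
  have "\<nexists>c. b = c *\<^sub>R e"
  proof
    assume "\<exists>c. b = c *\<^sub>R e"
    then obtain c where c: "b = c *\<^sub>R e" ..
    then have "c > 0" using pos_scale_nonneg[OF simple_pos simple_mem, OF assms(1,1)] b by blast
    then have "e = (1 / c) *\<^sub>R b" using c by simp
    then show False using pos_scale[OF assms(2), of b "1 / c"] b simple_root[OF assms(1)] assms(3) \<open>c > 0\<close>
      by simp
  qed
  then show "b \<in> \<Psi> \<inter> flip \<Xi> e" using b flip_iff[OF assms(1) bP] by simp
qed

lemma Int_subset_flip_insert:
  assumes "simple \<Xi> e" "\<Psi> \<subseteq> \<Phi>"
  shows "\<Psi> \<inter> \<Xi> \<subseteq> (\<Psi> \<inter> flip \<Xi> e) \<union> {e, 2 *\<^sub>R e}"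
proof
  fix b assume b: "b \<in> \<Psi> \<inter> \<Xi>"
  then have bP: "b \<in> \<Phi>" using assms(2) by blast
  show "b \<in> (\<Psi> \<inter> flip \<Xi> e) \<union> {e, 2 *\<^sub>R e}"
  proof (cases "\<exists>c. b = c *\<^sub>R e")
    case True
    then show ?thesis using simple_line[OF assms(1)] b by blast
  next
    case False
    then show ?thesis using flip_iff[OF assms(1) bP] b by simp
  qed
qed

text \<open>A root r e + s b with s > 0 stays off the line of \<open>e\<close> when \<open>b\<close>
  does, and off this line \<Xi> and its flip agree. This is what makes the group attached to \<Psi>
  \<inter> \<open>flip \<Xi> e\<close> stable under conjugation by the root group of
  \<open>e\<close>.\<close>

lemma interval_flip:
  assumes "pos \<Psi>" "simple \<Xi> e" "e \<in> \<Psi>" "b \<in> \<Psi> \<inter> flip \<Xi> e"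
  shows "\<nexists>c. c \<le> 0 \<and> b = c *\<^sub>R e" "open_root_interval \<Phi> e b \<subseteq> \<Psi> \<inter> flip \<Xi> e"
proof -
  have bP: "b \<in> \<Phi>" using assms pos_subset by blast
  have nl: "\<nexists>c. b = c *\<^sub>R e"
  proof
    assume ex: "\<exists>c. b = c *\<^sub>R e"
    then obtain c where c: "b = c *\<^sub>R e" ..
    then have "c > 0" using pos_scale_nonneg[OF assms(1,3)] assms(4) by blast
    then have "b \<in> \<Xi>" using pos_scale[OF simple_pos simple_mem, OF assms(2,2)] c bP by simp
    then show False using flip_iff[OF assms(2) bP] ex assms(4) by simp
  qed
  then show "\<nexists>c. c \<le> 0 \<and> b = c *\<^sub>R e" by blast
  show "open_root_interval \<Phi> e b \<subseteq> \<Psi> \<inter> flip \<Xi> e"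
  proof
    fix g assume "g \<in> open_root_interval \<Phi> e b"
    then obtain r s :: nat where rs: "r > 0" "s > 0" "g = real r *\<^sub>R e + real s *\<^sub>R b" and gP: "g \<in> \<Phi>"
      by (auto simp: open_root_interval_def)
    have bX: "b \<in> \<Xi>" using flip_iff[OF assms(2) bP] nl assms(4) by simp
    have 1: "g \<in> \<Psi>" using pos_comb[OF assms(1,3), of b "real r" "real s"] assms(4) rs gP by simp
    have 2: "g \<in> \<Xi>"
      using pos_comb[OF simple_pos simple_mem bX, OF assms(2,2), of "real r" "real s"] rs gP by simp
    have "\<nexists>c. g = c *\<^sub>R e"
    proof
      assume "\<exists>c. g = c *\<^sub>R e"
      then obtain c where "real s *\<^sub>R b = (c - real r) *\<^sub>R e" using rs by (auto simp: algebra_simps)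
      then have "b = ((c - real r) / real s) *\<^sub>R e" using rs
        by (simp add: divideR_right eq_vector_fraction_iff)
      then show False using nl by blast
    qed
    then show "g \<in> \<Psi> \<inter> flip \<Xi> e" using 1 2 flip_iff[OF assms(2) gP] by simp
  qed
qed

end

text \<open>Every root system has a base; assuming one here saves the proof, as a vector chamber provides it.\<close>

locale based_root_group_datum = root_group_datum G \<Phi> cr T U M
  for G :: "('g, 'b) monoid_scheme" (structure) and \<Phi> :: "'v::euclidean_space dual set" and cr T U M +
  assumes ex_pos: "\<exists>\<Psi>. pos \<Psi>"
    and ex_root: "\<Phi> \<noteq> {}"
begin

section \<open>Product decompositions of groups generated by root subgroups\<close>

definition Ugrp :: "('v dual \<Rightarrow> 'g set) \<Rightarrow> 'v dual set \<Rightarrow> 'g set" where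
  "Ugrp L X = generate G (\<Union>a\<in>X. L a)"

text \<open>Isolates what the product decompositions use, so that they hold both for the root groups
  \<open>U\<close> and for the filtration subgroups \<open>lev x S\<close>.\<close>

definition root_subfamily :: "('v dual \<Rightarrow> 'g set) \<Rightarrow> bool" where
  "root_subfamily L \<longleftrightarrow> (\<forall>a\<in>\<Phi>. subgroup (L a) G \<and> L a \<subseteq> U a) \<and>
     (\<forall>a\<in>\<Phi>. 2 *\<^sub>R a \<in> \<Phi> \<longrightarrow> L (2 *\<^sub>R a) \<subseteq> L a) \<and>
     (\<forall>a\<in>\<Phi>. \<forall>b\<in>\<Phi>. (\<nexists>c. c \<le> 0 \<and> b = c *\<^sub>R a) \<longrightarrow>
       (\<forall>u\<in>L a. \<forall>v\<in>L b. u \<otimes> v \<otimes> inv u \<otimes> inv v \<in> Ugrp L (open_root_interval \<Phi> a b)))"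

lemma root_subfamily_U: "root_subfamily U"
  unfolding root_subfamily_def
proof (intro conjI ballI impI)
  fix a b u v assume ab: "a \<in> \<Phi>" "b \<in> \<Phi>" "\<nexists>c. c \<le> 0 \<and> b = c *\<^sub>R a" and uv: "u \<in> U a" "v \<in> U b"
  have "u \<otimes> v \<otimes> inv u \<otimes> inv v \<in> generate G (commutators G (U a) (U b))"
    using uv by (intro generate.incl) (auto simp: commutators_def)
  moreover have "\<nexists>c. c < 0 \<and> b = c *\<^sub>R a" using ab(3) less_imp_le by blast
  ultimately show "u \<otimes> v \<otimes> inv u \<otimes> inv v \<in> Ugrp U (open_root_interval \<Phi> a b)"
    unfolding Ugrp_def using RGD2[OF ab(1,2)] by blast
qed (use RGD1 RGD3 in \<open>auto simp: multipliable_def\<close>)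

context
  fixes L
  assumes L: "root_subfamily L"
begin

lemma L_subgroup: "a \<in> \<Phi> \<Longrightarrow> subgroup (L a) G"
  using L by (simp add: root_subfamily_def)

lemma L_carrier: "a \<in> \<Phi> \<Longrightarrow> u \<in> L a \<Longrightarrow> u \<in> carrier G"
  using L_subgroup by (rule subgroup.mem_carrier)

lemma L_sub_U: "a \<in> \<Phi> \<Longrightarrow> L a \<subseteq> U a"
  using L by (simp add: root_subfamily_def)

lemma L_double: "a \<in> \<Phi> \<Longrightarrow> 2 *\<^sub>R a \<in> \<Phi> \<Longrightarrow> L (2 *\<^sub>R a) \<subseteq> L a"
  using L by (simp add: root_subfamily_def)

lemma L_Union_carrier: "X \<subseteq> \<Phi> \<Longrightarrow> (\<Union>a\<in>X. L a) \<subseteq> carrier G"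
  using L_carrier by blast

lemma Ugrp_subgroup: "X \<subseteq> \<Phi> \<Longrightarrow> subgroup (Ugrp L X) G"
  unfolding Ugrp_def by (intro generate_is_subgroup L_Union_carrier)

lemma Ugrp_carrier: "X \<subseteq> \<Phi> \<Longrightarrow> y \<in> Ugrp L X \<Longrightarrow> y \<in> carrier G"
  using Ugrp_subgroup by (rule subgroup.mem_carrier)

lemma Ugrp_incl: "a \<in> X \<Longrightarrow> u \<in> L a \<Longrightarrow> u \<in> Ugrp L X"
  unfolding Ugrp_def by (intro generate.incl) blast

lemma Ugrp_mono: "X \<subseteq> Y \<Longrightarrow> Ugrp L X \<subseteq> Ugrp L Y"
  unfolding Ugrp_def by (intro mono_generate) blast

lemma Ugrp_one: "\<one> \<in> Ugrp L X"
  unfolding Ugrp_def by (rule generate.one)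

lemma Ugrp_empty: "Ugrp L {} = {\<one>}"
  unfolding Ugrp_def by (simp add: generate_empty)

lemma Ugrp_sub_U: "X \<subseteq> \<Phi> \<Longrightarrow> Ugrp L X \<subseteq> Ugrp U X"
  unfolding Ugrp_def using L_sub_U by (intro mono_generate) blast

lemma Ugrp_mult: "X \<subseteq> \<Phi> \<Longrightarrow> y \<in> Ugrp L X \<Longrightarrow> z \<in> Ugrp L X \<Longrightarrow> y \<otimes> z \<in> Ugrp L X"
  using Ugrp_subgroup by (rule subgroup.m_closed)

lemma Ugrp_inv: "X \<subseteq> \<Phi> \<Longrightarrow> y \<in> Ugrp L X \<Longrightarrow> inv y \<in> Ugrp L X"
  using Ugrp_subgroup by (rule subgroup.m_inv_closed)

lemma Ugrp_cj:
  assumes "X \<subseteq> \<Phi>" "g \<in> carrier G" "subgroup H G" "\<And>a u. a \<in> X \<Longrightarrow> u \<in> L a \<Longrightarrow> cj g u \<in> H" "y \<in> Ugrp L X"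
  shows "cj g y \<in> H"
proof (rule cj_generate[OF assms(3) L_Union_carrier[OF assms(1)] assms(2)])
  show "y \<in> generate G (\<Union>a\<in>X. L a)" using assms(5) by (simp add: Ugrp_def)
qed (use assms(4) in blast)

lemma Ugrp_normal:
  assumes "a \<in> \<Phi>" "X \<subseteq> \<Phi>"
    and X: "\<And>b. b \<in> X \<Longrightarrow> (\<nexists>c. c \<le> 0 \<and> b = c *\<^sub>R a) \<and> open_root_interval \<Phi> a b \<subseteq> X"
    and "u \<in> L a" "y \<in> Ugrp L X"
  shows "cj u y \<in> Ugrp L X"
proof (rule Ugrp_cj[OF assms(2) L_carrier[OF assms(1,4)] Ugrp_subgroup[OF assms(2)] _ assms(5)])
  fix b v assume b: "b \<in> X" "v \<in> L b"
  have bP: "b \<in> \<Phi>" using b assms(2) by blast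
  have "u \<otimes> v \<otimes> inv u \<otimes> inv v \<in> Ugrp L (open_root_interval \<Phi> a b)"
    using L assms(1,4) bP b X[OF b(1)] unfolding root_subfamily_def by blast
  then have 1: "u \<otimes> v \<otimes> inv u \<otimes> inv v \<in> Ugrp L X" using Ugrp_mono X[OF b(1)] by blast
  have "cj u v = (u \<otimes> v \<otimes> inv u \<otimes> inv v) \<otimes> v"
    using L_carrier[OF assms(1,4)] L_carrier[OF bP b(2)] by (simp add: cj_def m_assoc)
  then show "cj u v \<in> Ugrp L X" using Ugrp_mult[OF assms(2) 1 Ugrp_incl[OF b]] by simp
qed

text \<open>\<open>L a\<close> normalizes the group attached to \<open>X\<close>, so the products of
  the two are stable under left multiplication by generators; generators attached to 2a already lie
  in \<open>L a\<close>.\<close>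

lemma Ugrp_split:
  assumes "a \<in> \<Phi>" "X \<subseteq> \<Phi>"
    and X: "\<And>b. b \<in> X \<Longrightarrow> (\<nexists>c. c \<le> 0 \<and> b = c *\<^sub>R a) \<and> open_root_interval \<Phi> a b \<subseteq> X"
    and Y: "Y \<subseteq> \<Phi>" "Y \<subseteq> X \<union> {a, 2 *\<^sub>R a}" and y: "y \<in> Ugrp L Y"
  shows "\<exists>u\<in>L a. \<exists>z\<in>Ugrp L X. y = u \<otimes> z"
proof -
  let ?Z = "{u \<otimes> z | u z. u \<in> L a \<and> z \<in> Ugrp L X}"
  have aL: "subgroup (L a) G" using assms(1) by (rule L_subgroup)
  have XL: "subgroup (Ugrp L X) G" using assms(2) by (rule Ugrp_subgroup)
  have car: "\<And>u. u \<in> L a \<Longrightarrow> u \<in> carrier G" "\<And>z. z \<in> Ugrp L X \<Longrightarrow> z \<in> carrier G"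
    using L_carrier[OF assms(1)] Ugrp_carrier[OF assms(2)] by blast+
  have "y \<otimes> \<one> \<in> ?Z"
  proof (rule generate_left_closed)
    show "(\<Union>b\<in>Y. L b) \<subseteq> carrier G" using Y(1) by (rule L_Union_carrier)
    show "?Z \<subseteq> carrier G" using car by auto
    show "inv s \<in> (\<Union>b\<in>Y. L b)" if s: "s \<in> (\<Union>b\<in>Y. L b)" for s
    proof -
      obtain b where "b \<in> Y" "s \<in> L b" using s by blast
      then show ?thesis using subgroup.m_inv_closed[OF L_subgroup, of b s] Y(1) by blast
    qed
    show "y \<in> generate G (\<Union>b\<in>Y. L b)" using y by (simp add: Ugrp_def)
    show "\<one> \<in> ?Z" using subgroup.one_closed[OF aL] Ugrp_one by force
    show "s \<otimes> x \<in> ?Z" if s: "s \<in> (\<Union>b\<in>Y. L b)" and x: "x \<in> ?Z" for s x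
    proof -
      obtain u z where uz: "u \<in> L a" "z \<in> Ugrp L X" "x = u \<otimes> z" using x by blast
      obtain b where b: "b \<in> Y" "s \<in> L b" using s by blast
      show ?thesis
      proof (cases "b \<in> X")
        case True
        then have sX: "s \<in> Ugrp L X" using Ugrp_incl b by blast
        then have c: "cj (inv u) s \<in> Ugrp L X"
          using Ugrp_normal[OF assms(1,2) X _ sX] subgroup.m_inv_closed[OF aL uz(1)] by blast
        have "s \<otimes> x = u \<otimes> (cj (inv u) s \<otimes> z)"
          using car(1)[OF uz(1)] car(2)[OF uz(2)] car(2)[OF sX] by (simp add: uz(3) cj_def m_assoc)
        then show ?thesis using uz(1) subgroup.m_closed[OF XL c uz(2)] by blast
      next
        case False
        then have "b = a \<or> b = 2 *\<^sub>R a" using b Y by blast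
        then have sa: "s \<in> L a" using b L_double[OF assms(1)] Y(1) by blast
        have "s \<otimes> x = (s \<otimes> u) \<otimes> z"
          using car(1)[OF uz(1)] car(2)[OF uz(2)] car(1)[OF sa] by (simp add: uz(3) m_assoc)
        then show ?thesis using uz(2) subgroup.m_closed[OF aL sa uz(1)] by blast
      qed
    qed
  qed
  moreover have "y \<in> carrier G" using y Y(1) Ugrp_carrier by blast
  ultimately show ?thesis by auto
qed

lemma flip_normal:
  assumes "pos \<Psi>" "simple \<Xi> e" "e \<in> \<Psi>" "u \<in> L e" "y \<in> Ugrp L (\<Psi> \<inter> flip \<Xi> e)"
  shows "cj u y \<in> Ugrp L (\<Psi> \<inter> flip \<Xi> e)"
proof (rule Ugrp_normal[OF simple_root[OF assms(2)] _ _ assms(4,5)])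
  show "\<Psi> \<inter> flip \<Xi> e \<subseteq> \<Phi>" using pos_subset[OF assms(1)] by blast
qed (use interval_flip[OF assms(1-3)] in blast)

lemma flip_split:
  assumes "pos \<Psi>" "simple \<Xi> e" "e \<in> \<Psi>" "y \<in> Ugrp L (\<Psi> \<inter> \<Xi>)"
  shows "\<exists>u\<in>L e. \<exists>z\<in>Ugrp L (\<Psi> \<inter> flip \<Xi> e). y = u \<otimes> z"
proof (rule Ugrp_split[OF simple_root[OF assms(2)] _ _ _ _ assms(4)])
  show "\<Psi> \<inter> flip \<Xi> e \<subseteq> \<Phi>" "\<Psi> \<inter> \<Xi> \<subseteq> \<Phi>" using pos_subset[OF assms(1)] by blast+
  show "\<Psi> \<inter> \<Xi> \<subseteq> \<Psi> \<inter> flip \<Xi> e \<union> {e, 2 *\<^sub>R e}"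
    using Int_subset_flip_insert[OF assms(2) pos_subset[OF assms(1)]] .
qed (use interval_flip[OF assms(1-3)] in blast)

lemma flip_split_right:
  assumes "pos \<Psi>" "simple \<Xi> e" "e \<in> \<Psi>" "y \<in> Ugrp L (\<Psi> \<inter> \<Xi>)"
  shows "\<exists>u\<in>L e. \<exists>z\<in>Ugrp L (\<Psi> \<inter> flip \<Xi> e). y = z \<otimes> u"
proof -
  obtain u z where uz: "u \<in> L e" "z \<in> Ugrp L (\<Psi> \<inter> flip \<Xi> e)" "y = u \<otimes> z"
    using flip_split[OF assms] by blast
  have "u \<in> carrier G" using L_carrier[OF simple_root[OF assms(2)] uz(1)] .
  moreover have "z \<in> carrier G" using Ugrp_carrier[OF _ uz(2)] pos_subset[OF assms(1)] by blast
  ultimately have "y = cj u z \<otimes> u" unfolding uz(3) by (rule cj_swap)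
  then show ?thesis using uz(1) flip_normal[OF assms(1-3) uz(1,2)] by blast
qed

text \<open>Each flip moves one root group across the product: that of \<open>e\<close> from the
  right factor to the left one, or that of \<open>- e\<close> back if \<open>e\<close> is negative
  for \<Psi>. The second case must be treated because \<open>gallery_pos\<close> relates the flipped
  root to the target system and not to the starting one.\<close>

lemma Ugrp_pos_split:
  assumes "pos \<Psi>" "pos \<Xi>" "y \<in> Ugrp L \<Psi>"
  shows "\<exists>p\<in>Ugrp L (\<Psi> - \<Xi>). \<exists>q\<in>Ugrp L (\<Psi> \<inter> \<Xi>). y = p \<otimes> q"
proof (rule gallery_pos[OF assms(1,2), where Q = "\<lambda>\<Xi>. \<exists>p\<in>Ugrp L (\<Psi> - \<Xi>). \<exists>q\<in>Ugrp L (\<Psi> \<inter> \<Xi>). y = p \<otimes> q"])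
  have "y \<in> carrier G" using assms(3) Ugrp_carrier[OF pos_subset[OF assms(1)]] by blast
  then show "\<exists>p\<in>Ugrp L (\<Psi> - \<Psi>). \<exists>q\<in>Ugrp L (\<Psi> \<inter> \<Psi>). y = p \<otimes> q"
    using assms(3) by (intro bexI[of _ "\<one>"] bexI[of _ y] Ugrp_one) auto
next
  fix \<Xi> e assume s: "simple \<Xi> e"
  assume "\<exists>p\<in>Ugrp L (\<Psi> - \<Xi>). \<exists>q\<in>Ugrp L (\<Psi> \<inter> \<Xi>). y = p \<otimes> q"
  then obtain p q where pq: "p \<in> Ugrp L (\<Psi> - \<Xi>)" "q \<in> Ugrp L (\<Psi> \<inter> \<Xi>)" "y = p \<otimes> q" by blast
  have sub: "\<Psi> \<subseteq> \<Phi>" using assms(1) by (rule pos_subset)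
  have c: "\<Psi> \<inter> (\<Phi> - X) = \<Psi> - X" for X using sub by blast
  have eP: "e \<in> \<Phi>" using s by (rule simple_root)
  have pc: "p \<in> carrier G" and qc: "q \<in> carrier G" using pq(1,2) Ugrp_carrier sub by blast+
  show "\<exists>p\<in>Ugrp L (\<Psi> - flip \<Xi> e). \<exists>q\<in>Ugrp L (\<Psi> \<inter> flip \<Xi> e). y = p \<otimes> q"
  proof (cases "e \<in> \<Psi>")
    case True
    obtain u z where uz: "u \<in> L e" "z \<in> Ugrp L (\<Psi> \<inter> flip \<Xi> e)" "q = u \<otimes> z"
      using flip_split[OF assms(1) s True pq(2)] by blast
    have "- e \<notin> \<Psi>" using pos_neg_iff[OF assms(1) eP] True by blast
    then have "\<Psi> - \<Xi> \<subseteq> \<Psi> - flip \<Xi> e"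
      using flip_Int_subset[OF simple_compl[OF s] assms(1)] unfolding flip_compl[OF s] c by blast
    then have p: "p \<in> Ugrp L (\<Psi> - flip \<Xi> e)" using pq(1) Ugrp_mono by blast
    have u: "u \<in> Ugrp L (\<Psi> - flip \<Xi> e)" using Ugrp_incl[of e _ u] uz(1) True simple_not_flip[OF s] by blast
    have "y = (p \<otimes> u) \<otimes> z" using pq(3) uz(3) pc L_carrier[OF eP uz(1)] Ugrp_carrier[OF _ uz(2)] sub
      by (simp add: m_assoc le_infI1)
    then show ?thesis using uz(2) Ugrp_mult[OF _ p u] sub by blast
  next
    case False
    then have ne: "- e \<in> \<Psi>" using pos_neg_iff[OF assms(1) eP] by blast
    have "p \<in> Ugrp L (\<Psi> \<inter> (\<Phi> - \<Xi>))" using pq(1) by (simp add: c)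
    from flip_split_right[OF assms(1) simple_compl[OF s] ne this]
    obtain u z where uz: "u \<in> L (- e)" "z \<in> Ugrp L (\<Psi> - flip \<Xi> e)" "p = z \<otimes> u"
      unfolding flip_compl[OF s] c by blast
    have q: "q \<in> Ugrp L (\<Psi> \<inter> flip \<Xi> e)" using pq(2) Ugrp_mono[OF flip_Int_subset[OF s assms(1) False]] by blast
    have u: "u \<in> Ugrp L (\<Psi> \<inter> flip \<Xi> e)" using Ugrp_incl[of "- e" _ u] uz(1) ne simple_neg_flip[OF s] by blast
    have "y = z \<otimes> (u \<otimes> q)"
      using pq(3) uz(3) qc L_carrier[OF root_neg[OF eP] uz(1)] Ugrp_carrier[OF _ uz(2)] sub
      by (simp add: m_assoc subset_iff)
    then show ?thesis using uz(2) Ugrp_mult[OF _ u q] sub by blast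
  qed
qed

end

lemma U_trivial_T:
  assumes "pos \<Psi>" "t \<in> T" "y \<in> Ugrp U \<Psi>" "t \<otimes> y \<in> Ugrp U (\<Phi> - \<Psi>)"
  shows "t \<otimes> y = \<one>"
proof -
  obtain \<Delta> where b: "root_base \<Phi> \<Delta>" "\<Psi> = positive_roots \<Phi> \<Delta>" using assms(1) by (auto simp: pos_def)
  show ?thesis using RGD6[OF b(1)] assms(2-4) unfolding Ugrp_def b(2) set_mult_def by blast
qed

lemma T_one: "\<one> \<in> T"
  using RGD1(1) by (rule subgroup.one_closed)

lemma U_trivial:
  assumes "pos \<Psi>" "y \<in> Ugrp U \<Psi>" "y \<in> Ugrp U (\<Phi> - \<Psi>)"
  shows "y = \<one>"
proof -
  have "y \<in> carrier G" using Ugrp_carrier[OF root_subfamily_U pos_subset[OF assms(1)] assms(2)] .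
  then show ?thesis using U_trivial_T[OF assms(1) T_one assms(2)] assms(3) by simp
qed

text \<open>Unique factorisation along a gallery from \<open>\<Phi> - D\<close> to \<open>D\<close>: the factors \<open>c\<close> of \<open>u\<close> do not
  depend on the subfamily, so they decide to which of the groups \<^term>\<open>Ugrp L D\<close> it belongs.\<close>

lemma coordinates:
  assumes "pos D" "u \<in> Ugrp U D"
  shows "\<exists>K. finite K \<and> (\<forall>(a, c)\<in>K. a \<in> D \<and> c \<in> U a) \<and>
    (\<forall>L. root_subfamily L \<longrightarrow> (u \<in> Ugrp L D \<longleftrightarrow> (\<forall>(a, c)\<in>K. c \<in> L a)))"
proof -
  let ?Q = "\<lambda>\<Xi>. \<forall>u\<in>Ugrp U (D \<inter> \<Xi>). \<exists>K. finite K \<and> (\<forall>(a, c)\<in>K. a \<in> D \<and> c \<in> U a) \<and>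
    (\<forall>L. root_subfamily L \<longrightarrow> (u \<in> Ugrp L (D \<inter> \<Xi>) \<longleftrightarrow> (\<forall>(a, c)\<in>K. c \<in> L a)))"
  have sub: "D \<subseteq> \<Phi>" using assms(1) by (rule pos_subset)
  have "?Q D"
  proof (rule gallery_pos[OF pos_compl[OF assms(1)] assms(1), where Q = ?Q])
    show "?Q (\<Phi> - D)"
      using Ugrp_empty[OF root_subfamily_U] Ugrp_one by (auto intro!: exI[of _ "{}"])
  next
    fix \<Xi> e assume s: "simple \<Xi> e" and e: "e \<notin> D" and Q: "?Q \<Xi>"
    have eP: "e \<in> \<Phi>" using s by (rule simple_root)
    then have ne: "- e \<in> D" using pos_neg_iff[OF assms(1)] e by blast
    have fs: "simple (flip \<Xi> e) (- e)" using s by (rule simple_flip)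
    have ff: "flip (flip \<Xi> e) (- e) = \<Xi>" using s by (rule flip_flip)
    show "?Q (flip \<Xi> e)"
    proof
      fix u assume "u \<in> Ugrp U (D \<inter> flip \<Xi> e)"
      from flip_split[OF root_subfamily_U assms(1) fs ne this]
      obtain c z where cz: "c \<in> U (- e)" "z \<in> Ugrp U (D \<inter> \<Xi>)" "u = c \<otimes> z" unfolding ff by blast
      obtain K where K: "finite K" "\<forall>(a, c)\<in>K. a \<in> D \<and> c \<in> U a"
        "\<forall>L. root_subfamily L \<longrightarrow> (z \<in> Ugrp L (D \<inter> \<Xi>) \<longleftrightarrow> (\<forall>(a, c)\<in>K. c \<in> L a))"
        using bspec[OF Q cz(2)] by (elim exE conjE)
      have "(u \<in> Ugrp L (D \<inter> flip \<Xi> e) \<longleftrightarrow> (\<forall>(a, c)\<in>insert (- e, c) K. c \<in> L a))" if L: "root_subfamily L" for L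
      proof
        assume "u \<in> Ugrp L (D \<inter> flip \<Xi> e)"
        from flip_split[OF L assms(1) fs ne this]
        obtain c' z' where cz': "c' \<in> L (- e)" "z' \<in> Ugrp L (D \<inter> \<Xi>)" "u = c' \<otimes> z'" unfolding ff by blast
        have c'U: "c' \<in> U (- e)" using cz'(1) L_sub_U[OF L root_neg[OF eP]] by blast
        have z'U: "z' \<in> Ugrp U (D \<inter> \<Xi>)" using cz'(2) Ugrp_sub_U[OF L] sub by blast
        have car: "c \<in> carrier G" "c' \<in> carrier G" "z \<in> carrier G" "z' \<in> carrier G"
          using L_carrier[OF root_subfamily_U root_neg[OF eP]] Ugrp_carrier[OF root_subfamily_U, of "D \<inter> \<Xi>"]
            cz(1,2) c'U z'U sub by blast+
        \<comment> \<open>The quotient of the two first factors lies in \<open>U (- e)\<close>,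
          which is negative for \<Xi>, and also in the group attached to D \<inter> \<Xi>; so RGD6
          makes it trivial.\<close>
        let ?d = "inv c' \<otimes> c"
        have "c \<otimes> z = c' \<otimes> z'" using cz(3) cz'(3) by simp
        then have "inv c' \<otimes> (c \<otimes> z) = z'" using car by simp
        then have d: "?d = z' \<otimes> inv z" using car by (simp add: inv_solve_right m_assoc)
        have "?d \<in> U (- e)" using RGD1(2)[OF root_neg[OF eP]] cz(1) c'U
          by (simp add: subgroup.m_closed subgroup.m_inv_closed)
        then have 1: "?d \<in> Ugrp U (\<Phi> - \<Xi>)"
          using Ugrp_incl[OF root_subfamily_U, of "- e" "\<Phi> - \<Xi>"] pos_neg_iff[OF simple_pos[OF s] eP] simple_mem[OF s]
          eP by simp
        have "?d \<in> Ugrp U (D \<inter> \<Xi>)" unfolding d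
          using Ugrp_mult[OF root_subfamily_U _ z'U Ugrp_inv[OF root_subfamily_U _ cz(2)]] sub by blast
        then have "?d \<in> Ugrp U \<Xi>" using Ugrp_mono[OF root_subfamily_U, of "D \<inter> \<Xi>" \<Xi>] by blast
        with 1 have "?d = \<one>" using U_trivial[OF simple_pos[OF s]] by blast
        then have "c = c'" and "z = z'" using d car
          by (metis inv_closed inv_equality inv_inv, metis inv_closed inv_equality inv_inv)
        then show "\<forall>(a, c)\<in>insert (- e, c) K. c \<in> L a" using cz' K(3) L by auto
      next
        assume a: "\<forall>(a, c)\<in>insert (- e, c) K. c \<in> L a"
        then have "z \<in> Ugrp L (D \<inter> \<Xi>)" using K(3) L by auto
        then have z: "z \<in> Ugrp L (D \<inter> flip \<Xi> e)" using Ugrp_mono[OF L flip_Int_subset[OF s assms(1) e]] by blast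
        have "c \<in> Ugrp L (D \<inter> flip \<Xi> e)" using a ne simple_neg_flip[OF s] by (intro Ugrp_incl[OF L, of "- e"]) auto
        then show "u \<in> Ugrp L (D \<inter> flip \<Xi> e)" using Ugrp_mult[OF L _ _ z] cz(3) sub by blast
      qed
      then show "\<exists>K. finite K \<and> (\<forall>(a, c)\<in>K. a \<in> D \<and> c \<in> U a) \<and> (\<forall>L. root_subfamily L \<longrightarrow>
          (u \<in> Ugrp L (D \<inter> flip \<Xi> e) \<longleftrightarrow> (\<forall>(a, c)\<in>K. c \<in> L a)))"
        using K(1,2) ne cz(1) by (intro exI[of _ "insert (- e, c) K"]) auto
    qed
  qed
  then show ?thesis using assms(2) by simp
qed

text \<open>Let \<open>X E\<close> be the triple product. The rank one hypothesis exchanges the two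
  adjacent factors on the wall of a simple root, so \<open>X E\<close> lies in the product for the
  flipped system and hence does not depend on \<open>E\<close>. A generator from \<open>L a\<close>
  is absorbed by the leftmost factor after passing to a system where \<open>a\<close> is
  negative.\<close>

lemma opposite_decomposition:
  assumes L: "root_subfamily L" and H: "subgroup H G"
    and norm: "\<And>h a u. h \<in> H \<Longrightarrow> a \<in> \<Phi> \<Longrightarrow> u \<in> L a \<Longrightarrow> cj h u \<in> L a"
    and swap: "\<And>a u v. a \<in> \<Phi> \<Longrightarrow> u \<in> L a \<Longrightarrow> v \<in> L (- a) \<Longrightarrow>
      \<exists>v'\<in>L (- a). \<exists>h\<in>H. \<exists>u'\<in>L a. u \<otimes> v = v' \<otimes> h \<otimes> u'"
    and E: "pos E" and g: "g \<in> generate G (H \<union> (\<Union>a\<in>\<Phi>. L a))"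
  shows "\<exists>y\<in>Ugrp L (\<Phi> - E). \<exists>z\<in>Ugrp L E. \<exists>h\<in>H. g = y \<otimes> z \<otimes> h"
proof -
  define X where "X E = {y \<otimes> z \<otimes> h | y z h. y \<in> Ugrp L (\<Phi> - E) \<and> z \<in> Ugrp L E \<and> h \<in> H}" for E
  have Hc: "h \<in> carrier G" if "h \<in> H" for h using H that by (rule subgroup.mem_carrier)
  have cjH: "cj h y \<in> Ugrp L Y" if "h \<in> H" "Y \<subseteq> \<Phi>" "y \<in> Ugrp L Y" for h y Y
    using that Ugrp_cj[OF L that(2) Hc[OF that(1)] Ugrp_subgroup[OF L that(2)] _ that(3)] norm Ugrp_incl[OF L] by blast
  have step: "X E \<subseteq> X (flip E e)" if s: "simple E e" for E e
  proof
    fix x assume "x \<in> X E"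
    then obtain y z h where x: "x = y \<otimes> z \<otimes> h" "y \<in> Ugrp L (\<Phi> - E)" "z \<in> Ugrp L E" "h \<in> H"
      by (auto simp: X_def)
    have p: "pos E" using s by (rule simple_pos)
    have eP: "e \<in> \<Phi>" using s by (rule simple_root)
    have E'P: "flip E e \<subseteq> \<Phi>" using s by (rule flip_subset)
    obtain u z1 where uz: "u \<in> L e" "z1 \<in> Ugrp L (E \<inter> flip E e)" "z = u \<otimes> z1"
      using flip_split[OF L p s simple_mem[OF s], unfolded Int_absorb, OF x(3)] by blast
    obtain v y1 where vy: "v \<in> L (- e)" "y1 \<in> Ugrp L ((\<Phi> - E) \<inter> (\<Phi> - flip E e))" "y = y1 \<otimes> v"
      using flip_split_right[OF L pos_compl[OF p] simple_compl[OF s] simple_mem[OF simple_compl[OF s]],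
        unfolded flip_compl[OF s] Int_absorb, OF x(2)] by blast
    \<comment> \<open>The hypothesis is used at \<open>- e\<close>: it rewrites negative times
      positive as positive times H times negative, the order that fits the flipped system.\<close>
    obtain u' t v' where w: "u' \<in> L e" "t \<in> H" "v' \<in> L (- e)" "v \<otimes> u = u' \<otimes> t \<otimes> v'"
      using swap[OF root_neg[OF eP] vy(1), unfolded minus_minus, OF uz(1)] by blast
    have z1: "z1 \<in> Ugrp L (flip E e)" using uz(2) Ugrp_mono[OF L, of "E \<inter> flip E e" "flip E e"] by blast
    have y1: "y1 \<in> Ugrp L (\<Phi> - flip E e)"
      using vy(2) Ugrp_mono[OF L, of "(\<Phi> - E) \<inter> (\<Phi> - flip E e)" "\<Phi> - flip E e"] by blast
    have v'z: "v' \<otimes> z1 \<in> Ugrp L (flip E e)"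
      using Ugrp_mult[OF L E'P Ugrp_incl[OF L simple_neg_flip[OF s] w(3)] z1] .
    have "u' \<in> Ugrp L (\<Phi> - flip E e)" using Ugrp_incl[OF L _ w(1), of "\<Phi> - flip E e"] eP simple_not_flip[OF s] by blast
    then have y1u: "y1 \<otimes> u' \<in> Ugrp L (\<Phi> - flip E e)" using Ugrp_mult[OF L _ y1] by blast
    have car: "u \<in> carrier G" "v \<in> carrier G" "u' \<in> carrier G" "v' \<in> carrier G" "t \<in> carrier G" "h \<in> carrier G"
      "z1 \<in> carrier G" "y1 \<in> carrier G"
      using L_carrier[OF L eP] L_carrier[OF L root_neg[OF eP]] Hc uz(1) vy(1) w x(4) Ugrp_carrier[OF L E'P z1]
        Ugrp_carrier[OF L _ y1] by blast+
    have "x = y1 \<otimes> (v \<otimes> u) \<otimes> z1 \<otimes> h" using car by (simp add: x(1) uz(3) vy(3) m_assoc)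
    also have "\<dots> = (y1 \<otimes> u') \<otimes> cj t (v' \<otimes> z1) \<otimes> (t \<otimes> h)"
      using car by (simp add: w(4) cj_def m_assoc)
    finally show "x \<in> X (flip E e)"
      unfolding X_def using y1u cjH[OF w(2) E'P v'z] subgroup.m_closed[OF H w(2) x(4)] by blast
  qed
  have indep: "X E \<subseteq> X E'" if "pos E" "pos E'" for E E'
    by (rule gallery_pos[OF that, where Q = "\<lambda>E'. X E \<subseteq> X E'"]) (use step in blast)+
  have Xc: "X E \<subseteq> carrier G" if "pos E" for E
    unfolding X_def using Ugrp_carrier[OF L pos_subset[OF that]] Ugrp_carrier[OF L, of "\<Phi> - E"] Hc by auto
  have "g \<otimes> \<one> \<in> X E"
  proof (rule generate_left_closed)
    show "H \<union> (\<Union>a\<in>\<Phi>. L a) \<subseteq> carrier G" using Hc L_Union_carrier[OF L] by blast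
    show "X E \<subseteq> carrier G" using E by (rule Xc)
    show "inv s \<in> H \<union> (\<Union>a\<in>\<Phi>. L a)" if "s \<in> H \<union> (\<Union>a\<in>\<Phi>. L a)" for s
      using that subgroup.m_inv_closed[OF H] subgroup.m_inv_closed[OF L_subgroup[OF L]] by blast
    show "g \<in> generate G (H \<union> (\<Union>a\<in>\<Phi>. L a))" by fact
    have "\<one> = \<one> \<otimes> \<one> \<otimes> \<one>" by simp
    then show "\<one> \<in> X E" unfolding X_def using Ugrp_one[OF L] subgroup.one_closed[OF H] by blast
    show "s \<otimes> x \<in> X E" if s: "s \<in> H \<union> (\<Union>a\<in>\<Phi>. L a)" and x: "x \<in> X E" for s x
    proof (cases "s \<in> H")
      case True
      obtain y z h where yz: "x = y \<otimes> z \<otimes> h" "y \<in> Ugrp L (\<Phi> - E)" "z \<in> Ugrp L E" "h \<in> H"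
        using x by (auto simp: X_def)
      have "y \<in> carrier G" "z \<in> carrier G" "h \<in> carrier G" "s \<in> carrier G"
        using Ugrp_carrier[OF L _ yz(2)] Ugrp_carrier[OF L pos_subset[OF E] yz(3)] Hc True yz(4) by blast+
      then have "s \<otimes> x = cj s y \<otimes> cj s z \<otimes> (s \<otimes> h)" by (simp add: yz(1) cj_def m_assoc)
      moreover have "cj s y \<in> Ugrp L (\<Phi> - E)" using cjH[OF True _ yz(2)] by blast
      ultimately show ?thesis unfolding X_def
        using cjH[OF True pos_subset[OF E] yz(3)] subgroup.m_closed[OF H True yz(4)] by blast
    next
      case False
      then obtain a where a: "a \<in> \<Phi>" "s \<in> L a" using s by blast
      obtain E' where E': "pos E'" "a \<notin> E'" using E pos_compl[OF E] by blast
      have "x \<in> X E'" using indep[OF E E'(1)] x by blast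
      then obtain y z h where yz: "x = y \<otimes> z \<otimes> h" "y \<in> Ugrp L (\<Phi> - E')" "z \<in> Ugrp L E'" "h \<in> H"
        by (auto simp: X_def)
      have "y \<in> carrier G" "z \<in> carrier G" "h \<in> carrier G" "s \<in> carrier G"
        using Ugrp_carrier[OF L _ yz(2)] Ugrp_carrier[OF L pos_subset[OF E'(1)] yz(3)] Hc yz(4) L_carrier[OF L a] by blast+
      then have "s \<otimes> x = (s \<otimes> y) \<otimes> z \<otimes> h" by (simp add: yz(1) m_assoc)
      moreover have "s \<otimes> y \<in> Ugrp L (\<Phi> - E')" using Ugrp_mult[OF L _ Ugrp_incl[OF L _ a(2)] yz(2)] a(1) E'(2) by blast
      ultimately have "s \<otimes> x \<in> X E'" unfolding X_def using yz(3,4) by blast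
      then show ?thesis using indep[OF E'(1) E] by blast
    qed
  qed
  moreover have "g \<in> carrier G" using g generate_in_carrier[of "H \<union> (\<Union>a\<in>\<Phi>. L a)"] Hc L_Union_carrier[OF L] by blast
  ultimately show ?thesis unfolding X_def by auto
qed

text \<open>The same change of positive system, now on the right: \<open>step\<close> trades a
  factor in \<open>L e\<close> for one in \<open>L (- e)\<close>, so \<open>X D\<close> does not
  depend on \<open>D\<close>, and u is absorbed in a system that contains its root. \<open>L\<close>
  and \<open>N\<close> are left general for two uses, one with all of \<open>U\<close> and the group
  N, one with the fixers of a point.\<close>

lemma iwasawa_right_closed:
  assumes L: "root_subfamily L" and B: "subgroup B G" and N: "N \<subseteq> carrier G"
    and step: "\<And>n a u. n \<in> N \<Longrightarrow> a \<in> \<Phi> \<Longrightarrow> u \<in> L a \<Longrightarrow>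
      \<exists>b\<in>B. \<exists>n'\<in>N. \<exists>v\<in>L (- a). n \<otimes> u = b \<otimes> n' \<otimes> v"
    and X_def: "\<And>D. X D = {b \<otimes> n \<otimes> y | b n y. b \<in> B \<and> n \<in> N \<and> y \<in> Ugrp L D}"
    and D: "pos D" and x: "x \<in> X D" and a: "a \<in> \<Phi>" and u: "u \<in> L a"
  shows "x \<otimes> u \<in> X D"
proof -
  have Bc: "b \<in> carrier G" if "b \<in> B" for b using B that by (rule subgroup.mem_carrier)
  have flip: "X D \<subseteq> X (flip D e)" if s: "simple D e" for D e
  proof
    fix x assume "x \<in> X D"
    then obtain b n y where x: "x = b \<otimes> n \<otimes> y" "b \<in> B" "n \<in> N" "y \<in> Ugrp L D" by (auto simp: X_def)
    have p: "pos D" using s by (rule simple_pos)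
    have eP: "e \<in> \<Phi>" using s by (rule simple_root)
    obtain w z where wz: "w \<in> L e" "z \<in> Ugrp L (D \<inter> flip D e)" "y = w \<otimes> z"
      using flip_split[OF L p s simple_mem[OF s], unfolded Int_absorb, OF x(4)] by blast
    obtain b' n' v where v: "b' \<in> B" "n' \<in> N" "v \<in> L (- e)" "n \<otimes> w = b' \<otimes> n' \<otimes> v"
      using step[OF x(3) eP wz(1)] by blast
    have z: "z \<in> Ugrp L (flip D e)" using wz(2) Ugrp_mono[OF L, of "D \<inter> flip D e" "flip D e"] by blast
    have car: "b \<in> carrier G" "n \<in> carrier G" "w \<in> carrier G" "z \<in> carrier G" "b' \<in> carrier G" "n' \<in> carrier G"
      "v \<in> carrier G"
      using Bc N x(2,3) v L_carrier[OF L eP wz(1)] L_carrier[OF L root_neg[OF eP] v(3)]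
        Ugrp_carrier[OF L flip_subset[OF s] z] by blast+
    have "x = b \<otimes> (n \<otimes> w) \<otimes> z" using car by (simp add: x(1) wz(3) m_assoc)
    also have "\<dots> = (b \<otimes> b') \<otimes> n' \<otimes> (v \<otimes> z)" using car by (simp add: v(4) m_assoc)
    finally show "x \<in> X (flip D e)" unfolding X_def
      using subgroup.m_closed[OF B x(2) v(1)] v(2)
        Ugrp_mult[OF L flip_subset[OF s] Ugrp_incl[OF L simple_neg_flip[OF s] v(3)] z] by blast
  qed
  have indep: "X D \<subseteq> X D'" if "pos D" "pos D'" for D D'
    by (rule gallery_pos[OF that, where Q = "\<lambda>D'. X D \<subseteq> X D'"]) (use flip in blast)+
  obtain D' where D': "pos D'" "a \<in> D'" using D pos_compl[OF D] a by blast
  have "x \<in> X D'" using indep[OF D D'(1)] x by blast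
  then obtain b n y where y: "x = b \<otimes> n \<otimes> y" "b \<in> B" "n \<in> N" "y \<in> Ugrp L D'" by (auto simp: X_def)
  have "b \<in> carrier G" "n \<in> carrier G" "y \<in> carrier G" "u \<in> carrier G"
    using Bc N y(2,3) Ugrp_carrier[OF L pos_subset[OF D'(1)] y(4)] L_carrier[OF L a u] by blast+
  then have "x \<otimes> u = b \<otimes> n \<otimes> (y \<otimes> u)" by (simp add: y(1) m_assoc)
  then have "x \<otimes> u \<in> X D'" unfolding X_def
    using y(2,3) Ugrp_mult[OF L pos_subset[OF D'(1)] y(4) Ugrp_incl[OF L D'(2) u]] by blast
  then show ?thesis using indep[OF D'(1) D] by blast
qed

end

section \<open>The group generated by the reflecting cosets\<close>

context root_system
begin

lemma reflection_bij: "a \<in> \<Phi> \<Longrightarrow> bij (reflection cr a)"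
  by (rule involuntory_imp_bij) simp

lemma weyl_closed:
  shows "id \<in> carrier (weyl_group \<Phi> cr)"
    and "w \<in> carrier (weyl_group \<Phi> cr) \<Longrightarrow> w' \<in> carrier (weyl_group \<Phi> cr) \<Longrightarrow> w \<circ> w' \<in> carrier (weyl_group \<Phi> cr)"
    and "a \<in> \<Phi> \<Longrightarrow> reflection cr a \<in> carrier (weyl_group \<Phi> cr)"
    and "w \<in> carrier (weyl_group \<Phi> cr) \<Longrightarrow> bij w"
    and "w \<in> carrier (weyl_group \<Phi> cr) \<Longrightarrow> w' \<in> carrier (weyl_group \<Phi> cr) \<Longrightarrow>
      w \<otimes>\<^bsub>weyl_group \<Phi> cr\<^esub> w' = w \<circ> w'"
proof -
  have refl_Bij: "reflection cr ` \<Phi> \<subseteq> Bij UNIV"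
    using reflection_bij by (auto simp: Bij_def)
  have one: "\<one>\<^bsub>BijGroup UNIV\<^esub> = (id :: 'v dual \<Rightarrow> 'v dual)" by (auto simp: BijGroup_def)
  have mult: "f \<otimes>\<^bsub>BijGroup UNIV\<^esub> g = f \<circ> g" if "f \<in> Bij UNIV" "g \<in> Bij UNIV" for f g :: "'v dual \<Rightarrow> 'v dual"
    using that by (auto simp: BijGroup_def compose_def)
  have car: "carrier (weyl_group \<Phi> cr) = generate (BijGroup UNIV) (reflection cr ` \<Phi>)"
    by (simp add: weyl_group_def)
  have sub: "carrier (weyl_group \<Phi> cr) \<subseteq> Bij UNIV"
    unfolding car using group.generate_incl[OF group_BijGroup, of "reflection cr ` \<Phi>" UNIV] refl_Bij
    by (simp add: BijGroup_def)
  show "id \<in> carrier (weyl_group \<Phi> cr)" unfolding car using generate.one[of "BijGroup UNIV"] one by metis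
  show "reflection cr a \<in> carrier (weyl_group \<Phi> cr)" if "a \<in> \<Phi>"
    unfolding car using that by (intro generate.incl) blast
  show "bij w" if "w \<in> carrier (weyl_group \<Phi> cr)" using that sub by (auto simp: Bij_def)
  show m: "w \<otimes>\<^bsub>weyl_group \<Phi> cr\<^esub> w' = w \<circ> w'"
    if "w \<in> carrier (weyl_group \<Phi> cr)" "w' \<in> carrier (weyl_group \<Phi> cr)" for w w'
    using mult[of w w'] that sub by (auto simp: weyl_group_def)
  show "w \<circ> w' \<in> carrier (weyl_group \<Phi> cr)"
    if w: "w \<in> carrier (weyl_group \<Phi> cr)" "w' \<in> carrier (weyl_group \<Phi> cr)"
  proof -
    have "w \<otimes>\<^bsub>BijGroup UNIV\<^esub> w' \<in> generate (BijGroup UNIV) (reflection cr ` \<Phi>)"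
      using w unfolding car by (rule generate.eng)
    moreover have "w \<in> Bij UNIV" "w' \<in> Bij UNIV" using w sub by blast+
    ultimately show ?thesis unfolding car using mult[of w w'] by metis
  qed
qed

text \<open>Reflections are involutions, so inverses of generators give no new case; products are
  handled by proving that composition with \<open>w\<close> on the left preserves
  \<open>Q\<close>.\<close>

lemma weyl_induct:
  assumes "w \<in> carrier (weyl_group \<Phi> cr)"
    and "Q id" "\<And>a w. a \<in> \<Phi> \<Longrightarrow> Q w \<Longrightarrow> Q (reflection cr a \<circ> w)"
  shows "Q w"
proof -
  have inv: "inv\<^bsub>BijGroup UNIV\<^esub> (reflection cr a) = reflection cr a" if "a \<in> \<Phi>" for a
  proof (rule group.inv_equality[OF group_BijGroup])
    have "reflection cr a \<in> Bij UNIV"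
      using reflection_bij[OF that] by (simp add: Bij_def)
    then show "reflection cr a \<otimes>\<^bsub>BijGroup UNIV\<^esub> reflection cr a = \<one>\<^bsub>BijGroup UNIV\<^esub>"
      "reflection cr a \<in> carrier (BijGroup UNIV)" "reflection cr a \<in> carrier (BijGroup UNIV)"
      using reflection_invol[OF that] by (auto simp: BijGroup_def compose_def)
  qed
  have one: "\<one>\<^bsub>BijGroup UNIV\<^esub> = (id :: 'v dual \<Rightarrow> 'v dual)" by (auto simp: BijGroup_def)
  have mult: "f \<otimes>\<^bsub>BijGroup UNIV\<^esub> g = f \<circ> g" if "bij f" "bij g" for f g :: "'v dual \<Rightarrow> 'v dual"
    using that by (auto simp: BijGroup_def Bij_def compose_def)
  have car: "w \<in> carrier (weyl_group \<Phi> cr) \<longleftrightarrow> w \<in> generate (BijGroup UNIV) (reflection cr ` \<Phi>)" for w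
    by (simp add: weyl_group_def)
  have "w \<in> generate (BijGroup UNIV) (reflection cr ` \<Phi>)" using assms(1) by (simp add: car)
  then have "\<forall>v. Q v \<longrightarrow> Q (w \<circ> v)"
  proof (induct rule: generate.induct)
    case one
    then show ?case by (simp add: \<open>\<one>\<^bsub>BijGroup UNIV\<^esub> = id\<close>)
  next
    case (incl h)
    then show ?case using assms(3) by blast
  next
    case (inv h)
    then obtain a where "a \<in> \<Phi>" "h = reflection cr a" by blast
    then show ?case
      using assms(3) \<open>\<And>a. a \<in> \<Phi> \<Longrightarrow> inv\<^bsub>BijGroup UNIV\<^esub> (reflection cr a) = reflection cr a\<close> by metis
  next
    case (eng h1 h2)
    then have "bij h1" "bij h2" using weyl_closed(4) car by blast+
    then show ?case using eng mult by (simp add: comp_assoc)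
  qed
  then show ?thesis using assms(2) by (metis comp_id)
qed

text \<open>All four properties pass from reflections to products. The last one, existence of the
  contragredient map, is what gives a meaning to the definite description in
  \<open>dual_action\<close>.\<close>

lemma weyl_props:
  assumes "w \<in> carrier (weyl_group \<Phi> cr)"
  shows "linear w" "w ` \<Phi> = \<Phi>" "pos \<Psi> \<Longrightarrow> pos (w ` \<Psi>)"
    and "\<exists>g. \<forall>\<beta> v. blinfun_apply (w \<beta>) (g v) = blinfun_apply \<beta> v"
proof -
  have "linear w \<and> w ` \<Phi> = \<Phi> \<and> (\<forall>\<Psi>. pos \<Psi> \<longrightarrow> pos (w ` \<Psi>)) \<and>
      (\<exists>g. \<forall>\<beta> v. blinfun_apply (w \<beta>) (g v) = blinfun_apply \<beta> v)"
  proof (rule weyl_induct[OF assms])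
    show "linear (id :: 'v dual \<Rightarrow> _) \<and> id ` \<Phi> = \<Phi> \<and> (\<forall>\<Psi>. pos \<Psi> \<longrightarrow> pos (id ` \<Psi>)) \<and>
      (\<exists>g. \<forall>\<beta> v. blinfun_apply (id \<beta>) (g v) = blinfun_apply \<beta> v)"
      using linear_id by (auto intro: exI[of _ id])
  next
    fix a w assume a: "a \<in> \<Phi>" and w: "linear w \<and> w ` \<Phi> = \<Phi> \<and> (\<forall>\<Psi>. pos \<Psi> \<longrightarrow> pos (w ` \<Psi>)) \<and>
      (\<exists>g. \<forall>\<beta> v. blinfun_apply (w \<beta>) (g v) = blinfun_apply \<beta> v)"
    then obtain g where g: "\<And>\<beta> v. blinfun_apply (w \<beta>) (g v) = blinfun_apply \<beta> v" by blast
    have "blinfun_apply ((reflection cr a \<circ> w) \<beta>) (g v - blinfun_apply a (g v) *\<^sub>R cr a) = blinfun_apply \<beta> v" for \<beta> v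
      using coroot_pairing[OF a] by (simp add: reflection_def blinfun.diff_left blinfun.scaleR_left
          blinfun.diff_right blinfun.scaleR_right g algebra_simps)
    moreover have "linear (reflection cr a \<circ> w)" using w linear_reflection by (blast intro: linear_compose)
    moreover have "(reflection cr a \<circ> w) ` \<Phi> = \<Phi>" using w reflection_roots[OF a] by (metis image_comp)
    moreover have "\<forall>\<Psi>. pos \<Psi> \<longrightarrow> pos ((reflection cr a \<circ> w) ` \<Psi>)"
      using w pos_reflection[OF _ a] by (metis image_comp)
    ultimately show "linear (reflection cr a \<circ> w) \<and> (reflection cr a \<circ> w) ` \<Phi> = \<Phi> \<and>
      (\<forall>\<Psi>. pos \<Psi> \<longrightarrow> pos ((reflection cr a \<circ> w) ` \<Psi>)) \<and>
      (\<exists>g. \<forall>\<beta> v. blinfun_apply ((reflection cr a \<circ> w) \<beta>) (g v) = blinfun_apply \<beta> v)"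
      by (intro conjI exI[of _ "\<lambda>v. g v - blinfun_apply a (g v) *\<^sub>R cr a"]) auto
  qed
  then show "linear w" "w ` \<Phi> = \<Phi>" "pos \<Psi> \<Longrightarrow> pos (w ` \<Psi>)"
    "\<exists>g. \<forall>\<beta> v. blinfun_apply (w \<beta>) (g v) = blinfun_apply \<beta> v" by blast+
qed

lemma weyl_root: "w \<in> carrier (weyl_group \<Phi> cr) \<Longrightarrow> b \<in> \<Phi> \<Longrightarrow> w b \<in> \<Phi>"
  using weyl_props(2) by blast

lemma weyl_neg: "w \<in> carrier (weyl_group \<Phi> cr) \<Longrightarrow> w (- b) = - w b"
  using weyl_props(1) by (rule linear_neg)

lemma dual_action_pairing:
  assumes "w \<in> carrier (weyl_group \<Phi> cr)"
  shows "blinfun_apply (w \<beta>) (dual_action w v) = blinfun_apply \<beta> v"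
proof -
  obtain g where g: "\<And>\<beta> v. blinfun_apply (w \<beta>) (g v) = blinfun_apply \<beta> v" using weyl_props(4)[OF assms] by blast
  have "\<exists>!v'. \<forall>\<beta>. blinfun_apply (w \<beta>) v' = blinfun_apply \<beta> v"
  proof (rule ex1I[of _ "g v"])
    show "\<forall>\<beta>. blinfun_apply (w \<beta>) (g v) = blinfun_apply \<beta> v" using g by blast
    fix v' assume v': "\<forall>\<beta>. blinfun_apply (w \<beta>) v' = blinfun_apply \<beta> v"
    have "surj w" using weyl_closed(4)[OF assms] by (rule bij_is_surj)
    have eq: "blinfun_apply \<gamma> v' = blinfun_apply \<gamma> (g v)" for \<gamma> :: "'v dual"
    proof -
      obtain \<beta> where "\<gamma> = w \<beta>" using surjD[OF \<open>surj w\<close>] by blast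
      then show ?thesis using v' g by simp
    qed
    then show "v' = g v" using eq[of "blinfun_inner_left _"] by (auto intro: euclidean_eqI)
  qed
  from theI'[OF this] show ?thesis unfolding dual_action_def by blast
qed

end

section \<open>The cosets M, the torus T and the group N, from the axioms\<close>

context based_root_group_datum
begin

abbreviation NN :: "'g set" where
  "NN \<equiv> carrier (N_group G \<Phi> M)"

lemma U_nontrivial:
  assumes "a \<in> \<Phi>" obtains u where "u \<in> U a" "u \<noteq> \<one>"
  using RGD1(3)[OF assms] subgroup.one_closed[OF RGD1(2)[OF assms]] by blast

lemma U_carrier: "a \<in> \<Phi> \<Longrightarrow> u \<in> U a \<Longrightarrow> u \<in> carrier G"
  using RGD1(2) by (rule subgroup.mem_carrier)

text \<open>Positive multiples are told apart by the strict inclusion in RGD3; any other two roots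
  are separated by a positive system, and RGD6 makes their groups meet trivially. So an element that
  permutes the root groups determines a permutation of the roots.\<close>

lemma U_inj:
  assumes "a \<in> \<Phi>" "b \<in> \<Phi>" "U a = U b"
  shows "a = b"
proof (cases "\<exists>c > 0. b = c *\<^sub>R a")
  case True
  then obtain c where c: "c > 0" "b = c *\<^sub>R a" by blast
  have "c = 1 \<or> c = 2 \<or> c = 1 / 2" using root_multiple[OF assms(1)] c assms(2) by blast
  moreover have "c \<noteq> 2" using RGD3[OF assms(1)] c assms(2,3) by (auto simp: multipliable_def)
  moreover have "c \<noteq> 1 / 2"
  proof
    assume "c = 1 / 2"
    then have "b = (1 / 2) *\<^sub>R a" using c(2) by metis
    then have "a = 2 *\<^sub>R b" by simp
    then show False using RGD3[OF assms(2)] assms(1,3) by (auto simp: multipliable_def)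
  qed
  ultimately show ?thesis using c by simp
next
  case False
  obtain \<Psi> where "pos \<Psi>" using ex_pos by blast
  then obtain \<Xi> where X: "pos \<Xi>" "a \<in> \<Xi>" "b \<notin> \<Xi>" using pos_separate[OF _ assms(1,2)] False by blast
  obtain u where u: "u \<in> U a" "u \<noteq> \<one>" using U_nontrivial[OF assms(1)] .
  have "u \<in> Ugrp U \<Xi>" using Ugrp_incl[OF root_subfamily_U X(2) u(1)] .
  moreover have "u \<in> Ugrp U (\<Phi> - \<Xi>)" using Ugrp_incl[OF root_subfamily_U, of b] u(1) X(3) assms(2,3) by blast
  ultimately show ?thesis using U_trivial[OF X(1)] u(2) by blast
qed

lemma U_opposite:
  assumes "a \<in> \<Phi>" shows "U (- a) \<noteq> U a"
proof
  assume "U (- a) = U a"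
  then have "- a = a" using U_inj[OF root_neg assms] assms by blast
  moreover have "blinfun_apply (- a) (cr a) = - 2" using coroot_pairing[OF assms] by (simp add: blinfun.minus_left)
  ultimately show False using coroot_pairing[OF assms] by simp
qed

lemma M_cj: "a \<in> \<Phi> \<Longrightarrow> b \<in> \<Phi> \<Longrightarrow> m \<in> M a \<Longrightarrow> cj m ` U b = U (reflection cr a b)"
  using RGD5[of a b m] unfolding cj_def .

lemma M_cj_self:
  assumes "a \<in> \<Phi>" "m \<in> M a"
  shows "cj m ` U a = U (- a)" "cj m ` U (- a) = U a"
  using M_cj[OF assms(1,1,2)] M_cj[OF assms(1) root_neg[OF assms(1)] assms(2)] assms(1) by simp_all

lemma T_subgroup: "subgroup T G"
  by (rule RGD1(1))

lemma T_carrier: "t \<in> T \<Longrightarrow> t \<in> carrier G"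
  using T_subgroup by (rule subgroup.mem_carrier)

lemma M_coset:
  assumes "a \<in> \<Phi>" obtains g where "g \<in> carrier G" "M a = T #> g"
  using RGD4(1)[OF assms] by (auto simp: RCOSETS_def)

lemma M_carrier: "a \<in> \<Phi> \<Longrightarrow> m \<in> M a \<Longrightarrow> m \<in> carrier G"
  using M_coset T_carrier by (metis (no_types, lifting) UN_E m_closed r_coset_def singletonD)

lemma M_T_mult:
  assumes "a \<in> \<Phi>" "m \<in> M a" "t \<in> T"
  shows "t \<otimes> m \<in> M a"
proof -
  obtain g where g: "g \<in> carrier G" "M a = T #> g" using M_coset[OF assms(1)] .
  then obtain s where s: "s \<in> T" "m = s \<otimes> g" using assms(2) by (auto simp: r_coset_def)
  then have "t \<otimes> m = (t \<otimes> s) \<otimes> g" using T_carrier assms(3) g by (simp add: m_assoc)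
  then show ?thesis using g(2) subgroup.m_closed[OF T_subgroup assms(3) s(1)] by (auto simp: r_coset_def)
qed

lemma M_quotient:
  assumes "a \<in> \<Phi>" "m \<in> M a" "m' \<in> M a"
  shows "m' \<otimes> inv m \<in> T"
proof -
  obtain g where g: "g \<in> carrier G" "M a = T #> g" using M_coset[OF assms(1)] .
  then obtain s s' where s: "s \<in> T" "m = s \<otimes> g" "s' \<in> T" "m' = s' \<otimes> g"
    using assms(2,3) by (auto simp: r_coset_def)
  then have "m' \<otimes> inv m = s' \<otimes> inv s" using T_carrier g by (simp add: m_assoc inv_mult_group)
  then show ?thesis using s T_subgroup by (simp add: subgroup.m_closed subgroup.m_inv_closed)
qed

lemma M_coset_eq:
  assumes "a \<in> \<Phi>" "m \<in> M a" shows "M a = (\<lambda>t. t \<otimes> m) ` T"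
proof (intro equalityI subsetI)
  fix m' assume m': "m' \<in> M a"
  have "m' = (m' \<otimes> inv m) \<otimes> m" using M_carrier[OF assms] M_carrier[OF assms(1) m'] by (simp add: m_assoc)
  then show "m' \<in> (\<lambda>t. t \<otimes> m) ` T" using M_quotient[OF assms m'] by blast
qed (use M_T_mult[OF assms] in blast)

lemma cj_image_cj:
  "g \<in> carrier G \<Longrightarrow> h \<in> carrier G \<Longrightarrow> X \<subseteq> carrier G \<Longrightarrow> cj (g \<otimes> h) ` X = cj g ` cj h ` X"
  unfolding image_image using cj_cj by (intro image_cong) auto

lemma cj_image_inv:
  assumes "g \<in> carrier G" "X \<subseteq> carrier G" "cj g ` X = Y"
  shows "cj (inv g) ` Y = X"
proof -
  have "cj (inv g) ` Y = (\<lambda>x. x) ` X" unfolding assms(3)[symmetric] image_image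
    using assms(1,2) by (intro image_cong) auto
  then show ?thesis by simp
qed

lemma U_sub_carrier: "a \<in> \<Phi> \<Longrightarrow> U a \<subseteq> carrier G"
  using U_carrier by blast

lemma cj_image_self:
  assumes "subgroup H G" "h \<in> H" shows "cj h ` H = H"
proof -
  have c: "h \<in> carrier G" "H \<subseteq> carrier G" using subgroup.mem_carrier[OF assms(1)] assms(2) by blast+
  have "x \<in> cj h ` H" if "x \<in> H" for x
    using that c cj_subgroup[OF assms(1) subgroup.m_inv_closed[OF assms(1,2)] that]
    by (intro image_eqI[of _ _ "cj (inv h) x"]) auto
  then show ?thesis using cj_subgroup[OF assms] by blast
qed

text \<open>RGD5 speaks only of the cosets \<open>M b\<close>; but t is the quotient of t g and g,
  two elements of \<open>M b\<close> that both carry \<open>U (- b)\<close> to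
  \<open>U b\<close>.\<close>

lemma T_cj:
  assumes "b \<in> \<Phi>" "t \<in> T"
  shows "cj t ` U b = U b"
proof -
  obtain g where g: "g \<in> carrier G" "M b = T #> g" using M_coset[OF assms(1)] .
  then have m: "g \<in> M b" using T_one by (force simp: r_coset_def)
  have "cj (t \<otimes> g) ` U (- b) = U b" "cj g ` U (- b) = U b"
    using M_cj_self[OF assms(1)] M_T_mult[OF assms(1) m assms(2)] m by blast+
  then show ?thesis
    using cj_image_cj[OF T_carrier[OF assms(2)] g(1) U_sub_carrier[OF root_neg[OF assms(1)]]] by simp
qed

text \<open>RGD4 writes a nontrivial q as x m y; if q normalized \<open>U a\<close>, so would m,
  which carries it to \<open>U (- a)\<close>.\<close>

lemma normalizing_trivial:
  assumes "a \<in> \<Phi>" "q \<in> U (- a)" "cj q ` U a = U a"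
  shows "q = \<one>"
proof (rule ccontr)
  assume "q \<noteq> \<one>"
  then obtain x m y where xy: "x \<in> U a" "m \<in> M a" "y \<in> U a" "q = x \<otimes> m \<otimes> y"
    using RGD4(2)[OF assms(1)] assms(2) by (fastforce simp: set_mult_def)
  have sub: "U a \<subseteq> carrier G" using U_sub_carrier[OF assms(1)] .
  have c: "x \<in> carrier G" "m \<in> carrier G" "y \<in> carrier G"
    using xy sub M_carrier[OF assms(1)] by blast+
  have "U a = cj x ` cj m ` cj y ` U a"
    using assms(3) cj_image_cj[of "x \<otimes> m" y "U a"] cj_image_cj[of x m "cj y ` U a"] c sub
    by (simp add: xy(4) cj_image_self[OF RGD1(2)[OF assms(1)] xy(3)])
  then have "cj x ` U (- a) = U a"
    using M_cj_self(1)[OF assms(1) xy(2)] cj_image_self[OF RGD1(2)[OF assms(1)] xy(3)] by simp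
  then have "cj (inv x) ` U a = U (- a)"
    using cj_image_inv[OF c(1)] U_sub_carrier[OF root_neg[OF assms(1)]] by blast
  then show False
    using cj_image_self[OF RGD1(2)[OF assms(1)] subgroup.m_inv_closed[OF RGD1(2)[OF assms(1)] xy(1)]]
      U_opposite[OF assms(1)] by simp
qed

text \<open>The quotient of the two middle factors is p q with p in \<open>U (- a)\<close> and q in
  \<open>U a\<close>, and it normalizes both groups; so q normalizes \<open>U (- a)\<close>, p
  normalizes \<open>U a\<close>, and both are trivial. The statement allows any elements that swap
  the two groups, so that conjugates and inverses of elements of \<open>M a\<close> can be compared
  with the factor supplied by RGD4.\<close>

lemma swapping_unique:
  assumes a: "a \<in> \<Phi>" and n: "n \<in> carrier G" "cj n ` U a = U (- a)" "cj n ` U (- a) = U a"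
    and n': "n' \<in> carrier G" "cj n' ` U a = U (- a)" "cj n' ` U (- a) = U a"
    and xy: "x \<in> U a" "y \<in> U a" "x' \<in> U a" "y' \<in> U a" "x \<otimes> n \<otimes> y = x' \<otimes> n' \<otimes> y'"
  shows "n = n'"
proof -
  let ?h = "inv n \<otimes> n'"
  define v where "v = inv x' \<otimes> x"
  define q where "q = y \<otimes> inv y'"
  define p where "p = cj (inv n) v"
  have na: "- a \<in> \<Phi>" using a by (rule root_neg)
  have sub: "U a \<subseteq> carrier G" "U (- a) \<subseteq> carrier G" using U_sub_carrier a na by blast+
  have c: "x \<in> carrier G" "y \<in> carrier G" "x' \<in> carrier G" "y' \<in> carrier G" using xy sub by blast+
  have v: "v \<in> U a" and q: "q \<in> U a" unfolding v_def q_def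
    using RGD1(2)[OF a] xy by (simp_all add: subgroup.m_closed subgroup.m_inv_closed)
  have inv: "cj (inv n) ` U a = U (- a)" "cj (inv n) ` U (- a) = U a"
    using cj_image_inv[OF n(1)] n sub by blast+
  have p: "p \<in> U (- a)" unfolding p_def using v inv by blast
  have vc: "v \<in> carrier G" "q \<in> carrier G" "p \<in> carrier G" using v q p sub by blast+
  have "n' = inv x' \<otimes> (x' \<otimes> n' \<otimes> y') \<otimes> inv y'" using c n'(1) by (simp add: m_assoc)
  also have "\<dots> = v \<otimes> n \<otimes> q" unfolding xy(5)[symmetric] v_def q_def using c n(1) by (simp add: m_assoc)
  finally have h: "?h = p \<otimes> q" unfolding p_def cj_def using vc n(1) by (simp add: m_assoc)
  have hU: "cj ?h ` U a = U a" "cj ?h ` U (- a) = U (- a)"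
    using cj_image_cj[OF inv_closed[OF n(1)] n'(1) sub(1)] cj_image_cj[OF inv_closed[OF n(1)] n'(1) sub(2)] n' inv
    by simp_all
  have "cj q ` U (- a) = cj (inv p) ` cj ?h ` U (- a)"
    unfolding h using vc sub(2) by (subst cj_image_cj[symmetric]) simp_all
  also have "\<dots> = U (- a)"
    using hU(2) cj_image_self[OF RGD1(2)[OF na] subgroup.m_inv_closed[OF RGD1(2)[OF na] p]] by simp
  finally have q1: "q = \<one>" using normalizing_trivial[OF na, of q] q by simp
  then have "?h = p" using h vc by simp
  then have "p = \<one>" using normalizing_trivial[OF a p] hU(1) by simp
  then have "?h = \<one>" using h q1 by simp
  then show ?thesis using n(1) n'(1) by (metis inv_closed inv_equality inv_inv)
qed

lemma cj_swapping:
  assumes "n \<in> carrier G" "X \<subseteq> carrier G" "Y \<subseteq> carrier G" "cj n ` X = Y" "cj n ` Y = X"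
  shows "cj (inv n) ` X = Y" "cj (inv n) ` Y = X"
  using cj_image_inv[OF assms(1,3,5)] cj_image_inv[OF assms(1,2,4)] by blast+

lemma RGD4_factor:
  assumes "a \<in> \<Phi>" "u \<in> U (- a)" "u \<noteq> \<one>"
  obtains x m y where "x \<in> U a" "m \<in> M a" "y \<in> U a" "u = x \<otimes> m \<otimes> y"
  using RGD4(2)[OF assms(1)] assms(2,3) by (fastforce simp: set_mult_def)

lemma RGD4_factor_inv:
  assumes a: "a \<in> \<Phi>" and u: "u \<in> U (- a)" "u \<noteq> \<one>"
    and xy: "x \<in> U a" "m \<in> M a" "y \<in> U a" "u = x \<otimes> m \<otimes> y"
  shows "inv m \<in> M a"
proof -
  have Us: "subgroup (U a) G" "subgroup (U (- a)) G" using RGD1(2) a root_neg by blast+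
  have uc: "u \<in> carrier G" using u U_carrier[OF root_neg[OF a]] by blast
  have c: "x \<in> carrier G" "m \<in> carrier G" "y \<in> carrier G" using xy U_carrier[OF a] M_carrier[OF a] by blast+
  have "inv u \<noteq> \<one>" using u uc by (metis inv_inv inv_one)
  then obtain x' m' y' where x': "x' \<in> U a" "m' \<in> M a" "y' \<in> U a" "inv u = x' \<otimes> m' \<otimes> y'"
    using RGD4_factor[OF a subgroup.m_inv_closed[OF Us(2) u(1)]] by blast
  have "inv u = inv y \<otimes> inv m \<otimes> inv x" using c by (simp add: xy(4) inv_mult_group m_assoc)
  then have "inv m = m'"
    using swapping_unique[OF a inv_closed[OF c(2)] cj_swapping[OF c(2)] M_carrier[OF a x'(2)] M_cj_self[OF a x'(2)]
        subgroup.m_inv_closed[OF Us(1) xy(3)] subgroup.m_inv_closed[OF Us(1) xy(1)] x'(1,3)] x'(4)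
      M_cj_self[OF a xy(2)] U_sub_carrier a root_neg by auto
  then show ?thesis using x'(2) by simp
qed

text \<open>Conjugation by m y carries \<open>U a\<close> to \<open>U (- a)\<close>, a group that u
  normalizes; equality would identify two opposite root groups.\<close>

lemma RGD4_factor_nontrivial:
  assumes a: "a \<in> \<Phi>" and u: "u \<in> U (- a)"
    and xy: "m \<in> M a" "y \<in> U a"
  shows "u \<noteq> m \<otimes> y"
proof
  assume *: "u = m \<otimes> y"
  have na: "- a \<in> \<Phi>" using a by (rule root_neg)
  have c: "u \<in> carrier G" "m \<in> carrier G" "y \<in> carrier G" using xy u U_carrier[OF a] U_carrier[OF na] M_carrier[OF a] by blast+
  have "cj u ` U a = U (- a)"
    unfolding * using cj_image_cj[OF c(2,3) U_sub_carrier[OF a]] cj_image_self[OF RGD1(2)[OF a] xy(2)]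
      M_cj_self[OF a xy(1)] by simp
  then have "cj (inv u) ` U (- a) = U a" using cj_image_inv[OF c(1) U_sub_carrier[OF a]] by blast
  then show False
    using cj_image_self[OF RGD1(2)[OF na] subgroup.m_inv_closed[OF RGD1(2)[OF na] u]] U_opposite[OF a] by simp
qed

text \<open>Solving u = x m y for x yields a factorization of x relative to the opposite root. This
  is the link between \<open>M a\<close> and \<open>M (- a)\<close>.\<close>

lemma RGD4_factor_dual:
  assumes a: "a \<in> \<Phi>" and u: "u \<in> U (- a)"
    and xy: "x \<in> U a" "m \<in> M a" "y \<in> U a" "u = x \<otimes> m \<otimes> y"
  shows "x \<noteq> \<one>" "cj m (inv y) \<in> U (- a)" "x = u \<otimes> inv m \<otimes> cj m (inv y)"
proof -
  have c: "x \<in> carrier G" "m \<in> carrier G" "y \<in> carrier G" using xy U_carrier[OF a] M_carrier[OF a] by blast+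
  show "x \<noteq> \<one>" using RGD4_factor_nontrivial[OF a u xy(2,3)] xy(4) c by auto
  show "cj m (inv y) \<in> U (- a)"
    using M_cj_self(1)[OF a xy(2)] subgroup.m_inv_closed[OF RGD1(2)[OF a] xy(3)] by blast
  show "x = u \<otimes> inv m \<otimes> cj m (inv y)" using c by (simp add: xy(4) cj_def m_assoc)
qed

text \<open>The inverse of one middle factor m lies in both cosets: in \<open>M (- a)\<close> by the
  dual factorization and uniqueness, in \<open>M a\<close> by factoring the inverse of u. Two right
  cosets of \<open>T\<close> with a common element agree.\<close>

lemma M_neg:
  assumes a: "a \<in> \<Phi>" shows "M (- a) = M a"
proof -
  have na: "- a \<in> \<Phi>" using a by (rule root_neg)
  obtain u where u: "u \<in> U (- a)" "u \<noteq> \<one>" using U_nontrivial[OF na] .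
  obtain x m y where xy: "x \<in> U a" "m \<in> M a" "y \<in> U a" "u = x \<otimes> m \<otimes> y" using RGD4_factor[OF a u] .
  note d = RGD4_factor_dual[OF a u(1) xy]
  have mc: "m \<in> carrier G" using M_carrier[OF a xy(2)] .
  obtain s m' s' where s: "s \<in> U (- a)" "m' \<in> M (- a)" "s' \<in> U (- a)" "x = s \<otimes> m' \<otimes> s'"
    using RGD4_factor[OF na _ d(1)] xy(1) by auto
  have sw: "cj m' ` U (- a) = U (- (- a))" "cj m' ` U (- (- a)) = U (- a)" using M_cj_self[OF na s(2)] by simp_all
  have sw': "cj (inv m) ` U (- a) = U (- (- a))" "cj (inv m) ` U (- (- a)) = U (- a)"
    using cj_swapping[OF mc U_sub_carrier[OF a] U_sub_carrier[OF na]] M_cj_self[OF a xy(2)] by simp_all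
  have "inv m = m'"
    using swapping_unique[OF na inv_closed[OF mc] sw' M_carrier[OF na s(2)] sw u(1) d(2) s(1,3)] d(3) s(4) by metis
  then have "inv m \<in> M (- a)" using s(2) by simp
  moreover have "inv m \<in> M a" using RGD4_factor_inv[OF a u xy] .
  ultimately show ?thesis using M_coset_eq[OF a] M_coset_eq[OF na] by metis
qed

text \<open>Conjugating a factorization of u by t^-1 gives another one, whose middle factor lies in
  \<open>M a\<close> by uniqueness; comparing it with m0 shows that m0 t m0^-1 is in
  \<open>T\<close>. A general m differs from m0 by an element of \<open>T\<close>.\<close>

lemma M_T_cj:
  assumes a: "a \<in> \<Phi>" and m: "m \<in> M a" and t: "t \<in> T" shows "cj m t \<in> T"
proof -
  have na: "- a \<in> \<Phi>" using a by (rule root_neg)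
  have tc: "t \<in> carrier G" using t by (rule T_carrier)
  have Ts: "subgroup T G" by (rule T_subgroup)
  obtain u where u: "u \<in> U (- a)" "u \<noteq> \<one>" using U_nontrivial[OF na] .
  obtain x m0 y where xy: "x \<in> U a" "m0 \<in> M a" "y \<in> U a" "u = x \<otimes> m0 \<otimes> y" using RGD4_factor[OF a u] .
  have c: "x \<in> carrier G" "m0 \<in> carrier G" "y \<in> carrier G" "u \<in> carrier G"
    using xy u U_carrier[OF a] U_carrier[OF na] M_carrier[OF a] by blast+
  have *: "cj m0 t \<in> T" if t: "t \<in> T" for t
  proof -
    let ?t = "inv t"
    have it: "?t \<in> T" using subgroup.m_inv_closed[OF Ts t] .
    have tc: "t \<in> carrier G" "?t \<in> carrier G" using t it T_carrier by blast+
    have cu: "cj ?t u \<in> U (- a)" using T_cj[OF na it] u(1) by blast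
    have cx: "cj ?t x \<in> U a" "cj ?t y \<in> U a" using T_cj[OF a it] xy(1,3) by blast+
    have "cj ?t u \<noteq> \<one>" using cj_eq_one_iff[OF tc(2) c(4)] u(2) by simp
    then obtain x' m' y' where x': "x' \<in> U a" "m' \<in> M a" "y' \<in> U a" "cj ?t u = x' \<otimes> m' \<otimes> y'"
      using RGD4_factor[OF a cu] by blast
    have e: "cj ?t x \<otimes> cj ?t m0 \<otimes> cj ?t y = x' \<otimes> m' \<otimes> y'"
      unfolding x'(4)[symmetric] xy(4) using c tc by (simp add: cj_mult)
    have m1: "cj ?t m0 = (?t \<otimes> m0) \<otimes> t" using tc by (simp add: cj_def)
    have sw: "cj (cj ?t m0) ` U a = U (- a)" "cj (cj ?t m0) ` U (- a) = U a"
      unfolding m1 using cj_image_cj[of "?t \<otimes> m0" t] T_cj[OF a t] T_cj[OF na t]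
        M_cj_self[OF a M_T_mult[OF a xy(2) it]] c tc U_sub_carrier[OF a] U_sub_carrier[OF na] by auto
    have "cj ?t m0 = m'"
      using swapping_unique[OF a cj_closed[OF tc(2) c(2)] sw M_carrier[OF a x'(2)] M_cj_self[OF a x'(2)] cx x'(1,3) e] .
    then have "cj ?t m0 \<otimes> inv m0 \<in> T" using M_quotient[OF a xy(2) x'(2)] by simp
    then have "t \<otimes> (cj ?t m0 \<otimes> inv m0) \<in> T" using subgroup.m_closed[OF Ts t] by blast
    then show ?thesis using tc c by (simp add: cj_def m_assoc)
  qed
  have q: "m \<otimes> inv m0 \<in> T" using M_quotient[OF a xy(2) m] .
  have "cj m t = cj (m \<otimes> inv m0) (cj m0 t)"
    using M_carrier[OF a m] c tc by (subst cj_cj) (simp_all add: m_assoc)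
  then show ?thesis using cj_subgroup[OF Ts q *[OF t]] by simp
qed

lemma M_inv:
  assumes a: "a \<in> \<Phi>" and m: "m \<in> M a" shows "inv m \<in> M a"
proof -
  have na: "- a \<in> \<Phi>" using a by (rule root_neg)
  obtain u where u: "u \<in> U (- a)" "u \<noteq> \<one>" using U_nontrivial[OF na] .
  obtain x m0 y where xy: "x \<in> U a" "m0 \<in> M a" "y \<in> U a" "u = x \<otimes> m0 \<otimes> y" using RGD4_factor[OF a u] .
  have i: "inv m0 \<in> M a" using RGD4_factor_inv[OF a u xy] .
  let ?q = "m \<otimes> inv m0"
  have q: "?q \<in> T" using M_quotient[OF a xy(2) m] .
  have c: "m0 \<in> carrier G" "m \<in> carrier G" using M_carrier[OF a] xy(2) m by blast+
  have "inv m = cj (inv m0) (inv ?q) \<otimes> inv m0"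
    using c by (simp add: cj_def m_assoc inv_mult_group)
  then show ?thesis using M_T_mult[OF a i M_T_cj[OF a i subgroup.m_inv_closed[OF T_subgroup q]]] by simp
qed

lemma NN_generate: "NN = generate G (\<Union>a\<in>\<Phi>. M a)"
  by (simp add: N_group_def)

lemma M_Union_carrier: "(\<Union>a\<in>\<Phi>. M a) \<subseteq> carrier G"
  using M_carrier by blast

lemma NN_subgroup: "subgroup NN G"
  unfolding NN_generate by (rule generate_is_subgroup[OF M_Union_carrier])

lemma NN_carrier: "n \<in> NN \<Longrightarrow> n \<in> carrier G"
  using NN_subgroup by (rule subgroup.mem_carrier)

lemma M_NN: "a \<in> \<Phi> \<Longrightarrow> m \<in> M a \<Longrightarrow> m \<in> NN"
  unfolding NN_generate by (intro generate.incl) blast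

lemma M_nonempty: "a \<in> \<Phi> \<Longrightarrow> \<exists>m. m \<in> M a"
  using M_coset[of a] T_one by (metis (no_types, lifting) UN_I r_coset_def singletonI)

text \<open>N is generated by the cosets \<open>M a\<close> alone; t is the quotient of t m and m
  for an m in one of them. This uses that there is a root.\<close>

lemma T_NN: "t \<in> T \<Longrightarrow> t \<in> NN"
proof -
  assume t: "t \<in> T"
  obtain a m where a: "a \<in> \<Phi>" "m \<in> M a" using ex_root M_nonempty by blast
  have "(t \<otimes> m) \<otimes> inv m \<in> NN"
    using NN_subgroup M_NN[OF a(1)] M_T_mult[OF a t] a(2) by (simp add: subgroup.m_closed subgroup.m_inv_closed)
  then show ?thesis using T_carrier[OF t] M_carrier[OF a] by (simp add: m_assoc)
qed

lemma NN_induct [consumes 1, case_names one step]: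
  assumes "n \<in> NN" "Q \<one>" "\<And>a m n. a \<in> \<Phi> \<Longrightarrow> m \<in> M a \<Longrightarrow> n \<in> NN \<Longrightarrow> Q n \<Longrightarrow> Q (m \<otimes> n)"
  shows "Q n"
proof -
  have "n \<otimes> \<one> \<in> {n \<in> NN. Q n}"
  proof (rule generate_left_closed[OF M_Union_carrier])
    show "{n \<in> NN. Q n} \<subseteq> carrier G" using NN_carrier by blast
    show "inv s \<in> (\<Union>a\<in>\<Phi>. M a)" if "s \<in> (\<Union>a\<in>\<Phi>. M a)" for s using that M_inv by blast
    show "s \<otimes> x \<in> {n \<in> NN. Q n}" if s: "s \<in> (\<Union>a\<in>\<Phi>. M a)" and x: "x \<in> {n \<in> NN. Q n}" for s x
    proof -
      obtain a where a: "a \<in> \<Phi>" "s \<in> M a" using s by blast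
      have "s \<otimes> x \<in> NN" using subgroup.m_closed[OF NN_subgroup M_NN[OF a]] x by blast
      then show ?thesis using assms(3)[OF a] x by blast
    qed
    show "n \<in> generate G (\<Union>a\<in>\<Phi>. M a)" using assms(1) NN_generate by simp
    show "\<one> \<in> {n \<in> NN. Q n}" using assms(2) subgroup.one_closed[OF NN_subgroup] by blast
  qed
  then show ?thesis using NN_carrier[OF assms(1)] by simp
qed

lemma NN_T_cj: "n \<in> NN \<Longrightarrow> t \<in> T \<Longrightarrow> cj n t \<in> T"
proof (induct arbitrary: t rule: NN_induct)
  case one
  then show ?case using T_carrier by simp
next
  case (step a m n)
  then show ?case using M_T_cj M_carrier NN_carrier T_carrier by (simp flip: cj_cj)
qed

text \<open>The concrete relation through which the abstractly described \<open>vnu\<close> becomes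
  computable: \<open>w\<close> is determined by \<open>n\<close> because \<open>U\<close> is
  injective on roots and the roots span.\<close>

definition acts :: "'g \<Rightarrow> ('v dual \<Rightarrow> 'v dual) \<Rightarrow> bool" where
  "acts n w \<longleftrightarrow> w \<in> carrier (weyl_group \<Phi> cr) \<and> (\<forall>b\<in>\<Phi>. cj n ` U b = U (w b))"

lemma acts_mult:
  assumes "n \<in> carrier G" "n' \<in> carrier G" "acts n w" "acts n' w'"
  shows "acts (n \<otimes> n') (w \<circ> w')"
  using assms weyl_closed(2)[of w w'] weyl_root[of w'] U_sub_carrier
  by (auto simp: acts_def cj_image_cj)

lemma acts_M: "a \<in> \<Phi> \<Longrightarrow> m \<in> M a \<Longrightarrow> acts m (reflection cr a)"
  by (simp add: acts_def weyl_closed(3) M_cj)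

lemma acts_ex: "n \<in> NN \<Longrightarrow> \<exists>w. acts n w"
proof (induct rule: NN_induct)
  case one
  have "cj \<one> ` U b = U b" if "b \<in> \<Phi>" for b using cj_image_self[OF RGD1(2)[OF that]] subgroup.one_closed[OF RGD1(2)[OF that]] .
  then have "acts \<one> id" unfolding acts_def using weyl_closed(1) by (simp only: id_apply) blast
  then show ?case by metis
next
  case (step a m n)
  then show ?case using acts_mult[OF M_carrier NN_carrier acts_M] by blast
qed

lemma acts_unique:
  assumes "acts n w" "acts n w'" shows "w = w'"
proof -
  have W: "w \<in> carrier (weyl_group \<Phi> cr)" "w' \<in> carrier (weyl_group \<Phi> cr)" using assms by (auto simp: acts_def)
  have "w b = w' b" if "b \<in> \<Phi>" for b
    using U_inj[OF weyl_root[OF W(1) that] weyl_root[OF W(2) that]] assms that by (simp add: acts_def)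
  then have "w x = w' x" for x
    using linear_eq_on_span[OF weyl_props(1)[OF W(1)] weyl_props(1)[OF W(2)], of \<Phi> x] span_roots by auto
  then show ?thesis by blast
qed

lemma acts_hom:
  assumes f: "\<And>n. n \<in> NN \<Longrightarrow> acts n (f n)"
  shows "f \<in> hom (N_group G \<Phi> M) (weyl_group \<Phi> cr)" "\<And>a. a \<in> \<Phi> \<Longrightarrow> f ` M a = {reflection cr a}"
proof -
  have W: "f n \<in> carrier (weyl_group \<Phi> cr)" if "n \<in> NN" for n using f[OF that] by (simp add: acts_def)
  show "f \<in> hom (N_group G \<Phi> M) (weyl_group \<Phi> cr)"
  proof (rule homI)
    fix n n' assume n: "n \<in> NN" "n' \<in> NN"
    have "n \<otimes> n' \<in> NN" using subgroup.m_closed[OF NN_subgroup n] .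
    from acts_unique[OF f[OF this] acts_mult[OF NN_carrier[OF n(1)] NN_carrier[OF n(2)] f[OF n(1)] f[OF n(2)]]]
    show "f (n \<otimes>\<^bsub>N_group G \<Phi> M\<^esub> n') = f n \<otimes>\<^bsub>weyl_group \<Phi> cr\<^esub> f n'"
      using weyl_closed(5)[OF W[OF n(1)] W[OF n(2)]] by (simp add: N_group_def)
  qed (rule W)
  show "f ` M a = {reflection cr a}" if a: "a \<in> \<Phi>" for a
  proof -
    have "f m = reflection cr a" if "m \<in> M a" for m
      using acts_unique[OF f[OF M_NN[OF a that]] acts_M[OF a that]] .
    then show ?thesis using M_nonempty[OF a] by auto
  qed
qed

text \<open>Choosing w with \<open>acts n w\<close> gives a homomorphism with the property that
  defines \<open>vnu\<close>; conversely any such homomorphism satisfies \<open>acts\<close> by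
  induction over words in the \<open>M a\<close>. So the definite description has exactly one
  solution.\<close>

lemma vnu_acts:
  assumes "n \<in> NN" shows "acts n (vnu G \<Phi> cr M n)"
proof -
  define f where "f = (\<lambda>n\<in>NN. SOME w. acts n w)"
  have f: "acts n (f n)" if "n \<in> NN" for n using someI_ex[OF acts_ex[OF that]] that by (simp add: f_def)
  have "vnu G \<Phi> cr M = f"
    unfolding vnu_def
  proof (rule the_equality)
    show "f \<in> extensional NN \<and> f \<in> hom (N_group G \<Phi> M) (weyl_group \<Phi> cr) \<and> (\<forall>\<alpha>\<in>\<Phi>. f ` M \<alpha> = {reflection cr \<alpha>})"
    proof -
      have "f \<in> extensional NN" by (simp add: f_def)
      then show ?thesis using acts_hom[OF f] by simp
    qed
  next
    fix g assume g: "g \<in> extensional NN \<and> g \<in> hom (N_group G \<Phi> M) (weyl_group \<Phi> cr) \<and> (\<forall>\<alpha>\<in>\<Phi>. g ` M \<alpha> = {reflection cr \<alpha>})"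
    have gm: "g (n \<otimes> n') = g n \<circ> g n'" if "n \<in> NN" "n' \<in> NN" for n n'
    proof -
      have "g n \<in> carrier (weyl_group \<Phi> cr)" "g n' \<in> carrier (weyl_group \<Phi> cr)"
        using g that by (auto simp: hom_def)
      then show ?thesis using g that weyl_closed(5) by (auto simp: hom_def N_group_def)
    qed
    have gW: "g n \<in> carrier (weyl_group \<Phi> cr)" if "n \<in> NN" for n using g that by (auto simp: hom_def)
    have one: "\<one> \<in> NN" using subgroup.one_closed[OF NN_subgroup] .
    have "acts n (g n)" if "n \<in> NN" for n using that
    proof (induct rule: NN_induct)
      case one
      have "g \<one> \<circ> g \<one> = g \<one>" using gm[OF \<open>\<one> \<in> NN\<close> \<open>\<one> \<in> NN\<close>] by simp
      then have "g \<one> = id"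
        using bij_is_inj[OF weyl_closed(4)[OF gW[OF \<open>\<one> \<in> NN\<close>]]] by (metis comp_apply eq_id_iff injD)
      moreover have "cj \<one> ` U b = U b" if "b \<in> \<Phi>" for b
        using cj_image_self[OF RGD1(2)[OF that]] subgroup.one_closed[OF RGD1(2)[OF that]] .
      ultimately show ?case unfolding acts_def using weyl_closed(1) by (simp only: id_apply) blast
    next
      case (step a m n)
      have "g m = reflection cr a" using g step(1,2) by blast
      then show ?case
        using acts_mult[OF M_carrier[OF step(1,2)] NN_carrier[OF step(3)] acts_M[OF step(1,2)] step(4)]
          gm[OF M_NN[OF step(1,2)] step(3)] by metis
    qed
    moreover have "f \<in> extensional NN" by (simp add: f_def)
    ultimately show "g = f" using g f acts_unique by (intro extensionalityI[of g NN f]) blast+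
  qed
  then show ?thesis using f[OF assms] by simp
qed

lemma vnu_weyl: "n \<in> NN \<Longrightarrow> vnu G \<Phi> cr M n \<in> carrier (weyl_group \<Phi> cr)"
  using vnu_acts by (simp add: acts_def)

lemma vnu_cj: "n \<in> NN \<Longrightarrow> b \<in> \<Phi> \<Longrightarrow> cj n ` U b = U (vnu G \<Phi> cr M n b)"
  using vnu_acts by (simp add: acts_def)

lemma vnu_M: "a \<in> \<Phi> \<Longrightarrow> m \<in> M a \<Longrightarrow> vnu G \<Phi> cr M m = reflection cr a"
  using acts_unique[OF vnu_acts acts_M] M_NN by blast

lemma vnu_mult:
  assumes "n \<in> NN" "n' \<in> NN"
  shows "vnu G \<Phi> cr M (n \<otimes> n') = vnu G \<Phi> cr M n \<circ> vnu G \<Phi> cr M n'"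
  using acts_unique[OF vnu_acts acts_mult[OF NN_carrier NN_carrier vnu_acts vnu_acts]]
    subgroup.m_closed[OF NN_subgroup assms] assms by blast

text \<open>Uniqueness comes from \<open>swapping_unique\<close> at \<open>- a\<close>, after moving
  the outer factors so that u is expressed through either middle factor.\<close>

lemma m_elt_equality:
  assumes a: "a \<in> \<Phi>" and x: "x \<in> U (- a)" "y \<in> U (- a)" and u: "u \<in> U a" and m: "x \<otimes> u \<otimes> y \<in> M a"
  shows "m_elt G U M a u = x \<otimes> u \<otimes> y"
  unfolding m_elt_def
proof (rule the_equality)
  show "x \<otimes> u \<otimes> y \<in> M a \<inter> (U (- a) <#> {u} <#> U (- a))"
    using x m by (auto simp: set_mult_def)
next
  fix m' assume "m' \<in> M a \<inter> (U (- a) <#> {u} <#> U (- a))"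
  then obtain x' y' where m': "m' \<in> M a" "x' \<in> U (- a)" "y' \<in> U (- a)" "m' = x' \<otimes> u \<otimes> y'"
    by (auto simp: set_mult_def)
  have na: "- a \<in> \<Phi>" using a by (rule root_neg)
  have sw: "cj m ` U (- a) = U (- (- a))" "cj m ` U (- (- a)) = U (- a)" if "m \<in> M a" for m
    using M_cj_self[OF a that] by simp_all
  have c: "x \<in> carrier G" "y \<in> carrier G" "x' \<in> carrier G" "y' \<in> carrier G" "u \<in> carrier G"
    using x m' u U_carrier[OF a] U_carrier[OF na] by blast+
  have e: "inv x' \<otimes> m' \<otimes> inv y' = inv x \<otimes> (x \<otimes> u \<otimes> y) \<otimes> inv y"
    unfolding m'(4) using c by (simp add: m_assoc)
  note i = subgroup.m_inv_closed[OF RGD1(2)[OF na]]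
  show "m' = x \<otimes> u \<otimes> y"
    using swapping_unique[OF na M_carrier[OF a m'(1)] sw[OF m'(1)] M_carrier[OF a m] sw[OF m] i[OF m'(2)] i[OF m'(3)]
        i[OF x(1)] i[OF x(2)] e] .
qed

lemma m_elt_factor:
  assumes a: "a \<in> \<Phi>" and u: "u \<in> U a" "u \<noteq> \<one>"
  obtains x y where "x \<in> U (- a)" "y \<in> U (- a)" "m_elt G U M a u \<in> M a" "u = x \<otimes> m_elt G U M a u \<otimes> y"
proof -
  have na: "- a \<in> \<Phi>" using a by (rule root_neg)
  obtain x m y where xy: "x \<in> U (- a)" "m \<in> M (- a)" "y \<in> U (- a)" "u = x \<otimes> m \<otimes> y"
    using RGD4_factor[OF na _ u(2)] u(1) by auto
  have m: "m \<in> M a" using xy(2) M_neg[OF a] by simp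
  have c: "x \<in> carrier G" "m \<in> carrier G" "y \<in> carrier G" using xy U_carrier[OF na] M_carrier[OF a m] by blast+
  have e: "inv x \<otimes> u \<otimes> inv y = m" using c by (simp add: xy(4) m_assoc)
  note i = subgroup.m_inv_closed[OF RGD1(2)[OF na]]
  have "m_elt G U M a u = m"
    using m_elt_equality[OF a i[OF xy(1)] i[OF xy(3)] u(1)] e m by simp
  then show ?thesis using that[OF xy(1,3)] m xy(4) by simp
qed

lemma vnu_root: "n \<in> NN \<Longrightarrow> b \<in> \<Phi> \<Longrightarrow> vnu G \<Phi> cr M n b \<in> \<Phi>"
  using vnu_weyl weyl_root by blast

lemma vnu_neg: "n \<in> NN \<Longrightarrow> vnu G \<Phi> cr M n (- b) = - vnu G \<Phi> cr M n b"
  using vnu_weyl weyl_neg by blast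

text \<open>Conjugation by n carries an RGD4 factorization for b to one for its image, and
  \<open>swapping_unique\<close> identifies the middle factor; the rest of the coset follows since N
  normalizes \<open>T\<close>.\<close>

lemma M_cj_NN:
  assumes n: "n \<in> NN" and b: "b \<in> \<Phi>" and m: "m \<in> M b"
  shows "cj n m \<in> M (vnu G \<Phi> cr M n b)"
proof -
  let ?w = "vnu G \<Phi> cr M n"
  have nb: "- b \<in> \<Phi>" using b by (rule root_neg)
  have wb: "?w b \<in> \<Phi>" "- ?w b \<in> \<Phi>" using vnu_root[OF n b] root_neg by blast+
  have nc: "n \<in> carrier G" using NN_carrier[OF n] .
  obtain u where u: "u \<in> U (- b)" "u \<noteq> \<one>" using U_nontrivial[OF nb] .
  obtain x m0 y where xy: "x \<in> U b" "m0 \<in> M b" "y \<in> U b" "u = x \<otimes> m0 \<otimes> y" using RGD4_factor[OF b u] .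
  have c: "x \<in> carrier G" "m0 \<in> carrier G" "y \<in> carrier G" "u \<in> carrier G" "m \<in> carrier G"
    using xy u m U_carrier[OF b] U_carrier[OF nb] M_carrier[OF b] by blast+
  have cu: "cj n u \<in> U (- ?w b)" using vnu_cj[OF n nb] u(1) vnu_neg[OF n] by auto
  have cx: "cj n x \<in> U (?w b)" "cj n y \<in> U (?w b)" using vnu_cj[OF n b] xy(1,3) by auto
  have "cj n u \<noteq> \<one>" using cj_eq_one_iff[OF nc c(4)] u(2) by simp
  then obtain x' m' y' where x': "x' \<in> U (?w b)" "m' \<in> M (?w b)" "y' \<in> U (?w b)" "cj n u = x' \<otimes> m' \<otimes> y'"
    using RGD4_factor[OF wb(1) cu] by blast
  have e: "cj n x \<otimes> cj n m0 \<otimes> cj n y = x' \<otimes> m' \<otimes> y'"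
    unfolding x'(4)[symmetric] xy(4) using c nc by (simp add: cj_mult)
  have E: "cj n m0 \<otimes> n = n \<otimes> m0" using c nc by (simp add: cj_def m_assoc)
  have sw: "cj (cj n m0) ` U (?w b) = U (- ?w b)" "cj (cj n m0) ` U (- ?w b) = U (?w b)"
  proof -
    have "cj (cj n m0) ` U (?w c) = U (?w (- c))" if c': "c \<in> \<Phi>" "cj m0 ` U c = U (- c)" for c
    proof -
      have "cj (cj n m0) ` U (?w c) = cj (cj n m0 \<otimes> n) ` U c"
        using vnu_cj[OF n c'(1)] cj_image_cj[OF cj_closed[OF nc c(2)] nc U_sub_carrier[OF c'(1)]] by simp
      also have "\<dots> = cj n ` U (- c)" unfolding E using cj_image_cj[OF nc c(2) U_sub_carrier[OF c'(1)]] c'(2) by simp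
      finally show ?thesis using vnu_cj[OF n root_neg[OF c'(1)]] by simp
    qed
    from this[OF b] this[OF nb] show "cj (cj n m0) ` U (?w b) = U (- ?w b)" "cj (cj n m0) ` U (- ?w b) = U (?w b)"
      using M_cj_self[OF b xy(2)] vnu_neg[OF n] by simp_all
  qed
  have m0: "cj n m0 = m'"
    using swapping_unique[OF wb(1) cj_closed[OF nc c(2)] sw M_carrier[OF wb(1) x'(2)] M_cj_self[OF wb(1) x'(2)] cx x'(1,3) e] .
  have "cj n m = cj n (m \<otimes> inv m0) \<otimes> cj n m0" using c nc by (subst cj_mult[symmetric]) (simp_all add: m_assoc)
  then show ?thesis using M_T_mult[OF wb(1) x'(2) NN_T_cj[OF n M_quotient[OF b xy(2) m]]] m0 by simp
qed

lemma m_elt_cj: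
  assumes n: "n \<in> NN" and b: "b \<in> \<Phi>" and u: "u \<in> U b" "u \<noteq> \<one>"
  shows "m_elt G U M (vnu G \<Phi> cr M n b) (cj n u) = cj n (m_elt G U M b u)"
proof -
  let ?w = "vnu G \<Phi> cr M n"
  have nb: "- b \<in> \<Phi>" using b by (rule root_neg)
  have wb: "?w b \<in> \<Phi>" using vnu_root[OF n b] .
  have nc: "n \<in> carrier G" using NN_carrier[OF n] .
  obtain x y where xy: "x \<in> U (- b)" "y \<in> U (- b)" "m_elt G U M b u \<in> M b" "u = x \<otimes> m_elt G U M b u \<otimes> y"
    using m_elt_factor[OF b u] .
  let ?m = "m_elt G U M b u"
  have c: "x \<in> carrier G" "y \<in> carrier G" "?m \<in> carrier G" "u \<in> carrier G"
    using xy u U_carrier[OF b] U_carrier[OF nb] M_carrier[OF b] by blast+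
  note i = subgroup.m_inv_closed[OF RGD1(2)[OF nb]]
  have cx: "cj n (inv x) \<in> U (- ?w b)" "cj n (inv y) \<in> U (- ?w b)"
    using vnu_cj[OF n nb] i[OF xy(1)] i[OF xy(2)] vnu_neg[OF n] by auto
  have "?m = inv x \<otimes> (x \<otimes> ?m \<otimes> y) \<otimes> inv y" using c by (simp add: m_assoc)
  then have e0: "?m = inv x \<otimes> u \<otimes> inv y" using xy(4) by simp
  have e: "cj n ?m = cj n (inv x) \<otimes> cj n u \<otimes> cj n (inv y)"
    by (subst e0) (use c nc in \<open>simp add: cj_mult\<close>)
  have "cj n ?m \<in> M (?w b)" using M_cj_NN[OF n b xy(3)] .
  then show ?thesis using m_elt_equality[OF wb cx _ ] e vnu_cj[OF n b] u(1) by auto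
qed

lemma Ugrp_cj_NN:
  assumes n: "n \<in> NN" and X: "X \<subseteq> \<Phi>" and y: "y \<in> Ugrp U X"
  shows "cj n y \<in> Ugrp U (vnu G \<Phi> cr M n ` X)"
proof (rule Ugrp_cj[OF root_subfamily_U X NN_carrier[OF n] Ugrp_subgroup[OF root_subfamily_U] _ y])
  show "vnu G \<Phi> cr M n ` X \<subseteq> \<Phi>" using vnu_root[OF n] X by blast
  show "cj n u \<in> Ugrp U (vnu G \<Phi> cr M n ` X)" if "a \<in> X" "u \<in> U a" for a u
    using Ugrp_incl[OF root_subfamily_U, of "vnu G \<Phi> cr M n a"] vnu_cj[OF n] that X by blast
qed

lemma flip_image: "simple \<Xi> a \<Longrightarrow> reflection cr a ` flip \<Xi> a = \<Xi>"
  using reflection_invol[OF simple_root] by (simp add: flip_def image_image)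

text \<open>Along a gallery from \<Psi> to its complement, z stays in the group attached to \<Psi>
  \<inter> \<Xi>, which is trivial at the end. At each step the part u of z in \<open>U a\<close>
  must vanish: otherwise write u = v1 m v2 and conjugate a nontrivial w in \<open>U (- a)\<close> by
  z and then by v1^-1; the result lies in the negative group but involves a nontrivial element of
  \<open>U a\<close>, against RGD6.\<close>

lemma normalizes_opposite_trivial:
  assumes P: "pos \<Psi>" and z: "z \<in> Ugrp U \<Psi>" and norm: "\<And>q. q \<in> Ugrp U (\<Phi> - \<Psi>) \<Longrightarrow> cj z q \<in> Ugrp U (\<Phi> - \<Psi>)"
  shows "z = \<one>"
proof -
  note R = root_subfamily_U
  have zc: "z \<in> carrier G" using Ugrp_carrier[OF R pos_subset[OF P] z] .
  have Psub: "\<Psi> \<subseteq> \<Phi>" using P by (rule pos_subset)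
  have "z \<in> Ugrp U (\<Psi> \<inter> (\<Phi> - \<Psi>))"
  proof (rule gallery_pos[OF P pos_compl[OF P], where Q = "\<lambda>\<Xi>. z \<in> Ugrp U (\<Psi> \<inter> \<Xi>)"])
    show "z \<in> Ugrp U (\<Psi> \<inter> \<Psi>)" using z by simp
  next
    fix \<Xi> a assume s: "simple \<Xi> a" and "a \<notin> \<Phi> - \<Psi>" and zX: "z \<in> Ugrp U (\<Psi> \<inter> \<Xi>)"
    let ?X = "flip \<Xi> a"
    let ?K = "\<Xi> \<inter> ?X"
    have aP: "a \<in> \<Phi>" using s by (rule simple_root)
    then have a: "a \<in> \<Psi>" using \<open>a \<notin> \<Phi> - \<Psi>\<close> by blast
    have nP: "- a \<in> \<Phi>" using aP by (rule root_neg)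
    have na: "- a \<notin> \<Psi>" using pos_neg_iff[OF P aP] a by blast
    have fs: "simple ?X (- a)" using s by (rule simple_flip)
    have ff: "flip ?X (- a) = \<Xi>" using s by (rule flip_flip)
    have Xsub: "\<Xi> \<subseteq> \<Phi>" "?X \<subseteq> \<Phi>" using pos_subset[OF simple_pos] s fs by blast+
    have Ksub: "?K \<subseteq> \<Phi>" using Xsub by blast
    obtain u z' where uz: "u \<in> U a" "z' \<in> Ugrp U (\<Psi> \<inter> ?X)" "z = u \<otimes> z'"
      using flip_split[OF R P s a zX] by blast
    have z'K: "z' \<in> Ugrp U ?K"
      using uz(2) Ugrp_mono[OF R, of "\<Psi> \<inter> ?X" ?K] flip_Int_subset[OF fs P na] unfolding ff by blast
    have nU: "cj v k \<in> Ugrp U ?K" if "v \<in> U (- a)" "k \<in> Ugrp U ?K" for v k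
      using flip_normal[OF R simple_pos[OF fs] fs simple_mem[OF fs] that(1), unfolded ff] that(2) by (simp add: Int_commute)
    have "u = \<one>"
    proof (rule ccontr)
      assume "u \<noteq> \<one>"
      then obtain v1 m v2 where v: "v1 \<in> U (- a)" "m \<in> M (- a)" "v2 \<in> U (- a)" "u = v1 \<otimes> m \<otimes> v2"
        using RGD4_factor[OF nP, of u] uz(1) by auto
      have m: "m \<in> M a" using v(2) M_neg[OF aP] by simp
      obtain w where w: "w \<in> U (- a)" "w \<noteq> \<one>" using U_nontrivial[OF nP] .
      have c: "u \<in> carrier G" "v1 \<in> carrier G" "v2 \<in> carrier G" "w \<in> carrier G" "m \<in> carrier G" "z' \<in> carrier G"
        using U_carrier[OF aP] U_carrier[OF nP] uz(1) v(1,3) w(1) M_carrier[OF aP m] Ugrp_carrier[OF R Ksub z'K] by blast+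
      \<comment> \<open>\<open>k\<close> is the commutator of z' and w, so z w z^-1 = u k w u^-1.
        Conjugation by m v2 keeps k in the group of \<open>?K\<close>, a set that the reflection
        preserves, and moves w to a nontrivial u2 in \<open>U a\<close>.\<close>
      define k where "k = z' \<otimes> cj w (inv z')"
      have k: "k \<in> Ugrp U ?K" unfolding k_def using Ugrp_mult[OF R Ksub z'K nU[OF w(1) Ugrp_inv[OF R Ksub z'K]]] .
      have kc: "k \<in> carrier G" using Ugrp_carrier[OF R Ksub k] .
      define w2 where "w2 = cj v2 w"
      have w2: "w2 \<in> U (- a)" "w2 \<noteq> \<one>" unfolding w2_def
        using cj_subgroup[OF RGD1(2)[OF nP] v(3) w(1)] cj_eq_one_iff[OF c(3,4)] w(2) by simp_all
      have w2c: "w2 \<in> carrier G" using U_carrier[OF nP w2(1)] .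
      define u2 where "u2 = cj m w2"
      have u2: "u2 \<in> U a" "u2 \<noteq> \<one>" unfolding u2_def
        using M_cj_self(2)[OF aP m] w2(1) cj_eq_one_iff[OF c(5) w2c] w2(2) by auto
      have u2c: "u2 \<in> carrier G" using U_carrier[OF aP u2(1)] .
      define k2 where "k2 = cj m (cj v2 k)"
      have "reflection cr a ` ?K \<subseteq> ?K" using flip_image[OF s] flip_def[of \<Xi> a] by blast
      then have k2: "k2 \<in> Ugrp U ?K" unfolding k2_def
        using Ugrp_cj_NN[OF M_NN[OF aP m] Ksub nU[OF v(3) k]] vnu_M[OF aP m] Ugrp_mono[OF R, of "reflection cr a ` ?K" ?K] by auto
      have k2c: "k2 \<in> carrier G" using Ugrp_carrier[OF R Ksub k2] .
      define q where "q = cj (inv v1) (cj z w)"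
      have q: "q = k2 \<otimes> u2"
        unfolding q_def k2_def u2_def k_def w2_def uz(3) v(4) using c by (simp add: cj_def m_assoc inv_mult_group)
      have "w \<in> Ugrp U (\<Phi> - \<Psi>)" "inv v1 \<in> Ugrp U (\<Phi> - \<Psi>)"
        using Ugrp_incl[OF R, of "- a" "\<Phi> - \<Psi>"] w(1) subgroup.m_inv_closed[OF RGD1(2)[OF nP] v(1)] nP na by blast+
      then have q1: "q \<in> Ugrp U (\<Phi> - \<Psi>)" unfolding q_def
        using cj_subgroup[OF Ugrp_subgroup[OF R, of "\<Phi> - \<Psi>"]] norm by blast
      have "q \<in> Ugrp U \<Xi>" unfolding q
        using Ugrp_mult[OF R Xsub(1) _ Ugrp_incl[OF R simple_mem[OF s] u2(1)]] k2 Ugrp_mono[OF R, of ?K \<Xi>] by blast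
      \<comment> \<open>q lies in the groups of \<Xi> and of \<Phi> - \<Psi>. In the splitting of
        the former its positive part is trivial, so q belongs to the group of the intersection,
        which contains no multiple of \<open>a\<close>.\<close>
      from Ugrp_pos_split[OF R simple_pos[OF s] pos_compl[OF P] this]
      obtain p r where pr: "p \<in> Ugrp U (\<Xi> - (\<Phi> - \<Psi>))" "r \<in> Ugrp U (\<Xi> \<inter> (\<Phi> - \<Psi>))" "q = p \<otimes> r" by blast
      have prc: "p \<in> carrier G" "r \<in> carrier G" using pr(1,2) Ugrp_carrier[OF R, of "\<Xi> - (\<Phi> - \<Psi>)"] Ugrp_carrier[OF R, of "\<Xi> \<inter> (\<Phi> - \<Psi>)"] Xsub by blast+
      have rP: "r \<in> Ugrp U (\<Phi> - \<Psi>)" using pr(2) Ugrp_mono[OF R, of "\<Xi> \<inter> (\<Phi> - \<Psi>)" "\<Phi> - \<Psi>"] by blast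
      have "p = q \<otimes> inv r" using prc by (simp add: pr(3) m_assoc)
      then have "p \<in> Ugrp U (\<Phi> - \<Psi>)" using Ugrp_mult[OF R _ q1 Ugrp_inv[OF R _ rP]] by blast
      moreover have "p \<in> Ugrp U \<Psi>" using pr(1) Ugrp_mono[OF R, of "\<Xi> - (\<Phi> - \<Psi>)" \<Psi>] Xsub by blast
      ultimately have "p = \<one>" using U_trivial[OF P] by blast
      then have "q = r" using pr(3) prc by simp
      moreover have "\<Xi> \<inter> (\<Phi> - \<Psi>) \<subseteq> ?X" using flip_Int_subset[OF s pos_compl[OF P]] a by blast
      ultimately have qX: "q \<in> Ugrp U ?X" using pr(2) Ugrp_mono[OF R] by blast
      have "u2 = inv k2 \<otimes> q" using k2c u2c by (simp add: q)
      moreover have "k2 \<in> Ugrp U ?X" using k2 Ugrp_mono[OF R, of ?K ?X] by blast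
      ultimately have "u2 \<in> Ugrp U ?X" using Ugrp_mult[OF R Xsub(2) Ugrp_inv[OF R Xsub(2)] qX] by blast
      moreover have "u2 \<in> Ugrp U (\<Phi> - ?X)" using Ugrp_incl[OF R, of a "\<Phi> - ?X"] u2(1) aP simple_not_flip[OF s] by blast
      ultimately show False using U_trivial[OF simple_pos[OF fs]] u2(2) by blast
    qed
    then have "z = z'" using uz(3) Ugrp_carrier[OF R Ksub z'K] by simp
    then show "z \<in> Ugrp U (\<Psi> \<inter> ?X)" using uz(2) by simp
  qed
  moreover have "\<Psi> \<inter> (\<Phi> - \<Psi>) = {}" by blast
  ultimately show ?thesis using Ugrp_empty[OF R] by simp
qed

text \<open>If \<open>vnu\<close> sent a positive root \<open>a\<close> to a negative one,
  conjugation by z = y^-1 n would carry \<open>U a\<close> into both the positive and the negative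
  group. So n normalizes both groups; then z normalizes the negative one and is trivial, and y = n
  is trivial for the same reason with the signs exchanged.\<close>

lemma NN_trivial:
  assumes P: "pos \<Psi>" and n: "n \<in> NN" and y: "y \<in> Ugrp U (\<Phi> - \<Psi>)" and z: "z \<in> Ugrp U \<Psi>" and nyz: "n = y \<otimes> z"
  shows "n = \<one>" "y = \<one>" "z = \<one>"
proof -
  note R = root_subfamily_U
  let ?w = "vnu G \<Phi> cr M n"
  have Psub: "\<Psi> \<subseteq> \<Phi>" using P by (rule pos_subset)
  have Ps: "subgroup (Ugrp U \<Psi>) G" and Ms: "subgroup (Ugrp U (\<Phi> - \<Psi>)) G" using Ugrp_subgroup[OF R] Psub by blast+
  have c: "n \<in> carrier G" "y \<in> carrier G" "z \<in> carrier G"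
    using NN_carrier[OF n] subgroup.mem_carrier[OF Ps z] subgroup.mem_carrier[OF Ms y] by blast+
  have wP: "?w a \<in> \<Psi>" if a: "a \<in> \<Psi>" for a
  proof (rule ccontr)
    assume na: "?w a \<notin> \<Psi>"
    have aP: "a \<in> \<Phi>" using a Psub by blast
    obtain u where u: "u \<in> U a" "u \<noteq> \<one>" using U_nontrivial[OF aP] .
    have uc: "u \<in> carrier G" using U_carrier[OF aP u(1)] .
    have "cj n u \<in> U (?w a)" using vnu_cj[OF n aP] u(1) by blast
    then have 1: "cj n u \<in> Ugrp U (\<Phi> - \<Psi>)" using Ugrp_incl[OF R, of "?w a" "\<Phi> - \<Psi>"] na vnu_root[OF n aP] by blast
    have "cj z u = cj (inv y) (cj n u)" using c uc by (simp add: nyz cj_def m_assoc inv_mult_group)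
    then have "cj z u \<in> Ugrp U (\<Phi> - \<Psi>)" using cj_subgroup[OF Ms subgroup.m_inv_closed[OF Ms y] 1] by simp
    moreover have "cj z u \<in> Ugrp U \<Psi>" using cj_subgroup[OF Ps z Ugrp_incl[OF R a u(1)]] .
    ultimately have "cj z u = \<one>" using U_trivial[OF P] by blast
    then show False using cj_eq_one_iff[OF c(3) uc] u(2) by blast
  qed
  have wM: "?w a \<in> \<Phi> - \<Psi>" if a: "a \<in> \<Phi> - \<Psi>" for a
  proof -
    have "- a \<in> \<Psi>" using pos_neg_iff[OF P] a by blast
    then have "- ?w a \<in> \<Psi>" using wP vnu_neg[OF n] by metis
    then show ?thesis using pos_neg_iff[OF P] vnu_root[OF n] a by blast
  qed
  have n1: "cj n q \<in> Ugrp U (\<Phi> - \<Psi>)" if "q \<in> Ugrp U (\<Phi> - \<Psi>)" for q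
    using Ugrp_cj_NN[OF n _ that] Ugrp_mono[OF R, of "?w ` (\<Phi> - \<Psi>)" "\<Phi> - \<Psi>"] wM by blast
  have n2: "cj n q \<in> Ugrp U \<Psi>" if "q \<in> Ugrp U \<Psi>" for q
    using Ugrp_cj_NN[OF n Psub that] Ugrp_mono[OF R, of "?w ` \<Psi>" \<Psi>] wP by blast
  show z1: "z = \<one>"
  proof (rule normalizes_opposite_trivial[OF P z])
    fix q assume q: "q \<in> Ugrp U (\<Phi> - \<Psi>)"
    have "cj z q = cj (inv y) (cj n q)"
      using c subgroup.mem_carrier[OF Ms q] by (simp add: nyz cj_def m_assoc inv_mult_group)
    then show "cj z q \<in> Ugrp U (\<Phi> - \<Psi>)" using cj_subgroup[OF Ms subgroup.m_inv_closed[OF Ms y] n1[OF q]] by simp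
  qed
  have ny: "n = y" using nyz z1 c by simp
  have PP: "\<Phi> - (\<Phi> - \<Psi>) = \<Psi>" using Psub by blast
  show "y = \<one>"
    using normalizes_opposite_trivial[OF pos_compl[OF P] y] n2 ny unfolding PP by blast
  then show "n = \<one>" using ny by simp
qed

end

section \<open>The apartment\<close>

lemma frag_eval_superset:
  assumes "finite S" "Poly_Mapping.keys c \<subseteq> S"
  shows "frag_eval t c = (\<Sum>p\<in>S. int_mult (Poly_Mapping.lookup c p) (t (fst p) (snd p)))"
  unfolding frag_eval_def using assms by (intro sum.mono_neutral_left) (auto simp: in_keys_iff)

lemma frag_eval_add: "frag_eval t (c + d) = frag_eval t c + frag_eval t d"
proof -
  let ?S = "Poly_Mapping.keys c \<union> Poly_Mapping.keys d"
  have "frag_eval t (c + d) = (\<Sum>p\<in>?S. int_mult (Poly_Mapping.lookup (c + d) p) (t (fst p) (snd p)))"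
    using keys_add[of c d] by (intro frag_eval_superset) auto
  also have "\<dots> = frag_eval t c + frag_eval t d"
    by (simp add: lookup_add int_mult_add_left sum.distrib frag_eval_superset[of ?S])
  finally show ?thesis .
qed

lemma frag_eval_0 [simp]: "frag_eval t 0 = 0"
  by (simp add: frag_eval_def)

lemma frag_eval_minus: "frag_eval t (- c) = - frag_eval t c"
  using frag_eval_add[of t c "- c"] by (simp add: eq_neg_iff_add_eq_0 add.commute)

lemma frag_eval_diff: "frag_eval t (c - d) = frag_eval t c - frag_eval t d"
  using frag_eval_add[of t c "- d"] by (simp add: frag_eval_minus)

lemma frag_eval_of [simp]: "frag_eval t (frag_of p) = t (fst p) (snd p)"
  by (simp add: frag_eval_def)

lemma additive_sum:
  assumes "additive f" shows "f (\<Sum>i\<in>I. g i) = (\<Sum>i\<in>I. f (g i))"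
proof -
  interpret additive f by fact
  show ?thesis by (rule sum)
qed

lemma additive_frag_eval:
  assumes "additive f" "\<And>p. p \<in> Poly_Mapping.keys c \<Longrightarrow> f (t (fst p) (snd p)) = b (fst p) (snd p)"
  shows "f (frag_eval t c) = frag_eval b c"
  unfolding frag_eval_def additive_sum[OF assms(1)] additive_int_mult[OF assms(1)]
  using assms(2) by (intro sum.cong) auto

context
  fixes A :: "'v::ab_group_add set" and t :: "'v \<Rightarrow> 'r::ab_group_add \<Rightarrow> 'y::ab_group_add"
  assumes tensor: "tensor_product A t" and A_add: "\<forall>v\<in>A. \<forall>w\<in>A. v + w \<in> A"
begin

lemma relations_carrier: "bilinear_relations A \<subseteq> carrier (free_Abelian_group (A \<times> (UNIV :: 'r set)))"
proof -
  have *: "Poly_Mapping.keys (x - y - z) \<subseteq> S"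
    if "Poly_Mapping.keys x \<subseteq> S" "Poly_Mapping.keys y \<subseteq> S" "Poly_Mapping.keys z \<subseteq> S"
    for x y z :: "('v \<times> 'r) \<Rightarrow>\<^sub>0 int" and S
    using keys_diff[of "x - y" z] keys_diff[of x y] that by blast
  show ?thesis
  proof
    fix c :: "'v \<times> 'r \<Rightarrow>\<^sub>0 int" assume "c \<in> bilinear_relations A"
    then obtain v w :: 'v and a b :: 'r where
      "v \<in> A \<and> w \<in> A \<and> c = frag_of (v + w, a) - frag_of (v, a) - frag_of (w, a) \<or>
       v \<in> A \<and> c = frag_of (v, a + b) - frag_of (v, a) - frag_of (v, b)"
      unfolding bilinear_relations_def by blast
    then have "Poly_Mapping.keys c \<subseteq> A \<times> UNIV"
      using A_add by (elim disjE conjE) (simp_all only:, (intro *; simp add: keys_frag_of)+)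
    then show "c \<in> carrier (free_Abelian_group (A \<times> (UNIV :: 'r set)))"
      by (simp add: carrier_free_Abelian_group_iff)
  qed
qed

lemma tensor_bilinear:
  shows "v \<in> A \<Longrightarrow> w \<in> A \<Longrightarrow> t (v + w) a = t v a + t w a"
    and "v \<in> A \<Longrightarrow> t v (a + b) = t v a + t v b"
proof -
  have *: "frag_eval t c = 0" if "c \<in> bilinear_relations A" for c
    using tensor generate.incl[OF that, of "free_Abelian_group (A \<times> UNIV)"] unfolding tensor_product_def by blast
  show "t (v + w) a = t v a + t w a" if "v \<in> A" "w \<in> A"
  proof -
    have "frag_of (v + w, a) - frag_of (v, a) - frag_of (w, a) \<in> bilinear_relations A"
      using that unfolding bilinear_relations_def by blast
    from *[OF this] have "t (v + w) a - t v a - t w a = 0" by (simp only: frag_eval_diff frag_eval_of fst_conv snd_conv)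
    then show ?thesis by (simp add: algebra_simps)
  qed
  show "t v (a + b) = t v a + t v b" if "v \<in> A"
  proof -
    have "frag_of (v, a + b) - frag_of (v, a) - frag_of (v, b) \<in> bilinear_relations A"
      using that unfolding bilinear_relations_def by blast
    from *[OF this] have "t v (a + b) - t v a - t v b = 0" by (simp only: frag_eval_diff frag_eval_of fst_conv snd_conv)
    then show ?thesis by (simp add: algebra_simps)
  qed
qed

lemma tensor_generates: "\<exists>c \<in> carrier (free_Abelian_group (A \<times> UNIV)). y = frag_eval t c"
  using tensor unfolding tensor_product_def by blast

lemma tensor_unique:
  assumes "additive f" "additive g" "\<And>v a. v \<in> A \<Longrightarrow> f (t v a) = g (t v a)"
  shows "f = g"
proof
  fix y
  obtain c where c: "c \<in> carrier (free_Abelian_group (A \<times> UNIV))" "y = frag_eval t c" using tensor_generates by blast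
  have "fst p \<in> A" if "p \<in> Poly_Mapping.keys c" for p using c(1) that by (auto simp: free_Abelian_group_def)
  then have "f (frag_eval t c) = frag_eval (\<lambda>v a. g (t v a)) c" "g (frag_eval t c) = frag_eval (\<lambda>v a. g (t v a)) c"
    using assms(3) by (auto intro!: additive_frag_eval assms(1,2))
  then show "f y = g y" using c(2) by simp
qed

text \<open>The kernel of \<open>frag_eval t\<close> is generated by the bilinearity relations, on
  which \<open>frag_eval b\<close> vanishes; so evaluating b on an arbitrarily chosen preimage is
  well defined.\<close>

lemma tensor_universal:
  fixes b :: "'v \<Rightarrow> 'r \<Rightarrow> 'z::ab_group_add"
  assumes b: "\<And>v w a. v \<in> A \<Longrightarrow> w \<in> A \<Longrightarrow> b (v + w) a = b v a + b w a"
    "\<And>v a a'. v \<in> A \<Longrightarrow> b v (a + a') = b v a + b v a'"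
  shows "\<exists>f. additive f \<and> (\<forall>v\<in>A. \<forall>a. f (t v a) = b v a)"
proof -
  let ?F = "free_Abelian_group (A \<times> (UNIV :: 'r set))"
  have ker: "frag_eval b c = 0" if "c \<in> carrier ?F" "frag_eval t c = 0" for c
  proof -
    have "c \<in> generate ?F (bilinear_relations A)" using that tensor unfolding tensor_product_def by blast
    then show ?thesis
    proof (induct rule: generate.induct)
      case one
      then show ?case by (simp add: free_Abelian_group_def)
    next
      case (incl h)
      then show ?case using b by (auto simp: bilinear_relations_def frag_eval_diff)
    next
      case (inv h)
      then have "Poly_Mapping.keys h \<subseteq> A \<times> UNIV" using relations_carrier by (auto simp: free_Abelian_group_def)
      then have "inv\<^bsub>?F\<^esub> h = - h" by simp
      moreover have "frag_eval b h = 0" using b inv by (auto simp: bilinear_relations_def frag_eval_diff)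
      ultimately show ?case by (simp add: frag_eval_minus)
    next
      case (eng h1 h2)
      then show ?case by (simp add: free_Abelian_group_def frag_eval_add)
    qed
  qed
  have F_add: "c + d \<in> carrier ?F" if "c \<in> carrier ?F" "d \<in> carrier ?F" for c d
    using that keys_add[of c d] by (auto simp: free_Abelian_group_def)
  have F_diff: "c - d \<in> carrier ?F" if "c \<in> carrier ?F" "d \<in> carrier ?F" for c d
    using that keys_diff[of c d] by (auto simp: free_Abelian_group_def)
  have wd: "frag_eval b c = frag_eval b d" if "c \<in> carrier ?F" "d \<in> carrier ?F" "frag_eval t c = frag_eval t d" for c d
    using ker[OF F_diff[OF that(1,2)]] that(3) by (simp add: frag_eval_diff)
  obtain r where r: "\<And>y. r y \<in> carrier ?F" "\<And>y. frag_eval t (r y) = y"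
    using tensor_generates by metis
  define f where "f y = frag_eval b (r y)" for y
  have "additive f"
  proof
    fix x y
    have "frag_eval b (r (x + y)) = frag_eval b (r x + r y)"
      by (rule wd[OF r(1) F_add[OF r(1) r(1)]]) (simp only: r(2) frag_eval_add)
    then show "f (x + y) = f x + f y" by (simp add: f_def frag_eval_add)
  qed
  moreover have "f (t v a) = b v a" if "v \<in> A" for v a
  proof -
    have "frag_eval b (r (t v a)) = frag_eval b (frag_of (v, a))"
      by (rule wd[OF r(1)]) (simp_all add: r(2) that del: carrier_free_Abelian_group_iff)
    then show ?thesis by (simp add: f_def)
  qed
  ultimately show ?thesis by blast
qed

end

lemma additive_compose: "additive f \<Longrightarrow> additive g \<Longrightarrow> additive (\<lambda>x. f (g x))"
  by (simp add: additive_def)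

text \<open>Divisibility by positive integers is how the Q-module structure of \<open>R\<close>
  enters: it halves vectors, supplies points of germs and solves for endpoints of intervals.\<close>

locale bruhat_setting = compatible_action G \<Phi> cr T U M \<phi> t diff orig \<nu> + based_root_group_datum G \<Phi> cr T U M
  for G :: "('g, 'b) monoid_scheme" (structure) and \<Phi> :: "'v::euclidean_space dual set" and cr T U M
    and \<phi> :: "'v dual \<Rightarrow> 'g \<Rightarrow> 'r::linordered_ab_group_add extended"
    and t :: "'v \<Rightarrow> 'r \<Rightarrow> 'y::ab_group_add"
    and diff :: "'p \<Rightarrow> 'p \<Rightarrow> 'y"
    and orig :: 'p
    and \<nu> :: "'g \<Rightarrow> 'p \<Rightarrow> 'p" +
  assumes divisible: "\<And>n (r :: 'r). 0 < n \<Longrightarrow> \<exists>s. int_mult n s = r"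
begin

section \<open>Roots as functions on V_R and on the apartment\<close>

abbreviation rv :: "'v dual \<Rightarrow> 'y \<Rightarrow> 'r" where
  "rv \<equiv> root_ext \<Phi> t"

abbreviation av :: "'v dual \<Rightarrow> 'p \<Rightarrow> 'r" where
  "av \<equiv> root_at \<Phi> t diff orig"

abbreviation CW :: "'v set" where
  "CW \<equiv> coweight_lattice \<Phi>"

abbreviation vn :: "'g \<Rightarrow> 'v dual \<Rightarrow> 'v dual" where
  "vn \<equiv> vnu G \<Phi> cr M"

lemma CW_add: "v \<in> CW \<Longrightarrow> w \<in> CW \<Longrightarrow> v + w \<in> CW"
  by (auto simp: coweight_lattice_def blinfun.add_right)

lemma CW_closed: "\<forall>v\<in>CW. \<forall>w\<in>CW. v + w \<in> CW"
  using CW_add by blast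

lemma CW_0: "0 \<in> CW"
  by (simp add: coweight_lattice_def)

lemma CW_minus: "v \<in> CW \<Longrightarrow> - v \<in> CW"
  by (simp add: coweight_lattice_def blinfun.minus_right)

lemma CW_int: "v \<in> CW \<Longrightarrow> of_int k *\<^sub>R v \<in> CW"
  by (simp add: coweight_lattice_def blinfun.scaleR_right)

lemma CW_cr: "a \<in> \<Phi> \<Longrightarrow> cr a \<in> CW"
  using pairing_int by (simp add: coweight_lattice_def)

lemma CW_floor: "v \<in> CW \<Longrightarrow> a \<in> \<Phi> \<Longrightarrow> of_int \<lfloor>blinfun_apply a v\<rfloor> = blinfun_apply a v"
  by (auto simp: coweight_lattice_def)

lemmas t_add = tensor_bilinear[OF tensor CW_closed]
lemmas t_unique = tensor_unique[OF tensor CW_closed]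
lemmas t_universal = tensor_universal[OF tensor CW_closed]

lemma t_additive: "v \<in> CW \<Longrightarrow> additive (t v)"
  by (simp add: additive_def t_add)

lemma t_0 [simp]: "t 0 a = 0"
  using t_add(1)[OF CW_0 CW_0, of a] by simp

lemma t_minus: "v \<in> CW \<Longrightarrow> t (- v) a = - t v a"
  using t_add(1)[OF _ CW_minus, of v v a] by (simp add: eq_neg_iff_add_eq_0 add.commute)

lemma t_int_left: "v \<in> CW \<Longrightarrow> t (of_int k *\<^sub>R v) a = int_mult k (t v a)"
proof (induct k rule: int_induct[where k = 0])
  case (step1 i)
  have "t (of_int (i + 1) *\<^sub>R v) a = t (of_int i *\<^sub>R v + v) a" by (simp add: algebra_simps)
  then show ?case using step1 t_add(1)[OF CW_int, of v v i a] by (simp add: int_mult_add_left)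
next
  case (step2 i)
  have "t (of_int (i - 1) *\<^sub>R v) a = t (of_int i *\<^sub>R v + - v) a" by (simp add: algebra_simps)
  then show ?case using step2 t_add(1)[OF CW_int CW_minus, of v v i a] t_minus[of v a]
      int_mult_add_left[of i "- 1" "t v a"] by simp
qed simp

text \<open>A root is integral on coweights, so (v, s) \<mapsto> a(v) s is biadditive and extends to
  the tensor product; the floor merely converts an integral real to an integer.\<close>

lemma rv_ex:
  assumes "a \<in> \<Phi>"
  shows "\<exists>!f. additive f \<and> (\<forall>v\<in>CW. \<forall>s :: 'r. f (t v s) = int_mult \<lfloor>blinfun_apply a v\<rfloor> s)"
proof -
  have fl: "\<lfloor>blinfun_apply a (v + w)\<rfloor> = \<lfloor>blinfun_apply a v\<rfloor> + \<lfloor>blinfun_apply a w\<rfloor>" if "v \<in> CW" "w \<in> CW" for v w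
    using CW_floor[OF that(1) assms] CW_floor[OF that(2) assms] by (metis blinfun.add_right floor_of_int of_int_add)
  have "\<exists>f. additive f \<and> (\<forall>v\<in>CW. \<forall>s :: 'r. f (t v s) = int_mult \<lfloor>blinfun_apply a v\<rfloor> s)"
    by (rule t_universal) (simp_all add: fl int_mult_add_left int_mult_add_right)
  then show ?thesis using t_unique by (metis (no_types, lifting))
qed

lemma rv_additive: "a \<in> \<Phi> \<Longrightarrow> additive (rv a)"
  and rv_t: "a \<in> \<Phi> \<Longrightarrow> v \<in> CW \<Longrightarrow> rv a (t v s) = int_mult \<lfloor>blinfun_apply a v\<rfloor> s"
  using theI'[OF rv_ex] unfolding root_ext_def by blast+

lemma rv_eqI:
  assumes "a \<in> \<Phi>" "additive f" "\<And>v s. v \<in> CW \<Longrightarrow> f (t v s) = int_mult \<lfloor>blinfun_apply a v\<rfloor> s"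
  shows "rv a y = f y"
  using t_unique[OF rv_additive[OF assms(1)] assms(2)] rv_t[OF assms(1)] assms(3) by metis

lemma rv_add: "a \<in> \<Phi> \<Longrightarrow> rv a (x + y) = rv a x + rv a y"
  using rv_additive by (rule additive.add)

lemma rv_minus: "a \<in> \<Phi> \<Longrightarrow> rv a (- x) = - rv a x"
  using rv_additive by (rule additive.minus)

text \<open>\<open>root_ext\<close> is described separately for each root, so its additivity in the
  root has to be proved by comparing two additive maps on pure tensors.\<close>

lemma rv_comb:
  assumes "D \<subseteq> \<Phi>" "finite D" "(\<Sum>d\<in>D. real (c d) *\<^sub>R d) \<in> \<Phi>"
  shows "rv (\<Sum>d\<in>D. real (c d) *\<^sub>R d) y = (\<Sum>d\<in>D. int_mult (int (c d)) (rv d y))"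
proof (rule rv_eqI[OF assms(3)])
  show "additive (\<lambda>y. \<Sum>d\<in>D. int_mult (int (c d)) (rv d y))"
  proof
    fix x y
    show "(\<Sum>d\<in>D. int_mult (int (c d)) (rv d (x + y)))
        = (\<Sum>d\<in>D. int_mult (int (c d)) (rv d x)) + (\<Sum>d\<in>D. int_mult (int (c d)) (rv d y))"
      unfolding sum.distrib[symmetric] using assms(1) by (intro sum.cong) (auto simp: rv_add int_mult_add_right)
  qed
  fix v and s :: 'r assume v: "v \<in> CW"
  have "blinfun_apply (\<Sum>d\<in>D. real (c d) *\<^sub>R d) v = of_int (\<Sum>d\<in>D. int (c d) * \<lfloor>blinfun_apply d v\<rfloor>)"
    unfolding blinfun.sum_left blinfun.scaleR_left of_int_sum
  proof (rule sum.cong[OF refl])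
    fix d assume "d \<in> D"
    then have "d \<in> \<Phi>" using assms(1) by blast
    then show "real (c d) *\<^sub>R blinfun_apply d v = of_int (int (c d) * \<lfloor>blinfun_apply d v\<rfloor>)"
      by (simp only: of_int_mult of_int_of_nat_eq real_scaleR_def CW_floor[OF v])
  qed
  then have "\<lfloor>blinfun_apply (\<Sum>d\<in>D. real (c d) *\<^sub>R d) v\<rfloor> = (\<Sum>d\<in>D. int (c d) * \<lfloor>blinfun_apply d v\<rfloor>)" by linarith
  then show "(\<Sum>d\<in>D. int_mult (int (c d)) (rv d (t v s))) = int_mult \<lfloor>blinfun_apply (\<Sum>d\<in>D. real (c d) *\<^sub>R d) v\<rfloor> s"
    using assms(1) v by (auto simp: int_mult_sum_left int_mult_mult rv_t intro!: sum.cong)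
qed

lemma rv_comb2:
  assumes "a \<in> \<Phi>" "b \<in> \<Phi>" "real r *\<^sub>R a + real s *\<^sub>R b \<in> \<Phi>"
  shows "rv (real r *\<^sub>R a + real s *\<^sub>R b) y = int_mult (int r) (rv a y) + int_mult (int s) (rv b y)"
proof (rule rv_eqI[OF assms(3)])
  show "additive (\<lambda>y. int_mult (int r) (rv a y) + int_mult (int s) (rv b y))"
    by (simp add: additive_def rv_add assms(1,2) int_mult_add_right)
  fix v and k :: 'r assume v: "v \<in> CW"
  have "blinfun_apply (real r *\<^sub>R a + real s *\<^sub>R b) v = of_int (int r * \<lfloor>blinfun_apply a v\<rfloor> + int s * \<lfloor>blinfun_apply b v\<rfloor>)"
    by (simp only: blinfun.add_left blinfun.scaleR_left of_int_mult of_int_add of_int_of_nat_eq real_scaleR_def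
        CW_floor[OF v] assms(1,2))
  then have "\<lfloor>blinfun_apply (real r *\<^sub>R a + real s *\<^sub>R b) v\<rfloor> = int r * \<lfloor>blinfun_apply a v\<rfloor> + int s * \<lfloor>blinfun_apply b v\<rfloor>"
    by linarith
  then show "int_mult (int r) (rv a (t v k)) + int_mult (int s) (rv b (t v k))
      = int_mult \<lfloor>blinfun_apply (real r *\<^sub>R a + real s *\<^sub>R b) v\<rfloor> k"
    using assms(1,2) v by (simp add: int_mult_add_left int_mult_mult rv_t)
qed

lemma rv_neg: "a \<in> \<Phi> \<Longrightarrow> rv (- a) y = - rv a y"
proof (rule rv_eqI[OF root_neg])
  assume a: "a \<in> \<Phi>"
  show "additive (\<lambda>y. - rv a y)" by (simp add: additive_def rv_add a)
  show "- rv a (t v s) = int_mult \<lfloor>blinfun_apply (- a) v\<rfloor> s" if "v \<in> CW" for v s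
  proof -
    have "blinfun_apply (- a) v = of_int (- \<lfloor>blinfun_apply a v\<rfloor>)"
      by (simp only: blinfun.minus_left of_int_minus CW_floor[OF that a])
    then have "\<lfloor>blinfun_apply (- a) v\<rfloor> = - \<lfloor>blinfun_apply a v\<rfloor>" by linarith
    then show ?thesis using that a by (simp add: rv_t)
  qed
qed

lemma rv_double: "a \<in> \<Phi> \<Longrightarrow> 2 *\<^sub>R a \<in> \<Phi> \<Longrightarrow> rv (2 *\<^sub>R a) y = rv a y + rv a y"
  using rv_comb2[of a a 1 1 y] by (simp add: scaleR_2)

lemma diff_add: "diff z y + diff y x = diff z x"
  using affine unfolding affine_space_def by blast

lemma diff_self [simp]: "diff x x = 0"
  using diff_add[of x x x] by simp

lemma diff_minus: "diff x y = - diff y x"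
  using diff_add[of x y x] by (simp add: eq_neg_iff_add_eq_0)

lemma diff_ex: "\<exists>y. diff y x = v"
  using affine unfolding affine_space_def by blast

lemma diff_inj: "diff y x = diff z x \<Longrightarrow> y = z"
  using affine unfolding affine_space_def by metis

lemma av_diff: "a \<in> \<Phi> \<Longrightarrow> rv a (diff y x) = av a y - av a x"
  unfolding root_at_def diff_add[of y x orig, symmetric] by (simp add: rv_add)

lemma av_neg: "a \<in> \<Phi> \<Longrightarrow> av (- a) y = - av a y"
  by (simp add: root_at_def rv_neg)

lemma pos_rv:
  assumes "pos \<Psi>" shows "pos {a \<in> \<Phi>. 0 < rv a y \<or> rv a y = 0 \<and> a \<in> \<Psi>}"
  by (rule pos_lex[OF assms]) (simp_all add: rv_neg rv_double rv_comb)

section \<open>The action of N on the apartment\<close>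

lemma \<nu>_bij: "n \<in> NN \<Longrightarrow> bij (\<nu> n)"
  using action by (auto simp: hom_def Aff_group_def)

lemma \<nu>_mult: "n \<in> NN \<Longrightarrow> n' \<in> NN \<Longrightarrow> \<nu> (n \<otimes> n') = \<nu> n \<circ> \<nu> n'"
proof -
  assume n: "n \<in> NN" "n' \<in> NN"
  have "\<nu> (n \<otimes> n') = \<nu> n \<otimes>\<^bsub>BijGroup UNIV\<^esub> \<nu> n'"
    using action n by (auto simp: hom_def Aff_group_def N_group_def)
  also have "\<dots> = \<nu> n \<circ> \<nu> n'"
    using \<nu>_bij[OF n(1)] \<nu>_bij[OF n(2)] by (auto simp: BijGroup_def Bij_def compose_def)
  finally show ?thesis .
qed

lemma NN_one: "\<one> \<in> NN"
  using NN_subgroup by (rule subgroup.one_closed)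

lemma NN_inv: "n \<in> NN \<Longrightarrow> inv n \<in> NN"
  using NN_subgroup by (rule subgroup.m_inv_closed)

lemma NN_mult: "n \<in> NN \<Longrightarrow> n' \<in> NN \<Longrightarrow> n \<otimes> n' \<in> NN"
  using NN_subgroup by (rule subgroup.m_closed)

lemma \<nu>_one: "\<nu> \<one> = id"
proof -
  have "\<nu> \<one> (\<nu> \<one> x) = \<nu> \<one> x" for x using \<nu>_mult[OF NN_one NN_one] by (metis comp_apply one_closed r_one)
  then show ?thesis using bij_is_inj[OF \<nu>_bij[OF NN_one]] by (metis eq_id_iff injD)
qed

lemma \<nu>_inv: "n \<in> NN \<Longrightarrow> \<nu> (inv n) (\<nu> n x) = x" "n \<in> NN \<Longrightarrow> \<nu> n (\<nu> (inv n) x) = x"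
proof -
  assume n: "n \<in> NN"
  have "\<nu> (inv n) \<circ> \<nu> n = id" "\<nu> n \<circ> \<nu> (inv n) = id"
    using \<nu>_mult[OF NN_inv[OF n] n] \<nu>_mult[OF n NN_inv[OF n]] NN_carrier[OF n] \<nu>_one by simp_all
  then show "\<nu> (inv n) (\<nu> n x) = x" "\<nu> n (\<nu> (inv n) x) = x" by (metis comp_apply id_apply)+
qed

lemma dual_action_CW:
  assumes "w \<in> carrier (weyl_group \<Phi> cr)" "v \<in> CW"
  shows "dual_action w v \<in> CW"
  unfolding coweight_lattice_def
proof (intro CollectI ballI)
  fix g assume "g \<in> \<Phi>"
  then obtain b where b: "b \<in> \<Phi>" "g = w b" using weyl_props(2)[OF assms(1)] by blast
  then show "blinfun_apply g (dual_action w v) \<in> \<int>"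
    using dual_action_pairing[OF assms(1)] assms(2) by (simp add: coweight_lattice_def)
qed

lemma rv_vn:
  assumes n: "n \<in> NN" and b: "b \<in> \<Phi>"
  shows "rv (vn n b) (diff (\<nu> n y) (\<nu> n z)) = rv b (diff y z)"
proof -
  obtain L where L: "additive L" "\<And>v a. v \<in> CW \<Longrightarrow> L (t v a) = t (dual_action (vn n) v) a"
    "\<And>x y. diff (\<nu> n x) (\<nu> n y) = L (diff x y)"
    using CA1[OF n] unfolding has_linear_part_def by blast
  note W = vnu_weyl[OF n]
  have "rv b (diff y z) = rv (vn n b) (L (diff y z))"
    by (rule rv_eqI[OF b, where f = "\<lambda>y. rv (vn n b) (L y)"])
      (simp_all add: additive_compose[OF rv_additive[OF vnu_root[OF n b]] L(1)] L(2) rv_t vnu_root[OF n b]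
        dual_action_CW[OF W] dual_action_pairing[OF W])
  then show ?thesis by (simp add: L(3))
qed

lemma double_inj: "(r :: 'r) + r = s + s \<Longrightarrow> r = s"
  by (metis add_less_le_mono linorder_less_linear order_less_imp_le order_less_irrefl)

text \<open>As \<open>R\<close> is divisible, \<open>x \<mapsto> x / 2\<close> is defined on \<open>V\<^sub>R\<close>.\<close>

lemma V_torsion_free:
  assumes "(y :: 'y) + y = 0" shows "y = 0"
proof -
  have "\<exists>s. s + s = r" for r :: 'r using divisible[of 2 r] by (auto simp: int_mult_2)
  then obtain h where h: "\<And>r :: 'r. h r + h r = r" by metis
  have h_add: "h (r + s) = h r + h s" for r s
    by (rule double_inj) (metis (no_types, opaque_lifting) h add.assoc add.commute)
  obtain f where f: "additive f" "\<And>v a. v \<in> CW \<Longrightarrow> f (t v a) = t v (h a)"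
    using t_universal[of "\<lambda>v a. t v (h a)"] by (auto simp: t_add h_add)
  interpret f: additive f by (rule f(1))
  have "(\<lambda>y. f y + f y) = (\<lambda>y. y)"
  proof (rule t_unique)
    show "additive (\<lambda>y. f y + f y)" by (simp add: additive_def f.add algebra_simps)
    show "additive (\<lambda>y :: 'y. y)" by (simp add: additive_def)
    show "f (t v a) + f (t v a) = t v a" if "v \<in> CW" for v a
      unfolding f(2)[OF that] t_add(2)[OF that, of "h a" "h a", symmetric] h ..
  qed
  then have "y = f y + f y" by metis
  also have "\<dots> = f (y + y)" by (simp add: f.add)
  finally show ?thesis by (simp add: assms f.zero)
qed

lemma dual_action_reflection:
  assumes a: "a \<in> \<Phi>"
  shows "dual_action (reflection cr a) v = v - blinfun_apply a v *\<^sub>R cr a"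
proof -
  note W = weyl_closed(3)[OF a]
  have "blinfun_apply \<gamma> (dual_action (reflection cr a) v) = blinfun_apply \<gamma> (v - blinfun_apply a v *\<^sub>R cr a)"
    for \<gamma> :: "'v dual"
  proof -
    have "blinfun_apply \<gamma> (dual_action (reflection cr a) v) = blinfun_apply (reflection cr a \<gamma>) v"
      using dual_action_pairing[OF W, of "reflection cr a \<gamma>" v] a by simp
    then show ?thesis
      by (simp add: reflection_def blinfun.diff_left blinfun.diff_right blinfun.scaleR_left blinfun.scaleR_right)
  qed
  from this[of "blinfun_inner_left _"] show ?thesis by (auto intro: euclidean_eqI)
qed

text \<open>At the origin, CA3 makes d = \<nu>(m)(o) - o an eigenvector of the linear reflection for
  the value -1; hence 2d = -2 \<open>t (cr a) r\<close>, and V_R has no 2-torsion. The linear part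
  then handles every p. So m acts as the reflection in the wall where a(p) = -r.\<close>

lemma \<nu>_reflection:
  assumes a: "a \<in> \<Phi>" and m: "m \<in> M a"
    and r: "r + r + rv a (diff (\<nu> m orig) orig) = 0"
  shows "diff (\<nu> m p) p = - t (cr a) (r + av a p)"
proof -
  have mN: "m \<in> NN" using M_NN[OF a m] .
  have crC: "cr a \<in> CW" using a by (rule CW_cr)
  interpret tc: additive "t (cr a)" using crC by (rule t_additive)
  obtain L where L: "additive L" "\<And>v s. v \<in> CW \<Longrightarrow> L (t v s) = t (dual_action (vn m) v) s"
    "\<And>x y. diff (\<nu> m x) (\<nu> m y) = L (diff x y)"
    using CA1[OF mN] unfolding has_linear_part_def by blast
  have L': "L y = y - t (cr a) (rv a y)" for y
  proof -
    have "L = (\<lambda>y. y - t (cr a) (rv a y))"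
    proof (rule t_unique[OF L(1)])
      show "additive (\<lambda>y. y - t (cr a) (rv a y))"
        by (simp add: additive_def rv_add a tc.add algebra_simps)
      fix v s assume v: "v \<in> CW"
      let ?k = "\<lfloor>blinfun_apply a v\<rfloor>"
      have "L (t v s) = t (v + of_int (- ?k) *\<^sub>R cr a) s"
        unfolding L(2)[OF v] vnu_M[OF a m] dual_action_reflection[OF a] of_int_minus CW_floor[OF v a] by simp
      also have "\<dots> = t v s - int_mult ?k (t (cr a) s)"
        unfolding t_add(1)[OF v CW_int[OF crC]] t_int_left[OF crC] by simp
      finally show "L (t v s) = t v s - t (cr a) (rv a (t v s))"
        using v by (simp add: rv_t a additive_int_mult[OF tc.additive_axioms])
    qed
    then show ?thesis by metis
  qed
  define d where "d = diff (\<nu> m orig) orig"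
  have "\<nu> m (\<nu> m orig) = orig" using CA3[OF a m] by (metis comp_apply id_apply)
  then have "- d = L d" using L(3)[of "\<nu> m orig" orig] diff_minus[of orig "\<nu> m orig"] by (simp add: d_def)
  then have "d + d = t (cr a) (rv a d)" by (simp add: L' algebra_simps)
  also have "rv a d = - (r + r)" using minus_unique[OF r] by (simp add: d_def)
  finally have dd: "d + d = - (t (cr a) r + t (cr a) r)" by (simp only: tc.minus tc.add)
  have "(d + t (cr a) r) + (d + t (cr a) r) = (d + d) + (t (cr a) r + t (cr a) r)" by (simp only: ac_simps)
  also have "\<dots> = 0" unfolding dd by (rule left_minus)
  finally have "(d + t (cr a) r) + (d + t (cr a) r) = 0" .
  then have d: "d = - t (cr a) r" using V_torsion_free by (metis eq_neg_iff_add_eq_0)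
  have "diff (\<nu> m p) p = diff (\<nu> m p) (\<nu> m orig) + (diff (\<nu> m orig) orig + diff orig p)"
    by (simp add: diff_add)
  also have "\<dots> = L (diff p orig) + d - diff p orig" using L(3) diff_minus[of orig p] by (simp add: d_def)
  also have "\<dots> = - t (cr a) (r + av a p)"
    unfolding L' d tc.add root_at_def by (simp add: algebra_simps)
  finally show ?thesis .
qed

lemma T_b_eq: "T_b G \<Phi> M \<nu> = {n \<in> NN. \<nu> n = id}"
  by (simp add: T_b_def)

end

section \<open>Valuations\<close>

context bruhat_setting
begin

text \<open>The identity, whose value is infinite, gets the dummy value 0; statements about
  \<open>fv\<close> therefore treat u = 1 separately.\<close>

definition fv :: "'v dual \<Rightarrow> 'g \<Rightarrow> 'r" where
  "fv a u = (case \<phi> a u of Fin r \<Rightarrow> r | _ \<Rightarrow> 0)"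

lemma \<phi>_one: "a \<in> \<Phi> \<Longrightarrow> \<phi> a \<one> = Pinf"
  using V1(2)[of a] by (auto simp: U_level_def)

lemma \<phi>_fv:
  assumes "a \<in> \<Phi>" "u \<in> U a" "u \<noteq> \<one>" shows "\<phi> a u = Fin (fv a u)"
proof -
  have "\<phi> a u \<noteq> Pinf" using V1(2)[OF assms(1)] assms(2,3) by (auto simp: U_level_def)
  then show ?thesis using not_Minf[OF assms(1,2)] by (cases "\<phi> a u") (auto simp: fv_def)
qed

lemma U_level_iff:
  assumes "a \<in> \<Phi>" "u \<in> U a"
  shows "u \<in> U_level U \<phi> a (Fin r) \<longleftrightarrow> u = \<one> \<or> r \<le> fv a u"
  using \<phi>_fv[OF assms] \<phi>_one[OF assms(1)] assms(2) by (cases "u = \<one>") (auto simp: U_level_def)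

lemma U_level_subgroup: "a \<in> \<Phi> \<Longrightarrow> subgroup (U_level U \<phi> a (Fin r)) G"
  by (rule V1(1)) auto

lemma U_level_subset: "U_level U \<phi> a l \<subseteq> U a"
  by (auto simp: U_level_def)

lemma fv_mult:
  assumes "a \<in> \<Phi>" "u \<in> U a" "v \<in> U a" "u = \<one> \<or> r \<le> fv a u" "v = \<one> \<or> r \<le> fv a v"
  shows "u \<otimes> v = \<one> \<or> r \<le> fv a (u \<otimes> v)"
proof -
  have "u \<otimes> v \<in> U_level U \<phi> a (Fin r)"
    using assms U_level_iff[OF assms(1)] by (intro subgroup.m_closed[OF U_level_subgroup]) auto
  moreover have "u \<otimes> v \<in> U a" using subgroup.m_closed[OF RGD1(2)] assms by blast
  ultimately show ?thesis using U_level_iff[OF assms(1)] by blast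
qed

lemma fv_inv_le:
  assumes "a \<in> \<Phi>" "u \<in> U a" "u \<noteq> \<one>"
  shows "fv a u \<le> fv a (inv u)" "inv u \<in> U a" "inv u \<noteq> \<one>"
proof -
  show i: "inv u \<in> U a" using subgroup.m_inv_closed[OF RGD1(2)] assms by blast
  show n: "inv u \<noteq> \<one>" using U_carrier[OF assms(1,2)] assms(3) by (metis inv_inv inv_one)
  have "inv u \<in> U_level U \<phi> a (Fin (fv a u))"
    using assms U_level_iff[OF assms(1)] by (intro subgroup.m_inv_closed[OF U_level_subgroup]) auto
  then show "fv a u \<le> fv a (inv u)" using U_level_iff[OF assms(1) i] n by blast
qed

lemma fv_inv:
  assumes "a \<in> \<Phi>" "u \<in> U a" "u \<noteq> \<one>"
  shows "fv a (inv u) = fv a u"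
  using fv_inv_le[OF assms] fv_inv_le(1)[OF assms(1) fv_inv_le(2,3)[OF assms]] U_carrier[OF assms(1,2)] by simp

text \<open>The ultrametric rule: if the product had a larger value than v, then v = u^-1 (u v)
  would have a value above its own.\<close>

lemma fv_mult_eq:
  assumes "a \<in> \<Phi>" "u \<in> U a" "v \<in> U a" "v \<noteq> \<one>" "u = \<one> \<or> fv a v < fv a u"
  shows "u \<otimes> v \<noteq> \<one>" "fv a (u \<otimes> v) = fv a v"
proof -
  have c: "u \<in> carrier G" "v \<in> carrier G" using U_carrier[OF assms(1)] assms(2,3) by blast+
  have uv: "u \<otimes> v \<in> U a" using subgroup.m_closed[OF RGD1(2)[OF assms(1)] assms(2,3)] .
  have iu: "inv u = \<one> \<or> fv a v < fv a (inv u)"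
    using assms(5) fv_inv[OF assms(1,2)] by (cases "u = \<one>") auto
  show n: "u \<otimes> v \<noteq> \<one>"
  proof
    assume "u \<otimes> v = \<one>"
    then have "inv u = v" using c by (metis inv_equality inv_inv inv_closed)
    then show False using iu assms(4) by auto
  qed
  have ge: "fv a v \<le> fv a (u \<otimes> v)" using fv_mult[OF assms(1-3), of "fv a v"] assms(5) n by (auto simp: less_imp_le)
  show "fv a (u \<otimes> v) = fv a v"
  proof (rule ccontr)
    assume "fv a (u \<otimes> v) \<noteq> fv a v"
    then have gt: "fv a v < fv a (u \<otimes> v)" using ge by simp
    have iuU: "inv u \<in> U a" using subgroup.m_inv_closed[OF RGD1(2)[OF assms(1)] assms(2)] .
    obtain r where r: "fv a v < r" "inv u = \<one> \<or> r \<le> fv a (inv u)" "r \<le> fv a (u \<otimes> v)"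
    proof (cases "inv u = \<one>")
      case True
      then show ?thesis using that[of "fv a (u \<otimes> v)"] gt by simp
    next
      case False
      then show ?thesis using that[of "min (fv a (inv u)) (fv a (u \<otimes> v))"] gt iu by simp
    qed
    have "inv u \<otimes> (u \<otimes> v) = v" using c by simp
    then show False using fv_mult[OF assms(1) iuU uv r(2)] r(1,3) assms(4) by auto
  qed
qed

lemma V5_fv:
  assumes a: "a \<in> \<Phi>" and u: "u \<in> U a" "u \<noteq> \<one>" and x: "x \<in> U (- a)" "y \<in> U (- a)"
    and m: "x \<otimes> u \<otimes> y \<in> M a"
  shows "x \<noteq> \<one>" "fv (- a) x = - fv a u"
proof -
  have eq: "\<phi> (- a) x = - Fin (fv a u)" using V5[OF a u(1) x m] \<phi>_fv[OF a u] by simp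
  then show n: "x \<noteq> \<one>" using \<phi>_one[OF root_neg[OF a]] by auto
  show "fv (- a) x = - fv a u" using eq \<phi>_fv[OF root_neg[OF a] x(1) n] by simp
qed

lemma CA2_fv:
  assumes a: "a \<in> \<Phi>" and u: "u \<in> U a" "u \<noteq> \<one>"
  shows "fv a u + fv a u + rv a (diff (\<nu> (m_elt G U M a u) orig) orig) = 0"
  using CA2[OF a, of u] u \<phi>_fv[OF a u] by (simp add: zero_extended_def)

lemma m_elt_M: "a \<in> \<Phi> \<Longrightarrow> u \<in> U a \<Longrightarrow> u \<noteq> \<one> \<Longrightarrow> m_elt G U M a u \<in> M a"
  using m_elt_factor by blast

text \<open>The wall fixed by m(u) is where \<open>av a\<close> equals \<open>- fv a u\<close>.
  Values of group elements can thus be read off from reflections of the apartment.\<close>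

lemma \<nu>_m_elt:
  assumes a: "a \<in> \<Phi>" and u: "u \<in> U a" "u \<noteq> \<one>"
  shows "diff (\<nu> (m_elt G U M a u) p) p = - t (cr a) (fv a u + av a p)"
  using \<nu>_reflection[OF a m_elt_M[OF a u] CA2_fv[OF a u]] .

lemma t_zero [simp]: "v \<in> CW \<Longrightarrow> t v 0 = 0"
  using t_additive by (rule additive.zero)

lemma \<nu>_m_elt_fixes:
  assumes a: "a \<in> \<Phi>" and u: "u \<in> U a" "u \<noteq> \<one>" and "fv a u = - av a p"
  shows "\<nu> (m_elt G U M a u) p = p"
  using \<nu>_m_elt[OF a u, of p] assms(4) CW_cr[OF a] diff_inj[of _ p p] by simp

lemma rv_m_elt:
  assumes a: "a \<in> \<Phi>" and u: "u \<in> U a" "u \<noteq> \<one>"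
  shows "rv a (diff (\<nu> (m_elt G U M a u) p) p) = - ((fv a u + av a p) + (fv a u + av a p))"
proof -
  have "\<lfloor>blinfun_apply a (cr a)\<rfloor> = 2" using coroot_pairing[OF a] by simp
  then show ?thesis
    unfolding \<nu>_m_elt[OF a u] by (simp only: rv_minus[OF a] rv_t[OF a CW_cr[OF a]] int_mult_2)
qed

text \<open>The value of u is recovered, up to halving, from the displacement of points by m(u), and
  m(n u n^-1) = n m(u) n^-1 acts as the transported reflection.\<close>

lemma fv_equivariant:
  assumes n: "n \<in> NN" and b: "b \<in> \<Phi>" and u: "u \<in> U b" "u \<noteq> \<one>"
  shows "fv (vn n b) (cj n u) + av (vn n b) (\<nu> n y) = fv b u + av b y"
proof -
  let ?m = "m_elt G U M b u"
  have wb: "vn n b \<in> \<Phi>" using vnu_root[OF n b] .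
  have cu: "cj n u \<in> U (vn n b)" "cj n u \<noteq> \<one>"
    using vnu_cj[OF n b] u cj_eq_one_iff[OF NN_carrier[OF n] U_carrier[OF b u(1)]] by blast+
  have m: "?m \<in> NN" using M_NN[OF b m_elt_M[OF b u]] .
  have E: "cj n ?m \<otimes> n = n \<otimes> ?m" using NN_carrier[OF n] NN_carrier[OF m] by (simp add: cj_def m_assoc)
  have cm: "cj n ?m \<in> NN" using cj_subgroup[OF NN_subgroup n m] .
  have "\<nu> (cj n ?m) (\<nu> n y) = \<nu> n (\<nu> ?m y)"
    using arg_cong[OF E, of \<nu>] \<nu>_mult[OF cm n] \<nu>_mult[OF n m] by (metis comp_apply)
  then have "rv (vn n b) (diff (\<nu> (cj n ?m) (\<nu> n y)) (\<nu> n y)) = rv b (diff (\<nu> ?m y) y)"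
    using rv_vn[OF n b] by simp
  then have "(fv (vn n b) (cj n u) + av (vn n b) (\<nu> n y)) + (fv (vn n b) (cj n u) + av (vn n b) (\<nu> n y))
      = (fv b u + av b y) + (fv b u + av b y)"
    using rv_m_elt[OF wb cu, of "\<nu> n y"] rv_m_elt[OF b u, of y] m_elt_cj[OF n b u] by (metis neg_equal_iff_equal)
  then show ?thesis by (rule double_inj)
qed

section \<open>The kernel of the action on the apartment\<close>

definition Tb :: "'g set" where
  "Tb = T_b G \<Phi> M \<nu>"

lemma Tb_iff: "h \<in> Tb \<longleftrightarrow> h \<in> NN \<and> \<nu> h = id"
  by (simp add: Tb_def T_b_eq)

lemma Tb_NN: "h \<in> Tb \<Longrightarrow> h \<in> NN"
  by (simp add: Tb_iff)

lemma Tb_carrier: "h \<in> Tb \<Longrightarrow> h \<in> carrier G"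
  using Tb_NN NN_carrier by blast

lemma Tb_subgroup: "subgroup Tb G"
proof (rule subgroupI)
  show "Tb \<subseteq> carrier G" using Tb_carrier by blast
  show "Tb \<noteq> {}" using NN_one \<nu>_one Tb_iff by blast
  show "inv h \<in> Tb" if "h \<in> Tb" for h
    using that NN_inv[of h] \<nu>_inv[of h] by (auto simp: Tb_iff)
  show "h \<otimes> k \<in> Tb" if "h \<in> Tb" "k \<in> Tb" for h k
    using that NN_mult \<nu>_mult by (auto simp: Tb_iff)
qed

lemma Tb_normal:
  assumes "n \<in> NN" "h \<in> Tb" shows "cj n h \<in> Tb"
proof -
  have h: "h \<in> NN" "\<nu> h = id" using assms(2) by (auto simp: Tb_iff)
  have "\<nu> (cj n h) = (\<nu> n \<circ> \<nu> h) \<circ> \<nu> (inv n)"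
    unfolding cj_def using \<nu>_mult[OF assms(1) h(1)] \<nu>_mult[OF NN_mult[OF assms(1) h(1)] NN_inv[OF assms(1)]] by simp
  also have "\<dots> = id" using \<nu>_inv(2)[OF assms(1)] h(2) by auto
  finally show ?thesis using cj_subgroup[OF NN_subgroup assms(1) h(1)] by (simp add: Tb_iff)
qed

text \<open>A nonzero s in the torsion-free group \<open>R\<close> recovers the integer coordinates
  of a root from its values on fundamental coweights tensored with s.\<close>

lemma rv_separates:
  assumes "a \<in> \<Phi>" "b \<in> \<Phi>" "\<And>y. rv a y = rv b y"
  shows "a = b"
proof -
  obtain \<Delta> where D: "root_base \<Phi> \<Delta>" using ex_pos by (auto simp: pos_def)
  obtain s :: 'r where s: "s \<noteq> 0" using nonzero by blast
  have "blinfun_apply a (cow \<Delta> \<delta>) = blinfun_apply b (cow \<Delta> \<delta>)" if d: "\<delta> \<in> \<Delta>" for \<delta>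
  proof -
    have c: "cow \<Delta> \<delta> \<in> CW" using base_cow_coweight[OF D d] .
    have "int_mult \<lfloor>blinfun_apply a (cow \<Delta> \<delta>)\<rfloor> s = int_mult \<lfloor>blinfun_apply b (cow \<Delta> \<delta>)\<rfloor> s"
      using assms(3)[of "t (cow \<Delta> \<delta>) s"] c by (simp add: rv_t assms(1,2))
    then have "\<lfloor>blinfun_apply a (cow \<Delta> \<delta>)\<rfloor> = \<lfloor>blinfun_apply b (cow \<Delta> \<delta>)\<rfloor>" by (rule int_mult_inj[OF s])
    then show ?thesis using CW_floor[OF c assms(1)] CW_floor[OF c assms(2)] by metis
  qed
  then have "(\<Sum>\<delta>\<in>\<Delta>. blinfun_apply a (cow \<Delta> \<delta>) *\<^sub>R \<delta>) = (\<Sum>\<delta>\<in>\<Delta>. blinfun_apply b (cow \<Delta> \<delta>) *\<^sub>R \<delta>)" by simp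
  then show ?thesis using base_rep[OF D assms(1)] base_rep[OF D assms(2)] by metis
qed

lemma vn_Tb:
  assumes "h \<in> Tb" "b \<in> \<Phi>" shows "vn h b = b"
proof (rule rv_separates[OF vnu_root[OF Tb_NN[OF assms(1)] assms(2)] assms(2)])
  fix y
  obtain z where "diff z orig = y" using diff_ex by blast
  then show "rv (vn h b) y = rv b y"
    using rv_vn[OF Tb_NN[OF assms(1)] assms(2), of z orig] assms(1) by (simp add: Tb_iff)
qed

lemma Tb_cj:
  assumes "h \<in> Tb" "b \<in> \<Phi>" "u \<in> U b"
  shows "cj h u \<in> U b" "u \<noteq> \<one> \<Longrightarrow> cj h u \<noteq> \<one>" "u \<noteq> \<one> \<Longrightarrow> fv b (cj h u) = fv b u"
proof -
  show "cj h u \<in> U b" using vnu_cj[OF Tb_NN[OF assms(1)] assms(2)] vn_Tb[OF assms(1,2)] assms(3) by auto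
  show "cj h u \<noteq> \<one>" if "u \<noteq> \<one>" using that cj_eq_one_iff[OF Tb_carrier[OF assms(1)] U_carrier[OF assms(2,3)]] by simp
  show "fv b (cj h u) = fv b u" if "u \<noteq> \<one>"
    using fv_equivariant[OF Tb_NN[OF assms(1)] assms(2,3) that, of orig] vn_Tb[OF assms(1,2)] assms(1) by (simp add: Tb_iff)
qed

text \<open>The rank one computation: with \<open>v = x m y\<close> and \<open>u x = v1 m' v2\<close>, both \<open>m\<close> and \<open>m'\<close> act as the
  reflection in the same wall, because \<open>u\<close> is too small to change the valuation of \<open>x\<close>.\<close>

lemma rank_one_half:
  assumes a: "a \<in> \<Phi>" and u: "u \<in> U a" "u \<noteq> \<one>" and v: "v \<in> U (- a)" "v \<noteq> \<one>"
    and pos: "- fv (- a) v < fv a u"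
  shows "\<exists>v1 h y. v1 \<in> U (- a) \<and> v1 \<noteq> \<one> \<and> fv (- a) v1 = fv (- a) v \<and> h \<in> Tb \<and> h \<in> T \<and> y \<in> U a \<and>
    u \<otimes> v = v1 \<otimes> h \<otimes> y"
proof -
  have na: "- a \<in> \<Phi>" using a by (rule root_neg)
  obtain x m y where xy: "x \<in> U a" "m \<in> M a" "y \<in> U a" "v = x \<otimes> m \<otimes> y" using RGD4_factor[OF a v] .
  note d = RGD4_factor_dual[OF a v(1) xy]
  have c: "x \<in> carrier G" "m \<in> carrier G" "y \<in> carrier G" "u \<in> carrier G" "v \<in> carrier G"
    using xy u(1) v(1) U_carrier[OF a] U_carrier[OF na] M_carrier[OF a] by blast+
  note ia = subgroup.m_inv_closed[OF RGD1(2)[OF a]] and ina = subgroup.m_inv_closed[OF RGD1(2)[OF na]]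
  have im: "inv m \<in> M a" using M_inv[OF a xy(2)] .
  have mx: "inv v \<otimes> x \<otimes> inv (cj m (inv y)) = inv m"
    using c by (simp add: xy(4) cj_def m_assoc inv_mult_group)
  have m_x: "m_elt G U M a x = inv m"
    using m_elt_equality[OF a ina[OF v(1)] ina[OF d(2)] xy(1)] im unfolding mx by blast
  have fx: "fv (- a) v = - fv a x"
    using V5_fv(2)[OF a xy(1) d(1) ina[OF v(1)] ina[OF d(2)]] im fv_inv[OF na v] unfolding mx by simp
  have ux: "u \<otimes> x \<in> U a" using subgroup.m_closed[OF RGD1(2)[OF a] u(1) xy(1)] .
  have "fv a x < fv a u" using pos fx by simp
  then have ux1: "u \<otimes> x \<noteq> \<one>" "fv a (u \<otimes> x) = fv a x" using fv_mult_eq[OF a u(1) xy(1) d(1)] by blast+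
  let ?m = "m_elt G U M a (u \<otimes> x)"
  obtain v1 v2 where v12: "v1 \<in> U (- a)" "v2 \<in> U (- a)" "?m \<in> M a" "u \<otimes> x = v1 \<otimes> ?m \<otimes> v2"
    using m_elt_factor[OF a ux ux1(1)] .
  have c': "v1 \<in> carrier G" "v2 \<in> carrier G" "?m \<in> carrier G"
    using v12 U_carrier[OF na] M_carrier[OF a] by blast+
  have "inv v1 \<otimes> (v1 \<otimes> ?m \<otimes> v2) \<otimes> inv v2 = ?m" using c' by (simp add: m_assoc)
  then have e: "inv v1 \<otimes> (u \<otimes> x) \<otimes> inv v2 = ?m" using v12(4) by metis
  have f1: "inv v1 \<noteq> \<one>" "fv (- a) (inv v1) = fv (- a) v"
    using V5_fv[OF a ux ux1(1) ina[OF v12(1)] ina[OF v12(2)]] v12(3) ux1(2) fx unfolding e by simp_all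
  have v1: "v1 \<noteq> \<one>" "fv (- a) v1 = fv (- a) v"
    using f1 fv_inv[OF na ina[OF v12(1)] f1(1)] c' by auto
  have hT: "?m \<otimes> m \<in> T" using M_quotient[OF a im v12(3)] c by simp
  have nu_eq: "\<nu> ?m p = \<nu> (inv m) p" for p
    using \<nu>_m_elt[OF a ux ux1(1), of p] \<nu>_m_elt[OF a xy(1) d(1), of p] ux1(2) m_x by (intro diff_inj[of _ p]) simp
  have mN: "?m \<in> NN" "m \<in> NN" using M_NN[OF a] v12(3) xy(2) by blast+
  have "\<nu> (?m \<otimes> m) = id" using \<nu>_mult[OF mN] nu_eq \<nu>_inv(1)[OF mN(2)] by (auto simp: fun_eq_iff)
  then have hTb: "?m \<otimes> m \<in> Tb" using NN_mult[OF mN] by (simp add: Tb_iff)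
  have v2': "cj (inv m) v2 \<in> U a" using M_cj_self(2)[OF a im] v12(2) by blast
  have "u \<otimes> v = (u \<otimes> x) \<otimes> m \<otimes> y" using c by (simp add: xy(4) m_assoc)
  also have "\<dots> = v1 \<otimes> (?m \<otimes> m) \<otimes> (cj (inv m) v2 \<otimes> y)"
    by (subst v12(4)) (use c c' in \<open>simp add: cj_def m_assoc\<close>)
  finally show ?thesis using v12(1) v1 hTb hT subgroup.m_closed[OF RGD1(2)[OF a] v2' xy(3)] by blast
qed

text \<open>\<open>rank_one_half\<close> controls the value of the left factor only. Applied to v^-1
  u^-1 with the roots exchanged, it controls the right factor of a second factorization of u v. Both
  have the shape U_-a T U_a, so RGD6 identifies their left factors; this is why the half version
  also records that h lies in \<open>T\<close>.\<close>

lemma rank_one_swap: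
  assumes a: "a \<in> \<Phi>" and u: "u \<in> U a" "u \<noteq> \<one>" and v: "v \<in> U (- a)" "v \<noteq> \<one>"
    and ps: "- fv (- a) v < fv a u"
  shows "\<exists>v1 h u1. v1 \<in> U (- a) \<and> v1 \<noteq> \<one> \<and> fv (- a) v1 = fv (- a) v \<and> h \<in> Tb \<and>
    u1 \<in> U a \<and> u1 \<noteq> \<one> \<and> fv a u1 = fv a u \<and> u \<otimes> v = v1 \<otimes> h \<otimes> u1"
proof -
  note R = root_subfamily_U
  have na: "- a \<in> \<Phi>" using a by (rule root_neg)
  obtain v1 h y where 1: "v1 \<in> U (- a)" "v1 \<noteq> \<one>" "fv (- a) v1 = fv (- a) v" "h \<in> Tb" "h \<in> T" "y \<in> U a"
    "u \<otimes> v = v1 \<otimes> h \<otimes> y" using rank_one_half[OF assms] by blast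
  have "- fv a u < fv (- a) v" using ps by (simp add: minus_less_iff)
  then have "- fv (- (- a)) (inv u) < fv (- a) (inv v)" using fv_inv[OF a u] fv_inv[OF na v] by simp
  moreover have "inv u \<in> U (- (- a))" using fv_inv_le(2)[OF a u] by simp
  ultimately obtain u2 h2 w where 2: "u2 \<in> U a" "u2 \<noteq> \<one>" "fv a u2 = fv a u" "h2 \<in> Tb" "h2 \<in> T" "w \<in> U (- a)"
    "inv v \<otimes> inv u = u2 \<otimes> h2 \<otimes> w"
    using rank_one_half[OF na fv_inv_le(2,3)[OF na v], of "inv u"] fv_inv_le(3)[OF a u] fv_inv[OF a u] by auto
  have c: "u \<in> carrier G" "v \<in> carrier G" "v1 \<in> carrier G" "y \<in> carrier G" "u2 \<in> carrier G" "w \<in> carrier G"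
      "h \<in> carrier G" "h2 \<in> carrier G"
    using U_carrier[OF a] U_carrier[OF na] u v 1 2 Tb_carrier by blast+
  have "u \<otimes> v = inv (inv v \<otimes> inv u)" using c by (simp add: inv_mult_group)
  also have "\<dots> = inv w \<otimes> inv h2 \<otimes> inv u2"
    unfolding 2(7) using c by (simp add: inv_mult_group m_assoc)
  finally have e: "v1 \<otimes> h \<otimes> y = inv w \<otimes> inv h2 \<otimes> inv u2" using 1(7) by simp
  define k where "k = inv h2 \<otimes> inv h"
  define z where "z = cj h (inv u2 \<otimes> inv y)"
  have kT: "k \<in> T" unfolding k_def
    using T_subgroup 1(5) 2(5) by (simp add: subgroup.m_closed subgroup.m_inv_closed)
  have "inv u2 \<otimes> inv y \<in> U a"
    using RGD1(2)[OF a] 1(6) 2(1) by (simp add: subgroup.m_closed subgroup.m_inv_closed)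
  then have zU: "z \<in> U a" unfolding z_def using Tb_cj(1)[OF 1(4) a] by blast
  have kz: "k \<otimes> z = w \<otimes> v1"
  proof -
    have "k \<otimes> z = w \<otimes> (inv w \<otimes> inv h2 \<otimes> inv u2) \<otimes> inv y \<otimes> inv h"
      unfolding k_def z_def cj_def using c by (simp add: m_assoc)
    also have "\<dots> = w \<otimes> v1" unfolding e[symmetric] using c by (simp add: m_assoc)
    finally show ?thesis .
  qed
  obtain \<Xi> where X: "pos \<Xi>" "a \<in> \<Xi>" using ex_pos pos_compl a by blast
  then have "- a \<in> \<Phi> - \<Xi>" using pos_neg_iff[OF X(1) a] na by blast
  then have "w \<otimes> v1 \<in> Ugrp U (\<Phi> - \<Xi>)"
    using Ugrp_incl[OF R] subgroup.m_closed[OF RGD1(2)[OF na] 2(6) 1(1)] by blast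
  then have "k \<otimes> z = \<one>" using U_trivial_T[OF X(1) kT Ugrp_incl[OF R X(2) zU]] kz by simp
  then have "w \<otimes> v1 = \<one>" using kz by simp
  then have w: "inv w = v1" using c by (metis inv_equality inv_inv inv_closed)
  have fin: "u \<otimes> v = v1 \<otimes> inv h2 \<otimes> inv u2" using 1(7) e w by simp
  have "inv u2 \<in> U a" "inv u2 \<noteq> \<one>" "fv a (inv u2) = fv a u"
    using fv_inv_le(2,3)[OF a 2(1,2)] fv_inv[OF a 2(1,2)] 2(3) by simp_all
  then show ?thesis using fin 1(1-3) subgroup.m_inv_closed[OF Tb_subgroup 2(4)] by blast
qed

end

section \<open>The groups attached to germs of chambers\<close>

context bruhat_setting
begin

text \<open>With \<open>S = \<Phi>\<close> this is the fixer in \<^term>\<open>U a\<close> of the point \<open>x\<close>, with \<open>S\<close> a positive system it is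
  the fixer of the germ at \<open>x\<close> of the corresponding chamber.\<close>

definition lev :: "'p \<Rightarrow> 'v dual set \<Rightarrow> 'v dual \<Rightarrow> 'g set" where
  "lev x S a = {u \<in> U a. u = \<one> \<or> - av a x < fv a u \<or> - av a x = fv a u \<and> a \<in> S}"

definition B :: "'p \<Rightarrow> 'v dual set \<Rightarrow> 'g set" where
  "B x S = generate G (Tb \<union> (\<Union>a\<in>\<Phi>. lev x S a))"

text \<open>Covers \<Phi> and all positive systems at once. The last clause, closure under halving,
  is what places the subgroup for 2a inside the one for a.\<close>

definition closed_roots :: "'v dual set \<Rightarrow> bool" where
  "closed_roots S \<longleftrightarrow> (\<forall>a\<in>S. \<forall>b\<in>S. \<forall>r s :: nat. real r *\<^sub>R a + real s *\<^sub>R b \<in> \<Phi> \<longrightarrow> real r *\<^sub>R a + real s *\<^sub>R b \<in> S)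
     \<and> (\<forall>a\<in>\<Phi>. 2 *\<^sub>R a \<in> S \<longrightarrow> a \<in> S)"

lemma closed_roots_\<Phi>: "closed_roots \<Phi>"
  by (simp add: closed_roots_def)

lemma closed_roots_pos:
  assumes "pos S" shows "closed_roots S"
  unfolding closed_roots_def
proof (intro conjI ballI allI impI)
  fix a b and r s :: nat assume "a \<in> S" "b \<in> S" "real r *\<^sub>R a + real s *\<^sub>R b \<in> \<Phi>"
  then show "real r *\<^sub>R a + real s *\<^sub>R b \<in> S" by (intro pos_comb[OF assms]) auto
next
  fix a assume "a \<in> \<Phi>" "2 *\<^sub>R a \<in> S"
  then show "a \<in> S" using pos_scale[OF assms, of "2 *\<^sub>R a" "1 / 2"] by simp
qed

lemma lev_one: "a \<in> \<Phi> \<Longrightarrow> \<one> \<in> lev x S a"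
  using subgroup.one_closed[OF RGD1(2)] by (simp add: lev_def)

lemma lev_U: "u \<in> lev x S a \<Longrightarrow> u \<in> U a"
  by (simp add: lev_def)

lemma neg_order:
  fixes q r :: "'a::linordered_ab_group_add"
  shows "- q < r \<longleftrightarrow> 0 < r + q" "- q = r \<longleftrightarrow> r + q = 0" "- q \<le> r \<longleftrightarrow> 0 \<le> r + q" "r \<le> - q \<longleftrightarrow> r + q \<le> 0"
  using add_less_cancel_right[of "- q" q r] add_le_cancel_right[of "- q" q r] add_le_cancel_right[of r q "- q"]
    add_right_cancel[of "- q" q r] by auto

lemma lev_iff:
  "u \<in> lev x S a \<longleftrightarrow> u \<in> U a \<and> (u = \<one> \<or> 0 < fv a u + av a x \<or> fv a u + av a x = 0 \<and> a \<in> S)"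
  unfolding lev_def neg_order by blast

lemma lev_up: "w \<in> lev x S a \<Longrightarrow> w \<noteq> \<one> \<Longrightarrow> z \<in> U a \<Longrightarrow> fv a w \<le> fv a z \<Longrightarrow> z \<in> lev x S a"
  unfolding lev_def by auto

text \<open>The monotonicity behind the absorptions below: a larger a(x) weakens the condition on u,
  and a strict increase outweighs the choice of \<open>S\<close>.\<close>

lemma lev_subset:
  assumes "av a x < av a y \<or> av a x = av a y \<and> (a \<in> S \<longrightarrow> a \<in> S')" shows "lev x S a \<subseteq> lev y S' a"
  using assms
proof
  assume "av a x < av a y"
  then have lt: "- av a y < - av a x" by simp
  show ?thesis
  proof
    fix u assume u: "u \<in> lev x S a"
    have "- av a y < fv a u" if "u \<noteq> \<one>"
    proof -
      have "- av a x \<le> fv a u" using u that by (auto simp: lev_def)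
      with lt show ?thesis by (rule less_le_trans)
    qed
    then show "u \<in> lev y S' a" using u by (auto simp: lev_def)
  qed
qed (auto simp: lev_def)

lemma lev_subgroup: "a \<in> \<Phi> \<Longrightarrow> subgroup (lev x S a) G"
proof (rule subgroupI)
  assume a: "a \<in> \<Phi>"
  show "lev x S a \<subseteq> carrier G" using U_carrier[OF a] lev_U by blast
  show "lev x S a \<noteq> {}" using lev_one[OF a] by blast
  show "inv u \<in> lev x S a" if u: "u \<in> lev x S a" for u
  proof (cases "u = \<one>")
    case False
    then show ?thesis using u fv_inv[OF a lev_U[OF u]] fv_inv_le(2)[OF a lev_U[OF u]] by (simp add: lev_def)
  qed (use u in simp)
  show "u \<otimes> v \<in> lev x S a" if uv: "u \<in> lev x S a" "v \<in> lev x S a" for u v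
  proof (cases "u = \<one> \<or> v = \<one>")
    case True
    then show ?thesis using uv U_carrier[OF a lev_U] by auto
  next
    case False
    then have "u \<otimes> v = \<one> \<or> min (fv a u) (fv a v) \<le> fv a (u \<otimes> v)"
      using fv_mult[OF a lev_U[OF uv(1)] lev_U[OF uv(2)], of "min (fv a u) (fv a v)"] by simp
    moreover have "u \<otimes> v \<in> U a" using subgroup.m_closed[OF RGD1(2)[OF a]] uv lev_U by blast
    ultimately show ?thesis
      using uv False lev_one[OF a] lev_up[OF uv(1)] lev_up[OF uv(2)] by (auto simp: min_def split: if_splits)
  qed
qed

lemma av_comb2:
  assumes "a \<in> \<Phi>" "b \<in> \<Phi>" "real r *\<^sub>R a + real s *\<^sub>R b \<in> \<Phi>"
  shows "av (real r *\<^sub>R a + real s *\<^sub>R b) x = int_mult (int r) (av a x) + int_mult (int s) (av b x)"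
  unfolding root_at_def by (rule rv_comb2[OF assms])

lemma av_double: "a \<in> \<Phi> \<Longrightarrow> 2 *\<^sub>R a \<in> \<Phi> \<Longrightarrow> av (2 *\<^sub>R a) x = av a x + av a x"
  unfolding root_at_def by (rule rv_double)

lemma fv_double:
  assumes "a \<in> \<Phi>" "2 *\<^sub>R a \<in> \<Phi>" "u \<in> U (2 *\<^sub>R a)" "u \<noteq> \<one>"
  shows "fv (2 *\<^sub>R a) u = fv a u + fv a u"
proof -
  have "u \<in> U a" using RGD3[OF assms(1)] assms(2,3) by (auto simp: multipliable_def)
  then show ?thesis
    using V4[OF assms(1) _ assms(3)] \<phi>_fv[OF assms(2-4)] \<phi>_fv[OF assms(1) _ assms(4)] assms(2)
    by (simp add: multipliable_def)
qed

lemma lev_double: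
  assumes S: "closed_roots S" and a: "a \<in> \<Phi>" "2 *\<^sub>R a \<in> \<Phi>" shows "lev x S (2 *\<^sub>R a) \<subseteq> lev x S a"
proof
  fix u assume u: "u \<in> lev x S (2 *\<^sub>R a)"
  have uU: "u \<in> U a" using RGD3[OF a(1)] a(2) lev_U[OF u] by (auto simp: multipliable_def)
  show "u \<in> lev x S a"
  proof (cases "u = \<one>")
    case True
    then show ?thesis using lev_one[OF a(1)] by simp
  next
    case False
    have e: "fv (2 *\<^sub>R a) u + av (2 *\<^sub>R a) x = int_mult 2 (fv a u + av a x)"
      using fv_double[OF a lev_U[OF u] False] av_double[OF a] by (simp add: int_mult_2 algebra_simps)
    have z: "0 < int_mult 2 r \<longleftrightarrow> 0 < r" "int_mult 2 r = 0 \<longleftrightarrow> r = 0" for r :: 'r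
      using int_mult_less_iff[of 2 0 r] double_inj[of r 0] by (auto simp: int_mult_2)
    have "2 *\<^sub>R a \<in> S \<longrightarrow> a \<in> S" using S a(1) unfolding closed_roots_def by blast
    then show ?thesis using u uU False unfolding lev_iff e z by blast
  qed
qed

text \<open>V3 is applied at the exact values of u and v. The bound obtained is strict at x unless
  both values lie exactly on the walls through x; then both roots are in \<open>S\<close>, and
  closedness puts the new root there.\<close>

lemma lev_commutator:
  assumes S: "closed_roots S" and ab: "a \<in> \<Phi>" "b \<in> \<Phi>" "\<nexists>c. c \<le> 0 \<and> b = c *\<^sub>R a"
    and uv: "u \<in> lev x S a" "v \<in> lev x S b"
  shows "u \<otimes> v \<otimes> inv u \<otimes> inv v \<in> Ugrp (lev x S) (open_root_interval \<Phi> a b)"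
proof (cases "u = \<one> \<or> v = \<one>")
  case True
  then have "u \<otimes> v \<otimes> inv u \<otimes> inv v = \<one>"
    using U_carrier[OF ab(1) lev_U[OF uv(1)]] U_carrier[OF ab(2) lev_U[OF uv(2)]] by auto
  then show ?thesis by (simp add: Ugrp_def generate.one)
next
  case False
  let ?l = "fv a u" and ?k = "fv b v"
  have u: "u \<in> U_level U \<phi> a (Fin ?l)" "v \<in> U_level U \<phi> b (Fin ?k)"
    using U_level_iff[OF ab(1) lev_U[OF uv(1)]] U_level_iff[OF ab(2) lev_U[OF uv(2)]] by simp_all
  then have c1: "u \<otimes> v \<otimes> inv u \<otimes> inv v
      \<in> generate G (commutators G (U_level U \<phi> a (Fin ?l)) (U_level U \<phi> b (Fin ?k)))"
    by (intro generate.incl) (auto simp: commutators_def)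
  have sub: "\<Union>{U_level U \<phi> (real r *\<^sub>R a + real s *\<^sub>R b) (Fin (int_mult (int r) ?l + int_mult (int s) ?k)) | r s :: nat.
      r > 0 \<and> s > 0 \<and> real r *\<^sub>R a + real s *\<^sub>R b \<in> \<Phi>} \<subseteq> (\<Union>c\<in>open_root_interval \<Phi> a b. lev x S c)"
  proof
    fix w assume "w \<in> \<Union>{U_level U \<phi> (real r *\<^sub>R a + real s *\<^sub>R b) (Fin (int_mult (int r) ?l + int_mult (int s) ?k)) | r s :: nat.
      r > 0 \<and> s > 0 \<and> real r *\<^sub>R a + real s *\<^sub>R b \<in> \<Phi>}"
    then obtain r s :: nat where rs: "r > 0" "s > 0" "real r *\<^sub>R a + real s *\<^sub>R b \<in> \<Phi>"
      and w: "w \<in> U_level U \<phi> (real r *\<^sub>R a + real s *\<^sub>R b) (Fin (int_mult (int r) ?l + int_mult (int s) ?k))"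
      by blast
    define c where "c = real r *\<^sub>R a + real s *\<^sub>R b"
    have cI: "c \<in> open_root_interval \<Phi> a b" using rs by (auto simp: open_root_interval_def c_def)
    have cP: "c \<in> \<Phi>" using rs by (simp add: c_def)
    have wU: "w \<in> U c" using w U_level_subset by (auto simp: c_def)
    have wl: "w = \<one> \<or> int_mult (int r) ?l + int_mult (int s) ?k \<le> fv c w"
      using w U_level_iff[OF cP wU] by (simp add: c_def)
    have m: "- av c x = int_mult (int r) (- av a x) + int_mult (int s) (- av b x)"
      using av_comb2[OF ab(1,2) rs(3)] by (simp add: c_def)
    have a_le: "- av a x \<le> ?l" "- av b x \<le> ?k" using uv False by (auto simp: lev_def)
    have le: "int_mult (int r) (- av a x) \<le> int_mult (int r) ?l" "int_mult (int s) (- av b x) \<le> int_mult (int s) ?k"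
      using a_le rs by (simp_all add: int_mult_le_iff del: int_mult_minus_right)
    have "- av c x \<le> int_mult (int r) ?l + int_mult (int s) ?k" unfolding m using le by (rule add_mono)
    moreover have "- av c x < int_mult (int r) ?l + int_mult (int s) ?k" if "- av a x < ?l"
      unfolding m using that rs le by (intro add_less_le_mono) (simp_all add: int_mult_less_iff del: int_mult_minus_right)
    moreover have "- av c x < int_mult (int r) ?l + int_mult (int s) ?k" if "- av b x < ?k"
      unfolding m using that rs le by (intro add_le_less_mono) (simp_all add: int_mult_less_iff del: int_mult_minus_right)
    moreover have "c \<in> S" if "\<not> - av a x < ?l" "\<not> - av b x < ?k"
    proof -
      have "a \<in> S" "b \<in> S" using uv False that by (auto simp: lev_def)
      then show ?thesis using S rs(3) unfolding closed_roots_def c_def by blast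
    qed
    ultimately have "w \<in> lev x S c" using wU wl unfolding lev_def by fastforce
    then show "w \<in> (\<Union>c\<in>open_root_interval \<Phi> a b. lev x S c)" using cI by blast
  qed
  show ?thesis
    unfolding Ugrp_def by (rule subsetD[OF mono_generate[OF sub] subsetD[OF V3[OF ab] c1]])
qed

lemma lev_subfamily: "closed_roots S \<Longrightarrow> root_subfamily (lev x S)"
  unfolding root_subfamily_def using lev_subgroup lev_double lev_commutator lev_U by blast

lemma lev_pos: "pos S \<Longrightarrow> root_subfamily (lev x S)"
  by (intro lev_subfamily closed_roots_pos)

lemma lev_\<Phi>: "root_subfamily (lev x \<Phi>)"
  by (intro lev_subfamily closed_roots_\<Phi>)

lemma lev_Tb_cj: "h \<in> Tb \<Longrightarrow> a \<in> \<Phi> \<Longrightarrow> u \<in> lev x S a \<Longrightarrow> cj h u \<in> lev x S a"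
  using Tb_cj[of h a u] Tb_carrier[of h] by (cases "u = \<one>") (auto simp: lev_def)

text \<open>A positive system contains only one of a and - a, so the inequalities for u and v at x
  are not both equalities and the two values have a positive sum, as \<open>rank_one_swap\<close>
  demands. With both roots in \<open>S\<close> the sum could be 0.\<close>

lemma lev_swap:
  assumes S: "pos S" and a: "a \<in> \<Phi>" and u: "u \<in> lev x S a" and v: "v \<in> lev x S (- a)"
  shows "\<exists>v'\<in>lev x S (- a). \<exists>h\<in>Tb. \<exists>u'\<in>lev x S a. u \<otimes> v = v' \<otimes> h \<otimes> u'"
proof -
  have na: "- a \<in> \<Phi>" using a by (rule root_neg)
  have c: "u \<in> carrier G" "v \<in> carrier G" using U_carrier[OF a lev_U[OF u]] U_carrier[OF na lev_U[OF v]] .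
  have hone: "\<one> \<in> Tb" using subgroup.one_closed[OF Tb_subgroup] .
  consider "u = \<one>" | "v = \<one>" | "u \<noteq> \<one>" "v \<noteq> \<one>" by blast
  then show ?thesis
  proof cases
    case 1
    then have "u \<otimes> v = v \<otimes> \<one> \<otimes> u" using c by simp
    then show ?thesis using u v hone by blast
  next
    case 2
    then have "u \<otimes> v = v \<otimes> \<one> \<otimes> u" using c by simp
    then show ?thesis using u v hone by blast
  next
    case 3
    have "- fv (- a) v < fv a u"
    proof -
      have "0 \<le> fv a u + av a x" "0 \<le> fv (- a) v - av a x" "0 < fv a u + av a x \<or> 0 < fv (- a) v - av a x"
        using u v 3 pos_neg_iff[OF S a] unfolding lev_iff av_neg[OF a] by auto
      then have "0 < (fv a u + av a x) + (fv (- a) v - av a x)" by (metis add_nonneg_pos add_pos_nonneg)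
      then show ?thesis unfolding neg_order by (simp add: algebra_simps)
    qed
    from rank_one_swap[OF a lev_U[OF u] 3(1) lev_U[OF v] 3(2) this]
    obtain v1 h u1 where *: "v1 \<in> U (- a)" "v1 \<noteq> \<one>" "fv (- a) v1 = fv (- a) v" "h \<in> Tb"
      "u1 \<in> U a" "u1 \<noteq> \<one>" "fv a u1 = fv a u" "u \<otimes> v = v1 \<otimes> h \<otimes> u1" by blast
    have "v1 \<in> lev x S (- a)" "u1 \<in> lev x S a" using * u v 3 by (auto simp: lev_def)
    then show ?thesis using *(4,8) by blast
  qed
qed

section \<open>The groups B and the decompositions of Iwasawa type\<close>

lemma B_gens_carrier: "Tb \<union> (\<Union>a\<in>\<Phi>. lev x S a) \<subseteq> carrier G"
  using Tb_carrier U_carrier lev_U by blast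

lemma B_subgroup: "subgroup (B x S) G"
  unfolding B_def using generate_is_subgroup[OF B_gens_carrier] .

lemma B_carrier: "b \<in> B x S \<Longrightarrow> b \<in> carrier G"
  using B_subgroup by (rule subgroup.mem_carrier)

lemma B_Tb: "h \<in> Tb \<Longrightarrow> h \<in> B x S"
  unfolding B_def by (intro generate.incl) blast

lemma B_lev: "a \<in> \<Phi> \<Longrightarrow> u \<in> lev x S a \<Longrightarrow> u \<in> B x S"
  unfolding B_def by (intro generate.incl) blast

lemma B_mult: "b \<in> B x S \<Longrightarrow> b' \<in> B x S \<Longrightarrow> b \<otimes> b' \<in> B x S"
  using B_subgroup by (rule subgroup.m_closed)

lemma B_inv: "b \<in> B x S \<Longrightarrow> inv b \<in> B x S"
  using B_subgroup by (rule subgroup.m_inv_closed)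

lemma B_GL:
  assumes "X \<subseteq> \<Phi>" "\<And>a. a \<in> X \<Longrightarrow> L a \<subseteq> lev x S a" shows "Ugrp L X \<subseteq> B x S"
  unfolding Ugrp_def using assms B_lev by (intro generate_subgroup_incl[OF _ B_subgroup]) blast

lemma Ugrp_Tb_cj:
  assumes "closed_roots S" "h \<in> Tb" "X \<subseteq> \<Phi>" "y \<in> Ugrp (lev x S) X" shows "cj h y \<in> Ugrp (lev x S) X"
proof (rule Ugrp_cj[OF lev_subfamily[OF assms(1)] assms(3) Tb_carrier[OF assms(2)] Ugrp_subgroup[OF lev_subfamily[OF assms(1)] assms(3)] _ assms(4)])
  fix a u assume "a \<in> X" "u \<in> lev x S a"
  then show "cj h u \<in> Ugrp (lev x S) X"
    using Ugrp_incl[OF lev_subfamily[OF assms(1)]] lev_Tb_cj[OF assms(2)] assms(3) by blast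
qed

lemma B_decomp:
  assumes "pos S" "pos E" "g \<in> B x S"
  shows "\<exists>y\<in>Ugrp (lev x S) (\<Phi> - E). \<exists>z\<in>Ugrp (lev x S) E. \<exists>h\<in>Tb. g = y \<otimes> z \<otimes> h"
  using opposite_decomposition[OF lev_pos[OF assms(1)] Tb_subgroup lev_Tb_cj lev_swap[OF assms(1)] assms(2)] assms(3)
  unfolding B_def by blast

lemma compl_compl: "pos E \<Longrightarrow> \<Phi> - (\<Phi> - E) = E"
  using pos_subset by blast

lemma B_decomp':
  assumes S: "pos S" and E: "pos E" and g: "g \<in> B x S"
  shows "\<exists>h\<in>Tb. \<exists>y\<in>Ugrp (lev x S) (\<Phi> - E). \<exists>z\<in>Ugrp (lev x S) E. g = h \<otimes> y \<otimes> z"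
proof -
  note L = lev_pos[OF S]
  obtain z y h where *: "z \<in> Ugrp (lev x S) E" "y \<in> Ugrp (lev x S) (\<Phi> - E)" "h \<in> Tb" "inv g = z \<otimes> y \<otimes> h"
    using B_decomp[OF S pos_compl[OF E] B_inv[OF g]] unfolding compl_compl[OF E] by blast
  have c: "z \<in> carrier G" "y \<in> carrier G" "h \<in> carrier G"
    using Ugrp_carrier[OF L pos_subset[OF E] *(1)] Ugrp_carrier[OF L _ *(2)] Tb_carrier[OF *(3)] by blast+
  have "g = inv (inv g)" using B_carrier[OF g] by simp
  also have "\<dots> = inv h \<otimes> inv y \<otimes> inv z" unfolding *(4) using c by (simp add: inv_mult_group m_assoc)
  finally show ?thesis
    using subgroup.m_inv_closed[OF Tb_subgroup *(3)] Ugrp_inv[OF L _ *(2)] Ugrp_inv[OF L pos_subset[OF E] *(1)] by blast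
qed

lemma vn_inv: "n \<in> NN \<Longrightarrow> b \<in> \<Phi> \<Longrightarrow> vn n (vn (inv n) b) = b"
proof -
  assume n: "n \<in> NN" "b \<in> \<Phi>"
  have "vn \<one> b = b" using vn_Tb[OF subgroup.one_closed[OF Tb_subgroup] n(2)] .
  then show ?thesis using vnu_mult[OF n(1) NN_inv[OF n(1)]] NN_carrier[OF n(1)] by (metis comp_apply r_inv)
qed

lemma vn_inj: "n \<in> NN \<Longrightarrow> inj (vn n)"
  using weyl_closed(4)[OF vnu_weyl] bij_is_inj by blast

lemma lev_cj:
  assumes n: "n \<in> NN" and a: "a \<in> \<Phi>" and u: "u \<in> lev x S a"
  shows "cj n u \<in> lev (\<nu> n x) (vn n ` S) (vn n a)"
proof (cases "u = \<one>")
  case True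
  then show ?thesis using lev_one[OF vnu_root[OF n a]] NN_carrier[OF n] by simp
next
  case False
  have 1: "cj n u \<in> U (vn n a)" using vnu_cj[OF n a] lev_U[OF u] by blast
  have 2: "vn n a \<in> vn n ` S \<longleftrightarrow> a \<in> S" using inj_image_mem_iff[OF vn_inj[OF n]] .
  show ?thesis using u False 1 2 fv_equivariant[OF n a lev_U[OF u] False, of x] unfolding lev_iff by simp
qed

text \<open>Conjugation by n carries the fixer of the germ at n^-1 x to the one at x. So in a
  product b n y the factor y can move to the left of n and disappear in
  \<open>B x S\<close>.\<close>

lemma absorb:
  assumes n: "n \<in> NN" and X: "X \<subseteq> \<Phi>" and L: "root_subfamily L" and S: "S \<subseteq> \<Phi>"
    and sub: "\<And>a. a \<in> X \<Longrightarrow> L a \<subseteq> lev (\<nu> (inv n) x) (vn (inv n) ` S) a"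
    and y: "y \<in> Ugrp L X"
  shows "cj n y \<in> B x S"
proof (rule Ugrp_cj[OF L X NN_carrier[OF n] B_subgroup _ y])
  fix a u assume au: "a \<in> X" "u \<in> L a"
  have a: "a \<in> \<Phi>" using au X by blast
  have "vn n ` vn (inv n) ` S = S" using vn_inv[OF n] S by (force simp: image_image)
  then have "cj n u \<in> lev x S (vn n a)"
    using lev_cj[OF n a, of u "\<nu> (inv n) x" "vn (inv n) ` S"] sub[OF au(1)] au(2) \<nu>_inv(2)[OF n] by auto
  then show "cj n u \<in> B x S" using B_lev[OF vnu_root[OF n a]] by blast
qed

lemma B_cj:
  assumes n: "n \<in> NN" and b: "b \<in> B x S"
  shows "cj n b \<in> B (\<nu> n x) (vn n ` S)"
proof (rule cj_generate[OF B_subgroup B_gens_carrier NN_carrier[OF n]])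
  show "b \<in> generate G (Tb \<union> (\<Union>a\<in>\<Phi>. lev x S a))" using b by (simp add: B_def)
  fix s assume "s \<in> Tb \<union> (\<Union>a\<in>\<Phi>. lev x S a)"
  then show "cj n s \<in> B (\<nu> n x) (vn n ` S)"
    using B_Tb Tb_normal[OF n] B_lev vnu_root[OF n] lev_cj[OF n] by blast
qed

lemma pos_vn: "n \<in> NN \<Longrightarrow> pos S \<Longrightarrow> pos (vn n ` S)"
  using weyl_props(3)[OF vnu_weyl] .

text \<open>By equivariance, the level of n u n^-1 at x (value plus root at x) changes sign when u
  is replaced by v1 and the root by its opposite. So if n u n^-1 fails the condition, n v1 n^-1
  meets it; at level 0 this holds because \<open>S\<close> contains one of two opposite
  roots.\<close>

lemma reflect_dichotomy:
  assumes S: "pos S" and n: "n \<in> NN" and a: "a \<in> \<Phi>" and u: "u \<in> U a" "u \<noteq> \<one>"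
    and nl: "cj n u \<notin> lev x S (vn n a)"
  obtains v1 v2 where "v1 \<in> U (- a)" "v2 \<in> U (- a)" "v1 \<noteq> \<one>" "v2 \<noteq> \<one>" "fv (- a) v1 = - fv a u" "fv (- a) v2 = - fv a u"
    "m_elt G U M a u \<in> M a" "u = v1 \<otimes> m_elt G U M a u \<otimes> v2" "cj n v1 \<in> lev x S (vn n (- a))"
    "fv (vn n a) (cj n u) \<le> - av (vn n a) x"
proof -
  have na: "- a \<in> \<Phi>" using a by (rule root_neg)
  have wa: "vn n a \<in> \<Phi>" using vnu_root[OF n a] .
  let ?m = "m_elt G U M a u"
  obtain v1 v2 where v: "v1 \<in> U (- a)" "v2 \<in> U (- a)" "?m \<in> M a" "u = v1 \<otimes> ?m \<otimes> v2" using m_elt_factor[OF a u] .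
  note ina = subgroup.m_inv_closed[OF RGD1(2)[OF na]]
  have c: "v1 \<in> carrier G" "v2 \<in> carrier G" "?m \<in> carrier G" "u \<in> carrier G"
    using v U_carrier[OF na] U_carrier[OF a u(1)] M_carrier[OF a] by blast+
  have "inv v1 \<otimes> (v1 \<otimes> ?m \<otimes> v2) \<otimes> inv v2 = ?m" using c by (simp add: m_assoc)
  then have e1: "inv v1 \<otimes> u \<otimes> inv v2 \<in> M a" using v(3,4) by metis
  have "v2 \<otimes> inv (v1 \<otimes> ?m \<otimes> v2) \<otimes> v1 = inv ?m" using c by (simp add: m_assoc inv_mult_group)
  then have e2: "v2 \<otimes> inv u \<otimes> v1 \<in> M a" using M_inv[OF a v(3)] v(4) by metis
  have i1: "inv v1 \<noteq> \<one>" "fv (- a) (inv v1) = - fv a u" using V5_fv[OF a u ina[OF v(1)] ina[OF v(2)] e1] .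
  have f1: "v1 \<noteq> \<one>" "fv (- a) v1 = - fv a u" using i1 fv_inv[OF na ina[OF v(1)] i1(1)] c by auto
  have f2: "v2 \<noteq> \<one>" "fv (- a) v2 = - fv a u"
    using V5_fv[OF a fv_inv_le(2,3)[OF a u] v(2,1) e2] fv_inv[OF a u] by simp_all
  define z where "z = \<nu> (inv n) x"
  have nz: "\<nu> n z = x" using \<nu>_inv(2)[OF n] by (simp add: z_def)
  have E1: "fv (vn n a) (cj n u) + av (vn n a) x = fv a u + av a z" using fv_equivariant[OF n a u, of z] nz by simp
  have E2: "fv (- vn n a) (cj n v1) - av (vn n a) x = - (fv a u + av a z)"
    using fv_equivariant[OF n na v(1) f1(1), of z] nz by (simp add: vnu_neg[OF n] av_neg[OF wa] av_neg[OF a] f1(2))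
  have cu: "cj n u \<in> U (vn n a)" "cj n u \<noteq> \<one>"
    using vnu_cj[OF n a] u cj_eq_one_iff[OF NN_carrier[OF n] c(4)] by blast+
  have cv: "cj n v1 \<in> U (- vn n a)" using vnu_cj[OF n na] v(1) vnu_neg[OF n] by auto
  define q where "q = fv (vn n a) (cj n u) + av (vn n a) x"
  have q2: "fv (- vn n a) (cj n v1) + av (- vn n a) x = - q" using E1 E2 by (simp add: q_def av_neg[OF wa])
  have nq: "q < 0 \<or> q = 0 \<and> vn n a \<notin> S"
    using nl cu unfolding lev_iff q_def[symmetric] by auto
  then have "cj n v1 \<in> lev x S (- vn n a)"
    using cv pos_neg_iff[OF S wa] unfolding lev_iff q2 by auto
  moreover have "fv (vn n a) (cj n u) \<le> - av (vn n a) x" using nq unfolding neg_order q_def[symmetric] by auto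
  ultimately show ?thesis using that[OF v(1,2) f1(1) f2(1) f1(2) f2(2) v(3,4)] vnu_neg[OF n] by simp
qed

text \<open>By the dichotomy, n u is either (n u n^-1) n or (n v1 n^-1) (n m) v2, in both cases with
  the first factor in \<open>B x S\<close> and the last one in the opposite root group. This is the
  exchange that lets the positive system be flipped.\<close>

lemma iwasawa:
  assumes gen: "generating G \<Phi> T U" and S: "pos S" and D: "pos D" and g: "g \<in> carrier G"
  shows "\<exists>b\<in>B x S. \<exists>n\<in>NN. \<exists>y\<in>Ugrp U D. g = b \<otimes> n \<otimes> y"
proof -
  note R = root_subfamily_U
  define X where "X D = {b \<otimes> n \<otimes> y | b n y. b \<in> B x S \<and> n \<in> NN \<and> y \<in> Ugrp U D}" for D
  have step: "\<exists>b\<in>B x S. \<exists>n'\<in>NN. \<exists>v\<in>U (- a). n \<otimes> u = b \<otimes> n' \<otimes> v"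
    if n: "n \<in> NN" and a: "a \<in> \<Phi>" and u: "u \<in> U a" for n a u
  proof -
    have na: "- a \<in> \<Phi>" using a by (rule root_neg)
    have c: "n \<in> carrier G" "u \<in> carrier G" using NN_carrier[OF n] U_carrier[OF a u] .
    have one: "\<one> \<in> U (- a)" using subgroup.one_closed[OF RGD1(2)[OF na]] .
    show ?thesis
    proof (cases "cj n u \<in> lev x S (vn n a)")
      case True
      then have "cj n u \<in> B x S" using B_lev[OF vnu_root[OF n a]] by blast
      moreover have "n \<otimes> u = cj n u \<otimes> n \<otimes> \<one>" using c by (simp add: cj_def m_assoc)
      ultimately show ?thesis using n one by blast
    next
      case False
      then have "u \<noteq> \<one>" using lev_one[OF vnu_root[OF n a]] c by auto
      from reflect_dichotomy[OF S n a u this False]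
      obtain v1 v2 where v: "v1 \<in> U (- a)" "v2 \<in> U (- a)" "m_elt G U M a u \<in> M a" "u = v1 \<otimes> m_elt G U M a u \<otimes> v2"
        "cj n v1 \<in> lev x S (vn n (- a))" by metis
      define m where "m = m_elt G U M a u"
      have vc: "v1 \<in> carrier G" "v2 \<in> carrier G" "m \<in> carrier G"
        using v U_carrier[OF na] M_carrier[OF a] by (auto simp: m_def)
      have u_eq: "u = v1 \<otimes> m \<otimes> v2" using v(4) by (simp add: m_def)
      have "n \<otimes> u = cj n v1 \<otimes> (n \<otimes> m) \<otimes> v2" unfolding u_eq using c vc by (simp add: cj_def m_assoc)
      moreover have "cj n v1 \<in> B x S" using B_lev[OF vnu_root[OF n na] v(5)] .
      moreover have "n \<otimes> m \<in> NN" using NN_mult[OF n M_NN[OF a v(3)]] by (simp add: m_def)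
      ultimately show ?thesis using v(2) by blast
    qed
  qed
  have NNc: "NN \<subseteq> carrier G" using NN_carrier by blast
  have "\<one> \<otimes> g \<in> X D"
  proof (rule generate_right_closed)
    show "T \<union> (\<Union>a\<in>\<Phi>. U a) \<subseteq> carrier G" using T_carrier U_carrier by blast
    show "X D \<subseteq> carrier G" unfolding X_def using B_carrier NN_carrier Ugrp_carrier[OF R pos_subset[OF D]] by auto
    show "inv s \<in> T \<union> (\<Union>a\<in>\<Phi>. U a)" if "s \<in> T \<union> (\<Union>a\<in>\<Phi>. U a)" for s
      using that subgroup.m_inv_closed[OF T_subgroup] subgroup.m_inv_closed[OF RGD1(2)] by blast
    show "g \<in> generate G (T \<union> (\<Union>a\<in>\<Phi>. U a))" using g gen by (simp add: generating_def)
    have "\<one> = \<one> \<otimes> \<one> \<otimes> \<one>" by simp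
    then show "\<one> \<in> X D" unfolding X_def using NN_one Ugrp_one[OF R] subgroup.one_closed[OF B_subgroup] by blast
    show "z \<otimes> s \<in> X D" if s: "s \<in> T \<union> (\<Union>a\<in>\<Phi>. U a)" and z: "z \<in> X D" for s z
    proof (cases "s \<in> T")
      case True
      obtain b n y where bn: "z = b \<otimes> n \<otimes> y" "b \<in> B x S" "n \<in> NN" "y \<in> Ugrp U D" using z by (auto simp: X_def)
      have i: "inv s \<in> T" using subgroup.m_inv_closed[OF T_subgroup True] .
      have "cj (inv s) y \<in> Ugrp U D"
        by (rule Ugrp_cj[OF R pos_subset[OF D] T_carrier[OF i] Ugrp_subgroup[OF R pos_subset[OF D]] _ bn(4)])
          (use T_cj[OF _ i] Ugrp_incl[OF R] pos_subset[OF D] in blast)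
      moreover have "z \<otimes> s = b \<otimes> (n \<otimes> s) \<otimes> cj (inv s) y"
        using B_carrier[OF bn(2)] NN_carrier[OF bn(3)] Ugrp_carrier[OF R pos_subset[OF D] bn(4)] T_carrier[OF True]
        by (simp add: bn(1) cj_def m_assoc)
      ultimately show ?thesis unfolding X_def using bn(2) NN_mult[OF bn(3) T_NN[OF True]] by blast
    next
      case False
      then obtain a where "a \<in> \<Phi>" "s \<in> U a" using s by blast
      then show ?thesis using iwasawa_right_closed[OF R B_subgroup NNc step X_def D z] by blast
    qed
  qed
  then show ?thesis using g unfolding X_def by auto
qed

text \<open>The Iwasawa argument inside the fixer of p, with N replaced by the stabilizer of p: when
  the dichotomy reflects, the value of u is exactly \<open>- av a p\<close>, so m(u) fixes p and v2
  again has the level of p. The product is obtained in the opposite order for g^-1 and then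
  inverted.\<close>

lemma parahoric_decomp:
  assumes E: "pos E" and D: "pos D" and g: "g \<in> Ugrp (lev p \<Phi>) \<Phi>"
  shows "\<exists>y\<in>Ugrp (lev p \<Phi>) D. \<exists>n\<in>NN. \<exists>b\<in>B p E. g = y \<otimes> n \<otimes> b"
proof -
  note R = lev_\<Phi>[of p]
  define Np where "Np = {n \<in> NN. \<nu> n p = p}"
  define X where "X D = {b \<otimes> n \<otimes> y | b n y. b \<in> B p E \<and> n \<in> Np \<and> y \<in> Ugrp (lev p \<Phi>) D}" for D
  have step: "\<exists>b\<in>B p E. \<exists>n'\<in>Np. \<exists>v\<in>lev p \<Phi> (- a). n \<otimes> u = b \<otimes> n' \<otimes> v"
    if nNp: "n \<in> Np" and a: "a \<in> \<Phi>" and u: "u \<in> lev p \<Phi> a" for n a u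
  proof -
    have n: "n \<in> NN" "\<nu> n p = p" using nNp by (auto simp: Np_def)
    have na: "- a \<in> \<Phi>" using a by (rule root_neg)
    have c: "n \<in> carrier G" "u \<in> carrier G" using NN_carrier[OF n(1)] U_carrier[OF a lev_U[OF u]] .
    show ?thesis
    proof (cases "cj n u \<in> lev p E (vn n a)")
      case True
      then have "cj n u \<in> B p E" using B_lev[OF vnu_root[OF n(1) a]] by blast
      moreover have "n \<otimes> u = cj n u \<otimes> n \<otimes> \<one>" using c by (simp add: cj_def m_assoc)
      ultimately show ?thesis using nNp lev_one[OF na] by blast
    next
      case False
      then have u1: "u \<noteq> \<one>" using lev_one[OF vnu_root[OF n(1) a]] c by auto
      define m where "m = m_elt G U M a u"
      obtain v1 v2 where v: "v1 \<in> U (- a)" "v2 \<in> U (- a)" "fv (- a) v2 = - fv a u" "m \<in> M a" "u = v1 \<otimes> m \<otimes> v2"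
        "cj n v1 \<in> lev p E (vn n (- a))" and le: "fv (vn n a) (cj n u) \<le> - av (vn n a) p"
        using reflect_dichotomy[OF E n(1) a lev_U[OF u] u1 False] unfolding m_def by metis
      have vc: "v1 \<in> carrier G" "v2 \<in> carrier G" "m \<in> carrier G"
        using v U_carrier[OF na] M_carrier[OF a] by auto
      have "fv a u + av a p = fv (vn n a) (cj n u) + av (vn n a) p"
        using fv_equivariant[OF n(1) a lev_U[OF u] u1, of p] n(2) by simp
      then have "fv a u + av a p \<le> 0" using le unfolding neg_order by simp
      moreover have "0 \<le> fv a u + av a p" using u u1 unfolding lev_iff by auto
      ultimately have eq: "fv a u = - av a p" by (simp add: eq_neg_iff_add_eq_0)
      have "\<nu> m p = p" unfolding m_def using \<nu>_m_elt_fixes[OF a lev_U[OF u] u1 eq] .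
      then have "n \<otimes> m \<in> Np" using NN_mult[OF n(1) M_NN[OF a v(4)]] \<nu>_mult[OF n(1) M_NN[OF a v(4)]] n(2) by (simp add: Np_def)
      moreover have "v2 \<in> lev p \<Phi> (- a)" using v(2,3) eq na av_neg[OF a] by (simp add: lev_def)
      moreover have "cj n v1 \<in> B p E" using B_lev[OF vnu_root[OF n(1) na] v(6)] .
      moreover have "n \<otimes> u = cj n v1 \<otimes> (n \<otimes> m) \<otimes> v2" unfolding v(5) using c vc by (simp add: cj_def m_assoc)
      ultimately show ?thesis by blast
    qed
  qed
  have Npc: "Np \<subseteq> carrier G" using NN_carrier by (auto simp: Np_def)
  have oneNp: "\<one> \<in> Np" using NN_one \<nu>_one by (simp add: Np_def)
  have gi: "inv g \<in> Ugrp (lev p \<Phi>) \<Phi>" using Ugrp_inv[OF R _ g] by blast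
  have "\<one> \<otimes> inv g \<in> X D"
  proof (rule generate_right_closed)
    show "(\<Union>a\<in>\<Phi>. lev p \<Phi> a) \<subseteq> carrier G" using L_Union_carrier[OF R] by blast
    show "X D \<subseteq> carrier G" unfolding X_def using B_carrier Npc Ugrp_carrier[OF R pos_subset[OF D]] by auto
    show "inv s \<in> (\<Union>a\<in>\<Phi>. lev p \<Phi> a)" if "s \<in> (\<Union>a\<in>\<Phi>. lev p \<Phi> a)" for s
      using that subgroup.m_inv_closed[OF lev_subgroup] by blast
    show "inv g \<in> generate G (\<Union>a\<in>\<Phi>. lev p \<Phi> a)" using gi by (simp add: Ugrp_def)
    have "\<one> = \<one> \<otimes> \<one> \<otimes> \<one>" by simp
    then show "\<one> \<in> X D" unfolding X_def using oneNp Ugrp_one[OF R] subgroup.one_closed[OF B_subgroup] by blast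
    show "z \<otimes> s \<in> X D" if s: "s \<in> (\<Union>a\<in>\<Phi>. lev p \<Phi> a)" and z: "z \<in> X D" for s z
      using s iwasawa_right_closed[OF R B_subgroup Npc step X_def D z] by blast
  qed
  moreover have gc: "g \<in> carrier G" using Ugrp_carrier[OF R _ g] by blast
  ultimately obtain b n y where *: "inv g = b \<otimes> n \<otimes> y" "b \<in> B p E" "n \<in> Np" "y \<in> Ugrp (lev p \<Phi>) D"
    unfolding X_def by auto
  have c: "b \<in> carrier G" "n \<in> carrier G" "y \<in> carrier G"
    using B_carrier[OF *(2)] Npc *(3) Ugrp_carrier[OF R pos_subset[OF D] *(4)] by blast+
  have "g = inv (inv g)" using gc by simp
  also have "\<dots> = inv y \<otimes> inv n \<otimes> inv b" unfolding *(1) using c by (simp add: inv_mult_group m_assoc)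
  finally show ?thesis
    using Ugrp_inv[OF R pos_subset[OF D] *(4)] B_inv[OF *(2)] NN_inv *(3) unfolding Np_def by blast
qed

lemma NN_B_B:
  assumes S: "pos S1" "pos S2" and n: "n \<in> NN" and b: "b1 \<in> B x1 S1" "b2 \<in> B x2 S2" "n = b1 \<otimes> b2"
  shows "n \<in> Tb"
proof -
  define D where "D = {a \<in> \<Phi>. 0 < rv a (diff x2 x1) \<or> rv a (diff x2 x1) = 0 \<and> a \<in> S2}"
  have D: "pos D" unfolding D_def by (rule pos_rv[OF S(2)])
  note L1 = lev_pos[OF S(1)] and L2 = lev_pos[OF S(2)]
  obtain h1 y1 z1 where 1: "h1 \<in> Tb" "y1 \<in> Ugrp (lev x1 S1) (\<Phi> - D)" "z1 \<in> Ugrp (lev x1 S1) D" "b1 = h1 \<otimes> y1 \<otimes> z1"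
    using B_decomp'[OF S(1) D b(1)] by blast
  \<comment> \<open>Ties in \<open>D\<close> are broken by \<open>S2\<close>, so the inclusion holds
    whatever \<open>S1\<close> is, and z1 can be passed on to \<open>b2\<close>.\<close>
  have "lev x1 S1 a \<subseteq> lev x2 S2 a" if "a \<in> D" for a
  proof -
    have "av a x1 < av a x2 \<or> av a x1 = av a x2 \<and> a \<in> S2" using that by (auto simp: D_def av_diff)
    then show ?thesis by (intro lev_subset) auto
  qed
  then have "z1 \<in> B x2 S2" using 1(3) B_GL[OF pos_subset[OF D]] by blast
  then have "z1 \<otimes> b2 \<in> B x2 S2" using B_mult b(2) by blast
  then obtain y2 z2 h2 where 2: "y2 \<in> Ugrp (lev x2 S2) (\<Phi> - D)" "z2 \<in> Ugrp (lev x2 S2) D" "h2 \<in> Tb"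
    "z1 \<otimes> b2 = y2 \<otimes> z2 \<otimes> h2" using B_decomp[OF S(2) D] by blast
  have P: "\<Phi> - D \<subseteq> \<Phi>" "D \<subseteq> \<Phi>" using pos_subset[OF D] by blast+
  have yU: "y1 \<otimes> y2 \<in> Ugrp U (\<Phi> - D)" and zU: "z2 \<in> Ugrp U D"
    using Ugrp_mult[OF root_subfamily_U P(1)] Ugrp_sub_U[OF L1 P(1)] Ugrp_sub_U[OF L2 P(1)] Ugrp_sub_U[OF L2 P(2)] 1(2) 2(1,2)
    by blast+
  have c: "h1 \<in> carrier G" "y1 \<in> carrier G" "z1 \<in> carrier G" "y2 \<in> carrier G" "z2 \<in> carrier G" "h2 \<in> carrier G" "b2 \<in> carrier G"
    using Tb_carrier 1(1) 2(3) Ugrp_carrier[OF L1 P(1) 1(2)] Ugrp_carrier[OF L1 P(2) 1(3)] Ugrp_carrier[OF L2 P(1) 2(1)]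
      Ugrp_carrier[OF L2 P(2) 2(2)] B_carrier[OF b(2)] by blast+
  have n_eq: "n = h1 \<otimes> (y1 \<otimes> y2 \<otimes> z2) \<otimes> h2"
  proof -
    have "n = h1 \<otimes> y1 \<otimes> (z1 \<otimes> b2)" using c by (simp add: b(3) 1(4) m_assoc)
    then show ?thesis using c by (simp add: 2(4) m_assoc)
  qed
  let ?n = "inv h1 \<otimes> n \<otimes> inv h2"
  have "?n \<in> NN" by (intro NN_mult NN_inv Tb_NN 1(1) 2(3) n)
  moreover have e: "?n = (y1 \<otimes> y2) \<otimes> z2" unfolding n_eq using c by (simp add: m_assoc)
  ultimately have "?n = \<one>" using NN_trivial(1)[OF D _ yU zU] by blast
  then have "n = h1 \<otimes> h2" using e n_eq c by simp
  then show ?thesis using subgroup.m_closed[OF Tb_subgroup 1(1) 2(3)] by simp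
qed

text \<open>The quotient of the unipotent parts is c n2^-1 n1 with c fixing the germ at n2^-1 x.
  Decomposing c relative to \<open>D\<close> exhibits an element of N in U^- U^+, so
  \<open>NN_trivial\<close> leaves just the \<open>D\<close>-part of c. This bounds how far the
  unipotent part of an Iwasawa decomposition can vary.\<close>

lemma iwasawa_unique:
  assumes S: "pos S" and D: "pos D" and b: "b1 \<in> B x S" "b2 \<in> B x S" and n: "n1 \<in> NN" "n2 \<in> NN"
    and u: "u1 \<in> Ugrp U D" "u2 \<in> Ugrp U D" and eq: "b1 \<otimes> n1 \<otimes> u1 = b2 \<otimes> n2 \<otimes> u2"
  shows "u2 \<otimes> inv u1 \<in> Ugrp (lev (\<nu> (inv n2) x) (vn (inv n2) ` S)) D"
proof -
  note R = root_subfamily_U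
  let ?x = "\<nu> (inv n2) x" and ?S = "vn (inv n2) ` S"
  have P: "\<Phi> - D \<subseteq> \<Phi>" "D \<subseteq> \<Phi>" using pos_subset[OF D] by blast+
  have in2: "inv n2 \<in> NN" using NN_inv[OF n(2)] .
  have S': "pos ?S" using pos_vn[OF in2 S] .
  note L = lev_pos[OF S', of ?x]
  define c where "c = cj (inv n2) (inv b2 \<otimes> b1)"
  have cB: "c \<in> B ?x ?S" unfolding c_def using B_cj[OF in2 B_mult[OF B_inv[OF b(2)] b(1)]] .
  obtain y z h where *: "y \<in> Ugrp (lev ?x ?S) D" "z \<in> Ugrp (lev ?x ?S) (\<Phi> - D)" "h \<in> Tb" "c = y \<otimes> z \<otimes> h"
    using B_decomp[OF S' pos_compl[OF D] cB] unfolding compl_compl[OF D] by blast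
  have g: "b1 \<in> carrier G" "b2 \<in> carrier G" "n1 \<in> carrier G" "n2 \<in> carrier G" "u1 \<in> carrier G" "u2 \<in> carrier G"
    "y \<in> carrier G" "z \<in> carrier G" "h \<in> carrier G"
    using B_carrier b NN_carrier n Ugrp_carrier[OF R P(2)] u Ugrp_carrier[OF L P(2) *(1)] Ugrp_carrier[OF L P(1) *(2)]
      Tb_carrier[OF *(3)] by blast+
  let ?u = "u2 \<otimes> inv u1"
  have e: "c \<otimes> (inv n2 \<otimes> n1) = ?u"
  proof -
    have "c \<otimes> (inv n2 \<otimes> n1) = inv n2 \<otimes> inv b2 \<otimes> (b1 \<otimes> n1 \<otimes> u1) \<otimes> inv u1"
      unfolding c_def cj_def using g by (simp add: m_assoc)
    also have "\<dots> = ?u" unfolding eq using g by (simp add: m_assoc)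
    finally show ?thesis .
  qed
  let ?n = "h \<otimes> (inv n2 \<otimes> n1)"
  have nN: "?n \<in> NN" using NN_mult Tb_NN[OF *(3)] in2 n(1) by blast
  have "?n = inv z \<otimes> (inv y \<otimes> ?u)" unfolding e[symmetric] *(4) using g by (simp add: m_assoc)
  moreover have "inv z \<in> Ugrp U (\<Phi> - D)" using Ugrp_inv[OF R P(1)] Ugrp_sub_U[OF L P(1)] *(2) by blast
  moreover have "inv y \<otimes> ?u \<in> Ugrp U D"
  proof -
    have "y \<in> Ugrp U D" using Ugrp_sub_U[OF L P(2)] *(1) by blast
    then show ?thesis using Ugrp_mult[OF R P(2)] Ugrp_inv[OF R P(2)] u by blast
  qed
  ultimately have "inv y \<otimes> ?u = \<one>" using NN_trivial(3)[OF D nN] by blast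
  then have "y \<otimes> (inv y \<otimes> ?u) = y" using g by simp
  then have "?u = y" using g by simp
  then show ?thesis using *(1) by simp
qed

text \<open>\<open>D\<close> consists of the roots that increase from p to n^-1 x, with ties decided
  by the germ there. So the factor of u in the group of \<open>D\<close> passes to the left of n
  into \<open>B x S\<close>, and what remains is in N times the fixer of the germ at p.\<close>

lemma parahoric_absorb:
  assumes S: "pos S" and E: "pos E" and b: "b \<in> B x S" and n: "n \<in> NN" and u: "u \<in> Ugrp (lev p \<Phi>) \<Phi>"
  shows "\<exists>b'\<in>B x S. \<exists>n'\<in>NN. \<exists>c\<in>B p E. b \<otimes> n \<otimes> u = b' \<otimes> n' \<otimes> c"
proof -
  let ?x = "\<nu> (inv n) x" and ?S = "vn (inv n) ` S"
  have S': "pos ?S" using pos_vn[OF NN_inv[OF n] S] .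
  define D where "D = {a \<in> \<Phi>. 0 < rv a (diff ?x p) \<or> rv a (diff ?x p) = 0 \<and> a \<in> ?S}"
  have D: "pos D" unfolding D_def by (rule pos_rv[OF S'])
  obtain y k c where *: "y \<in> Ugrp (lev p \<Phi>) D" "k \<in> NN" "c \<in> B p E" "u = y \<otimes> k \<otimes> c"
    using parahoric_decomp[OF E D u] by blast
  have "lev p \<Phi> a \<subseteq> lev ?x ?S a" if "a \<in> D" for a
  proof -
    have "av a p < av a ?x \<or> av a p = av a ?x \<and> a \<in> ?S" using that by (auto simp: D_def av_diff)
    then show ?thesis by (intro lev_subset) auto
  qed
  then have "cj n y \<in> B x S" using absorb[OF n pos_subset[OF D] lev_\<Phi> pos_subset[OF S] _ *(1)] by blast
  then have "b \<otimes> cj n y \<in> B x S" using B_mult[OF b] by blast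
  moreover have "b \<otimes> n \<otimes> u = (b \<otimes> cj n y) \<otimes> (n \<otimes> k) \<otimes> c"
    using B_carrier[OF b] NN_carrier[OF n] NN_carrier[OF *(2)] B_carrier[OF *(3)] Ugrp_carrier[OF lev_\<Phi> pos_subset[OF D] *(1)]
    by (simp add: *(4) cj_def m_assoc)
  ultimately show ?thesis using NN_mult[OF n *(2)] *(3) by blast
qed

end

section \<open>The Bruhat decomposition\<close>

context bruhat_setting
begin

text \<open>The sum of the fundamental coweights: its value at a positive root is a sum of
  nonnegative coordinates, one of them positive.\<close>

lemma strictly_dominant:
  assumes "pos E"
  obtains \<rho> where "\<rho> \<in> CW" "\<And>a. a \<in> E \<Longrightarrow> 0 < \<lfloor>blinfun_apply a \<rho>\<rfloor>"
    "\<And>a. a \<in> \<Phi> \<Longrightarrow> a \<notin> E \<Longrightarrow> \<lfloor>blinfun_apply a \<rho>\<rfloor> < 0"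
proof -
  obtain \<Delta> where D: "root_base \<Phi> \<Delta>" "E = positive_roots \<Phi> \<Delta>" using assms by (auto simp: pos_def)
  define \<rho> where "\<rho> = (\<Sum>\<delta>\<in>\<Delta>. cow \<Delta> \<delta>)"
  have fin: "finite \<Delta>" using base_finite[OF D(1)] .
  have ap: "blinfun_apply a \<rho> = (\<Sum>\<delta>\<in>\<Delta>. blinfun_apply a (cow \<Delta> \<delta>))" for a
    by (simp add: \<rho>_def blinfun.sum_right)
  have C: "\<rho> \<in> CW" unfolding coweight_lattice_def using base_cow_int[OF D(1)] by (auto simp: ap intro!: Ints_sum)
  have P: "0 < \<lfloor>blinfun_apply a \<rho>\<rfloor>" if a: "a \<in> E" for a
  proof -
    have aP: "a \<in> \<Phi>" using a pos_subset[OF assms] by blast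
    have "0 \<le> blinfun_apply a (cow \<Delta> \<delta>)" if "\<delta> \<in> \<Delta>" for \<delta>
      using base_pos_iff_all[OF D(1) aP] a D(2) that by blast
    moreover obtain \<delta> where "\<delta> \<in> \<Delta>" "0 < blinfun_apply a (cow \<Delta> \<delta>)"
      using base_pos_iff_ex[OF D(1) aP] a D(2) by blast
    ultimately have "0 < blinfun_apply a \<rho>" unfolding ap using fin by (intro sum_pos2) auto
    then have "0 < (of_int \<lfloor>blinfun_apply a \<rho>\<rfloor> :: real)" unfolding CW_floor[OF C aP] .
    then show ?thesis by simp
  qed
  show ?thesis
  proof (rule that[OF C P])
    fix a assume a: "a \<in> \<Phi>" "a \<notin> E"
    then have n: "- a \<in> E" using pos_neg_iff[OF assms] by blast
    then have "0 < (of_int \<lfloor>blinfun_apply (- a) \<rho>\<rfloor> :: real)" using P by simp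
    then have "blinfun_apply a \<rho> < 0" unfolding CW_floor[OF C root_neg[OF a(1)]] by (simp add: blinfun.minus_left)
    then have "(of_int \<lfloor>blinfun_apply a \<rho>\<rfloor> :: real) < 0" unfolding CW_floor[OF C a(1)] .
    then show "\<lfloor>blinfun_apply a \<rho>\<rfloor> < 0" by simp
  qed
qed

lemma divide_pos:
  assumes "0 < n" "0 < (r :: 'r)" obtains s where "int_mult n s = r" "0 < s"
proof -
  obtain s where s: "int_mult n s = r" using divisible[OF assms(1)] by blast
  then have "0 < s" using int_mult_less_iff[OF assms(1), of 0 s] assms(2) by simp
  then show ?thesis using that s by blast
qed

text \<open>For a pair (k, q) every d up to q / (|k| + 1) is small enough, and divisibility supplies
  this quotient. The bound \<open>s0\<close> keeps the parameter nonnegative when it is lowered by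
  \<delta>.\<close>

lemma small_step:
  assumes "finite F" "\<And>k q. (k, q) \<in> F \<Longrightarrow> 0 < q" "0 < (s0 :: 'r)"
  shows "\<exists>\<delta>. 0 < \<delta> \<and> \<delta> \<le> s0 \<and> (\<forall>(k, q)\<in>F. \<forall>d. 0 < d \<longrightarrow> d \<le> \<delta> \<longrightarrow> - int_mult k d \<le> q)"
  using assms(1,2)
proof (induct F rule: finite_induct)
  case empty
  then show ?case using assms(3) by auto
next
  case (insert x F)
  obtain k q where x: "x = (k, q)" by (cases x)
  obtain \<delta> where d: "0 < \<delta>" "\<delta> \<le> s0" "\<forall>(k, q)\<in>F. \<forall>d. 0 < d \<longrightarrow> d \<le> \<delta> \<longrightarrow> - int_mult k d \<le> q"
    using insert by blast
  have q: "0 < q" using insert(4) x by blast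
  obtain e where e: "int_mult (\<bar>k\<bar> + 1) e = q" "0 < e" using divide_pos[of "\<bar>k\<bar> + 1" q] q by auto
  have "- int_mult k d \<le> q" if "0 < d" "d \<le> e" for d
  proof -
    have "int_mult (- k) d \<le> int_mult (\<bar>k\<bar> + 1) d" using that by (intro int_mult_le_left) auto
    also have "\<dots> \<le> int_mult (\<bar>k\<bar> + 1) e" using that by (simp add: int_mult_le_iff)
    finally show ?thesis using e by simp
  qed
  then show ?case using d e by (intro exI[of _ "min \<delta> e"]) (auto simp: x min.coboundedI1)
qed

text \<open>The point \<open>p s\<close> moves from \<open>x'\<close> into the chamber opposite to \<open>E\<close>.  Far away, \<open>g\<close> lies in
  \<open>B x S N\<close> times the fixer of \<open>p s\<close>.  The \<open>s\<close> with this property form a finite union of closed intervals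
  (one for each Iwasawa decomposition of \<open>g\<close>), so there is a smallest one, and it cannot be positive.\<close>

lemma bruhat:
  assumes gen: "generating G \<Phi> T U" and S: "pos S" and E: "pos E" and g: "g \<in> carrier G"
  shows "\<exists>b\<in>B x S. \<exists>n\<in>NN. \<exists>c\<in>B x' E. g = b \<otimes> n \<otimes> c"
proof -
  note R = root_subfamily_U
  obtain \<rho> where \<rho>: "\<rho> \<in> CW" and \<rho>_pos: "\<And>a. a \<in> E \<Longrightarrow> 0 < \<lfloor>blinfun_apply a \<rho>\<rfloor>"
    and \<rho>_neg: "\<And>a. a \<in> \<Phi> \<Longrightarrow> a \<notin> E \<Longrightarrow> \<lfloor>blinfun_apply a \<rho>\<rfloor> < 0" using strictly_dominant[OF E] by metis
  define k where "k a = \<lfloor>blinfun_apply a \<rho>\<rfloor>" for a :: "'v dual"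
  \<comment> \<open>The point at parameter s is x' - s \<rho>; lowering s raises the roots of
    \<open>E\<close> at it.\<close>
  have "\<forall>s. \<exists>y. diff y x' = - t \<rho> s" using diff_ex by blast
  then obtain p where p: "\<And>s. diff (p s) x' = - t \<rho> s" by metis
  have avp: "av a (p s) = av a x' - int_mult (k a) s" if "a \<in> \<Phi>" for a s
  proof -
    have "av a (p s) - av a x' = - int_mult (k a) s"
      using av_diff[OF that, of "p s" x'] p rv_minus[OF that] rv_t[OF that \<rho>] by (simp add: k_def)
    then show ?thesis by (simp add: algebra_simps)
  qed
  have p0: "p 0 = x'" using p[of 0] \<rho> diff_inj[of "p 0" x' x'] by simp
  \<comment> \<open>One decomposition per positive system is fixed before s varies; this keeps the
    set of candidate endpoints finite.\<close>
  have "\<forall>D. \<exists>b n u. pos D \<longrightarrow> b \<in> B x S \<and> n \<in> NN \<and> u \<in> Ugrp U D \<and> g = b \<otimes> n \<otimes> u"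
    using iwasawa[OF gen S _ g] by metis
  then obtain bD nD uD where dec: "\<And>D. pos D \<Longrightarrow> bD D \<in> B x S \<and> nD D \<in> NN \<and> uD D \<in> Ugrp U D \<and>
      g = bD D \<otimes> nD D \<otimes> uD D" by metis
  define PK where "PK D K \<longleftrightarrow> finite K \<and> (\<forall>(a, c)\<in>K. a \<in> D \<and> c \<in> U a) \<and>
      (\<forall>L. root_subfamily L \<longrightarrow> (uD D \<in> Ugrp L D \<longleftrightarrow> (\<forall>(a, c)\<in>K. c \<in> L a)))" for D K
  have "\<exists>K. PK D K" if "pos D" for D
    unfolding PK_def using coordinates[OF that] dec[OF that] by blast
  then obtain K where K0: "\<And>D. pos D \<Longrightarrow> PK D (K D)" by metis
  have K: "finite (K D)" "\<And>a c. (a, c) \<in> K D \<Longrightarrow> a \<in> D \<and> c \<in> U a"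
    "\<And>L. root_subfamily L \<Longrightarrow> uD D \<in> Ugrp L D \<longleftrightarrow> (\<forall>(a, c)\<in>K D. c \<in> L a)" if "pos D" for D
    using K0[OF that] unfolding PK_def by blast+
  \<comment> \<open>This says that the chosen \<open>uD D\<close> fixes p s. A coordinate bounds s
    from above if k a > 0 and from below if k a < 0.\<close>
  define good where "good D s \<longleftrightarrow> (\<forall>(a, c)\<in>K D. c = \<one> \<or> int_mult (k a) s \<le> fv a c + av a x')" for D s
  have good_iff: "uD D \<in> Ugrp (lev (p s) \<Phi>) D \<longleftrightarrow> good D s" if D: "pos D" for D s
  proof -
    have "c \<in> lev (p s) \<Phi> a \<longleftrightarrow> c = \<one> \<or> int_mult (k a) s \<le> fv a c + av a x'" if ac: "(a, c) \<in> K D" for a c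
    proof -
      have a: "a \<in> \<Phi>" "c \<in> U a" using K(2)[OF D ac] pos_subset[OF D] by blast+
      have "c \<in> lev (p s) \<Phi> a \<longleftrightarrow> c = \<one> \<or> 0 \<le> fv a c + av a (p s)" using a unfolding lev_iff by auto
      also have "0 \<le> fv a c + av a (p s) \<longleftrightarrow> int_mult (k a) s \<le> fv a c + av a x'"
        unfolding avp[OF a(1)] by (simp add: algebra_simps)
      finally show ?thesis .
    qed
    then show ?thesis unfolding K(3)[OF D lev_\<Phi>] good_def by blast
  qed
  define A where "A = {s. 0 \<le> s \<and> (\<exists>D. pos D \<and> good D s)}"
  have "\<forall>a c. \<exists>l. k a < 0 \<longrightarrow> int_mult (- k a) l = - (fv a c + av a x')" using divisible by (metis neg_0_less_iff_less)
  then obtain l where l: "\<And>a c. k a < 0 \<Longrightarrow> int_mult (- k a) (l a c) = - (fv a c + av a x')" by metis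
  have l_iff: "int_mult (k a) s \<le> fv a c + av a x' \<longleftrightarrow> l a c \<le> s" if "k a < 0" for a c s
  proof -
    have "l a c \<le> s \<longleftrightarrow> int_mult (- k a) (l a c) \<le> int_mult (- k a) s" using that int_mult_le_iff[of "- k a" "l a c" s] by (simp del: int_mult_minus_left)
    then have "l a c \<le> s \<longleftrightarrow> - (fv a c + av a x') \<le> int_mult (- k a) s" unfolding l[OF that] .
    then show ?thesis by (simp only: int_mult_minus_left neg_le_iff_le)
  qed
  \<comment> \<open>0 is inserted because s must also be nonnegative; it makes the maximum of the
    lower bounds well defined.\<close>
  define low where "low D = insert 0 ((\<lambda>(a, c). l a c) ` {(a, c)\<in>K D. k a < 0 \<and> c \<noteq> \<one>})" for D
  have low_fin: "finite (low D)" if "pos D" for D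
    unfolding low_def using K(1)[OF that] by (auto intro: finite_subset[of _ "K D"])
  \<comment> \<open>Lowering s to its largest lower bound respects all lower bounds and can only
    help with the upper ones.\<close>
  have A_low: "\<exists>s'. s' \<in> A \<and> s' \<le> s \<and> (\<exists>D. pos D \<and> s' \<in> low D)" if s: "s \<in> A" for s
  proof -
    obtain D where D: "pos D" "good D s" and s0: "0 \<le> s" using s by (auto simp: A_def)
    define s' where "s' = Max (low D)"
    have ne: "low D \<noteq> {}" by (simp add: low_def)
    have in_low: "s' \<in> low D" unfolding s'_def using Max_in[OF low_fin[OF D(1)] ne] .
    have up: "r \<le> s'" if "r \<in> low D" for r unfolding s'_def using Max_ge[OF low_fin[OF D(1)] that] .
    have "r \<le> s" if "r \<in> low D" for r
      using that D(2) s0 l_iff unfolding low_def good_def by auto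
    then have le: "s' \<le> s" using in_low by blast
    have "good D s'" unfolding good_def
    proof (clarify)
      fix a c assume ac: "(a, c) \<in> K D" and c: "\<not> int_mult (k a) s' \<le> fv a c + av a x'"
      show "c = \<one>"
      proof (rule ccontr)
        assume c1: "c \<noteq> \<one>"
        show False
        proof (cases "k a < 0")
          case True
          then have "l a c \<in> low D" unfolding low_def using ac c1 by (auto intro!: image_eqI[of _ _ "(a, c)"])
          then show False using up l_iff[OF True] c by blast
        next
          case False
          then have "int_mult (k a) s' \<le> int_mult (k a) s"
            using int_mult_le_iff[of "k a" s' s] le by (cases "k a = 0") auto
          then show False using D(2) ac c1 c unfolding good_def by (auto dest!: bspec)
        qed
      qed
    qed
    moreover have "0 \<le> s'" using up by (simp add: low_def)
    ultimately show ?thesis using in_low le D(1) unfolding A_def by blast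
  qed
  \<comment> \<open>For the complement of \<open>E\<close> all constraints are lower bounds, since
    \<rho> is negative on its roots; so a large s is good.\<close>
  have A_ne: "A \<noteq> {}"
  proof -
    have D: "pos (\<Phi> - E)" using pos_compl[OF E] .
    define M0 where "M0 = insert 0 ((\<lambda>(a, c). l a c) ` K (\<Phi> - E))"
    have fin: "finite M0" unfolding M0_def using K(1)[OF D] by simp
    have up: "r \<le> Max M0" if "r \<in> M0" for r using Max_ge[OF fin that] .
    have "good (\<Phi> - E) (Max M0)" unfolding good_def
    proof clarify
      fix a c assume ac: "(a, c) \<in> K (\<Phi> - E)" and c: "\<not> int_mult (k a) (Max M0) \<le> fv a c + av a x'"
      have "k a < 0" unfolding k_def using K(2)[OF D ac] \<rho>_neg by blast
      moreover have "l a c \<le> Max M0" by (rule up) (use ac in \<open>auto simp: M0_def intro!: image_eqI[of _ _ "(a, c)"]\<close>)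
      ultimately show "c = \<one>" using l_iff c by blast
    qed
    moreover have "0 \<le> Max M0" by (rule up) (simp add: M0_def)
    ultimately show ?thesis using D unfolding A_def by blast
  qed
  \<comment> \<open>Re-expand g through the fixer of the germ at p s0 in the direction of
    \<open>E\<close>, with \<open>D\<close> given by the sign of the roots on p s0 - x1. The
    constraints for \<open>D\<close> that are equalities at s0 come from roots of \<open>E\<close>
    and relax when s decreases; the strict ones survive a small step.\<close>
  have descend: "\<exists>s\<in>A. s < s0" if s0: "s0 \<in> A" "0 < s0" for s0
  proof -
    obtain D0 where D0: "pos D0" "good D0 s0" using s0 by (auto simp: A_def)
    have "uD D0 \<in> Ugrp (lev (p s0) \<Phi>) \<Phi>"
      using good_iff[OF D0(1)] D0(2) Ugrp_mono[OF lev_\<Phi> pos_subset[OF D0(1)]] by blast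
    then obtain b n \<beta> where bn: "b \<in> B x S" "n \<in> NN" "\<beta> \<in> B (p s0) E" "g = b \<otimes> n \<otimes> \<beta>"
      using parahoric_absorb[OF S E, of "bD D0" x "nD D0" "uD D0" "p s0"] dec[OF D0(1)] by metis
    define x1 where "x1 = \<nu> (inv n) x"
    define S1 where "S1 = vn (inv n) ` S"
    have S1: "pos S1" unfolding S1_def using pos_vn[OF NN_inv[OF bn(2)] S] .
    define D where "D = {a \<in> \<Phi>. 0 < rv a (diff (p s0) x1) \<or> rv a (diff (p s0) x1) = 0 \<and> a \<in> E}"
    have D: "pos D" unfolding D_def by (rule pos_rv[OF E])
    have P: "\<Phi> - D \<subseteq> \<Phi>" "D \<subseteq> \<Phi>" using pos_subset[OF D] by blast+
    note LE = lev_pos[OF E, of "p s0"]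
    obtain y z h where yz: "y \<in> Ugrp (lev (p s0) E) (\<Phi> - D)" "z \<in> Ugrp (lev (p s0) E) D" "h \<in> Tb" "\<beta> = y \<otimes> z \<otimes> h"
      using B_decomp[OF E D bn(3)] by blast
    have "lev (p s0) E a \<subseteq> lev x1 S1 a" if a: "a \<in> \<Phi> - D" for a
    proof -
      have "av a (p s0) < av a x1 \<or> av a (p s0) = av a x1 \<and> a \<notin> E" using a by (auto simp: D_def av_diff)
      then show ?thesis by (intro lev_subset) auto
    qed
    then have cy: "cj n y \<in> B x S"
      using absorb[OF bn(2) P(1) LE pos_subset[OF S] _ yz(1)] unfolding x1_def S1_def by blast
    define u' where "u' = cj (inv h) z"
    have ih: "inv h \<in> Tb" using subgroup.m_inv_closed[OF Tb_subgroup yz(3)] .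
    have u'L: "u' \<in> Ugrp (lev (p s0) E) D" unfolding u'_def
      using Ugrp_Tb_cj[OF closed_roots_pos[OF E] ih P(2) yz(2)] .
    have u'U: "u' \<in> Ugrp U D" using Ugrp_sub_U[OF LE P(2)] u'L by blast
    have car: "b \<in> carrier G" "n \<in> carrier G" "y \<in> carrier G" "z \<in> carrier G" "h \<in> carrier G" "uD D \<in> carrier G" "u' \<in> carrier G"
      using B_carrier[OF bn(1)] NN_carrier[OF bn(2)] Ugrp_carrier[OF LE P(1) yz(1)] Ugrp_carrier[OF LE P(2) yz(2)]
        Tb_carrier[OF yz(3)] Ugrp_carrier[OF R P(2)] dec[OF D] u'U by blast+
    have nh: "n \<otimes> h \<in> NN" using NN_mult[OF bn(2) Tb_NN[OF yz(3)]] .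
    have g_eq: "g = (b \<otimes> cj n y) \<otimes> (n \<otimes> h) \<otimes> u'"
      unfolding bn(4) yz(4) u'_def using car by (simp add: cj_def m_assoc)
    have x1': "\<nu> (inv (n \<otimes> h)) x = x1"
    proof -
      have "inv (n \<otimes> h) = inv h \<otimes> inv n" using car by (simp add: inv_mult_group)
      then show ?thesis using \<nu>_mult[OF Tb_NN[OF ih] NN_inv[OF bn(2)]] ih by (simp add: Tb_iff x1_def)
    qed
    define S2 where "S2 = vn (inv (n \<otimes> h)) ` S"
    have S2: "pos S2" unfolding S2_def using pos_vn[OF NN_inv[OF nh] S] .
    have w: "u' \<otimes> inv uD D \<in> Ugrp (lev x1 S2) D"
      using iwasawa_unique[OF S D _ B_mult[OF bn(1) cy] _ nh _ u'U, of "bD D" "nD D" "uD D"] dec[OF D] g_eq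
      unfolding x1' S2_def by metis
    obtain K' where K': "finite K'" "\<And>a c. (a, c) \<in> K' \<Longrightarrow> a \<in> D \<and> c \<in> U a"
      "\<And>L. root_subfamily L \<Longrightarrow> u' \<in> Ugrp L D \<longleftrightarrow> (\<forall>(a, c)\<in>K'. c \<in> L a)"
      using coordinates[OF D u'U] by blast
    have cE: "c \<in> lev (p s0) E a" if "(a, c) \<in> K'" for a c using K'(3)[OF LE] u'L that by blast
    \<comment> \<open>The strict inequalities at s0: positive levels of the coordinates of u', and
      roots of \<open>D\<close> that are strictly larger at p s0 than at x1.\<close>
    define F where "F = (\<lambda>(a, c). (k a, fv a c + av a (p s0))) ` {(a, c) \<in> K'. 0 < fv a c + av a (p s0)}
      \<union> (\<lambda>a. (k a, av a (p s0) - av a x1)) ` {a \<in> D. 0 < av a (p s0) - av a x1}"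
    have "finite F" unfolding F_def
      using K'(1) finite_subset[OF P(2) finite_roots] by (auto intro: finite_subset[of _ K'])
    moreover have "0 < q" if "(j, q) \<in> F" for j q using that unfolding F_def by auto
    ultimately obtain \<delta> where \<delta>: "0 < \<delta>" "\<delta> \<le> s0" "\<And>j q. (j, q) \<in> F \<Longrightarrow> - int_mult j \<delta> \<le> q"
      using small_step[of F s0] s0(2) by blast
    define s where "s = s0 - \<delta>"
    have avs: "av a (p s) = av a (p s0) + int_mult (k a) \<delta>" if "a \<in> \<Phi>" for a
      unfolding avp[OF that] s_def int_mult_diff_right by simp
    have u's: "u' \<in> Ugrp (lev (p s) \<Phi>) D"
      unfolding K'(3)[OF lev_\<Phi>]
    proof clarify
      fix a c assume ac: "(a, c) \<in> K'"
      have a: "a \<in> \<Phi>" "c \<in> U a" using K'(2)[OF ac] P by blast+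
      have "0 \<le> fv a c + av a (p s)" if "c \<noteq> \<one>"
      proof (cases "0 < fv a c + av a (p s0)")
        case True
        then have "(k a, fv a c + av a (p s0)) \<in> F" unfolding F_def using ac by (auto intro!: image_eqI[of _ _ "(a, c)"])
        from \<delta>(3)[OF this] show ?thesis unfolding avs[OF a(1)] neg_order by (simp add: ac_simps)
      next
        case False
        then have *: "fv a c + av a (p s0) = 0" "a \<in> E" using cE[OF ac] that unfolding lev_iff by auto
        then have "0 \<le> int_mult (k a) \<delta>" using int_mult_nonneg[of "k a" \<delta>] \<rho>_pos[OF *(2)] \<delta>(1) by (simp add: k_def)
        then show ?thesis using *(1) unfolding avs[OF a(1)] by (simp flip: add.assoc)
      qed
      then show "c \<in> lev (p s) \<Phi> a" using a unfolding lev_iff by auto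
    qed
    have "lev x1 S2 a \<subseteq> lev (p s) \<Phi> a" if aD: "a \<in> D" for a
    proof -
      have a: "a \<in> \<Phi>" using aD P by blast
      have "av a x1 \<le> av a (p s)"
      proof (cases "0 < av a (p s0) - av a x1")
        case True
        then have "(k a, av a (p s0) - av a x1) \<in> F" unfolding F_def using aD by blast
        from \<delta>(3)[OF this] show ?thesis unfolding avs[OF a] by (simp add: algebra_simps)
      next
        case False
        then have *: "av a (p s0) = av a x1" "a \<in> E" using aD by (auto simp: D_def av_diff)
        then have "0 \<le> int_mult (k a) \<delta>" using int_mult_nonneg[of "k a" \<delta>] \<rho>_pos[OF *(2)] \<delta>(1) by (simp add: k_def)
        then show ?thesis unfolding avs[OF a] *(1) by simp
      qed
      then show ?thesis using a by (intro lev_subset) auto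
    qed
    then have w': "u' \<otimes> inv uD D \<in> Ugrp (lev (p s) \<Phi>) D"
      using w unfolding Ugrp_def by (auto intro: subsetD[OF mono_generate, rotated])
    \<comment> \<open>By \<open>iwasawa_unique\<close> the chosen \<open>uD D\<close> differs from
      u' by an element fixing a germ at x1, and along \<open>D\<close> such elements fix p s as
      well.\<close>
    have "uD D = inv (u' \<otimes> inv uD D) \<otimes> u'" using car by (simp add: inv_mult_group m_assoc)
    then have "uD D \<in> Ugrp (lev (p s) \<Phi>) D" using Ugrp_mult[OF lev_\<Phi> P(2) Ugrp_inv[OF lev_\<Phi> P(2) w'] u's] by simp
    then have "good D s" using good_iff[OF D] by blast
    moreover have "0 \<le> s" "s < s0" using \<delta>(1,2) by (simp_all add: s_def)
    ultimately show ?thesis using D unfolding A_def by blast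
  qed
  have "0 \<in> A"
  proof -
    define A' where "A' = A \<inter> (\<Union>D\<in>{D. pos D}. low D)"
    have "finite {D. pos D}" using finite_subset[of "{D. pos D}" "Pow \<Phi>"] pos_subset finite_roots by auto
    then have fin: "finite A'" unfolding A'_def using low_fin by auto
    obtain s where "s \<in> A" using A_ne by blast
    then have ne: "A' \<noteq> {}" using A_low unfolding A'_def by blast
    define s0 where "s0 = Min A'"
    have s0: "s0 \<in> A" using Min_in[OF fin ne] by (simp add: s0_def A'_def)
    have "\<not> 0 < s0"
    proof
      assume "0 < s0"
      then obtain s where "s \<in> A" "s < s0" using descend[OF s0] by blast
      then obtain s' where s': "s' \<in> A'" "s' \<le> s" using A_low[of s] unfolding A'_def by blast
      then show False using Min_le[OF fin s'(1)] \<open>s < s0\<close> unfolding s0_def by simp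
    qed
    moreover have "0 \<le> s0" using s0 by (simp add: A_def)
    ultimately show ?thesis using s0 by (simp add: not_less order.antisym)
  qed
  then obtain D where D: "pos D" "good D 0" by (auto simp: A_def)
  have "uD D \<in> Ugrp (lev x' \<Phi>) \<Phi>"
    using good_iff[OF D(1), of 0] D(2) Ugrp_mono[OF lev_\<Phi> pos_subset[OF D(1)]] unfolding p0 by blast
  from parahoric_absorb[OF S E _ _ this, of "bD D" x "nD D"] dec[OF D(1)] show ?thesis by metis
qed

end

section \<open>Germs of chambers\<close>

context bruhat_setting
begin

text \<open>Since \<Phi> = -\<Phi>, the upper bounds confine every root to absolute value below
  \<epsilon>. These are test sets contained in the members of the chamber filter; they need not be
  members, as the filter is generated by half-spaces with levels in
  \<open>Gamma_values\<close>.\<close>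

definition germ :: "'p \<Rightarrow> 'y set \<Rightarrow> 'r \<Rightarrow> 'p set" where
  "germ x C \<epsilon> = {y. diff y x \<in> C \<and> (\<forall>a\<in>\<Phi>. rv a (diff y x) < \<epsilon>)}"

lemma ex_positive: "\<exists>r :: 'r. 0 < r"
  using nonzero by (metis neg_0_less_iff_less linorder_neqE)

lemma apartment_open_ball:
  assumes "apartment_open \<Phi> av S" "x \<in> S"
  shows "\<exists>\<epsilon>>0. \<forall>y. (\<forall>a\<in>\<Phi>. rv a (diff y x) < \<epsilon>) \<longrightarrow> y \<in> S"
  using assms unfolding apartment_open_def
proof (induct S rule: generate_topology.induct)
  case UNIV
  then show ?case using ex_positive by auto
next
  case (Int A B)
  then obtain e1 e2 where "0 < e1" "0 < e2"
    "\<forall>y. (\<forall>a\<in>\<Phi>. rv a (diff y x) < e1) \<longrightarrow> y \<in> A" "\<forall>y. (\<forall>a\<in>\<Phi>. rv a (diff y x) < e2) \<longrightarrow> y \<in> B" by blast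
  then show ?case by (intro exI[of _ "min e1 e2"]) auto
next
  case (UN K)
  then show ?case by (meson UnionE UnionI)
next
  case (Basis A)
  then obtain a l where a: "a \<in> \<Phi>" "A = open_half_space av a (Fin l)" by blast
  have mem: "y \<in> A \<longleftrightarrow> 0 < av a y + l" for y unfolding a(2) open_half_space_def by (simp add: neg_order)
  have "0 < av a x + l" using Basis(2) mem by blast
  moreover have "y \<in> A" if "\<forall>a\<in>\<Phi>. rv a (diff y x) < av a' x + l" "a' = a" for y a'
  proof -
    have "rv (- a) (diff y x) < av a x + l" using that root_neg[OF a(1)] by blast
    then show ?thesis unfolding mem rv_neg[OF a(1)] av_diff[OF a(1)] by (simp add: algebra_simps)
  qed
  ultimately show ?case by (intro exI[of _ "av a x + l"]) blast
qed

lemma germ_mono: "\<epsilon> \<le> \<epsilon>' \<Longrightarrow> germ x C \<epsilon> \<subseteq> germ x C \<epsilon>'"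
  unfolding germ_def by (auto intro: less_le_trans)

lemma chamber_filter_germ:
  assumes "eventually (\<lambda>y. y \<in> \<Omega>) (chamber_filter G \<Phi> U \<phi> diff av x C)"
  shows "\<exists>\<epsilon>>0. germ x C \<epsilon> \<subseteq> \<Omega>"
proof -
  obtain X where X: "finite X" "\<And>A. A \<in> X \<Longrightarrow> \<exists>\<Omega>. neighbourhood \<Phi> av x \<Omega> \<and> {y. diff y x \<in> C} \<inter> \<Omega> \<subseteq> A"
    "eventually (\<lambda>y. y \<in> \<Omega>) (INF A\<in>X. principal A)"
  proof -
    from iffD1[OF eventually_INF assms[unfolded chamber_filter_def]] obtain X where
      X: "X \<subseteq> {A. (\<exists>\<Psi> l. \<Psi> \<subseteq> \<Phi> \<and> (\<forall>\<alpha>\<in>\<Phi>. l \<alpha> \<in> Gamma_values G U \<phi> \<alpha> \<union> {Pinf}) \<and>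
                   A = (\<Inter>\<alpha>\<in>\<Psi>. open_half_space av \<alpha> (l \<alpha>)) \<inter> (\<Inter>\<alpha>\<in>\<Phi> - \<Psi>. half_space av \<alpha> (l \<alpha>))) \<and>
                (\<exists>\<Omega>. neighbourhood \<Phi> av x \<Omega> \<and> {y. diff y x \<in> C} \<inter> \<Omega> \<subseteq> A)}"
      "finite X" "eventually (\<lambda>y. y \<in> \<Omega>) (INF A\<in>X. principal A)" by (elim exE conjE)
    show ?thesis
    proof (rule that[OF X(2) _ X(3)])
      fix A assume "A \<in> X"
      from subsetD[OF X(1) this] show "\<exists>\<Omega>. neighbourhood \<Phi> av x \<Omega> \<and> {y. diff y x \<in> C} \<inter> \<Omega> \<subseteq> A" by simp
    qed
  qed
  have "\<Inter>X \<subseteq> \<Omega>" using X(3) unfolding INF_principal_finite[OF X(1)] by (auto simp: eventually_principal)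
  moreover have "\<exists>\<epsilon>>0. germ x C \<epsilon> \<subseteq> \<Inter>X"
    using X(1,2)
  proof (induct X rule: finite_induct)
    case empty
    then show ?case using ex_positive by auto
  next
    case (insert A X)
    then obtain e1 where e1: "0 < e1" "germ x C e1 \<subseteq> \<Inter>X" by blast
    obtain W where "neighbourhood \<Phi> av x W" "{y. diff y x \<in> C} \<inter> W \<subseteq> A" using insert(4) by blast
    then obtain S where S: "apartment_open \<Phi> av S" "x \<in> S" "{y. diff y x \<in> C} \<inter> S \<subseteq> A"
      unfolding neighbourhood_def by blast
    obtain e2 where e2: "0 < e2" "\<forall>y. (\<forall>a\<in>\<Phi>. rv a (diff y x) < e2) \<longrightarrow> y \<in> S"
      using apartment_open_ball[OF S(1,2)] by blast
    have "germ x C e2 \<subseteq> A" using e2(2) S(3) unfolding germ_def by blast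
    then have "germ x C (min e1 e2) \<subseteq> \<Inter>(insert A X)"
      using e1(2) germ_mono[of "min e1 e2" e1 x C] germ_mono[of "min e1 e2" e2 x C] by auto
    then show ?case using e1(1) e2(1) by (intro exI[of _ "min e1 e2"]) auto
  qed
  ultimately show ?thesis by blast
qed

lemma small_multiple:
  assumes "w \<in> CW" "0 < \<epsilon>"
  shows "\<exists>\<delta>>0. \<forall>a\<in>\<Phi>. rv a (t w \<delta>) < \<epsilon>"
proof -
  define N where "N = (\<Sum>a\<in>\<Phi>. \<bar>\<lfloor>blinfun_apply a w\<rfloor>\<bar>)"
  have N: "\<bar>\<lfloor>blinfun_apply a w\<rfloor>\<bar> \<le> N" if "a \<in> \<Phi>" for a
    unfolding N_def using finite_roots that by (intro member_le_sum) auto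
  have N0: "0 \<le> N" unfolding N_def by (intro sum_nonneg) auto
  \<comment> \<open>\<open>N\<close> bounds all |a(w)|; dividing by N + 1 gives a strict inequality
    and is possible even for N = 0.\<close>
  obtain \<delta> where d: "int_mult (N + 1) \<delta> = \<epsilon>" "0 < \<delta>" using divide_pos[of "N + 1" \<epsilon>] N0 assms(2) by auto
  have lt: "int_mult N \<delta> < \<epsilon>" using d int_mult_Suc[of N \<delta>] by (metis less_add_same_cancel1)
  have "rv a (t w \<delta>) < \<epsilon>" if a: "a \<in> \<Phi>" for a
  proof -
    let ?k = "\<lfloor>blinfun_apply a w\<rfloor>"
    have "int_mult ?k \<delta> \<le> int_mult N \<delta>" using N[OF a] d(2) by (intro int_mult_le_left) auto
    then show ?thesis using lt rv_t[OF a assms(1)] by simp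
  qed
  then show ?thesis using d(2) by blast
qed

context
  fixes \<Delta> E C
  assumes base: "root_base \<Phi> \<Delta>" and E_def: "E = positive_roots \<Phi> \<Delta>"
    and C_def: "C = {v. \<forall>\<alpha>\<in>\<Delta>. rv \<alpha> v > 0}"
begin

lemma E_pos: "pos E"
  using base E_def by (auto simp: pos_def)

lemma \<Delta>_root: "\<delta> \<in> \<Delta> \<Longrightarrow> \<delta> \<in> \<Phi>"
  using base by (auto simp: root_base_def)

lemma chamber_pos:
  assumes v: "v \<in> C" and a: "a \<in> E" shows "0 < rv a v"
proof -
  have aP: "a \<in> \<Phi>" using a pos_subset[OF E_pos] by blast
  obtain c :: "'v dual \<Rightarrow> nat" where c: "a = (\<Sum>\<delta>\<in>\<Delta>. real (c \<delta>) *\<^sub>R \<delta>)"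
    using a unfolding E_def positive_roots_def nonneg_comb_def by blast
  have sP: "\<Delta> \<subseteq> \<Phi>" and fin: "finite \<Delta>" using \<Delta>_root base_finite[OF base] by blast+
  have e: "rv a v = (\<Sum>\<delta>\<in>\<Delta>. int_mult (int (c \<delta>)) (rv \<delta> v))" using rv_comb[OF sP fin, of c v] aP c by simp
  have "\<exists>\<delta>\<in>\<Delta>. c \<delta> \<noteq> 0"
  proof (rule ccontr)
    assume "\<not> ?thesis"
    then have "a = 0" using c by simp
    then show False using aP zero_not_root by simp
  qed
  then obtain \<delta> where d: "\<delta> \<in> \<Delta>" "0 < c \<delta>" by blast
  have ge: "0 \<le> int_mult (int (c \<delta>)) (rv \<delta> v)" if "\<delta> \<in> \<Delta>" for \<delta>
    using v that unfolding C_def by (intro int_mult_nonneg) auto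
  have "0 < int_mult (int (c \<delta>)) (rv \<delta> v)" using v d unfolding C_def by (intro int_mult_pos) auto
  then show ?thesis unfolding e using fin d(1) ge by (intro sum_pos2) auto
qed

lemma chamber_neg: "v \<in> C \<Longrightarrow> a \<in> \<Phi> \<Longrightarrow> a \<notin> E \<Longrightarrow> rv a v < 0"
  using chamber_pos[of v "- a"] pos_neg_iff[OF E_pos, of a] rv_neg[of a v] by simp

text \<open>z = x + \<rho> d1 lies inside the chamber, and adding a multiple of the weakly dominant
  w stays there; each displacement gets half of \<epsilon>. With w = 0 this shows that germs are
  nonempty, with fundamental coweights it tests the linear part of an element fixing a germ.\<close>

lemma germ_shift:
  assumes "w \<in> CW" "\<And>\<delta>. \<delta> \<in> \<Delta> \<Longrightarrow> 0 \<le> \<lfloor>blinfun_apply \<delta> w\<rfloor>" "0 < \<epsilon>"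
  shows "\<exists>z y \<eta>. z \<in> germ x C \<epsilon> \<and> y \<in> germ x C \<epsilon> \<and> 0 < \<eta> \<and> diff y z = t w \<eta>"
proof -
  obtain \<rho> where \<rho>: "\<rho> \<in> CW" "\<And>a. a \<in> E \<Longrightarrow> 0 < \<lfloor>blinfun_apply a \<rho>\<rfloor>"
    using strictly_dominant[OF E_pos] by metis
  obtain \<epsilon>2 where e2: "int_mult 2 \<epsilon>2 = \<epsilon>" "0 < \<epsilon>2" using divide_pos[of 2 \<epsilon>] assms(3) by auto
  obtain d1 where d1: "0 < d1" "\<forall>a\<in>\<Phi>. rv a (t \<rho> d1) < \<epsilon>2" using small_multiple[OF \<rho>(1) e2(2)] by blast
  obtain d2 where d2: "0 < d2" "\<forall>a\<in>\<Phi>. rv a (t w d2) < \<epsilon>2" using small_multiple[OF assms(1) e2(2)] by blast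
  obtain z where z: "diff z x = t \<rho> d1" using diff_ex by blast
  obtain y where y: "diff y z = t w d2" using diff_ex by blast
  have yx: "diff y x = t w d2 + t \<rho> d1" using diff_add[of y z x] y z by simp
  have \<Delta>E: "\<delta> \<in> E" if "\<delta> \<in> \<Delta>" for \<delta> using simple_mem[of E \<delta>] base that E_def unfolding simple_def by blast
  have zp: "0 < rv \<delta> (t \<rho> d1)" if "\<delta> \<in> \<Delta>" for \<delta>
    using rv_t[OF \<Delta>_root[OF that] \<rho>(1)] int_mult_pos[OF \<rho>(2)[OF \<Delta>E[OF that]] d1(1)] by simp
  have yp: "0 \<le> rv \<delta> (t w d2)" if "\<delta> \<in> \<Delta>" for \<delta>
    using rv_t[OF \<Delta>_root[OF that] assms(1)] int_mult_nonneg[OF assms(2)[OF that], of d2] d2(1) by simp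
  have lt: "\<epsilon>2 < \<epsilon>" using e2 by (auto simp: int_mult_2)
  have "z \<in> germ x C \<epsilon>" unfolding germ_def C_def mem_Collect_eq z
  proof (intro conjI ballI)
    show "rv a (t \<rho> d1) < \<epsilon>" if "a \<in> \<Phi>" for a using less_trans[OF _ lt] d1(2) that by blast
  qed (rule zp)
  moreover have "y \<in> germ x C \<epsilon>" unfolding germ_def C_def mem_Collect_eq yx
  proof (intro conjI ballI)
    show "0 < rv \<delta> (t w d2 + t \<rho> d1)" if "\<delta> \<in> \<Delta>" for \<delta>
      unfolding rv_add[OF \<Delta>_root[OF that]] using add_nonneg_pos[OF yp[OF that] zp[OF that]] .
    show "rv a (t w d2 + t \<rho> d1) < \<epsilon>" if a: "a \<in> \<Phi>" for a
      unfolding rv_add[OF a] e2(1)[symmetric] int_mult_2 using d1(2) d2(2) a by (intro add_strict_mono) auto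
  qed
  ultimately show ?thesis using d2(1) y by blast
qed

lemma germ_nonempty: "0 < \<epsilon> \<Longrightarrow> \<exists>y. y \<in> germ x C \<epsilon>"
  using germ_shift[OF CW_0] by fastforce

text \<open>For \<open>a\<close> in \<open>E\<close>, points of the germ have a(y) > a(x) but come
  arbitrarily close, which forces the weak inequality at x; for \<open>a\<close> outside
  \<open>E\<close> a single point of the germ gives the strict one.\<close>

lemma fixer_germ_U:
  assumes a: "a \<in> \<Phi>" and \<epsilon>: "0 < \<epsilon>" "germ x C \<epsilon> \<subseteq> \<Omega>"
  shows "U_root_subset U \<phi> av \<Omega> a \<subseteq> lev x E a"
proof
  fix u assume u: "u \<in> U_root_subset U \<phi> av \<Omega> a"
  obtain y0 where y0: "y0 \<in> germ x C \<epsilon>" using germ_nonempty[OF \<epsilon>(1)] by blast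
  have uU: "u \<in> U a" using u y0 \<epsilon>(2) U_level_subset unfolding U_root_subset_def by blast
  have uy: "u = \<one> \<or> - av a y \<le> fv a u" if "y \<in> germ x C \<epsilon>" for y
    using u that \<epsilon>(2) U_level_iff[OF a uU] unfolding U_root_subset_def by blast
  have y_eq: "av a y = av a x + rv a (diff y x)" for y using av_diff[OF a, of y x] by simp
  show "u \<in> lev x E a"
  proof (cases "u = \<one>")
    case True
    then show ?thesis using lev_one[OF a] by simp
  next
    case False
    show ?thesis
    proof (cases "a \<in> E")
      case True
      have "- av a x \<le> fv a u"
      proof (rule ccontr)
        assume "\<not> ?thesis"
        then have q: "0 < - av a x - fv a u" by simp
        define e where "e = min \<epsilon> (- av a x - fv a u)"
        obtain y where y: "y \<in> germ x C e" using germ_nonempty[of e] \<epsilon>(1) q by (auto simp: e_def)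
        have "rv a (diff y x) < - av a x - fv a u"
          using y a unfolding germ_def e_def by auto
        then have "fv a u < - av a y" unfolding y_eq[of y] by (simp add: algebra_simps)
        moreover have "y \<in> germ x C \<epsilon>" using y germ_mono[of e \<epsilon>] by (auto simp: e_def)
        ultimately show False using uy[of y] False by (auto simp: not_less[symmetric])
      qed
      then show ?thesis using uU True by (auto simp: lev_def)
    next
      case nE: False
      have "rv a (diff y0 x) < 0" using chamber_neg[OF _ a nE] y0 unfolding germ_def by blast
      then have "- av a x < - av a y0" using y_eq[of y0] by simp
      also have "\<dots> \<le> fv a u" using uy[OF y0] False by blast
      finally show ?thesis using uU by (auto simp: lev_def)
    qed
  qed
qed

text \<open>Two fixed points that differ by a multiple of a fundamental coweight show that a root
  and its image have the same coordinate. So the linear part is trivial, and a translation with a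
  fixed point is the identity.\<close>

lemma fixer_germ_N:
  assumes \<epsilon>: "0 < \<epsilon>" and n: "n \<in> NN" and fix_n: "\<And>y. y \<in> germ x C \<epsilon> \<Longrightarrow> \<nu> n y = y"
  shows "n \<in> Tb"
proof -
  have vb: "vn n b = b" if b: "b \<in> \<Phi>" for b
  proof -
    have wb: "vn n b \<in> \<Phi>" using vnu_root[OF n b] .
    have "blinfun_apply (vn n b) (cow \<Delta> \<delta>) = blinfun_apply b (cow \<Delta> \<delta>)" if d: "\<delta> \<in> \<Delta>" for \<delta>
    proof -
      have c: "cow \<Delta> \<delta> \<in> CW" using base_cow_coweight[OF base d] .
      have "0 \<le> \<lfloor>blinfun_apply \<delta>' (cow \<Delta> \<delta>)\<rfloor>" if "\<delta>' \<in> \<Delta>" for \<delta>' using base_cow[OF base that] by simp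
      from germ_shift[OF c this \<epsilon>] obtain z y \<eta> where
        zy: "z \<in> germ x C \<epsilon>" "y \<in> germ x C \<epsilon>" "0 < \<eta>" "diff y z = t (cow \<Delta> \<delta>) \<eta>" by blast
      have "rv (vn n b) (diff y z) = rv b (diff y z)" using rv_vn[OF n b, of y z] fix_n zy(1,2) by simp
      then have "int_mult \<lfloor>blinfun_apply (vn n b) (cow \<Delta> \<delta>)\<rfloor> \<eta> = int_mult \<lfloor>blinfun_apply b (cow \<Delta> \<delta>)\<rfloor> \<eta>"
        unfolding zy(4) rv_t[OF wb c] rv_t[OF b c] .
      then have "\<lfloor>blinfun_apply (vn n b) (cow \<Delta> \<delta>)\<rfloor> = \<lfloor>blinfun_apply b (cow \<Delta> \<delta>)\<rfloor>"
        using int_mult_inj[of \<eta>] zy(3) by blast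
      then show ?thesis using CW_floor[OF c wb] CW_floor[OF c b] by metis
    qed
    then have "(\<Sum>\<delta>\<in>\<Delta>. blinfun_apply (vn n b) (cow \<Delta> \<delta>) *\<^sub>R \<delta>) = (\<Sum>\<delta>\<in>\<Delta>. blinfun_apply b (cow \<Delta> \<delta>) *\<^sub>R \<delta>)" by simp
    then show ?thesis using base_rep[OF base b] base_rep[OF base wb] by metis
  qed
  have W: "vn n \<in> carrier (weyl_group \<Phi> cr)" using vnu_weyl[OF n] .
  have vid: "vn n \<beta> = \<beta>" for \<beta>
    using linear_eq_on_span[OF weyl_props(1)[OF W] linear_id, of \<Phi> \<beta>] vb span_roots by auto
  have di: "dual_action (vn n) v = v" for v
  proof -
    have "blinfun_apply \<beta> (dual_action (vn n) v) = blinfun_apply \<beta> v" for \<beta> :: "'v dual"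
      using dual_action_pairing[OF W, of \<beta> v] vid by simp
    from this[of "blinfun_inner_left _"] show ?thesis by (auto intro: euclidean_eqI)
  qed
  obtain L where L: "additive L" "\<And>v a. v \<in> CW \<Longrightarrow> L (t v a) = t (dual_action (vn n) v) a"
    "\<And>x y. diff (\<nu> n x) (\<nu> n y) = L (diff x y)"
    using CA1[OF n] unfolding has_linear_part_def by blast
  have "L = (\<lambda>y. y)" by (rule t_unique[OF L(1)]) (simp_all add: additive_def L(2) di)
  then have eq: "diff (\<nu> n y) (\<nu> n z) = diff y z" for y z using L(3) by simp
  obtain z where "z \<in> germ x C \<epsilon>" using germ_nonempty[OF \<epsilon>] by blast
  then have "diff (\<nu> n y) z = diff y z" for y using eq[of y z] fix_n by simp
  then have "\<nu> n y = y" for y using diff_inj by blast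
  then show ?thesis using n by (auto simp: Tb_iff)
qed

text \<open>For the empty set, \<open>U_root_subset\<close> is an intersection over nothing, that
  is, the whole type; hence the assumption.\<close>

lemma P_hat_carrier: "U_subset G \<Phi> U \<phi> av \<Omega> \<union> N_hat G \<Phi> M \<nu> \<Omega> \<subseteq> carrier G" if "\<Omega> \<noteq> {}"
proof -
  obtain y where y: "y \<in> \<Omega>" using \<open>\<Omega> \<noteq> {}\<close> by blast
  have "U_root_subset U \<phi> av \<Omega> a \<subseteq> carrier G" if "a \<in> \<Phi>" for a
  proof -
    have "U_root_subset U \<phi> av \<Omega> a \<subseteq> U a" unfolding U_root_subset_def using y by (auto simp: U_level_def)
    then show ?thesis using U_sub_carrier[OF that] by (rule order_trans)
  qed
  then have "(\<Union>a\<in>\<Phi>. U_root_subset U \<phi> av \<Omega> a) \<subseteq> carrier G" by blast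
  then have "U_subset G \<Phi> U \<phi> av \<Omega> \<subseteq> carrier G" unfolding U_subset_def by (rule generate_incl)
  then show ?thesis using NN_carrier by (auto simp: N_hat_def)
qed

lemma P_hat_antimono:
  assumes "\<Omega> \<subseteq> \<Omega>'" shows "P_hat G \<Phi> U M \<phi> \<nu> av \<Omega>' \<subseteq> P_hat G \<Phi> U M \<phi> \<nu> av \<Omega>"
proof -
  have "(\<Union>a\<in>\<Phi>. U_root_subset U \<phi> av \<Omega>' a) \<subseteq> (\<Union>a\<in>\<Phi>. U_root_subset U \<phi> av \<Omega> a)"
    using assms unfolding U_root_subset_def by blast
  from mono_generate[OF this] have "U_subset G \<Phi> U \<phi> av \<Omega>' \<subseteq> U_subset G \<Phi> U \<phi> av \<Omega>" unfolding U_subset_def .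
  moreover have "N_hat G \<Phi> M \<nu> \<Omega>' \<subseteq> N_hat G \<Phi> M \<nu> \<Omega>" using assms unfolding N_hat_def by blast
  ultimately show ?thesis unfolding P_hat_def by (intro mono_generate Un_mono)
qed

text \<open>The level \<open>fv a u\<close> is a value of \<phi>_a, so this half-space is one of the
  sets that may generate the filter. It contains all of x + C if \<open>a\<close> is in
  \<open>E\<close>; otherwise x is strictly inside it, and a neighbourhood of x suffices.\<close>

lemma root_fixer_in_filter:
  assumes a: "a \<in> \<Phi>" and u: "u \<in> lev x E a" "u \<noteq> \<one>"
  shows "eventually (\<lambda>y. y \<in> {y. - av a y \<le> fv a u}) (chamber_filter G \<Phi> U \<phi> diff av x C)"
proof -
  define l where "l b = (if b = a then Fin (fv a u) else Pinf)" for b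
  define A where "A = (\<Inter>b\<in>{}. open_half_space av b (l b)) \<inter> (\<Inter>b\<in>\<Phi> - {}. half_space av b (l b))"
  have "half_space av b Pinf = UNIV" for b by (auto simp: half_space_def)
  moreover have "half_space av a (Fin (fv a u)) = {y. - av a y \<le> fv a u}"
    unfolding half_space_def by (auto simp: minus_le_iff)
  ultimately have A_eq: "A = {y. - av a y \<le> fv a u}" unfolding A_def l_def using a by auto
  have \<phi>u: "Fin (fv a u) = \<phi> a u" using \<phi>_fv[OF a lev_U[OF u(1)] u(2)] by simp
  have "l b \<in> Gamma_values G U \<phi> b \<union> {Pinf}" for b
    using lev_U[OF u(1)] u(2) \<phi>u unfolding l_def Gamma_values_def by auto
  moreover have "\<exists>\<Omega>. neighbourhood \<Phi> av x \<Omega> \<and> {y. diff y x \<in> C} \<inter> \<Omega> \<subseteq> A"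
  proof (cases "a \<in> E")
    case True
    have "neighbourhood \<Phi> av x UNIV" unfolding neighbourhood_def apartment_open_def
      using generate_topology.UNIV by blast
    moreover have "y \<in> A" if "diff y x \<in> C" for y
    proof -
      have "av a x < av a y" using chamber_pos[OF that True] av_diff[OF a, of y x] by simp
      then have "- av a y \<le> - av a x" by simp
      also have "\<dots> \<le> fv a u" using u unfolding lev_def by auto
      finally show ?thesis by (simp add: A_eq)
    qed
    ultimately show ?thesis by blast
  next
    case False
    let ?O = "open_half_space av a (Fin (fv a u))"
    have O: "y \<in> ?O \<longleftrightarrow> - av a y < fv a u" for y unfolding open_half_space_def by (auto simp: minus_less_iff)
    have "apartment_open \<Phi> av ?O" unfolding apartment_open_def using a by (intro generate_topology.Basis) blast
    moreover have "x \<in> ?O" unfolding O using u False by (auto simp: lev_def)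
    ultimately have "neighbourhood \<Phi> av x ?O" unfolding neighbourhood_def by blast
    moreover have "?O \<subseteq> A" using O by (auto simp: A_eq)
    ultimately show ?thesis by blast
  qed
  ultimately have "A \<in> {A. (\<exists>\<Psi> l. \<Psi> \<subseteq> \<Phi> \<and> (\<forall>\<alpha>\<in>\<Phi>. l \<alpha> \<in> Gamma_values G U \<phi> \<alpha> \<union> {Pinf}) \<and>
                   A = (\<Inter>\<alpha>\<in>\<Psi>. open_half_space av \<alpha> (l \<alpha>)) \<inter> (\<Inter>\<alpha>\<in>\<Phi> - \<Psi>. half_space av \<alpha> (l \<alpha>))) \<and>
                (\<exists>\<Omega>. neighbourhood \<Phi> av x \<Omega> \<and> {y. diff y x \<in> C} \<inter> \<Omega> \<subseteq> A)}" (is "A \<in> ?F")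
    unfolding A_def by blast
  then have "(INF A\<in>?F. principal A) \<le> principal A" by (rule INF_lower)
  then have "chamber_filter G \<Phi> U \<phi> diff av x C \<le> principal A" unfolding chamber_filter_def .
  then show ?thesis using A_eq by (simp add: le_principal)
qed

text \<open>In one direction the fixers are tested on a small germ inside the given filter member.
  In the other, each generator of \<open>B x E\<close> lies in the group of some filter member, and
  a product is handled by intersecting the members of its factors.\<close>

lemma P_hat_chamber_filter: "P_hat_filter G \<Phi> U M \<phi> \<nu> av (chamber_filter G \<Phi> U \<phi> diff av x C) = B x E"
proof (intro equalityI subsetI)
  let ?F = "chamber_filter G \<Phi> U \<phi> diff av x C"
  fix g assume "g \<in> P_hat_filter G \<Phi> U M \<phi> \<nu> av ?F"
  then obtain \<Omega> where W: "eventually (\<lambda>y. y \<in> \<Omega>) ?F" "g \<in> P_hat G \<Phi> U M \<phi> \<nu> av \<Omega>"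
    unfolding P_hat_filter_def by blast
  obtain \<epsilon> where \<epsilon>: "0 < \<epsilon>" "germ x C \<epsilon> \<subseteq> \<Omega>" using chamber_filter_germ[OF W(1)] by blast
  have "(\<Union>a\<in>\<Phi>. U_root_subset U \<phi> av \<Omega> a) \<subseteq> B x E" using fixer_germ_U[OF _ \<epsilon>] B_lev by blast
  then have "U_subset G \<Phi> U \<phi> av \<Omega> \<subseteq> B x E"
    unfolding U_subset_def by (rule generate_subgroup_incl[OF _ B_subgroup])
  moreover have "N_hat G \<Phi> M \<nu> \<Omega> \<subseteq> B x E"
    using fixer_germ_N[OF \<epsilon>(1)] \<epsilon>(2) B_Tb unfolding N_hat_def by blast
  ultimately have "P_hat G \<Phi> U M \<phi> \<nu> av \<Omega> \<subseteq> B x E"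
    unfolding P_hat_def by (intro generate_subgroup_incl[OF _ B_subgroup]) blast
  then show "g \<in> B x E" using W(2) by blast
next
  let ?F = "chamber_filter G \<Phi> U \<phi> diff av x C"
  let ?P = "\<lambda>\<Omega>. P_hat G \<Phi> U M \<phi> \<nu> av \<Omega>"
  have nonempty: "\<Omega> \<noteq> {}" if "eventually (\<lambda>y. y \<in> \<Omega>) ?F" for \<Omega>
    using chamber_filter_germ[OF that] germ_nonempty by blast
  have sub: "subgroup (?P \<Omega>) G" if "eventually (\<lambda>y. y \<in> \<Omega>) ?F" for \<Omega>
    unfolding P_hat_def by (rule generate_is_subgroup[OF P_hat_carrier[OF nonempty[OF that]]])
  have gens: "\<exists>\<Omega>. eventually (\<lambda>y. y \<in> \<Omega>) ?F \<and> h \<in> ?P \<Omega>" if h: "h \<in> Tb \<union> (\<Union>a\<in>\<Phi>. lev x E a)" for h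
  proof (cases "h \<in> Tb")
    case True
    then have "h \<in> N_hat G \<Phi> M \<nu> UNIV" by (simp add: N_hat_def Tb_iff)
    then have "h \<in> ?P UNIV" unfolding P_hat_def by (intro generate.incl) blast
    then show ?thesis by (intro exI[of _ UNIV]) simp
  next
    case False
    then obtain a where a: "a \<in> \<Phi>" "h \<in> lev x E a" using h by blast
    have "h \<noteq> \<one>" using False subgroup.one_closed[OF Tb_subgroup] by blast
    from root_fixer_in_filter[OF a this]
    have ev: "eventually (\<lambda>y. y \<in> {y. - av a y \<le> fv a h}) ?F" .
    have "h \<in> U_root_subset U \<phi> av {y. - av a y \<le> fv a h} a"
      unfolding U_root_subset_def using U_level_iff[OF a(1) lev_U[OF a(2)]] by blast
    then have "h \<in> U_subset G \<Phi> U \<phi> av {y. - av a y \<le> fv a h}"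
      unfolding U_subset_def using a(1) by (intro generate.incl) blast
    then have "h \<in> ?P {y. - av a y \<le> fv a h}" unfolding P_hat_def by (intro generate.incl) blast
    then show ?thesis using ev by blast
  qed
  fix g assume "g \<in> B x E"
  then have "g \<in> generate G (Tb \<union> (\<Union>a\<in>\<Phi>. lev x E a))" by (simp add: B_def)
  then have "\<exists>\<Omega>. eventually (\<lambda>y. y \<in> \<Omega>) ?F \<and> g \<in> ?P \<Omega>"
  proof (induct rule: generate.induct)
    case one
    have "\<one> \<in> ?P UNIV" unfolding P_hat_def by (rule generate.one)
    then show ?case by (intro exI[of _ UNIV]) simp
  next
    case (incl h)
    then show ?case by (rule gens)
  next
    case (inv h)
    then show ?case using gens[OF inv] subgroup.m_inv_closed[OF sub] by blast
  next
    case (eng h1 h2)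
    then obtain W1 W2 where W: "eventually (\<lambda>y. y \<in> W1) ?F" "h1 \<in> ?P W1" "eventually (\<lambda>y. y \<in> W2) ?F" "h2 \<in> ?P W2" by blast
    have ev: "eventually (\<lambda>y. y \<in> W1 \<inter> W2) ?F" using W(1,3) by (simp add: eventually_conj)
    have "h1 \<in> ?P (W1 \<inter> W2)" "h2 \<in> ?P (W1 \<inter> W2)"
      using W(2,4) P_hat_antimono[of "W1 \<inter> W2" W1] P_hat_antimono[of "W1 \<inter> W2" W2] by blast+
    then show ?case using subgroup.m_closed[OF sub[OF ev]] ev by blast
  qed
  then show "g \<in> P_hat_filter G \<Phi> U M \<phi> \<nu> av ?F" unfolding P_hat_filter_def by blast
qed

end

text \<open>For injectivity, n = b n' c gives n'^-1 n = (n'^-1 b n') c, an element of N in a product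
  of two groups \<open>B\<close>, so \<open>NN_B_B\<close> applies. The map is X \<mapsto> P X Q on
  subsets of G, which needs no choice of representatives.\<close>

lemma double_coset_bij:
  assumes gen: "generating G \<Phi> T U" and E: "pos E" "pos E'"
  shows "carrier G = B x E <#> NN <#> B x' E'"
    and "\<exists>f. bij_betw f (carrier (N_group G \<Phi> M Mod T_b G \<Phi> M \<nu>))
           {B x E <#> {g} <#> B x' E' | g. g \<in> carrier G} \<and>
         (\<forall>n\<in>NN. f (T_b G \<Phi> M \<nu> #>\<^bsub>N_group G \<Phi> M\<^esub> n) = B x E <#> {n} <#> B x' E')"
proof -
  let ?P = "B x E" and ?Q = "B x' E'" and ?N = "N_group G \<Phi> M"
  have dc: "?P <#> X <#> ?Q = {b \<otimes> g \<otimes> c | b g c. b \<in> ?P \<and> g \<in> X \<and> c \<in> ?Q}" for X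
    by (auto simp: set_mult_def)
  have one: "\<one> \<in> B y S" for y S using subgroup.one_closed[OF B_subgroup] .
  show "carrier G = ?P <#> NN <#> ?Q"
  proof (intro equalityI subsetI)
    fix g assume "g \<in> carrier G"
    then show "g \<in> ?P <#> NN <#> ?Q" unfolding dc using bruhat[OF gen E] by blast
  next
    fix g assume "g \<in> ?P <#> NN <#> ?Q"
    then show "g \<in> carrier G" unfolding dc using B_carrier NN_carrier by auto
  qed
  define f where "f X = ?P <#> X <#> ?Q" for X
  have coset: "T_b G \<Phi> M \<nu> #>\<^bsub>?N\<^esub> n = (\<lambda>h. h \<otimes> n) ` Tb" for n
    by (auto simp: r_coset_def Tb_def N_group_def)
  have f_coset: "f (T_b G \<Phi> M \<nu> #>\<^bsub>?N\<^esub> n) = ?P <#> {n} <#> ?Q" if n: "n \<in> NN" for n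
    unfolding f_def dc coset
  proof (intro equalityI subsetI)
    fix y assume "y \<in> {b \<otimes> g \<otimes> c | b g c. b \<in> ?P \<and> g \<in> (\<lambda>h. h \<otimes> n) ` Tb \<and> c \<in> ?Q}"
    then obtain b h c where *: "b \<in> ?P" "h \<in> Tb" "c \<in> ?Q" "y = b \<otimes> (h \<otimes> n) \<otimes> c" by blast
    then have "y = (b \<otimes> h) \<otimes> n \<otimes> c"
      using B_carrier[OF *(1)] B_carrier[OF *(3)] Tb_carrier NN_carrier[OF n] by (simp add: m_assoc)
    then show "y \<in> {b \<otimes> g \<otimes> c | b g c. b \<in> ?P \<and> g \<in> {n} \<and> c \<in> ?Q}"
      using B_mult[OF *(1) B_Tb[OF *(2)]] *(3) by blast
  next
    fix y assume "y \<in> {b \<otimes> g \<otimes> c | b g c. b \<in> ?P \<and> g \<in> {n} \<and> c \<in> ?Q}"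
    moreover have "n \<in> (\<lambda>h. h \<otimes> n) ` Tb"
      using subgroup.one_closed[OF Tb_subgroup] NN_carrier[OF n] by (intro image_eqI[of _ _ "\<one>"]) auto
    ultimately show "y \<in> {b \<otimes> g \<otimes> c | b g c. b \<in> ?P \<and> g \<in> (\<lambda>h. h \<otimes> n) ` Tb \<and> c \<in> ?Q}" by blast
  qed
  have car: "carrier (?N Mod T_b G \<Phi> M \<nu>) = {T_b G \<Phi> M \<nu> #>\<^bsub>?N\<^esub> n | n. n \<in> NN}"
    by (auto simp: FactGroup_def RCOSETS_def)
  have inj: "T_b G \<Phi> M \<nu> #>\<^bsub>?N\<^esub> n = T_b G \<Phi> M \<nu> #>\<^bsub>?N\<^esub> n'"
    if n: "n \<in> NN" "n' \<in> NN" and eq: "?P <#> {n} <#> ?Q = ?P <#> {n'} <#> ?Q" for n n'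
  proof -
    have nc: "n \<in> carrier G" "n' \<in> carrier G" using n NN_carrier by blast+
    have "n = \<one> \<otimes> n \<otimes> \<one>" using nc by simp
    then have "n \<in> ?P <#> {n} <#> ?Q" unfolding dc using one by blast
    then have "n \<in> ?P <#> {n'} <#> ?Q" by (simp only: eq)
    then obtain b c where bc: "b \<in> ?P" "c \<in> ?Q" "n = b \<otimes> n' \<otimes> c" unfolding dc by blast
    have in': "inv n' \<in> NN" using NN_inv[OF n(2)] .
    define m where "m = inv n' \<otimes> n"
    have mN: "m \<in> NN" unfolding m_def using NN_mult[OF in' n(1)] .
    have "m = cj (inv n') b \<otimes> c"
      unfolding m_def bc(3) cj_def using B_carrier[OF bc(1)] B_carrier[OF bc(2)] nc by (simp add: m_assoc)
    then have "m \<in> Tb" using NN_B_B[OF pos_vn[OF in' E(1)] E(2) mN B_cj[OF in' bc(1)] bc(2)] by blast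
    then have k: "cj n' m \<in> Tb" using Tb_normal[OF n(2)] by blast
    have nk: "n = cj n' m \<otimes> n'" unfolding m_def cj_def using nc by (simp add: m_assoc)
    have n'k: "n' = inv (cj n' m) \<otimes> n" by (subst nk) (use Tb_carrier[OF k] nc in simp)
    have sub: "(\<lambda>h. h \<otimes> n) ` Tb \<subseteq> (\<lambda>h. h \<otimes> n') ` Tb"
      if "n \<in> carrier G" "n' \<in> carrier G" "k \<in> Tb" "n = k \<otimes> n'" for n n' k
    proof
      fix y assume "y \<in> (\<lambda>h. h \<otimes> n) ` Tb"
      then obtain h where h: "h \<in> Tb" "y = h \<otimes> n" by blast
      then have "y = (h \<otimes> k) \<otimes> n'" using that Tb_carrier by (simp add: m_assoc)
      then show "y \<in> (\<lambda>h. h \<otimes> n') ` Tb" using subgroup.m_closed[OF Tb_subgroup h(1) that(3)] by blast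
    qed
    show ?thesis unfolding coset
      using sub[OF nc k nk] sub[OF nc(2,1) subgroup.m_inv_closed[OF Tb_subgroup k] n'k] by (rule equalityI)
  qed
  have "bij_betw f (carrier (?N Mod T_b G \<Phi> M \<nu>)) {?P <#> {g} <#> ?Q | g. g \<in> carrier G}"
    unfolding bij_betw_def
  proof
    show "inj_on f (carrier (?N Mod T_b G \<Phi> M \<nu>))"
    proof (rule inj_onI)
      fix X Y assume X: "X \<in> carrier (?N Mod T_b G \<Phi> M \<nu>)" and Y: "Y \<in> carrier (?N Mod T_b G \<Phi> M \<nu>)"
        and fXY: "f X = f Y"
      obtain n where n: "n \<in> NN" "X = T_b G \<Phi> M \<nu> #>\<^bsub>?N\<^esub> n" using X unfolding car by blast
      obtain n' where n': "n' \<in> NN" "Y = T_b G \<Phi> M \<nu> #>\<^bsub>?N\<^esub> n'" using Y unfolding car by blast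
      show "X = Y" unfolding n(2) n'(2)
        using fXY unfolding n(2) n'(2) f_coset[OF n(1)] f_coset[OF n'(1)] by (rule inj[OF n(1) n'(1)])
    qed
    show "f ` carrier (?N Mod T_b G \<Phi> M \<nu>) = {?P <#> {g} <#> ?Q | g. g \<in> carrier G}"
    proof (intro equalityI subsetI)
      fix Z assume "Z \<in> f ` carrier (?N Mod T_b G \<Phi> M \<nu>)"
      then obtain n where "n \<in> NN" "Z = f (T_b G \<Phi> M \<nu> #>\<^bsub>?N\<^esub> n)" unfolding car by blast
      then show "Z \<in> {?P <#> {g} <#> ?Q | g. g \<in> carrier G}" using f_coset NN_carrier by blast
    next
      fix Z assume "Z \<in> {?P <#> {g} <#> ?Q | g. g \<in> carrier G}"
      then obtain g where g: "g \<in> carrier G" "Z = ?P <#> {g} <#> ?Q" by blast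
      obtain b n c where *: "b \<in> ?P" "n \<in> NN" "c \<in> ?Q" "g = b \<otimes> n \<otimes> c" using bruhat[OF gen E g(1)] by blast
      have sub: "?P <#> {b \<otimes> n \<otimes> c} <#> ?Q \<subseteq> ?P <#> {n} <#> ?Q"
        if b: "b \<in> ?P" and n: "n \<in> carrier G" and c: "c \<in> ?Q" for b n c
        unfolding dc
      proof
        fix y assume "y \<in> {b' \<otimes> g \<otimes> c' | b' g c'. b' \<in> ?P \<and> g \<in> {b \<otimes> n \<otimes> c} \<and> c' \<in> ?Q}"
        then obtain b' c' where y: "b' \<in> ?P" "c' \<in> ?Q" "y = b' \<otimes> (b \<otimes> n \<otimes> c) \<otimes> c'" by blast
        have "y = (b' \<otimes> b) \<otimes> n \<otimes> (c \<otimes> c')"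
          unfolding y(3) using B_carrier[OF b] B_carrier[OF c] B_carrier[OF y(1)] B_carrier[OF y(2)] n by (simp add: m_assoc)
        then show "y \<in> {b \<otimes> g \<otimes> c | b g c. b \<in> ?P \<and> g \<in> {n} \<and> c \<in> ?Q}"
          using B_mult[OF y(1) b] B_mult[OF c y(2)] by blast
      qed
      have nc: "n \<in> carrier G" using NN_carrier[OF *(2)] .
      have n_eq: "n = inv b \<otimes> g \<otimes> inv c"
        unfolding *(4) using B_carrier[OF *(1)] B_carrier[OF *(3)] nc by (simp add: m_assoc)
      have "Z = ?P <#> {n} <#> ?Q"
        using sub[OF *(1) nc *(3)] sub[OF B_inv[OF *(1)] g(1) B_inv[OF *(3)]] unfolding g(2) *(4)[symmetric] n_eq[symmetric]
        by (rule equalityI)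
      then have "Z = f (T_b G \<Phi> M \<nu> #>\<^bsub>?N\<^esub> n)" using f_coset[OF *(2)] by simp
      then show "Z \<in> f ` carrier (?N Mod T_b G \<Phi> M \<nu>)" unfolding car using *(2) by blast
    qed
  qed
  then show "\<exists>f. bij_betw f (carrier (?N Mod T_b G \<Phi> M \<nu>)) {?P <#> {g} <#> ?Q | g. g \<in> carrier G} \<and>
      (\<forall>n\<in>NN. f (T_b G \<Phi> M \<nu> #>\<^bsub>?N\<^esub> n) = ?P <#> {n} <#> ?Q)"
    using f_coset by blast
qed

end

lemma rational_module_divisible:
  fixes qscale :: "rat \<Rightarrow> 'r::ab_group_add \<Rightarrow> 'r"
  assumes "Modules.module qscale" "0 < n"
  shows "\<exists>s. int_mult n s = (r :: 'r)"
proof -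
  interpret module qscale by fact
  have q: "int_mult k s = qscale (of_int k) s" for k s
    by (induct k rule: int_induct[where k = 0])
      (simp_all add: int_mult_add_left scale_left_distrib scale_left_diff_distrib int_mult_add_left[of _ "- _", simplified])
  have "int_mult n (qscale (1 / of_int n) r) = r" using assms(2) by (simp add: q)
  then show ?thesis ..
qed

theorem theorem5p37:
  fixes G :: "('g, 'b) monoid_scheme"
    and \<Phi> :: "'v::euclidean_space dual set"
    and cr :: "'v dual \<Rightarrow> 'v"
    and T :: "'g set"
    and U M :: "'v dual \<Rightarrow> 'g set"
    and \<phi> :: "'v dual \<Rightarrow> 'g \<Rightarrow> 'r::linordered_ab_group_add extended"
    and t :: "'v \<Rightarrow> 'r \<Rightarrow> 'y::ab_group_add"
    and diff :: "'p \<Rightarrow> 'p \<Rightarrow> 'y"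
    and orig x x' :: 'p
    and \<nu> :: "'g \<Rightarrow> 'p \<Rightarrow> 'p"
    and qscale :: "rat \<Rightarrow> 'r \<Rightarrow> 'r"
    and C C' :: "'y set"
  assumes "\<Phi> \<noteq> {}"
    and "root_group_datum G \<Phi> cr T U M"
    and "generating G \<Phi> T U"
    and "R_valuation G \<Phi> cr T U M \<phi>"
    and "compatible_action G \<Phi> cr T U M \<phi> t diff orig \<nu>"
    and "Modules.module qscale"
    and "C \<in> vector_chambers \<Phi> t"
    and "C' \<in> vector_chambers \<Phi> t"
  shows "let a = root_at \<Phi> t diff orig;
             N = N_group G \<Phi> M;
             P = P_hat_filter G \<Phi> U M \<phi> \<nu> a (chamber_filter G \<Phi> U \<phi> diff a x C);
             P' = P_hat_filter G \<Phi> U M \<phi> \<nu> a (chamber_filter G \<Phi> U \<phi> diff a x' C')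
         in carrier G = P <#>\<^bsub>G\<^esub> carrier N <#>\<^bsub>G\<^esub> P' \<and>
            (\<exists>f. bij_betw f (carrier (N Mod T_b G \<Phi> M \<nu>))
                   {P <#>\<^bsub>G\<^esub> {g} <#>\<^bsub>G\<^esub> P' | g. g \<in> carrier G} \<and>
                 (\<forall>n\<in>carrier N. f (T_b G \<Phi> M \<nu> #>\<^bsub>N\<^esub> n) = P <#>\<^bsub>G\<^esub> {n} <#>\<^bsub>G\<^esub> P'))"
proof -
  obtain \<Delta> where D: "root_base \<Phi> \<Delta>" "C = {v. \<forall>\<alpha>\<in>\<Delta>. root_ext \<Phi> t \<alpha> v > 0}"
    using assms(7) unfolding vector_chambers_def by blast
  obtain \<Delta>' where D': "root_base \<Phi> \<Delta>'" "C' = {v. \<forall>\<alpha>\<in>\<Delta>'. root_ext \<Phi> t \<alpha> v > 0}"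
    using assms(8) unfolding vector_chambers_def by blast
  interpret compatible_action G \<Phi> cr T U M \<phi> t diff orig \<nu> by (rule assms(5))
  interpret bruhat_setting G \<Phi> cr T U M \<phi> t diff orig \<nu>
  proof unfold_locales
    show "\<exists>\<Psi>. pos \<Psi>" using D(1) unfolding pos_def by blast
    show "\<Phi> \<noteq> {}" by (rule assms(1))
    show "\<exists>s. int_mult n s = r" if "0 < n" for n and r :: 'r
      by (rule rational_module_divisible[OF assms(6) that])
  qed
  show ?thesis
    unfolding Let_def P_hat_chamber_filter[OF D(1) refl D(2)] P_hat_chamber_filter[OF D'(1) refl D'(2)]
    by (intro conjI double_coset_bij[OF assms(3) E_pos[OF D(1) refl D(2)] E_pos[OF D'(1) refl D'(2)]])
qed

end
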